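(* Let $n\ge 1$, $s\ge 2$ and let $n>m_1\geq \dots\geq m_s\geq 0$ be integers. Let $$\Lambda=\Lambda_1+\dots+\Lambda_s\subset\mathbb{P}^n$$ be a generic configuration of linear spaces of weight vector $(m_1,\dots,m_s)$ in complex projective space $\mathbb{P}^n$, and let $I_\Lambda$ be its defining ideal, with degree $2$ part $(I_\Lambda)_2$. If $m_1+m_2<n$, then $$\dim (I_{\Lambda})_2=\max\left\{\binom{n+2}{2}-\sum_{i=1}^s\binom{m_i+2}{2};\,0\right\}.$$ If $m_1+m_2\geq n$, let $$\tau=\max\{i\in\{1,\dots,s\}\mid m_1+m_i\geq n\},\qquad v=\sum_{i=2}^{\tau}(m_1+m_i-n+1).$$ Then the following statements hold. (i) If $v\geq m_1+1$, then $\dim(I_\Lambda)_2=0$. (ii) Suppose $2m_1-n+2\leq v\leq m_1$. (a) If $\tau\geq 4$, then $\dim (I_\Lambda)_2=0$. (b) If $\tau=3$, $s\geq 4$ and $2n\leq\sum_{i=1}^4 m_i+2$, then $\dim(I_\Lambda)_2=0$. (c) If $\tau=3$, $s\geq 4$ and $2n\geq\sum_{i=1}^4 m_i+2$, or if $\tau=s=3$, then $$\dim(I_\Lambda)_2=\max\left\{\binom{n+2}{2}-\sum_{i=1}^s\binom{m_i+2}{2}+\sum_{1\le i<j\le 3}\binom{m_i+m_j-n+2}{2};\,0\right\}.$$ (iii) If $v\leq 2m_1-n+1$, then $$\dim(I_\Lambda)_2=\max\left\{\binom{n+2}{2}-\sum_{i=1}^s\binom{m_i+2}{2}+\sum_{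i=2}^{\tau}\binom{m_1+m_i-n+2}{2};\,0\right\}.$$
   Context: Work over $\mathbb{C}$, with $S=\mathbb{C}[x_0,\dots,x_n]=\bigoplus_{d\ge 0}S_d$ the homogeneous coordinate ring of $\mathbb{P}^n$. A configuration of linear spaces $\Lambda=\Lambda_1+\dots+\Lambda_s\subset\mathbb{P}^n$ is a finite union of distinct linear subspaces $\Lambda_i\simeq\mathbb{P}^{m_i}$ with $0\le m_i<n$; its weight vector is $L=(m_1,\dots,m_s)$. Configurations with weight vector $L$ are parameterized by $\mathcal{D}_L=\mathbb{G}(m_1,\mathbb{P}^n)\times\dots\times\mathbb{G}(m_s,\mathbb{P}^n)$, where $\mathbb{G}(m,\mathbb{P}^n)$ is the Grassmannian of $m$-dimensional linear subspaces of $\mathbb{P}^n$. A statement holds for a generic configuration of weight vector $L$ if there is a nonempty Zariski open subset of $\mathcal{D}_L$ such that it holds for every $\Lambda$ in that subset. $I_\Lambda\subset S$ is the homogeneous ideal of polynomials vanishing on $\Lambda$, $(I_\Lambda)_2=I_\Lambda\cap S_2$, and $\dim$ of it is the dimension as a $\mathbb{C}$-vector space. (The Hilbert function of $\Lambda$ in degree 2 is $HF(\Lambda,2)=\binom{n+2}{2}-\dim(I_\Lambda)_2$.) *)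

theory Defs
  imports
    Complex_Main
    "HOL-Library.Function_Algebras"
    "HOL-Library.FuncSet"
    "HOL-Library.Poly_Mapping"
    "Jordan_Normal_Form.Determinant"
    "Jordan_Normal_Form.DL_Submatrix"
begin

section \<open>Polynomials\<close>

text \<open>
  Polynomials over the complex numbers in variables of type \<open>'v\<close>: a monomial is a finitely
  supported exponent vector. The ring structure is that of \<^theory>\<open>HOL-Library.Poly_Mapping\<close>.
\<close>

type_synonym 'v monom = "'v \<Rightarrow>\<^sub>0 nat"
type_synonym 'v cpoly = "'v monom \<Rightarrow>\<^sub>0 complex"

definition poly_eval :: "('v \<Rightarrow> complex) \<Rightarrow> 'v cpoly \<Rightarrow> complex" where
  "poly_eval x f =
     (\<Sum>\<mu>\<in>Poly_Mapping.keys f. Poly_Mapping.lookup f \<mu> *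
        (\<Prod>v\<in>Poly_Mapping.keys \<mu>. x v ^ Poly_Mapping.lookup \<mu> v))"

definition polys_in :: "'v set \<Rightarrow> 'v cpoly set" where
  "polys_in V = {f. \<forall>\<mu>\<in>Poly_Mapping.keys f. Poly_Mapping.keys \<mu> \<subseteq> V}"

text \<open>Homogeneity of degree \<open>d\<close> with respect to the block \<open>A\<close> of variables.\<close>

definition homogeneous_in :: "'v set \<Rightarrow> nat \<Rightarrow> 'v cpoly \<Rightarrow> bool" where
  "homogeneous_in A d f \<longleftrightarrow>
     (\<forall>\<mu>\<in>Poly_Mapping.keys f. (\<Sum>v\<in>Poly_Mapping.keys \<mu> \<inter> A. Poly_Mapping.lookup \<mu> v) = d)"

definition poly_scale :: "complex \<Rightarrow> 'v cpoly \<Rightarrow> 'v cpoly" where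
  "poly_scale c f = Poly_Mapping.map (\<lambda>a. c * a) f"

lemma lookup_poly_scale:
  "Poly_Mapping.lookup (poly_scale c f) \<mu> = c * Poly_Mapping.lookup f \<mu>"
  by (simp add: poly_scale_def Poly_Mapping.map.rep_eq when_def)

global_interpretation poly_vs: vector_space "poly_scale :: complex \<Rightarrow> 'v cpoly \<Rightarrow> 'v cpoly"
  by unfold_locales
    (auto intro!: poly_mapping_eqI simp: lookup_poly_scale lookup_add algebra_simps)

definition coord_ring :: "nat \<Rightarrow> nat cpoly set" where
  "coord_ring n = polys_in {0..n}"

definition coord_ring_deg :: "nat \<Rightarrow> nat \<Rightarrow> nat cpoly set" where
  "coord_ring_deg n d = {f \<in> coord_ring n. homogeneous_in UNIV d f}"


section \<open>Linear subspaces of projective space\<close>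

text \<open>
  A vector of complex coordinates \<open>(x\<^sub>0, \<dots>, x\<^sub>n)\<close> is a function on the naturals that vanishes
  beyond \<open>n\<close>. A linear subspace of projective \<open>n\<close>-space of (projective) dimension \<open>m\<close> is
  represented by the corresponding vector subspace of dimension \<open>m + 1\<close>; its points are the
  lines spanned by the nonzero vectors.
\<close>

definition vec_scale :: "complex \<Rightarrow> (nat \<Rightarrow> complex) \<Rightarrow> (nat \<Rightarrow> complex)" where
  "vec_scale c x = (\<lambda>k. c * x k)"

global_interpretation cvec: vector_space vec_scale
  by unfold_locales (auto simp: vec_scale_def fun_eq_iff algebra_simps)

definition coord_space :: "nat \<Rightarrow> (nat \<Rightarrow> complex) set" where
  "coord_space n = {x. \<forall>k>n. x k = 0}"

definition grassmannian :: "nat \<Rightarrow> nat \<Rightarrow> (nat \<Rightarrow> complex) set set" where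
  "grassmannian m n = {W. W \<subseteq> coord_space n \<and> cvec.subspace W \<and> cvec.dim W = m + 1}"

text \<open>
  The parameter space of configurations of weight vector \<open>(m 1, \<dots>, m s)\<close>, a product of
  Grassmannians. A configuration is the tuple of its components; that these are distinct
  is not imposed, as it is a dense open condition when all \<open>m i < n\<close>.
\<close>

definition config_space ::
    "nat \<Rightarrow> nat \<Rightarrow> (nat \<Rightarrow> nat) \<Rightarrow> (nat \<Rightarrow> (nat \<Rightarrow> complex) set) set" where
  "config_space n s m = (\<Pi>\<^sub>E i\<in>{1..s}. grassmannian (m i) n)"


section \<open>Zariski topology on products of Grassmannians\<close>

text \<open>
  \<open>p\<close> is a vector of homogeneous Pluecker coordinates of the \<open>m\<close>-dimensional linear subspace
  \<open>W\<close>: for some basis \<open>b 0, \<dots>, b m\<close> of \<open>W\<close>, \<open>p J\<close> is the maximal minor with column set \<open>J\<close>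
  of the matrix whose rows are the basis vectors. For \<open>W\<close> in the Grassmannian a spanning family
  of \<open>m + 1\<close> vectors is automatically a basis.
\<close>

definition pluecker_coords ::
    "nat \<Rightarrow> nat \<Rightarrow> (nat \<Rightarrow> complex) set \<Rightarrow> (nat set \<Rightarrow> complex) \<Rightarrow> bool" where
  "pluecker_coords n m W p \<longleftrightarrow>
     (\<exists>b :: nat \<Rightarrow> nat \<Rightarrow> complex. cvec.span (b ` {0..m}) = W \<and>
        p = (\<lambda>J. det (submatrix (mat (m + 1) (n + 1) (\<lambda>(r, k). b r k)) UNIV J)))"

definition pluecker_vars :: "nat \<Rightarrow> nat \<Rightarrow> (nat \<Rightarrow> nat) \<Rightarrow> (nat \<times> nat set) set" where
  "pluecker_vars n s m = (SIGMA i : {1..s}. {J. J \<subseteq> {0..n} \<and> card J = m i + 1})"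

definition multihomogeneous :: "nat \<Rightarrow> (nat \<times> nat set) cpoly \<Rightarrow> bool" where
  "multihomogeneous s f \<longleftrightarrow>
     (\<exists>d. \<forall>i\<in>{1..s}. homogeneous_in ({i} \<times> UNIV) (d i) f)"

text \<open>
  Closed subsets are the common zero loci of multihomogeneous polynomials in the Pluecker
  coordinates of the factors, i.e. the topology is induced from the product of the Pluecker
  embeddings. By multihomogeneity, the vanishing does not depend on the choice of the
  homogeneous coordinates \<open>p i\<close>.
\<close>

definition zariski_closed ::
    "nat \<Rightarrow> nat \<Rightarrow> (nat \<Rightarrow> nat) \<Rightarrow> (nat \<Rightarrow> (nat \<Rightarrow> complex) set) set \<Rightarrow> bool" where
  "zariski_closed n s m Z \<longleftrightarrow>
     (\<exists>F. F \<subseteq> {f \<in> polys_in (pluecker_vars n s m). multihomogeneous s f} \<and>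
        Z = {\<Lambda> \<in> config_space n s m. \<forall>f\<in>F. \<forall>p.
               (\<forall>i\<in>{1..s}. pluecker_coords n (m i) (\<Lambda> i) (p i)) \<longrightarrow>
               poly_eval (\<lambda>(i, J). p i J) f = 0})"

definition zariski_open ::
    "nat \<Rightarrow> nat \<Rightarrow> (nat \<Rightarrow> nat) \<Rightarrow> (nat \<Rightarrow> (nat \<Rightarrow> complex) set) set \<Rightarrow> bool" where
  "zariski_open n s m U \<longleftrightarrow>
     U \<subseteq> config_space n s m \<and> zariski_closed n s m (config_space n s m - U)"

definition generic_config ::
    "nat \<Rightarrow> nat \<Rightarrow> (nat \<Rightarrow> nat) \<Rightarrow> ((nat \<Rightarrow> (nat \<Rightarrow> complex) set) \<Rightarrow> bool) \<Rightarrow> bool" where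
  "generic_config n s m P \<longleftrightarrow>
     (\<exists>U. zariski_open n s m U \<and> U \<noteq> {} \<and> (\<forall>\<Lambda>\<in>U. P \<Lambda>))"


section \<open>The ideal of a configuration\<close>

text \<open>
  A polynomial vanishes at a point of projective space if it vanishes at all homogeneous
  coordinate vectors of that point.
\<close>

definition config_ideal ::
    "nat \<Rightarrow> nat \<Rightarrow> (nat \<Rightarrow> (nat \<Rightarrow> complex) set) \<Rightarrow> nat cpoly set" where
  "config_ideal n s \<Lambda> =
     {f \<in> coord_ring n. \<forall>x \<in> (\<Union>i\<in>{1..s}. \<Lambda> i) - {0}. poly_eval x f = 0}"

definition config_ideal_dim ::
    "nat \<Rightarrow> nat \<Rightarrow> (nat \<Rightarrow> (nat \<Rightarrow> complex) set) \<Rightarrow> nat \<Rightarrow> nat" where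
  "config_ideal_dim n s \<Lambda> d = poly_vs.dim (config_ideal n s \<Lambda> \<inter> coord_ring_deg n d)"

end

(*
  By semicontinuity, it suffices to find one configuration with as few quadrics as predicted, up to
  adding general points; the lower bound counts conditions on bases adapted to the intersections of
  the spaces.

  If no two spaces meet, the existence of a configuration without quadrics, once the conditions are
  numerous enough, is proved by induction on n. When two spaces are complementary, a hyperplane is
  split off. Otherwise suppose that every configuration lies on a quadric, and choose a quadric for
  which first the nullity of the system is minimal and then the ranks of the form and of its
  restrictions are maximal. Then the quadric and its kernels move with the configuration, and the
  first-order conditions in all directions contradict the number of conditions.

  If spaces do meet, coordinate vectors are put into their intersections. A form vanishing on two
  spaces through such a vector is orthogonal to the span of both, hence the vector splits off when
  the residual spaces span, and what remains is a configuration of the disjoint kind (four spaces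
  of half the dimension, in the extreme cases).
*)

theory Submission
  imports Defs
begin

subsection \<open>Homogeneous linear systems\<close>

text \<open>Write N = n + 1 and a for vector dimensions. The contradiction from first-order
  conditions (\<open>rank_numerics\<close>) needs that any two spaces satisfy a + a' < N strictly.
  Complementary pairs still cannot be avoided: splitting off the intersections with the first space
  leaves that space complementary to each of the spaces it met. Cutting such a pair by a hyperplane
  lowers both sides of N(N + 1) \<le> sum of a(a + 1) by 2N, so the count survives; only a second
  complementary pair blocks this, and then four spaces have dimension exactly N/2 and an explicit
  configuration is used.

  The ranks are made maximal so that the kernels can be lifted along with the quadric. The lifted
  relations fix the values of the derivative on certain pairs of vectors; these pairs are
  independent functionals on the symmetric forms vanishing on the kernel, and all of them vanish at
  the quadric itself, which makes the dimension count strict.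

  Points are spaces of vector dimension 1 and enter the same induction. With as many of them as the
  predicted dimension, every upper bound becomes the absence of quadrics.\<close>

lemma homogeneous_system_nontrivial:
  fixes M :: "'e \<Rightarrow> 'j \<Rightarrow> 'a::field"
  assumes "finite E" "finite J" "card E < card J"
  shows "\<exists>v. (\<exists>j\<in>J. v j \<noteq> 0) \<and> (\<forall>e\<in>E. (\<Sum>j\<in>J. M e j * v j) = 0)"
  using assms
proof (induction E arbitrary: J M rule: finite_induct)
  case empty
  then have "J \<noteq> {}" by auto
  then show ?case by (intro exI[of _ "\<lambda>_. 1"]) auto
next
  case (insert e E)
  show ?case
  proof (cases "\<forall>j\<in>J. M e j = 0")
    case True
    have "card E < card J" using insert by auto
    from insert.IH[OF insert.prems(1) this, of M] obtain v
      where "\<exists>j\<in>J. v j \<noteq> 0" "\<forall>f\<in>E. (\<Sum>j\<in>J. M f j * v j) = 0" by auto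
    then show ?thesis using True by (intro exI[of _ v]) auto
  next
    case False
    then obtain j0 where j0: "j0 \<in> J" "M e j0 \<noteq> 0" by auto
    define J' where "J' = J - {j0}"
    have f: "finite J'" "card E < card J'"
      using insert j0 by (auto simp: J'_def)
    from insert.IH[OF f, of "\<lambda>f j. M f j - M f j0 * M e j / M e j0"] obtain v
      where v: "\<exists>j\<in>J'. v j \<noteq> 0"
        and vE: "\<And>f. f \<in> E \<Longrightarrow> (\<Sum>j\<in>J'. (M f j - M f j0 * M e j / M e j0) * v j) = 0" by auto
    define S where "S = (\<Sum>j\<in>J'. M e j * v j)"
    define w where "w = (\<lambda>j. if j = j0 then - S / M e j0 else v j)"
    have split: "(\<Sum>j\<in>J. M f j * w j) = - M f j0 * S / M e j0 + (\<Sum>j\<in>J'. M f j * v j)" for f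
    proof -
      have "(\<Sum>j\<in>J. M f j * w j) = M f j0 * w j0 + (\<Sum>j\<in>J'. M f j * w j)"
        unfolding J'_def by (rule sum.remove[OF insert.prems(1) j0(1)])
      also have "(\<Sum>j\<in>J'. M f j * w j) = (\<Sum>j\<in>J'. M f j * v j)"
        by (rule sum.cong) (auto simp: w_def J'_def)
      finally show ?thesis by (simp add: w_def)
    qed
    have E: "(\<Sum>j\<in>J. M f j * w j) = 0" if "f \<in> E" for f
    proof -
      have "0 = (\<Sum>j\<in>J'. M f j * v j - M f j0 / M e j0 * (M e j * v j))"
        using vE[OF that] by (simp add: algebra_simps)
      also have "\<dots> = (\<Sum>j\<in>J'. M f j * v j) - M f j0 / M e j0 * S"
        by (simp add: sum_subtractf S_def sum_distrib_left)
      finally show ?thesis using split[of f] by (simp add: field_simps)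
    qed
    moreover have "(\<Sum>j\<in>J. M e j * w j) = 0"
      using split[of e] j0 by (simp add: S_def)
    moreover have "\<exists>j\<in>J. w j \<noteq> 0" using v by (auto simp: w_def J'_def)
    ultimately show ?thesis by (intro exI[of _ w]) auto
  qed
qed

definition inj_system :: "'e set \<Rightarrow> 'j set \<Rightarrow> ('e \<Rightarrow> 'j \<Rightarrow> 'a::comm_ring_1) \<Rightarrow> bool" where
  "inj_system E J M \<longleftrightarrow> (\<forall>v. (\<forall>e\<in>E. (\<Sum>j\<in>J. M e j * v j) = 0) \<longrightarrow> (\<forall>j\<in>J. v j = 0))"

lemma inj_systemD:
  "\<lbrakk>inj_system E J M; \<And>e. e \<in> E \<Longrightarrow> (\<Sum>j\<in>J. M e j * v j) = 0; j \<in> J\<rbrakk> \<Longrightarrow> v j = 0"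
  by (auto simp: inj_system_def)

lemma inj_system_card:
  fixes M :: "'e \<Rightarrow> 'j \<Rightarrow> 'a::field"
  assumes "finite E" "finite J" "inj_system E J M"
  shows "card J \<le> card E"
proof (rule ccontr)
  assume "\<not> card J \<le> card E"
  with homogeneous_system_nontrivial[OF assms(1,2), of M] obtain v
    where "\<exists>j\<in>J. v j \<noteq> 0" "\<forall>e\<in>E. (\<Sum>j\<in>J. M e j * v j) = 0" by force
  with inj_systemD[OF assms(3), of v] show False by auto
qed

text \<open>A minimal set R of rows with trivial kernel has at most \<open>card J\<close> elements.
  For each row e of R minimality yields a nonzero \<open>w e\<close> killed by the other rows; more
  than \<open>card J\<close> such vectors would be dependent, and applying a row with nonzero
  coefficient to the dependence would put its \<open>w e\<close> into the kernel.\<close>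

lemma inj_system_row_selection:
  fixes M :: "'e \<Rightarrow> 'j \<Rightarrow> 'a::field"
  assumes fE: "finite E" and fJ: "finite J" and inj: "inj_system E J M"
  obtains R where "R \<subseteq> E" "card R = card J" "inj_system R J M"
proof -
  obtain R where R: "R \<subseteq> E" "inj_system R J M"
    and min: "\<And>R'. R' \<subseteq> E \<Longrightarrow> inj_system R' J M \<Longrightarrow> card R \<le> card R'"
    using ex_has_least_nat[of "\<lambda>R. R \<subseteq> E \<and> inj_system R J M" E card] inj by auto
  have fR: "finite R" using R fE finite_subset by auto
  have "card R \<le> card J"
  proof (rule ccontr)
    assume lt: "\<not> card R \<le> card J"
    have "\<exists>w. (\<forall>f\<in>R - {e}. (\<Sum>j\<in>J. M f j * w j) = 0) \<and> (\<exists>j\<in>J. w j \<noteq> 0)" if e: "e \<in> R" for e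
    proof -
      have "card (R - {e}) < card R" using e fR by (meson card_Diff1_less)
      then have "\<not> inj_system (R - {e}) J M" using min[of "R - {e}"] R by force
      then show ?thesis by (auto simp: inj_system_def)
    qed
    then obtain w where w: "\<And>e f. e \<in> R \<Longrightarrow> f \<in> R - {e} \<Longrightarrow> (\<Sum>j\<in>J. M f j * w e j) = 0"
      and wn: "\<And>e. e \<in> R \<Longrightarrow> \<exists>j\<in>J. w e j \<noteq> 0" by metis
    obtain c where c: "\<exists>e\<in>R. c e \<noteq> 0" "\<And>j. j \<in> J \<Longrightarrow> (\<Sum>e\<in>R. w e j * c e) = 0"
      using homogeneous_system_nontrivial[OF fJ fR, of "\<lambda>j e. w e j"] lt by auto
    from c obtain e0 where e0: "e0 \<in> R" "c e0 \<noteq> 0" by auto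
    have "0 = (\<Sum>j\<in>J. M e0 j * (\<Sum>e\<in>R. w e j * c e))" using c by simp
    also have "\<dots> = (\<Sum>e\<in>R. c e * (\<Sum>j\<in>J. M e0 j * w e j))"
      unfolding sum_distrib_left by (subst sum.swap) (simp add: ac_simps)
    also have "\<dots> = (\<Sum>e\<in>R. if e = e0 then c e0 * (\<Sum>j\<in>J. M e0 j * w e0 j) else 0)"
      by (rule sum.cong) (use w e0 in auto)
    also have "\<dots> = c e0 * (\<Sum>j\<in>J. M e0 j * w e0 j)" using e0 fR by simp
    finally have "(\<Sum>j\<in>J. M e0 j * w e0 j) = 0" using e0 by simp
    then have "\<And>f. f \<in> R \<Longrightarrow> (\<Sum>j\<in>J. M f j * w e0 j) = 0" using w[OF e0(1)] by (metis DiffI singletonD)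
    from inj_systemD[OF R(2) this] wn[OF e0(1)] show False by blast
  qed
  with inj_system_card[OF fR fJ R(2)] R that show thesis by auto
qed

text \<open>The right-hand side becomes the column of an extra unknown \<open>None\<close>, so that
  counting gives a nontrivial solution. Its \<open>None\<close> component is nonzero because the
  original kernel is trivial, and dividing by it solves the inhomogeneous system.\<close>

lemma inj_system_solvable:
  fixes M :: "'e \<Rightarrow> 'j \<Rightarrow> 'a::field"
  assumes fE: "finite E" and fJ: "finite J" and card: "card E = card J" and inj: "inj_system E J M"
  shows "\<exists>v. \<forall>e\<in>E. (\<Sum>j\<in>J. M e j * v j) = b e"
proof -
  define J' where "J' = insert None (Some ` J)"
  have fJ': "finite J'" using fJ by (simp add: J'_def)
  have cJ': "card J' = Suc (card J)" using fJ by (simp add: J'_def card_image)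
  obtain w where w: "\<exists>j\<in>J'. w j \<noteq> 0"
    and wE: "\<And>e. e \<in> E \<Longrightarrow> (\<Sum>j\<in>J'. (case j of None \<Rightarrow> - b e | Some j \<Rightarrow> M e j) * w j) = 0"
    using homogeneous_system_nontrivial[OF fE fJ', of "\<lambda>e j. case j of None \<Rightarrow> - b e | Some j \<Rightarrow> M e j"]
      card cJ' by auto
  have wE': "(\<Sum>j\<in>J. M e j * w (Some j)) = b e * w None" if "e \<in> E" for e
    using wE[OF that] fJ by (simp add: J'_def sum.reindex)
  have n0: "w None \<noteq> 0"
  proof
    assume 0: "w None = 0"
    then have "\<forall>j\<in>J. w (Some j) = 0" using inj_systemD[OF inj, of "\<lambda>j. w (Some j)"] wE' by simp
    with 0 w show False by (auto simp: J'_def)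
  qed
  show ?thesis
  proof (intro exI[of _ "\<lambda>j. w (Some j) / w None"] ballI)
    fix e assume "e \<in> E"
    then show "(\<Sum>j\<in>J. M e j * (w (Some j) / w None)) = b e"
      using wE'[of e] n0 by (simp add: sum_divide_distrib[symmetric])
  qed
qed

section \<open>Nullity of a linear system\<close>

text \<open>The kernel has dimension at most d, expressed by d further functionals that cut it down
  to zero. In this form a bound on the nullity is a trivial-kernel statement for an enlarged system,
  hence the nonvanishing of a minor, which makes it an open condition.\<close>

definition nullity_le :: "'e set \<Rightarrow> 'j set \<Rightarrow> ('e \<Rightarrow> 'j \<Rightarrow> complex) \<Rightarrow> nat \<Rightarrow> bool" where
  "nullity_le E J M d \<longleftrightarrow> (\<exists>l::nat \<Rightarrow> 'j \<Rightarrow> complex. \<forall>v.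
     (\<forall>e\<in>E. (\<Sum>j\<in>J. M e j * v j) = 0) \<longrightarrow> (\<forall>i<d. (\<Sum>j\<in>J. l i j * v j) = 0) \<longrightarrow>
     (\<forall>j\<in>J. v j = 0))"

lemma nullity_le_0: "nullity_le E J M 0 \<longleftrightarrow> inj_system E J M"
  by (auto simp: nullity_le_def inj_system_def)

lemma nullity_le_card:
  fixes J :: "'j set"
  assumes fJ: "finite J"
  shows "nullity_le E J M (card J)"
proof -
  obtain f where f: "bij_betw f {..<card J} J"
    using ex_bij_betw_nat_finite[OF fJ] by (auto simp: atLeast0LessThan)
  show ?thesis unfolding nullity_le_def
  proof (intro exI[of _ "\<lambda>i j. if j = f i then 1 else 0"] allI impI ballI)
    fix v :: "'j \<Rightarrow> complex" and j assume v: "\<forall>i<card J. (\<Sum>j\<in>J. (if j = f i then 1 else 0) * v j) = 0" and j: "j \<in> J"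
    obtain i where i: "i < card J" "j = f i" using f j by (auto simp: bij_betw_def)
    have "(\<Sum>j'\<in>J. (if j' = f i then 1 else 0) * v j') = (\<Sum>j'\<in>J. if j' = f i then v j' else 0)"
      by (rule sum.cong) auto
    also have "\<dots> = v j" using fJ j i by simp
    finally show "v j = 0" using v i by simp
  qed
qed

lemma nullity_leI_finite:
  assumes "finite F" "card F = d"
    and "\<And>v. \<lbrakk>\<And>e. e \<in> E \<Longrightarrow> (\<Sum>j\<in>J. M e j * v j) = 0; \<And>f. f \<in> F \<Longrightarrow> (\<Sum>j\<in>J. l f j * v j) = 0\<rbrakk>
           \<Longrightarrow> \<forall>j\<in>J. v j = 0"
  shows "nullity_le E J M d"
proof -
  obtain f where f: "bij_betw f {..<d} F"
    using ex_bij_betw_nat_finite[OF assms(1)] assms(2) by (auto simp: atLeast0LessThan)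
  show ?thesis unfolding nullity_le_def
    by (rule exI[of _ "\<lambda>i. l (f i)"]) (use assms(3) f in \<open>auto simp: bij_betw_def\<close>)
qed

definition nullity :: "'e set \<Rightarrow> 'j set \<Rightarrow> ('e \<Rightarrow> 'j \<Rightarrow> complex) \<Rightarrow> nat" where
  "nullity E J M = (LEAST d. nullity_le E J M d)"

lemma nullity_le_nullity: "finite J \<Longrightarrow> nullity_le E J M (nullity E J M)"
  unfolding nullity_def by (rule LeastI) (rule nullity_le_card)

lemma not_nullity_le: "d < nullity E J M \<Longrightarrow> \<not> nullity_le E J M d"
  unfolding nullity_def by (rule not_less_Least)

lemma nullity_least: "nullity_le E J M d \<Longrightarrow> nullity E J M \<le> d"
  unfolding nullity_def by (rule Least_le)

text \<open>A selection of rows from E and the functionals has to keep all d functionals, since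
  otherwise fewer would do. What remains is an invertible square system whose functionals are
  coordinates on the kernel of R.\<close>

lemma minimal_nullity_rows:
  assumes fE: "finite E" and fJ: "finite J" and le: "nullity_le E J M d"
    and min: "\<And>d'. d' < d \<Longrightarrow> \<not> nullity_le E J M d'"
  obtains R l where "R \<subseteq> E" "card R + d = card J"
    "inj_system (Inl ` R \<union> Inr ` {..<d}) J (\<lambda>e. case e of Inl e \<Rightarrow> M e | Inr i \<Rightarrow> l i)"
proof -
  obtain l :: "nat \<Rightarrow> 'b \<Rightarrow> complex" where l: "\<And>v. \<lbrakk>\<forall>e\<in>E. (\<Sum>j\<in>J. M e j * v j) = 0; \<forall>i<d. (\<Sum>j\<in>J. l i j * v j) = 0\<rbrakk>
      \<Longrightarrow> \<forall>j\<in>J. v j = 0" using le by (auto simp: nullity_le_def)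
  define M' where "M' = (\<lambda>e. case e of Inl e \<Rightarrow> M e | Inr i \<Rightarrow> l i)"
  have "inj_system (Inl ` E \<union> Inr ` {..<d}) J M'"
    unfolding inj_system_def using l by (auto simp: M'_def ball_Un)
  from inj_system_row_selection[OF _ fJ this] fE obtain R' where
    R': "R' \<subseteq> Inl ` E \<union> Inr ` {..<d}" "card R' = card J" "inj_system R' J M'" by auto
  define R where "R = {e\<in>E. Inl e \<in> R'}"
  define I where "I = {i. i < d \<and> Inr i \<in> R'}"
  have R'eq: "R' = Inl ` R \<union> Inr ` I" using R' by (auto simp: R_def I_def)
  have fI: "finite I" by (simp add: I_def)
  have "nullity_le E J M (card I)"
  proof (rule nullity_leI_finite[OF fI refl, of _ _ _ l])
    fix v assume "\<And>e. e \<in> E \<Longrightarrow> (\<Sum>j\<in>J. M e j * v j) = 0" "\<And>i. i \<in> I \<Longrightarrow> (\<Sum>j\<in>J. l i j * v j) = 0"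
    then show "\<forall>j\<in>J. v j = 0" using R'(3) unfolding R'eq inj_system_def
      by (auto simp: M'_def R_def ball_Un)
  qed
  then have "\<not> card I < d" using min by blast
  moreover have "I \<subseteq> {..<d}" by (auto simp: I_def)
  ultimately have I: "I = {..<d}" by (intro card_seteq) auto
  have "card R' = card R + d"
    unfolding R'eq I by (subst card_Un_disjoint) (use fE in \<open>auto simp: card_image R_def\<close>)
  moreover have "inj_system (Inl ` R \<union> Inr ` {..<d}) J M'"
    using R'(3) unfolding R'eq I .
  moreover have "R \<subseteq> E" by (auto simp: R_def)
  ultimately show ?thesis using R'(2) by (intro that[of R l]) (simp_all add: M'_def)
qed

text \<open>The selected rows already have full rank. Otherwise a row e is nonzero on some vector
  \<open>w i0\<close> of the basis of their kernel dual to the functionals; then e takes over the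
  role of \<open>l i0\<close>, and d - 1 functionals suffice, against minimality.\<close>

lemma kernel_of_rows:
  assumes fE: "finite E" and fJ: "finite J" and R: "R \<subseteq> E" and card: "card R + d = card J"
    and inj: "inj_system (Inl ` R \<union> Inr ` {..<d}) J (\<lambda>e. case e of Inl e \<Rightarrow> M e | Inr i \<Rightarrow> l i)"
    and min: "\<And>d'. d' < d \<Longrightarrow> \<not> nullity_le E J M d'"
    and v: "\<And>e. e \<in> R \<Longrightarrow> (\<Sum>j\<in>J. M e j * v j) = 0" and e: "e \<in> E"
  shows "(\<Sum>j\<in>J. M e j * v j) = 0"
proof (rule ccontr)
  assume ne: "(\<Sum>j\<in>J. M e j * v j) \<noteq> 0"
  define S where "S = (Inl ` R \<union> Inr ` {..<d} :: ('a + nat) set)"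
  define M' where "M' = (\<lambda>e. case e of Inl e \<Rightarrow> M e | Inr i \<Rightarrow> l i)"
  have fR: "finite R" using R fE finite_subset by auto
  have fS: "finite S" "card S = card J"
    using fR card unfolding S_def by (simp, subst card_Un_disjoint) (auto simp: card_image)
  have inj': "u j = 0" if "\<And>e. e \<in> R \<Longrightarrow> (\<Sum>j\<in>J. M e j * u j) = 0" "\<And>i. i < d \<Longrightarrow> (\<Sum>j\<in>J. l i j * u j) = 0" "j \<in> J" for u j
    by (rule inj_systemD[OF inj[folded S_def M'_def], of u j]) (use that in \<open>auto simp: S_def M'_def\<close>)
  have "\<exists>w. \<forall>e\<in>S. (\<Sum>j\<in>J. M' e j * w j) = (case e of Inl _ \<Rightarrow> 0 | Inr i' \<Rightarrow> if i' = i then 1 else 0)" for i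
    by (rule inj_system_solvable[OF fS(1) fJ fS(2) inj[folded S_def M'_def]])
  then obtain w where w: "\<And>i e. e \<in> S \<Longrightarrow> (\<Sum>j\<in>J. M' e j * w i j) = (case e of Inl _ \<Rightarrow> 0 | Inr i' \<Rightarrow> if i' = i then 1 else 0)"
    by metis
  have wR: "(\<Sum>j\<in>J. M e j * w i j) = 0" if "e \<in> R" for e i
    using w[of "Inl e" i] that by (auto simp: S_def M'_def)
  have wl: "(\<Sum>j\<in>J. l i' j * w i j) = (if i' = i then 1 else 0)" if "i' < d" for i i'
    using w[of "Inr i'" i] that by (auto simp: S_def M'_def)
  have "\<exists>i<d. (\<Sum>j\<in>J. M e j * w i j) \<noteq> 0"
  proof (rule ccontr)
    assume "\<not> ?thesis"
    then have z: "\<And>i. i < d \<Longrightarrow> (\<Sum>j\<in>J. M e j * w i j) = 0" by auto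
    define c where "c = (\<lambda>i. \<Sum>j\<in>J. l i j * v j)"
    define u where "u = (\<lambda>j. v j - (\<Sum>i<d. c i * w i j))"
    have lin: "(\<Sum>j\<in>J. m j * u j) = (\<Sum>j\<in>J. m j * v j) - (\<Sum>i<d. c i * (\<Sum>j\<in>J. m j * w i j))" for m
    proof -
      have "(\<Sum>j\<in>J. m j * u j) = (\<Sum>j\<in>J. m j * v j) - (\<Sum>j\<in>J. \<Sum>i<d. c i * (m j * w i j))"
        by (simp add: u_def right_diff_distrib sum_subtractf sum_distrib_left ac_simps)
      also have "(\<Sum>j\<in>J. \<Sum>i<d. c i * (m j * w i j)) = (\<Sum>i<d. c i * (\<Sum>j\<in>J. m j * w i j))"
        by (subst sum.swap) (simp add: sum_distrib_left)
      finally show ?thesis .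
    qed
    have "u j = 0" if "j \<in> J" for j
    proof (rule inj'[OF _ _ that])
      show "(\<Sum>j\<in>J. M e j * u j) = 0" if "e \<in> R" for e using v wR that by (simp add: lin)
      show "(\<Sum>j\<in>J. l i j * u j) = 0" if "i < d" for i
      proof -
        have "(\<Sum>i'<d. c i' * (\<Sum>j\<in>J. l i j * w i' j)) = (\<Sum>i'<d. if i' = i then c i' else 0)"
          by (rule sum.cong) (use wl that in auto)
        also have "\<dots> = c i" using that by simp
        finally show ?thesis by (simp add: lin c_def)
      qed
    qed
    then have "(\<Sum>j\<in>J. M e j * u j) = 0" by simp
    then have "(\<Sum>j\<in>J. M e j * v j) = 0" using z by (simp add: lin)
    with ne show False by simp
  qed
  then obtain i0 where i0: "i0 < d" "(\<Sum>j\<in>J. M e j * w i0 j) \<noteq> 0" by auto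
  have "nullity_le E J M (d - 1)"
  proof (rule nullity_leI_finite[of "{..<d} - {i0}" _ _ _ _ l])
    show "finite ({..<d} - {i0})" "card ({..<d} - {i0}) = d - 1" using i0 by auto
    fix u assume u: "\<And>e. e \<in> E \<Longrightarrow> (\<Sum>j\<in>J. M e j * u j) = 0"
      and ul: "\<And>f. f \<in> {..<d} - {i0} \<Longrightarrow> (\<Sum>j\<in>J. l f j * u j) = 0"
    define c where "c = (\<Sum>j\<in>J. l i0 j * u j)"
    have lin: "(\<Sum>j\<in>J. m j * (u j - c * w i0 j)) = (\<Sum>j\<in>J. m j * u j) - c * (\<Sum>j\<in>J. m j * w i0 j)" for m
      by (simp add: right_diff_distrib sum_subtractf sum_distrib_left ac_simps)
    have eq: "u j - c * w i0 j = 0" if "j \<in> J" for j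
    proof (rule inj'[OF _ _ that])
      show "(\<Sum>j\<in>J. M e j * (u j - c * w i0 j)) = 0" if "e \<in> R" for e
        using u R wR that by (auto simp: lin)
      show "(\<Sum>j\<in>J. l i j * (u j - c * w i0 j)) = 0" if "i < d" for i
        using ul[of i] wl[of i i0] that unfolding lin by (cases "i = i0") (auto simp: c_def)
    qed
    then have "(\<Sum>j\<in>J. M e j * (u j - c * w i0 j)) = 0" by simp
    then have "c = 0" using u[OF e] i0(2) by (simp add: lin)
    then show "\<forall>j\<in>J. u j = 0" using eq by simp
  qed
  moreover have "d - 1 < d" using i0 by simp
  ultimately show False using min by blast
qed

text \<open>A basis \<open>c\<close> of coordinate space with dual basis \<open>\<gamma>\<close>, the part from \<open>r\<close> on spanning the kernel
  of the system, so that \<open>r\<close> is its rank.\<close>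

lemma adapted_basis:
  fixes M :: "'e \<Rightarrow> nat \<Rightarrow> complex"
  assumes fE: "finite E"
  obtains r and c \<gamma> :: "nat \<Rightarrow> nat \<Rightarrow> complex" where "r \<le> a"
    and "\<And>\<alpha> \<beta>. \<alpha> < a \<Longrightarrow> \<beta> < a \<Longrightarrow> (\<Sum>j<a. \<gamma> \<alpha> j * c \<beta> j) = (if \<alpha> = \<beta> then 1 else 0)"
    and "\<And>v j. j < a \<Longrightarrow> v j = (\<Sum>\<alpha><a. (\<Sum>k<a. \<gamma> \<alpha> k * v k) * c \<alpha> j)"
    and "\<And>\<alpha> e. r \<le> \<alpha> \<Longrightarrow> \<alpha> < a \<Longrightarrow> e \<in> E \<Longrightarrow> (\<Sum>j<a. M e j * c \<alpha> j) = 0"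
    and "\<And>\<mu> \<alpha>. (\<And>e. e \<in> E \<Longrightarrow> (\<Sum>\<beta><r. \<mu> \<beta> * (\<Sum>j<a. M e j * c \<beta> j)) = 0) \<Longrightarrow> \<alpha> < r \<Longrightarrow> \<mu> \<alpha> = 0"
proof -
  define d where "d = nullity E {..<a} M"
  have le: "nullity_le E {..<a} M d" unfolding d_def by (rule nullity_le_nullity) simp
  have min: "\<And>d'. d' < d \<Longrightarrow> \<not> nullity_le E {..<a} M d'" unfolding d_def by (rule not_nullity_le)
  obtain R l where R: "R \<subseteq> E" "card R + d = a"
    and inj: "inj_system (Inl ` R \<union> Inr ` {..<d}) {..<a} (\<lambda>e. case e of Inl e \<Rightarrow> M e | Inr i \<Rightarrow> l i)"
    using minimal_nullity_rows[OF fE _ le min] by auto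
  define r where "r = card R"
  have fR: "finite R" using R fE finite_subset by auto
  obtain f where f: "bij_betw f {..<r} R"
    using ex_bij_betw_nat_finite[OF fR] by (auto simp: atLeast0LessThan r_def)
  \<comment> \<open>The dual basis consists of the r selected rows followed by the d functionals.
    Basis vectors from r on are therefore killed by the selected rows, hence by all of E, and for
    \<alpha> < r the row \<open>f \<alpha>\<close> reads off the coordinate \<alpha>.\<close>
  define \<gamma> where "\<gamma> = (\<lambda>\<alpha>. if \<alpha> < r then M (f \<alpha>) else l (\<alpha> - r))"
  have inj': "inj_system {..<a} {..<a} \<gamma>"
    unfolding inj_system_def
  proof (intro allI impI)
    fix v assume v: "\<forall>e\<in>{..<a}. (\<Sum>j<a. \<gamma> e j * v j) = 0"
    have "(\<Sum>j<a. M e j * v j) = 0" if eR: "e \<in> R" for e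
    proof -
      obtain \<alpha> where "\<alpha> < r" "e = f \<alpha>" using f eR unfolding bij_betw_def by blast
      then show ?thesis using v[rule_format, of \<alpha>] R by (auto simp: \<gamma>_def r_def)
    qed
    moreover have "(\<Sum>j<a. l i j * v j) = 0" if "i < d" for i
      using v[rule_format, of "r + i"] R that by (auto simp: \<gamma>_def r_def)
    ultimately show "\<forall>j\<in>{..<a}. v j = 0"
      using inj unfolding inj_system_def by (auto simp: ball_Un)
  qed
  have "\<exists>w. \<forall>e\<in>{..<a}. (\<Sum>j<a. \<gamma> e j * w j) = (if e = \<beta> then 1 else 0)" for \<beta>
    by (rule inj_system_solvable[OF _ _ refl inj']) auto
  then obtain c where c: "\<And>\<alpha> \<beta>. \<alpha> < a \<Longrightarrow> (\<Sum>j<a. \<gamma> \<alpha> j * c \<beta> j) = (if \<alpha> = \<beta> then 1 else 0)"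
    by (metis lessThan_iff)
  have rec: "v j = (\<Sum>\<alpha><a. (\<Sum>k<a. \<gamma> \<alpha> k * v k) * c \<alpha> j)" if "j < a" for v j
  proof -
    define u where "u = (\<lambda>j. v j - (\<Sum>\<alpha><a. (\<Sum>k<a. \<gamma> \<alpha> k * v k) * c \<alpha> j))"
    have "u j = 0"
    proof (rule inj_systemD[OF inj'])
      fix e assume "e \<in> {..<a}"
      have "(\<Sum>j<a. \<gamma> e j * u j) = (\<Sum>j<a. \<gamma> e j * v j) - (\<Sum>j<a. \<Sum>\<alpha><a. (\<Sum>k<a. \<gamma> \<alpha> k * v k) * (\<gamma> e j * c \<alpha> j))"
        by (simp add: u_def right_diff_distrib sum_subtractf sum_distrib_left ac_simps)
      also have "(\<Sum>j<a. \<Sum>\<alpha><a. (\<Sum>k<a. \<gamma> \<alpha> k * v k) * (\<gamma> e j * c \<alpha> j))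
          = (\<Sum>\<alpha><a. (\<Sum>k<a. \<gamma> \<alpha> k * v k) * (\<Sum>j<a. \<gamma> e j * c \<alpha> j))"
        by (subst sum.swap) (simp add: sum_distrib_left)
      also have "\<dots> = (\<Sum>\<alpha><a. if \<alpha> = e then (\<Sum>k<a. \<gamma> \<alpha> k * v k) else 0)"
        by (rule sum.cong) (use c \<open>e \<in> _\<close> in auto)
      also have "\<dots> = (\<Sum>k<a. \<gamma> e k * v k)" using \<open>e \<in> _\<close> by simp
      finally show "(\<Sum>j<a. \<gamma> e j * u j) = 0" by simp
    qed (use that in auto)
    then show ?thesis by (simp add: u_def)
  qed
  have ker: "(\<Sum>j<a. M e j * c \<alpha> j) = 0" if "r \<le> \<alpha>" "\<alpha> < a" "e \<in> E" for \<alpha> e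
  proof (rule kernel_of_rows[OF fE _ R(1) _ inj min])
    fix e' assume "e' \<in> R"
    then obtain \<beta> where "\<beta> < r" "e' = f \<beta>" using f unfolding bij_betw_def by blast
    then show "(\<Sum>j<a. M e' j * c \<alpha> j) = 0" using c[of \<beta> \<alpha>] that by (auto simp: \<gamma>_def)
  qed (use R that in auto)
  have ind: "\<mu> \<alpha> = 0" if "\<And>e. e \<in> E \<Longrightarrow> (\<Sum>\<beta><r. \<mu> \<beta> * (\<Sum>j<a. M e j * c \<beta> j)) = 0" "\<alpha> < r" for \<mu> \<alpha>
  proof -
    have fa: "f \<alpha> \<in> E" using f that R by (auto simp: bij_betw_def)
    have "0 = (\<Sum>\<beta><r. \<mu> \<beta> * (\<Sum>j<a. M (f \<alpha>) j * c \<beta> j))" using that(1)[OF fa] by simp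
    also have "\<dots> = (\<Sum>\<beta><r. if \<beta> = \<alpha> then \<mu> \<beta> else 0)"
      by (rule sum.cong) (use c[of \<alpha>] that R in \<open>auto simp: \<gamma>_def r_def\<close>)
    also have "\<dots> = \<mu> \<alpha>" using that by simp
    finally show ?thesis by simp
  qed
  show thesis by (rule that[of r \<gamma> c]) (use R c rec ker ind in \<open>auto simp: r_def\<close>)
qed

subsection \<open>Polynomial families of linear systems\<close>

lemma inj_system_iff_det:
  fixes M :: "'e \<Rightarrow> 'j \<Rightarrow> 'a::field"
  assumes f: "bij_betw f {..<n} E" and g: "bij_betw g {..<n} J"
  shows "inj_system E J M \<longleftrightarrow> det (mat n n (\<lambda>(i, j). M (f i) (g j))) \<noteq> 0"
proof -
  define A where "A = mat n n (\<lambda>(i, j). M (f i) (g j))"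
  have A: "A \<in> carrier_mat n n" by (simp add: A_def)
  have row: "(A *\<^sub>v vec n (\<lambda>j. v (g j))) $ i = (\<Sum>j\<in>J. M (f i) j * v j)" if "i < n" for i v
  proof -
    have "(A *\<^sub>v vec n (\<lambda>j. v (g j))) $ i = (\<Sum>j<n. M (f i) (g j) * v (g j))"
      using that by (auto simp: A_def scalar_prod_def atLeast0LessThan intro!: sum.cong)
    also have "\<dots> = (\<Sum>j\<in>J. M (f i) j * v j)"
      by (rule sum.reindex_bij_betw[OF g])
    finally show ?thesis .
  qed
  have "inj_system E J M \<longleftrightarrow> \<not> (\<exists>w \<in> carrier_vec n. w \<noteq> 0\<^sub>v n \<and> A *\<^sub>v w = 0\<^sub>v n)"
  proof (intro iffI notI)
    assume inj: "inj_system E J M"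
    assume "\<exists>w\<in>carrier_vec n. w \<noteq> 0\<^sub>v n \<and> A *\<^sub>v w = 0\<^sub>v n"
    then obtain w where w: "w \<in> carrier_vec n" "w \<noteq> 0\<^sub>v n" "A *\<^sub>v w = 0\<^sub>v n" by auto
    define v where "v = (\<lambda>j. w $ (inv_into {..<n} g j))"
    have wv: "w = vec n (\<lambda>j. v (g j))"
      using w(1) g by (auto simp: v_def bij_betw_def)
    have "\<forall>j\<in>J. v j = 0"
    proof
      fix j assume "j \<in> J"
      show "v j = 0"
      proof (rule inj_systemD[OF inj _ \<open>j \<in> J\<close>])
        fix e assume "e \<in> E"
        then have "e \<in> f ` {..<n}" using f by (simp add: bij_betw_def)
        then obtain i where "i < n" "e = f i" by auto
        then show "(\<Sum>j\<in>J. M e j * v j) = 0" using row[of i v] w(3) wv by simp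
      qed
    qed
    then have "w = 0\<^sub>v n" using g unfolding wv by (intro eq_vecI) (auto simp: bij_betw_def)
    with w show False by simp
  next
    assume no: "\<not> (\<exists>w\<in>carrier_vec n. w \<noteq> 0\<^sub>v n \<and> A *\<^sub>v w = 0\<^sub>v n)"
    show "inj_system E J M" unfolding inj_system_def
    proof (intro allI impI ballI)
      fix v j assume v: "\<forall>e\<in>E. (\<Sum>j\<in>J. M e j * v j) = 0" and j: "j \<in> J"
      have "A *\<^sub>v vec n (\<lambda>j. v (g j)) = 0\<^sub>v n"
      proof (rule eq_vecI)
        fix i assume i: "i < dim_vec (0\<^sub>v n)"
        have "f i \<in> E" using i f by (auto simp: bij_betw_def)
        then show "(A *\<^sub>v vec n (\<lambda>j. v (g j))) $ i = 0\<^sub>v n $ i" using row[of i v] i v by simp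
      qed (simp add: A_def)
      then have eq: "vec n (\<lambda>j. v (g j)) = 0\<^sub>v n" using no by auto
      have "j \<in> g ` {..<n}" using j g by (simp add: bij_betw_def)
      then obtain k where "k < n" "j = g k" by auto
      then show "v j = 0" using arg_cong[OF eq, of "\<lambda>w. w $ k"] by simp
    qed
  qed
  then show ?thesis using det_0_iff_vec_prod_zero[OF A] unfolding A_def by blast
qed

lemma poly_det: "poly (det A) x = det (map_mat (\<lambda>p. poly p x) A)"
proof -
  interpret comm_ring_hom "\<lambda>p. poly p x" by unfold_locales auto
  show ?thesis by simp
qed

text \<open>D is the determinant. As in Cramer's rule, the adjugate matrix solves the system for D
  times any right-hand side without leaving the polynomials.\<close>

lemma polynomial_square_system:
  fixes A :: "'e \<Rightarrow> 'j \<Rightarrow> complex poly"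
  assumes fE: "finite E" and fJ: "finite J" and card: "card E = card J"
    and inj: "inj_system E J (\<lambda>e j. poly (A e j) 0)"
  obtains D where "poly D 0 \<noteq> 0"
    and "\<And>x. poly D x \<noteq> 0 \<Longrightarrow> inj_system E J (\<lambda>e j. poly (A e j) x)"
    and "\<And>b. \<exists>V. \<forall>e\<in>E. (\<Sum>j\<in>J. A e j * V j) = D * b e"
proof -
  define n where "n = card J"
  obtain f where f: "bij_betw f {..<n} E"
    using ex_bij_betw_nat_finite[OF fE] card by (auto simp: atLeast0LessThan n_def)
  obtain g where g: "bij_betw g {..<n} J"
    using ex_bij_betw_nat_finite[OF fJ] by (auto simp: atLeast0LessThan n_def)
  define B where "B = mat n n (\<lambda>(i, j). A (f i) (g j))"
  have B: "B \<in> carrier_mat n n" by (simp add: B_def)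
  have mB: "map_mat (\<lambda>p. poly p x) B = mat n n (\<lambda>(i, j). poly (A (f i) (g j)) x)" for x
    by (rule eq_matI) (auto simp: B_def)
  have dx: "poly (det B) x \<noteq> 0 \<longleftrightarrow> inj_system E J (\<lambda>e j. poly (A e j) x)" for x
    by (subst inj_system_iff_det[OF f g]) (simp add: poly_det mB)
  show thesis
  proof (rule that[of "det B"])
    show "poly (det B) 0 \<noteq> 0" using dx inj by simp
    show "\<And>x. poly (det B) x \<noteq> 0 \<Longrightarrow> inj_system E J (\<lambda>e j. poly (A e j) x)" using dx by simp
    fix b :: "'e \<Rightarrow> complex poly"
    define w where "w = vec n (\<lambda>i. b (f i))"
    define u where "u = adj_mat B *\<^sub>v w"
    define V where "V = (\<lambda>j. u $ (inv_into {..<n} g j))"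
    have w: "w \<in> carrier_vec n" by (simp add: w_def)
    have u: "u \<in> carrier_vec n" unfolding u_def using adj_mat(1)[OF B] w by simp
    have "B *\<^sub>v u = (B * adj_mat B) *\<^sub>v w"
      unfolding u_def using assoc_mult_mat_vec[OF B adj_mat(1)[OF B] w] by simp
    also have "\<dots> = det B \<cdot>\<^sub>v w"
      unfolding adj_mat(2)[OF B]
    proof (rule eq_vecI)
      fix i assume "i < dim_vec (det B \<cdot>\<^sub>v w)"
      then have i: "i < n" using w by simp
      have "row (det B \<cdot>\<^sub>m 1\<^sub>m n) i = det B \<cdot>\<^sub>v unit_vec n i"
        using i by (intro eq_vecI) auto
      then show "((det B \<cdot>\<^sub>m 1\<^sub>m n) *\<^sub>v w) $ i = (det B \<cdot>\<^sub>v w) $ i"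
        using i w by simp
    qed (use w in simp)
    finally have Bu: "B *\<^sub>v u = det B \<cdot>\<^sub>v w" .
    show "\<exists>V. \<forall>e\<in>E. (\<Sum>j\<in>J. A e j * V j) = det B * b e"
    proof (intro exI[of _ V] ballI)
      fix e assume "e \<in> E"
      then have "e \<in> f ` {..<n}" using f by (simp add: bij_betw_def)
      then obtain i where i: "i < n" "e = f i" by auto
      have "(\<Sum>j\<in>J. A e j * V j) = (\<Sum>j<n. A e (g j) * V (g j))"
        by (rule sum.reindex_bij_betw[OF g, symmetric])
      also have "\<dots> = (B *\<^sub>v u) $ i"
        using i u g by (auto simp: B_def scalar_prod_def atLeast0LessThan V_def bij_betw_def intro!: sum.cong)
      also have "\<dots> = det B * b e" unfolding Bu using i by (simp add: w_def)
      finally show "(\<Sum>j\<in>J. A e j * V j) = det B * b e" .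
    qed
  qed
qed

text \<open>Semicontinuity: together with the functionals that witness the bound at 0, some square
  subsystem is invertible at 0. Its determinant is a nonzero polynomial, and the same functionals
  witness the bound wherever it does not vanish.\<close>

lemma nullity_le_cofinite:
  fixes A :: "'e \<Rightarrow> 'j \<Rightarrow> complex poly"
  assumes fE: "finite E" and fJ: "finite J" and le: "nullity_le E J (\<lambda>e j. poly (A e j) 0) d"
  shows "finite {x. \<not> nullity_le E J (\<lambda>e j. poly (A e j) x) d}"
proof -
  obtain l :: "nat \<Rightarrow> 'j \<Rightarrow> complex" where l: "\<And>v. \<lbrakk>\<forall>e\<in>E. (\<Sum>j\<in>J. poly (A e j) 0 * v j) = 0; \<forall>i<d. (\<Sum>j\<in>J. l i j * v j) = 0\<rbrakk>
      \<Longrightarrow> \<forall>j\<in>J. v j = 0" using le by (auto simp: nullity_le_def)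
  define A' where "A' = (\<lambda>e j. case e of Inl e \<Rightarrow> A e j | Inr i \<Rightarrow> [:l i j:])"
  have "inj_system (Inl ` E \<union> Inr ` {..<d}) J (\<lambda>e j. poly (A' e j) 0)"
    unfolding inj_system_def using l by (auto simp: A'_def ball_Un)
  from inj_system_row_selection[OF _ fJ this] fE obtain R where
    R: "R \<subseteq> Inl ` E \<union> Inr ` {..<d}" "card R = card J" "inj_system R J (\<lambda>e j. poly (A' e j) 0)" by auto
  have fR: "finite R" by (rule finite_subset[OF R(1)]) (use fE in auto)
  obtain D where D: "poly D 0 \<noteq> 0"
    "\<And>x. poly D x \<noteq> 0 \<Longrightarrow> inj_system R J (\<lambda>e j. poly (A' e j) x)"
    by (rule polynomial_square_system[OF fR fJ R(2,3)]) (rule that; assumption)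
  have "nullity_le E J (\<lambda>e j. poly (A e j) x) d" if "poly D x \<noteq> 0" for x
    unfolding nullity_le_def
  proof (intro exI[of _ l] allI impI)
    fix v assume v: "\<forall>e\<in>E. (\<Sum>j\<in>J. poly (A e j) x * v j) = 0" "\<forall>i<d. (\<Sum>j\<in>J. l i j * v j) = 0"
    show "\<forall>j\<in>J. v j = 0"
    proof
      fix j assume "j \<in> J"
      show "v j = 0"
      proof (rule inj_systemD[OF D(2)[OF that] _ \<open>j \<in> J\<close>])
        fix e assume "e \<in> R"
        then have "e \<in> Inl ` E \<union> Inr ` {..<d}" using R(1) by blast
        then show "(\<Sum>j\<in>J. poly (A' e j) x * v j) = 0" using v by (auto simp: A'_def)
      qed
    qed
  qed
  then have "{x. \<not> nullity_le E J (\<lambda>e j. poly (A e j) x) d} \<subseteq> {x. poly D x = 0}" by auto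
  moreover have "finite {x. poly D x = 0}" using D by (intro poly_roots_finite) auto
  ultimately show ?thesis by (rule finite_subset)
qed

text \<open>If the nullity is d at 0 and stays at least d at infinitely many parameters, the kernel
  moves polynomially. The lift solves the selected rows with value 0 and the functionals with the
  values they take on v. The other rows of E follow from the selected ones at infinitely many
  parameters, hence identically.\<close>

lemma kernel_lift:
  fixes A :: "'e \<Rightarrow> 'j \<Rightarrow> complex poly"
  assumes fE: "finite E" and fJ: "finite J" and le: "nullity_le E J (\<lambda>e j. poly (A e j) 0) d"
    and min: "\<And>d'. d' < d \<Longrightarrow> \<not> nullity_le E J (\<lambda>e j. poly (A e j) 0) d'"
    and inf: "infinite {x. \<forall>d'<d. \<not> nullity_le E J (\<lambda>e j. poly (A e j) x) d'}"
    and v: "\<And>e. e \<in> E \<Longrightarrow> (\<Sum>j\<in>J. poly (A e j) 0 * v j) = 0"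
  shows "\<exists>V. (\<forall>j\<in>J. poly (V j) 0 = v j) \<and> (\<forall>e\<in>E. (\<Sum>j\<in>J. A e j * V j) = 0)"
proof -
  obtain R l where R: "R \<subseteq> E" "card R + d = card J"
    and inj: "inj_system (Inl ` R \<union> Inr ` {..<d}) J (\<lambda>e. case e of Inl e \<Rightarrow> (\<lambda>j. poly (A e j) 0) | Inr i \<Rightarrow> l i)"
    using minimal_nullity_rows[OF fE fJ le min] by auto
  define S where "S = (Inl ` R \<union> Inr ` {..<d} :: ('e + nat) set)"
  define A' where "A' = (\<lambda>e j. case e of Inl e \<Rightarrow> A e j | Inr i \<Rightarrow> [:l i j:])"
  have fR: "finite R" using R fE finite_subset by auto
  have fS: "finite S" "card S = card J"
    using fR R(2) unfolding S_def by (simp, subst card_Un_disjoint) (auto simp: card_image)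
  have A'x: "(\<lambda>e j. poly (A' e j) x) = (\<lambda>e. case e of Inl e \<Rightarrow> (\<lambda>j. poly (A e j) x) | Inr i \<Rightarrow> l i)" for x
    by (auto simp: A'_def fun_eq_iff split: sum.splits)
  have inj0: "inj_system S J (\<lambda>e j. poly (A' e j) 0)" using inj unfolding A'x S_def .
  obtain D where D: "poly D 0 \<noteq> 0"
    "\<And>x. poly D x \<noteq> 0 \<Longrightarrow> inj_system S J (\<lambda>e j. poly (A' e j) x)"
    "\<And>b. \<exists>V. \<forall>e\<in>S. (\<Sum>j\<in>J. A' e j * V j) = D * b e"
    by (rule polynomial_square_system[OF fS(1) fJ fS(2) inj0]) (rule that; assumption)
  \<comment> \<open>Dividing by D(0) makes the right-hand side at 0 equal to the values on v, so
    that uniqueness at 0 forces V(0) = v.\<close>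
  obtain V where V: "\<And>e. e \<in> S \<Longrightarrow> (\<Sum>j\<in>J. A' e j * V j)
      = D * (case e of Inl _ \<Rightarrow> 0 | Inr i \<Rightarrow> [: (\<Sum>j\<in>J. l i j * v j) / poly D 0 :])"
    using D(3)[of "\<lambda>e. case e of Inl _ \<Rightarrow> 0 | Inr i \<Rightarrow> [: (\<Sum>j\<in>J. l i j * v j) / poly D 0 :]"] by auto
  have Vx: "(\<Sum>j\<in>J. poly (A' e j) x * poly (V j) x)
      = poly D x * (case e of Inl _ \<Rightarrow> 0 | Inr i \<Rightarrow> (\<Sum>j\<in>J. l i j * v j) / poly D 0)" if "e \<in> S" for e x
    using arg_cong[OF V[OF that], of "\<lambda>p. poly p x"] by (auto simp: poly_sum split: sum.splits)
  have V0: "poly (V j) 0 - v j = 0" if "j \<in> J" for j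
  proof (rule inj_systemD[OF inj0 _ that])
    fix e assume e: "e \<in> S"
    have "(\<Sum>j\<in>J. poly (A' e j) 0 * v j) = (case e of Inl _ \<Rightarrow> 0 | Inr i \<Rightarrow> (\<Sum>j\<in>J. l i j * v j))"
      using e v R by (auto simp: S_def A'_def)
    then show "(\<Sum>j\<in>J. poly (A' e j) 0 * (poly (V j) 0 - v j)) = 0"
      using Vx[OF e, of 0] D(1) by (auto simp: right_diff_distrib sum_subtractf split: sum.splits)
  qed
  have "(\<Sum>j\<in>J. A e j * V j) = 0" if e: "e \<in> E" for e
  proof (rule ccontr)
    assume ne: "(\<Sum>j\<in>J. A e j * V j) \<noteq> 0"
    have "poly (\<Sum>j\<in>J. A e j * V j) x = 0" if x: "poly D x \<noteq> 0" "\<forall>d'<d. \<not> nullity_le E J (\<lambda>e j. poly (A e j) x) d'" for x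
    proof -
      have "(\<Sum>j\<in>J. poly (A e j) x * poly (V j) x) = 0"
      proof (rule kernel_of_rows[OF fE fJ R _ _ _ e])
        show "inj_system (Inl ` R \<union> Inr ` {..<d}) J (\<lambda>e. case e of Inl e \<Rightarrow> (\<lambda>j. poly (A e j) x) | Inr i \<Rightarrow> l i)"
          using D(2)[OF x(1)] unfolding A'x S_def .
        show "\<And>d'. d' < d \<Longrightarrow> \<not> nullity_le E J (\<lambda>e j. poly (A e j) x) d'" using x by auto
        show "(\<Sum>j\<in>J. poly (A e' j) x * poly (V j) x) = 0" if "e' \<in> R" for e'
          using Vx[of "Inl e'" x] that by (auto simp: S_def A'_def)
      qed
      then show ?thesis by (simp add: poly_sum)
    qed
    then have "{x. \<forall>d'<d. \<not> nullity_le E J (\<lambda>e j. poly (A e j) x) d'}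
      \<subseteq> {x. poly (\<Sum>j\<in>J. A e j * V j) x = 0} \<union> {x. poly D x = 0}" by auto
    moreover have "finite ({x. poly (\<Sum>j\<in>J. A e j * V j) x = 0} \<union> {x. poly D x = 0})"
      using ne D(1) by (auto intro!: poly_roots_finite)
    ultimately show False using inf finite_subset by blast
  qed
  then show ?thesis using V0 by (intro exI[of _ V]) auto
qed

subsection \<open>Polynomial functions of frames\<close>

text \<open>A frame assigns to every space \<open>i\<close> vectors \<open>x i r\<close> with coordinates \<open>x i r k\<close>.\<close>

type_synonym 'a frame = "nat \<Rightarrow> nat \<Rightarrow> nat \<Rightarrow> 'a"

definition line :: "complex frame \<Rightarrow> complex frame \<Rightarrow> complex \<Rightarrow> complex frame" where
  "line x y t = (\<lambda>i r k. x i r k + t * (y i r k - x i r k))"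

text \<open>Polynomial functions of a frame, homogeneous of degree \<open>d i\<close> in the vectors
  of space i. \<open>zero\<close> is a separate rule because 0 has every degree whereas
  \<open>const\<close> gives degree 0. The inductive form makes both restriction to lines and
  substitution of Pluecker coordinates a rule induction.\<close>

inductive multihom :: "nat set \<Rightarrow> (nat \<Rightarrow> nat) \<Rightarrow> (complex frame \<Rightarrow> complex) \<Rightarrow> bool" for I where
  const: "multihom I (\<lambda>_. 0) (\<lambda>_. c)"
| zero: "multihom I d (\<lambda>_. 0)"
| coord: "i \<in> I \<Longrightarrow> multihom I (\<lambda>j. if j = i then 1 else 0) (\<lambda>x. x i r k)"
| add: "\<lbrakk>multihom I d P; multihom I d Q\<rbrakk> \<Longrightarrow> multihom I d (\<lambda>x. P x + Q x)"
| mult: "\<lbrakk>multihom I d P; multihom I d' Q\<rbrakk> \<Longrightarrow> multihom I (\<lambda>i. d i + d' i) (\<lambda>x. P x * Q x)"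

lemma multihom_line:
  assumes "multihom I d P"
  shows "\<exists>p. \<forall>t. P (line x y t) = poly p t"
  using assms
proof induction
  case (const c) show ?case by (rule exI[of _ "[:c:]"]) simp
next
  case (zero d) show ?case by (rule exI[of _ 0]) simp
next
  case (coord i r k)
  show ?case by (rule exI[of _ "[:x i r k, y i r k - x i r k:]"]) (simp add: line_def)
next
  case (add d P Q)
  then obtain p q where "\<forall>t. P (line x y t) = poly p t" "\<forall>t. Q (line x y t) = poly q t" by auto
  then show ?case by (intro exI[of _ "p + q"]) simp
next
  case (mult d P d' Q)
  then obtain p q where "\<forall>t. P (line x y t) = poly p t" "\<forall>t. Q (line x y t) = poly q t" by auto
  then show ?case by (intro exI[of _ "p * q"]) simp
qed

lemma multihom_sum:
  assumes "\<And>s. s \<in> S \<Longrightarrow> multihom I d (P s)"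
  shows "multihom I d (\<lambda>x. \<Sum>s\<in>S. P s x)"
  using assms by (induction S rule: infinite_finite_induct) (auto intro: multihom.intros)

lemma multihom_cmult: "multihom I d P \<Longrightarrow> multihom I d (\<lambda>x. c * P x)"
  using multihom.mult[OF multihom.const[of I c], of d P] by simp

lemma multihom_prod:
  assumes "\<And>s. s \<in> S \<Longrightarrow> multihom I (d s) (P s)"
  shows "multihom I (\<lambda>i. \<Sum>s\<in>S. d s i) (\<lambda>x. \<Prod>s\<in>S. P s x)"
  using assms
proof (induction S rule: infinite_finite_induct)
  case (insert s S)
  then show ?case using multihom.mult[of I "d s" "P s"] by simp
qed (auto intro: multihom.const)

text \<open>Every term of the Leibniz formula takes one factor from each row, so all terms have the
  same degree as soon as the degree of a row does not depend on the column.\<close>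

lemma multihom_det:
  assumes "\<And>e j. e \<in> E \<Longrightarrow> j \<in> J \<Longrightarrow> multihom I (d e) (\<lambda>x. M x e j)"
    and "finite E" "finite J" "card E = card J"
  obtains P d' where "multihom I d' P" "\<And>x. P x \<noteq> 0 \<longleftrightarrow> inj_system E J (M x)"
proof -
  define n where "n = card J"
  obtain f where f: "bij_betw f {..<n} E"
    using ex_bij_betw_nat_finite[OF assms(2)] assms(4) by (auto simp: atLeast0LessThan n_def)
  obtain g where g: "bij_betw g {..<n} J"
    using ex_bij_betw_nat_finite[OF assms(3)] by (auto simp: atLeast0LessThan n_def)
  have fE: "f i \<in> E" and gJ: "g i \<in> J" if "i < n" for i
    using f g that by (auto simp: bij_betw_def)
  define P where "P = (\<lambda>x. \<Sum>p | p permutes {0..<n}. signof p * (\<Prod>i = 0..<n. M x (f i) (g (p i))))"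
  have "multihom I (\<lambda>i. \<Sum>s=0..<n. d (f s) i) P"
    unfolding P_def
  proof (intro multihom_sum multihom_cmult multihom_prod)
    fix p s assume "p \<in> {p. p permutes {0..<n}}" "s \<in> {0..<n}"
    then show "multihom I (d (f s)) (\<lambda>x. M x (f s) (g (p s)))"
      using assms(1) fE gJ permutes_in_image[of p "{0..<n}" s] by auto
  qed
  moreover have "P x = det (mat n n (\<lambda>(i, j). M x (f i) (g j)))" for x
    unfolding P_def by (subst det_def'[where n = n]) (auto intro!: sum.cong prod.cong)
  moreover have "det (mat n n (\<lambda>(i, j). M x (f i) (g j))) \<noteq> 0 \<longleftrightarrow> inj_system E J (M x)" for x
    using inj_system_iff_det[OF f g, of "M x"] by simp
  ultimately show thesis by (intro that[of "\<lambda>i. \<Sum>s=0..<n. d (f s) i" P]) simp_all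
qed

text \<open>A substitute for Zariski openness that looks at lines only. It is enough for combining
  conditions, because frames satisfying different conditions can be joined by a line.\<close>

definition line_open :: "(complex frame \<Rightarrow> bool) \<Rightarrow> bool" where
  "line_open Q \<longleftrightarrow> (\<forall>x y. Q x \<longrightarrow> finite {t. \<not> Q (line x y t)})"

lemma line_open_conj:
  assumes "line_open P" "line_open Q"
  shows "line_open (\<lambda>x. P x \<and> Q x)"
  unfolding line_open_def
proof (intro allI impI)
  fix x y assume "P x \<and> Q x"
  then have "finite ({t. \<not> P (line x y t)} \<union> {t. \<not> Q (line x y t)})"
    using assms by (auto simp: line_open_def)
  then show "finite {t. \<not> (P (line x y t) \<and> Q (line x y t))}" by (rule finite_subset[rotated]) auto
qed

lemma line_open_ball:
  assumes "finite S" "\<And>s. s \<in> S \<Longrightarrow> line_open (P s)"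
  shows "line_open (\<lambda>x. \<forall>s\<in>S. P s x)"
  using assms
proof (induction S rule: finite_induct)
  case empty
  then show ?case by (simp add: line_open_def)
next
  case (insert s S)
  then show ?case using line_open_conj[of "P s" "\<lambda>x. \<forall>s\<in>S. P s x"] by simp
qed

text \<open>On the line joining x and y each condition fails at finitely many parameters, and the
  field is infinite. Reversing the line is the substitution of 1 - t for t.\<close>

lemma line_open_ex_conj:
  assumes "line_open P" "line_open Q" "P x" "Q y"
  shows "\<exists>z. P z \<and> Q z"
proof -
  have swap: "line y x (1 - t) = line x y t" for t by (auto simp: line_def fun_eq_iff algebra_simps)
  have "finite {t. \<not> P (line x y t)}" using assms by (auto simp: line_open_def)
  moreover have "finite ((\<lambda>t. 1 - t) ` {t. \<not> Q (line y x t)})" using assms by (auto simp: line_open_def)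
  then have "finite {t. \<not> Q (line x y t)}"
  proof (rule finite_subset[rotated])
    show "{t. \<not> Q (line x y t)} \<subseteq> (\<lambda>t. 1 - t) ` {t. \<not> Q (line y x t)}"
    proof
      fix t assume "t \<in> {t. \<not> Q (line x y t)}"
      then have "1 - t \<in> {t. \<not> Q (line y x t)}" using swap[of t] by simp
      then show "t \<in> (\<lambda>t. 1 - t) ` {t. \<not> Q (line y x t)}" by (rule rev_image_eqI) simp
    qed
  qed
  ultimately have "finite ({t. \<not> P (line x y t)} \<union> {t. \<not> Q (line x y t)})" by simp
  then have "{t. \<not> P (line x y t)} \<union> {t. \<not> Q (line x y t)} \<noteq> UNIV"
    using infinite_UNIV_char_0[where ?'a = complex] by metis
  then show ?thesis by auto
qed

lemma line_open_ex_ball: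
  assumes "finite S" "\<And>s. s \<in> S \<Longrightarrow> line_open (P s)" "\<And>s. s \<in> S \<Longrightarrow> \<exists>x. P s x"
  shows "\<exists>x. \<forall>s\<in>S. P s x"
  using assms
proof (induction S rule: finite_induct)
  case (insert s S)
  then obtain x y where "P s x" "\<forall>s\<in>S. P s y" by (metis insert_iff)
  then show ?case using line_open_ex_conj[of "P s" "\<lambda>x. \<forall>s\<in>S. P s x" x y]
      line_open_ball[OF insert.hyps(1), of P] insert.prems by auto
qed auto

lemma line_open_nullity_le:
  assumes "finite E" "finite J" and M: "\<And>e j. e \<in> E \<Longrightarrow> j \<in> J \<Longrightarrow> multihom I (d e j) (\<lambda>x. M x e j)"
  shows "line_open (\<lambda>x. nullity_le E J (M x) c)"
  unfolding line_open_def
proof (intro allI impI)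
  fix x y assume le: "nullity_le E J (M x) c"
  have "\<forall>e j. \<exists>p. e \<in> E \<longrightarrow> j \<in> J \<longrightarrow> (\<forall>t. M (line x y t) e j = poly p t)"
    using multihom_line[OF M] by blast
  then obtain A where A: "\<And>e j t. e \<in> E \<Longrightarrow> j \<in> J \<Longrightarrow> M (line x y t) e j = poly (A e j) t" by metis
  have eq: "nullity_le E J (M (line x y t)) c \<longleftrightarrow> nullity_le E J (\<lambda>e j. poly (A e j) t) c" for t
    unfolding nullity_le_def using A by (simp cong: sum.cong)
  have "line x y 0 = x" by (simp add: line_def)
  then have "nullity_le E J (\<lambda>e j. poly (A e j) 0) c" using le eq[of 0] by simp
  from nullity_le_cofinite[OF assms(1,2) this] show "finite {t. \<not> nullity_le E J (M (line x y t)) c}"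
    by (simp add: eq)
qed

subsection \<open>Quadrics through the spans of a frame\<close>

definition bil :: "nat \<Rightarrow> (nat \<Rightarrow> nat \<Rightarrow> 'a) \<Rightarrow> (nat \<Rightarrow> 'a) \<Rightarrow> (nat \<Rightarrow> 'a) \<Rightarrow> 'a::comm_ring_1" where
  "bil N q u v = (\<Sum>k<N. \<Sum>l<N. q k l * u k * v l)"

definition quadric :: "nat \<Rightarrow> nat set \<Rightarrow> (nat \<Rightarrow> nat) \<Rightarrow> 'a::comm_ring_1 frame \<Rightarrow> (nat \<Rightarrow> nat \<Rightarrow> 'a) \<Rightarrow> bool" where
  "quadric N I a x q \<longleftrightarrow> (\<forall>k<N. \<forall>l<N. q k l = q l k) \<and>
     (\<forall>i\<in>I. \<forall>r<a i. \<forall>t<a i. bil N q (x i r) (x i t) = 0)"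

definition no_quadric :: "nat \<Rightarrow> nat set \<Rightarrow> (nat \<Rightarrow> nat) \<Rightarrow> complex frame \<Rightarrow> bool" where
  "no_quadric N I a x \<longleftrightarrow> (\<forall>q. quadric N I a x q \<longrightarrow> (\<forall>k<N. \<forall>l<N. q k l = 0))"

text \<open>The unknowns are all N * N entries of the form; symmetry is imposed by the
  \<open>Inr\<close> rows rather than built into the unknowns.\<close>

definition quad_rows :: "nat \<Rightarrow> nat set \<Rightarrow> (nat \<Rightarrow> nat) \<Rightarrow> ((nat \<times> nat \<times> nat) + nat \<times> nat) set" where
  "quad_rows N I a = Inl ` (SIGMA i:I. {..<a i} \<times> {..<a i}) \<union> Inr ` ({..<N} \<times> {..<N})"

definition quad_coeff :: "'a::comm_ring_1 frame \<Rightarrow> (nat \<times> nat \<times> nat) + nat \<times> nat \<Rightarrow> nat \<times> nat \<Rightarrow> 'a" where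
  "quad_coeff x e j = (case e of Inl (i, r, t) \<Rightarrow> x i r (fst j) * x i t (snd j)
     | Inr (k, l) \<Rightarrow> (if j = (k, l) then 1 else 0) - (if j = (l, k) then 1 else 0))"

lemma finite_quad_rows: "finite I \<Longrightarrow> finite (quad_rows N I a)"
  by (auto simp: quad_rows_def)

lemma quad_sum_Inl:
  "(\<Sum>j\<in>{..<N} \<times> {..<N}. quad_coeff x (Inl (i, r, t)) j * v j) = bil N (\<lambda>k l. v (k, l)) (x i r) (x i t)"
  unfolding bil_def by (simp add: quad_coeff_def sum.cartesian_product split_def ac_simps)

lemma quad_sum_Inr:
  assumes "k < N" "l < N"
  shows "(\<Sum>j\<in>{..<N} \<times> {..<N}. quad_coeff x (Inr (k, l)) j * v j) = v (k, l) - v (l, k)"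
proof -
  have "(\<Sum>j\<in>{..<N} \<times> {..<N}. quad_coeff x (Inr (k, l)) j * v j)
     = (\<Sum>j\<in>{..<N} \<times> {..<N}. (if j = (k, l) then v j else 0) - (if j = (l, k) then v j else 0))"
    unfolding quad_coeff_def sum.case prod.case by (rule sum.cong[OF refl]) (simp only: left_diff_distrib if_distrib[of "\<lambda>c. c * _"] mult_1_left mult_zero_left)
  also have "\<dots> = v (k, l) - v (l, k)" using assms unfolding sum_subtractf by (subst (1 2) sum.delta) auto
  finally show ?thesis .
qed

lemma quad_system_iff:
  "(\<forall>e\<in>quad_rows N I a. (\<Sum>j\<in>{..<N} \<times> {..<N}. quad_coeff x e j * v j) = 0)
     \<longleftrightarrow> quadric N I a x (\<lambda>k l. v (k, l))"
proof -
  have "(\<forall>e\<in>quad_rows N I a. (\<Sum>j\<in>{..<N} \<times> {..<N}. quad_coeff x e j * v j) = 0)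
    \<longleftrightarrow> (\<forall>i\<in>I. \<forall>r<a i. \<forall>t<a i. (\<Sum>j\<in>{..<N} \<times> {..<N}. quad_coeff x (Inl (i, r, t)) j * v j) = 0)
       \<and> (\<forall>k<N. \<forall>l<N. (\<Sum>j\<in>{..<N} \<times> {..<N}. quad_coeff x (Inr (k, l)) j * v j) = 0)"
    unfolding quad_rows_def ball_Un by blast
  then show ?thesis unfolding quad_sum_Inl quadric_def using quad_sum_Inr[of _ N _ x v] by auto
qed

lemma no_quadric_iff_nullity:
  "no_quadric N I a x \<longleftrightarrow> nullity_le (quad_rows N I a) ({..<N} \<times> {..<N}) (quad_coeff x) 0"
  (is "?L \<longleftrightarrow> ?R")
proof
  assume L: ?L
  show ?R unfolding nullity_le_0 inj_system_def quad_system_iff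
  proof (intro allI impI ballI)
    fix v j assume v: "quadric N I a x (\<lambda>k l. v (k, l))" and j: "j \<in> {..<N} \<times> {..<N}"
    obtain k l where "j = (k, l)" "k < N" "l < N" using j by auto
    then show "v j = 0" using L[unfolded no_quadric_def, rule_format, OF v] by blast
  qed
next
  assume R: ?R
  show ?L unfolding no_quadric_def
  proof (intro allI impI)
    fix q k l assume q: "quadric N I a x q" and kl: "k < N" "l < N"
    have R': "\<forall>v. quadric N I a x (\<lambda>k l. v (k, l)) \<longrightarrow> (\<forall>j\<in>{..<N} \<times> {..<N}. v j = 0)"
      using R unfolding nullity_le_0 inj_system_def quad_system_iff .
    show "q k l = 0" using spec[OF R', of "\<lambda>j. q (fst j) (snd j)"] q kl by force
  qed
qed

text \<open>The degree of a row is the same in all columns, as \<open>multihom_det\<close> requires: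
  2 in a single space for a vanishing condition, 0 for a symmetry condition.\<close>

lemma multihom_quad_coeff:
  "e \<in> quad_rows N I a \<Longrightarrow> \<exists>d. \<forall>j. multihom I d (\<lambda>x. quad_coeff x e j)"
proof -
  assume e: "e \<in> quad_rows N I a"
  show ?thesis
  proof (cases e)
    case (Inl p)
    obtain i r t where p: "p = (i, r, t)" by (cases p)
    have "i \<in> I" using e Inl p by (auto simp: quad_rows_def)
    then have "multihom I (\<lambda>j. (if j = i then 1 else 0) + (if j = i then 1 else 0)) (\<lambda>x. x i r (fst j) * x i t (snd j))" for j
      by (rule multihom.mult[OF multihom.coord multihom.coord]) (use \<open>i \<in> I\<close> in auto)
    then show ?thesis unfolding Inl p quad_coeff_def sum.case prod.case by blast
  next
    case (Inr p)
    obtain k l where p: "p = (k, l)" by (cases p)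
    have "multihom I (\<lambda>_. 0) (\<lambda>x. quad_coeff x e j)" for j
      unfolding Inr p quad_coeff_def sum.case prod.case by (rule multihom.const)
    then show ?thesis by blast
  qed
qed

lemma line_open_no_quadric: "finite I \<Longrightarrow> line_open (no_quadric N I a)"
proof -
  assume fI: "finite I"
  have "\<forall>e\<in>quad_rows N I a. \<exists>d. \<forall>j. multihom I d (\<lambda>x. quad_coeff x e j)"
    by (intro ballI multihom_quad_coeff)
  from bchoice[OF this] obtain d where d: "\<forall>e\<in>quad_rows N I a. \<forall>j. multihom I (d e) (\<lambda>x. quad_coeff x e j)" ..
  show ?thesis unfolding no_quadric_iff_nullity
  proof (rule line_open_nullity_le[where d = "\<lambda>e j. d e" and I = I])
    show "finite (quad_rows N I a)" using fI by (rule finite_quad_rows)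
    show "multihom I (d e) (\<lambda>x. quad_coeff x e j)" if "e \<in> quad_rows N I a" for e j
      using d that by blast
  qed simp
qed

lemma bil_swap: "(\<And>k l. k < N \<Longrightarrow> l < N \<Longrightarrow> q k l = q l k) \<Longrightarrow> bil N q u v = bil N q v u"
  unfolding bil_def by (subst sum.swap) (auto intro!: sum.cong simp: ac_simps)

lemma bil_cong:
  "\<lbrakk>\<And>k l. k < N \<Longrightarrow> l < N \<Longrightarrow> q k l = q' k l; \<And>k. k < N \<Longrightarrow> u k = u' k; \<And>k. k < N \<Longrightarrow> v k = v' k\<rbrakk>
   \<Longrightarrow> bil N q u v = bil N q' u' v'"
  unfolding bil_def by (auto intro!: sum.cong)

lemma bil_sum_left: "bil N q (\<lambda>k. \<Sum>s\<in>S. c s * u s k) v = (\<Sum>s\<in>S. c s * bil N q (u s) v)"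
proof -
  have "bil N q (\<lambda>k. \<Sum>s\<in>S. c s * u s k) v = (\<Sum>k<N. \<Sum>l<N. \<Sum>s\<in>S. c s * (q k l * u s k * v l))"
    unfolding bil_def by (simp add: sum_distrib_left sum_distrib_right ac_simps)
  also have "\<dots> = (\<Sum>s\<in>S. \<Sum>k<N. \<Sum>l<N. c s * (q k l * u s k * v l))"
    by (subst (2) sum.swap, subst sum.swap) rule
  finally show ?thesis by (simp add: bil_def sum_distrib_left)
qed

lemma bil_transpose: "bil N (\<lambda>k l. q l k) v u = bil N q u v"
  unfolding bil_def by (subst sum.swap) (intro sum.cong refl, simp only: mult.assoc mult.commute[of "u _"])

lemma bil_sum_right: "bil N q u (\<lambda>k. \<Sum>s\<in>S. c s * v s k) = (\<Sum>s\<in>S. c s * bil N q u (v s))"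
proof -
  have "bil N q u (\<lambda>k. \<Sum>s\<in>S. c s * v s k) = bil N (\<lambda>k l. q l k) (\<lambda>k. \<Sum>s\<in>S. c s * v s k) u"
    by (rule bil_transpose[symmetric])
  also have "\<dots> = (\<Sum>s\<in>S. c s * bil N q u (v s))"
    unfolding bil_sum_left by (intro sum.cong refl arg_cong2[of _ _ _ _ "(*)"] bil_transpose)
  finally show ?thesis .
qed

lemma bil_alt: "bil N q u v = (\<Sum>k<N. u k * (\<Sum>l<N. q k l * v l))"
  unfolding bil_def by (simp add: sum_distrib_left ac_simps)

lemma bil_alt2:
  assumes "\<And>k l. k < N \<Longrightarrow> l < N \<Longrightarrow> q k l = q l k"
  shows "bil N q u v = (\<Sum>l<N. v l * (\<Sum>k<N. q l k * u k))"
  using bil_swap[of N q u v] assms unfolding bil_alt by simp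

subsection \<open>First-order deformations of a generic configuration\<close>

lemma coeff_mult_1: "coeff (p * q) 1 = coeff p 1 * coeff q 0 + coeff p 0 * coeff q (1::nat)"
  by (simp add: coeff_mult add.commute)

lemma coeff_bil_1:
  "coeff (bil N Q U V) 1 = bil N (\<lambda>k l. coeff (Q k l) 1) (\<lambda>k. coeff (U k) 0) (\<lambda>k. coeff (V k) 0)
     + bil N (\<lambda>k l. coeff (Q k l) 0) (\<lambda>k. coeff (U k) 1) (\<lambda>k. coeff (V k) 0)
     + bil N (\<lambda>k l. coeff (Q k l) 0) (\<lambda>k. coeff (U k) 0) (\<lambda>k. coeff (V k) 1)"
  unfolding bil_def
  by (simp add: coeff_sum coeff_mult_1 coeff_mult_0 sum.distrib algebra_simps del: One_nat_def)

lemma poly_bil: "poly (bil N Q U V) t = bil N (\<lambda>k l. poly (Q k l) t) (\<lambda>k. poly (U k) t) (\<lambda>k. poly (V k) t)"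
  unfolding bil_def by (simp add: poly_sum)

text \<open>Where the nullity of the quadric system is minimal, every quadric \<open>q\<close> deforms along with the
  frame; when moreover the rank of \<open>q\<close> and its ranks on the spaces are maximal, so do the kernels.\<close>

lemma first_order_deformation:
  assumes fI: "finite I" and ex: "\<And>x. \<not> no_quadric N I a x"
  obtains x q where "quadric N I a x q" "\<exists>k<N. \<exists>l<N. q k l \<noteq> (0::complex)"
    and "\<And>\<delta>. \<exists>q'. (\<forall>k<N. \<forall>l<N. q' k l = q' l k)
      \<and> (\<forall>i\<in>I. \<forall>r<a i. \<forall>t<a i. bil N q' (x i r) (x i t) + bil N q (\<delta> i r) (x i t) + bil N q (x i r) (\<delta> i t) = 0)
      \<and> (\<forall>u u'. (\<forall>l<N. (\<Sum>k<N. q l k * u k) = 0) \<longrightarrow> (\<forall>l<N. (\<Sum>k<N. q l k * u' k) = 0) \<longrightarrow> bil N q' u u' = 0)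
      \<and> (\<forall>i\<in>I. \<forall>c \<theta>. (\<forall>l<N. (\<Sum>r<a i. (\<Sum>k<N. q l k * x i r k) * c r) = 0) \<longrightarrow>
           (\<forall>r<a i. bil N q \<theta> (x i r) = 0) \<longrightarrow>
           (\<Sum>r<a i. c r * (bil N q' \<theta> (x i r) + bil N q \<theta> (\<delta> i r))) = 0)"
proof -
  define J where "J = {..<N} \<times> {..<N}"
  define E where "E = quad_rows N I a"
  have fJ: "finite J" and fE: "finite E" using fI by (auto simp: J_def E_def finite_quad_rows)
  define nul where "nul = (\<lambda>x. nullity E J (quad_coeff x))"
  obtain x0 where x0: "\<And>x. nul x0 \<le> nul x"
    using ex_has_least_nat[of "\<lambda>_. True" _ nul] by auto
  define d where "d = nul x0"
  define nz where "nz = (\<lambda>q. \<exists>k<N. \<exists>l<N. q k l \<noteq> (0::complex))"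
  define adm where "adm = (\<lambda>(x, q). nul x = d \<and> quadric N I a x q \<and> nz q)"
  define nq where "nq = (\<lambda>q. nullity {..<N} {..<N} (\<lambda>l k. q l k :: complex))"
  define nw where "nw = (\<lambda>i (x, q). nullity {..<N} {..<a i} (\<lambda>l r. \<Sum>k<N. q l k * x i r k :: complex))"
  \<comment> \<open>Each summand can only drop at a general point of a deformation, so minimality of
    the sum keeps every summand constant there. This is what allows \<open>kernel_lift\<close> to be
    applied to each kernel separately.\<close>
  define G where "G = (\<lambda>p. nq (snd p) + (\<Sum>i\<in>I. nw i p))"
  obtain q0 where "adm (x0, q0)" using ex[of x0] by (auto simp: no_quadric_def adm_def nz_def d_def)
  from ex_has_least_nat[of adm, OF this, of G] obtain x q where
    adm: "adm (x, q)" and least: "\<And>y p. adm (y, p) \<Longrightarrow> G (x, q) \<le> G (y, p)" by auto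
  have xd: "nul x = d" and xq: "quadric N I a x q" and q0: "nz q" using adm by (auto simp: adm_def)
  have qs: "q k l = q l k" if "k < N" "l < N" for k l using xq that by (auto simp: quadric_def)
  show thesis
  proof (rule that[OF xq q0[unfolded nz_def]])
    fix \<delta> :: "complex frame"
    \<comment> \<open>The frame moves linearly in direction \<delta>. Minimal nullity lifts q to a
      polynomial family Q of quadrics through the moving frame, and the wanted q' is the coefficient
      of degree 1 of Q.\<close>
    define X where "X = (\<lambda>i r k. [:x i r k, \<delta> i r k:])"
    define y where "y = (\<lambda>t i r k. poly (X i r k) t)"
    have y0: "y 0 = x" by (auto simp: y_def X_def)
    have pc: "poly (quad_coeff X e j) t = quad_coeff (y t) e j" for e j t
    proof (cases e)
      case (Inl p)
      then show ?thesis by (cases p) (simp add: quad_coeff_def y_def)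
    next
      case (Inr p)
      have "poly (if b then 1 else 0) t = (if b then 1 else 0)" for b :: bool and t :: complex by simp
      then show ?thesis unfolding Inr quad_coeff_def by (cases p) (simp only: sum.case prod.case poly_diff)
    qed
    have "\<exists>V. (\<forall>j\<in>J. poly (V j) 0 = q (fst j) (snd j)) \<and> (\<forall>e\<in>E. (\<Sum>j\<in>J. quad_coeff X e j * V j) = 0)"
    proof (rule kernel_lift[OF fE fJ])
      show "nullity_le E J (\<lambda>e j. poly (quad_coeff X e j) 0) d"
        unfolding pc y0 using nullity_le_nullity[OF fJ, of E "quad_coeff x"] xd by (simp add: nul_def)
      have nn: "\<not> nullity_le E J (\<lambda>e j. poly (quad_coeff X e j) t) d'" if "d' < d" for d' t
        unfolding pc using not_nullity_le[of d' E J "quad_coeff (y t)"] x0[of "y t"] that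
        by (simp add: nul_def d_def)
      then show "\<And>d'. d' < d \<Longrightarrow> \<not> nullity_le E J (\<lambda>e j. poly (quad_coeff X e j) 0) d'" .
      have "{t. \<forall>d'<d. \<not> nullity_le E J (\<lambda>e j. poly (quad_coeff X e j) t) d'} = UNIV" using nn by auto
      then show "infinite {t. \<forall>d'<d. \<not> nullity_le E J (\<lambda>e j. poly (quad_coeff X e j) t) d'}"
        using infinite_UNIV_char_0[where ?'a = complex] by simp
      show "(\<Sum>j\<in>J. poly (quad_coeff X e j) 0 * q (fst j) (snd j)) = 0" if "e \<in> E" for e
        unfolding pc y0 using quad_system_iff[of N I a x "\<lambda>j. q (fst j) (snd j)"] xq that
        by (simp add: E_def J_def)
    qed
    then obtain V where V0: "\<And>j. j \<in> J \<Longrightarrow> poly (V j) 0 = q (fst j) (snd j)"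
      and VE: "\<forall>e\<in>E. (\<Sum>j\<in>J. quad_coeff X e j * V j) = 0" by auto
    define Q where "Q = (\<lambda>k l. V (k, l))"
    have Q0: "poly (Q k l) 0 = q k l" if "k < N" "l < N" for k l using V0[of "(k, l)"] that by (simp add: Q_def J_def)
    have QX: "quadric N I a X Q" using VE unfolding E_def J_def quad_system_iff Q_def .
    then have Qs: "\<And>k l. k < N \<Longrightarrow> l < N \<Longrightarrow> Q k l = Q l k"
      and Qb: "\<And>i r t. i \<in> I \<Longrightarrow> r < a i \<Longrightarrow> t < a i \<Longrightarrow> bil N Q (X i r) (X i t) = 0" by (auto simp: quadric_def)
    define Qt where "Qt = (\<lambda>t k l. poly (Q k l) t)"
    define cq where "cq = (\<lambda>l k. Q l k)"
    define cw where "cw = (\<lambda>i l r. \<Sum>k<N. Q l k * X i r k)"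
    have quad_t: "quadric N I a (y t) (Qt t)" for t
    proof -
      have "bil N (Qt t) (y t i r) (y t i s) = poly (bil N Q (X i r) (X i s)) t" for i r s
        by (simp add: poly_bil Qt_def y_def)
      then show ?thesis using Qs Qb by (auto simp: quadric_def Qt_def)
    qed
    have nq_t: "nq (Qt t) = nullity {..<N} {..<N} (\<lambda>l k. poly (cq l k) t)" for t
      by (simp add: nq_def Qt_def cq_def)
    have nw_t: "nw i (y t, Qt t) = nullity {..<N} {..<a i} (\<lambda>l r. poly (cw i l r) t)" for i t
      by (simp add: nw_def Qt_def cw_def y_def poly_sum)
    have null_cong: "nullity E' J' M = nullity E' J' M'" if "\<And>e j. e \<in> E' \<Longrightarrow> j \<in> J' \<Longrightarrow> M e j = M' e j" for E' :: "nat set" and J' :: "nat set" and M M'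
      unfolding nullity_def nullity_le_def using that by (simp cong: sum.cong)
    have nq_0: "nq (Qt 0) = nq q" unfolding nq_def by (rule null_cong) (simp add: Qt_def Q0)
    have nw_0: "nw i (y 0, Qt 0) = nw i (x, q)" if "i \<in> I" for i
      unfolding nw_def prod.case y0 by (rule null_cong) (simp add: Qt_def Q0)
    obtain k0 l0 where kl: "k0 < N" "l0 < N" "q k0 l0 \<noteq> 0" using q0 by (auto simp: nz_def)
    define bad where "bad = {t. \<not> nullity_le E J (\<lambda>e j. poly (quad_coeff X e j) t) d} \<union> {t. poly (Q k0 l0) t = 0}
      \<union> {t. \<not> nullity_le {..<N} {..<N} (\<lambda>l k. poly (cq l k) t) (nq q)}
      \<union> (\<Union>i\<in>I. {t. \<not> nullity_le {..<N} {..<a i} (\<lambda>l r. poly (cw i l r) t) (nw i (x, q))})"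
    have "finite bad"
      unfolding bad_def
    proof (intro finite_UnI finite_UN_I fI)
      show "finite {t. \<not> nullity_le E J (\<lambda>e j. poly (quad_coeff X e j) t) d}"
        by (rule nullity_le_cofinite[OF fE fJ])
          (use nullity_le_nullity[OF fJ, of E "quad_coeff x"] xd in \<open>simp add: pc y0 nul_def\<close>)
      show "finite {t. poly (Q k0 l0) t = 0}"
        using Q0[OF kl(1,2)] kl(3) by (intro poly_roots_finite) auto
      show "finite {t. \<not> nullity_le {..<N} {..<N} (\<lambda>l k. poly (cq l k) t) (nq q)}"
        by (rule nullity_le_cofinite)
          (use nullity_le_nullity[of "{..<N}" "{..<N}" "\<lambda>l k. poly (cq l k) 0"] nq_t[of 0] nq_0 in auto)
      show "finite {t. \<not> nullity_le {..<N} {..<a i} (\<lambda>l r. poly (cw i l r) t) (nw i (x, q))}" if "i \<in> I" for i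
        by (rule nullity_le_cofinite)
          (use nullity_le_nullity[of "{..<a i}" "{..<N}" "\<lambda>l r. poly (cw i l r) 0"] nw_t[of i 0] nw_0[OF that] in auto)
    qed
    have eqs: "nq (Qt t) = nq q \<and> (\<forall>i\<in>I. nw i (y t, Qt t) = nw i (x, q))" if "t \<notin> bad" for t
    proof -
      have "nul (y t) \<le> d" using that nullity_least[of E J "quad_coeff (y t)" d] by (simp add: bad_def pc nul_def)
      then have "nul (y t) = d" using x0[of "y t"] by (simp add: d_def)
      moreover have "nz (Qt t)" using that kl by (auto simp: nz_def Qt_def bad_def)
      ultimately have "adm (y t, Qt t)" using quad_t by (auto simp: adm_def)
      from least[OF this] have "nq q + (\<Sum>i\<in>I. nw i (x, q)) \<le> nq (Qt t) + (\<Sum>i\<in>I. nw i (y t, Qt t))"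
        by (simp add: G_def)
      moreover have 1: "nq (Qt t) \<le> nq q" using that by (auto simp: bad_def nq_t intro!: nullity_least)
      moreover have 2: "nw i (y t, Qt t) \<le> nw i (x, q)" if "i \<in> I" for i
        using that \<open>t \<notin> bad\<close> by (auto simp: bad_def nw_t intro!: nullity_least)
      moreover have 3: "(\<Sum>i\<in>I. nw i (y t, Qt t)) \<le> (\<Sum>i\<in>I. nw i (x, q))" by (rule sum_mono) (rule 2)
      ultimately have "nq (Qt t) = nq q" "(\<Sum>i\<in>I. nw i (y t, Qt t)) = (\<Sum>i\<in>I. nw i (x, q))" by linarith+
      with sum_mono_inv[OF this(2) 2 _ fI] show ?thesis by blast
    qed
    have inf: "infinite {t. P t}" if "\<And>t. t \<notin> bad \<Longrightarrow> P t" for P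
    proof
      assume "finite {t. P t}"
      then have "finite ({t. P t} \<union> bad)" using \<open>finite bad\<close> by simp
      moreover have "{t. P t} \<union> bad = UNIV" using that by auto
      ultimately show False using infinite_UNIV_char_0[where ?'a = complex] by simp
    qed
    define q' where "q' = (\<lambda>k l. coeff (Q k l) 1)"
    have cQ0: "coeff (Q k l) 0 = q k l" if "k < N" "l < N" for k l
      using Q0[OF that] by (simp add: poly_0_coeff_0)
    have cX0: "coeff (X i r k) 0 = x i r k" and cX1: "coeff (X i r k) 1 = \<delta> i r k" for i r k
      by (auto simp: X_def)
    show "\<exists>q'. (\<forall>k<N. \<forall>l<N. q' k l = q' l k)
      \<and> (\<forall>i\<in>I. \<forall>r<a i. \<forall>t<a i. bil N q' (x i r) (x i t) + bil N q (\<delta> i r) (x i t) + bil N q (x i r) (\<delta> i t) = 0)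
      \<and> (\<forall>u u'. (\<forall>l<N. (\<Sum>k<N. q l k * u k) = 0) \<longrightarrow> (\<forall>l<N. (\<Sum>k<N. q l k * u' k) = 0) \<longrightarrow> bil N q' u u' = 0)
      \<and> (\<forall>i\<in>I. \<forall>c \<theta>. (\<forall>l<N. (\<Sum>r<a i. (\<Sum>k<N. q l k * x i r k) * c r) = 0) \<longrightarrow>
           (\<forall>r<a i. bil N q \<theta> (x i r) = 0) \<longrightarrow>
           (\<Sum>r<a i. c r * (bil N q' \<theta> (x i r) + bil N q \<theta> (\<delta> i r))) = 0)"
    proof (intro exI[of _ q'] conjI allI ballI impI)
      fix k l assume "k < N" "l < N"
      then show "q' k l = q' l k" using Qs by (simp add: q'_def)
    next
      fix i r t assume "i \<in> I" "r < a i" "t < a i"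
      then have "coeff (bil N Q (X i r) (X i t)) 1 = 0" using Qb by simp
      then show "bil N q' (x i r) (x i t) + bil N q (\<delta> i r) (x i t) + bil N q (x i r) (\<delta> i t) = 0"
        unfolding coeff_bil_1 cX0 cX1 q'_def by (simp add: cQ0 cong: bil_cong)
    next
      \<comment> \<open>Only u' is lifted, to U with Q U = 0. The coefficient of degree 1 gives q'
        u' = - q U1, with U1 that of U, and pairing with u kills the right-hand side because q is
        symmetric and u lies in its kernel.\<close>
      fix u u' assume u: "\<forall>l<N. (\<Sum>k<N. q l k * u k) = 0" and u': "\<forall>l<N. (\<Sum>k<N. q l k * u' k) = 0"
      have "\<exists>U. (\<forall>j\<in>{..<N}. poly (U j) 0 = u' j) \<and> (\<forall>e\<in>{..<N}. (\<Sum>j<N. cq e j * U j) = 0)"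
      proof (rule kernel_lift)
        show "nullity_le {..<N} {..<N} (\<lambda>e j. poly (cq e j) 0) (nq q)"
          using nullity_le_nullity[of "{..<N}" "{..<N}" "\<lambda>l k. poly (cq l k) 0"] nq_t[of 0] nq_0 by auto
        show "\<not> nullity_le {..<N} {..<N} (\<lambda>e j. poly (cq e j) 0) d'" if "d' < nq q" for d'
          using that not_nullity_le nq_t[of 0] nq_0 by auto
        show "infinite {t. \<forall>d'<nq q. \<not> nullity_le {..<N} {..<N} (\<lambda>e j. poly (cq e j) t) d'}"
        proof (rule inf, intro allI impI)
          fix t d' assume "t \<notin> bad" "d' < nq q"
          then have "d' < nullity {..<N} {..<N} (\<lambda>l k. poly (cq l k) t)" using eqs[of t] nq_t[of t] by simp
          then show "\<not> nullity_le {..<N} {..<N} (\<lambda>e j. poly (cq e j) t) d'" by (rule not_nullity_le)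
        qed
        show "(\<Sum>j<N. poly (cq e j) 0 * u' j) = 0" if "e \<in> {..<N}" for e
          using u' that by (simp add: cq_def Q0)
      qed auto
      then obtain U where U0: "\<And>j. j < N \<Longrightarrow> coeff (U j) 0 = u' j"
        and UE: "\<And>l. l < N \<Longrightarrow> (\<Sum>k<N. Q l k * U k) = 0" by (auto simp: cq_def poly_0_coeff_0)
      have U1: "(\<Sum>k<N. q' l k * u' k) = - (\<Sum>k<N. q l k * coeff (U k) 1)" if "l < N" for l
      proof -
        have "0 = coeff (\<Sum>k<N. Q l k * U k) 1" using UE[OF that] by simp
        also have "\<dots> = (\<Sum>k<N. q' l k * u' k + q l k * coeff (U k) 1)"
          unfolding coeff_sum by (rule sum.cong) (use that in \<open>auto simp: coeff_mult_1 q'_def U0 cQ0 simp del: One_nat_def\<close>)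
        finally show ?thesis by (simp add: sum.distrib eq_neg_iff_add_eq_0 del: One_nat_def)
      qed
      have "bil N q' u u' = (\<Sum>l<N. u l * (\<Sum>k<N. q' l k * u' k))" by (rule bil_alt)
      also have "\<dots> = - bil N q u (\<lambda>k. coeff (U k) 1)"
        unfolding bil_alt using U1 by (simp add: sum_negf del: One_nat_def)
      also have "bil N q u (\<lambda>k. coeff (U k) 1) = 0" using u by (subst bil_alt2) (auto simp: qs)
      finally show "bil N q' u u' = 0" by simp
    next
      \<comment> \<open>The coefficients c are lifted to C with Q X C = 0. In the coefficient of
        degree 1, the terms with the derivative of C disappear on pairing with \<theta>, which is
        orthogonal to the i-th space.\<close>
      fix i c \<theta> assume i: "i \<in> I" and c: "\<forall>l<N. (\<Sum>r<a i. (\<Sum>k<N. q l k * x i r k) * c r) = 0"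
        and \<theta>: "\<forall>r<a i. bil N q \<theta> (x i r) = 0"
      have "\<exists>C. (\<forall>j\<in>{..<a i}. poly (C j) 0 = c j) \<and> (\<forall>e\<in>{..<N}. (\<Sum>j<a i. cw i e j * C j) = 0)"
      proof (rule kernel_lift)
        show "nullity_le {..<N} {..<a i} (\<lambda>e j. poly (cw i e j) 0) (nw i (x, q))"
          using nullity_le_nullity[of "{..<a i}" "{..<N}" "\<lambda>l k. poly (cw i l k) 0"] nw_t[of i 0] nw_0[OF i] by auto
        show "\<not> nullity_le {..<N} {..<a i} (\<lambda>e j. poly (cw i e j) 0) d'" if "d' < nw i (x, q)" for d'
          using that not_nullity_le nw_t[of i 0] nw_0[OF i] by auto
        show "infinite {t. \<forall>d'<nw i (x, q). \<not> nullity_le {..<N} {..<a i} (\<lambda>e j. poly (cw i e j) t) d'}"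
        proof (rule inf, intro allI impI)
          fix t d' assume "t \<notin> bad" "d' < nw i (x, q)"
          then have "d' < nullity {..<N} {..<a i} (\<lambda>l r. poly (cw i l r) t)" using eqs[of t] nw_t[of i t] i by simp
          then show "\<not> nullity_le {..<N} {..<a i} (\<lambda>e j. poly (cw i e j) t) d'" by (rule not_nullity_le)
        qed
        show "(\<Sum>j<a i. poly (cw i e j) 0 * c j) = 0" if "e \<in> {..<N}" for e
          using c that by (simp add: cw_def poly_sum Q0 X_def mult.commute[of "x _ _ _"])
      qed auto
      then obtain C where C0: "\<And>r. r < a i \<Longrightarrow> coeff (C r) 0 = c r"
        and CE: "\<And>l. l < N \<Longrightarrow> (\<Sum>r<a i. (\<Sum>k<N. Q l k * X i r k) * C r) = 0"
        by (auto simp: cw_def poly_0_coeff_0)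
      have C1: "0 = (\<Sum>r<a i. c r * (\<Sum>k<N. q' l k * x i r k) + c r * (\<Sum>k<N. q l k * \<delta> i r k)
            + coeff (C r) 1 * (\<Sum>k<N. q l k * x i r k))" if "l < N" for l
      proof -
        have "0 = coeff (\<Sum>r<a i. (\<Sum>k<N. Q l k * X i r k) * C r) 1" using CE[OF that] by simp
        also have "\<dots> = (\<Sum>r<a i. (\<Sum>k<N. q' l k * x i r k + q l k * \<delta> i r k) * c r
            + (\<Sum>k<N. q l k * x i r k) * coeff (C r) 1)"
          unfolding coeff_sum coeff_mult_1
          by (intro sum.cong refl arg_cong2[of _ _ _ _ "(+)"] arg_cong2[of _ _ _ _ "(*)"])
             (use that in \<open>auto simp: coeff_sum coeff_mult_1 coeff_mult_0 q'_def C0 cQ0 cX0 cX1 simp del: One_nat_def\<close>)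
        finally show ?thesis by (simp add: sum.distrib algebra_simps del: One_nat_def)
      qed
      have "0 = (\<Sum>l<N. \<theta> l * (\<Sum>r<a i. c r * (\<Sum>k<N. q' l k * x i r k) + c r * (\<Sum>k<N. q l k * \<delta> i r k)
            + coeff (C r) 1 * (\<Sum>k<N. q l k * x i r k)))"
        using C1 by (intro sum.neutral[symmetric]) auto
      also have "\<dots> = (\<Sum>r<a i. \<Sum>l<N. \<theta> l * (c r * (\<Sum>k<N. q' l k * x i r k) + c r * (\<Sum>k<N. q l k * \<delta> i r k)
            + coeff (C r) 1 * (\<Sum>k<N. q l k * x i r k)))"
        unfolding sum_distrib_left by (rule sum.swap)
      also have "\<dots> = (\<Sum>r<a i. c r * bil N q' \<theta> (x i r) + c r * bil N q \<theta> (\<delta> i r) + coeff (C r) 1 * bil N q \<theta> (x i r))"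
        unfolding bil_alt by (rule sum.cong[OF refl])
          (simp add: distrib_left sum.distrib sum_distrib_left mult.left_commute del: One_nat_def)
      also have "\<dots> = (\<Sum>r<a i. c r * (bil N q' \<theta> (x i r) + bil N q \<theta> (\<delta> i r)))"
        using \<theta> by (intro sum.cong) (auto simp: distrib_left)
      finally show "(\<Sum>r<a i. c r * (bil N q' \<theta> (x i r) + bil N q \<theta> (\<delta> i r))) = 0" by simp
    qed
  qed
qed

section \<open>Bases adapted to a quadric that deforms with the frame\<close>

definition adapted :: "'e set \<Rightarrow> nat \<Rightarrow> ('e \<Rightarrow> nat \<Rightarrow> complex) \<Rightarrow> nat \<Rightarrow> (nat \<Rightarrow> nat \<Rightarrow> complex) \<Rightarrow> (nat \<Rightarrow> nat \<Rightarrow> complex) \<Rightarrow> bool" where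
  "adapted E a M r c \<gamma> \<longleftrightarrow> r \<le> a
    \<and> (\<forall>\<alpha><a. \<forall>\<beta><a. (\<Sum>j<a. \<gamma> \<alpha> j * c \<beta> j) = (if \<alpha> = \<beta> then 1 else 0))
    \<and> (\<forall>v. \<forall>j<a. v j = (\<Sum>\<alpha><a. (\<Sum>k<a. \<gamma> \<alpha> k * v k) * c \<alpha> j))
    \<and> (\<forall>\<alpha> e. r \<le> \<alpha> \<longrightarrow> \<alpha> < a \<longrightarrow> e \<in> E \<longrightarrow> (\<Sum>j<a. M e j * c \<alpha> j) = 0)
    \<and> (\<forall>\<mu>. (\<forall>e\<in>E. (\<Sum>\<beta><r. \<mu> \<beta> * (\<Sum>j<a. M e j * c \<beta> j)) = 0) \<longrightarrow> (\<forall>\<alpha><r. \<mu> \<alpha> = 0))"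

lemma ex_adapted: "finite E \<Longrightarrow> \<exists>r c \<gamma>. adapted E a M r c \<gamma>"
proof -
  assume "finite E"
  then show ?thesis
  proof (rule adapted_basis[of E a M])
    fix r and c \<gamma> :: "nat \<Rightarrow> nat \<Rightarrow> complex"
    assume "r \<le> a"
    and "\<And>\<alpha> \<beta>. \<alpha> < a \<Longrightarrow> \<beta> < a \<Longrightarrow> (\<Sum>j<a. \<gamma> \<alpha> j * c \<beta> j) = (if \<alpha> = \<beta> then 1 else 0)"
    and "\<And>v j. j < a \<Longrightarrow> v j = (\<Sum>\<alpha><a. (\<Sum>k<a. \<gamma> \<alpha> k * v k) * c \<alpha> j)"
    and "\<And>\<alpha> e. r \<le> \<alpha> \<Longrightarrow> \<alpha> < a \<Longrightarrow> e \<in> E \<Longrightarrow> (\<Sum>j<a. M e j * c \<alpha> j) = 0"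
    and "\<And>\<mu> \<alpha>. (\<And>e. e \<in> E \<Longrightarrow> (\<Sum>\<beta><r. \<mu> \<beta> * (\<Sum>j<a. M e j * c \<beta> j)) = 0) \<Longrightarrow> \<alpha> < r \<Longrightarrow> \<mu> \<alpha> = 0"
    then have "adapted E a M r c \<gamma>" unfolding adapted_def by blast
    then show ?thesis by blast
  qed
qed

lemma adapted_rank_le: "adapted E a M r c \<gamma> \<Longrightarrow> r \<le> a"
  by (simp add: adapted_def)

lemma adapted_dual:
  "\<lbrakk>adapted E a M r c \<gamma>; \<alpha> < a; \<beta> < a\<rbrakk> \<Longrightarrow> (\<Sum>j<a. \<gamma> \<alpha> j * c \<beta> j) = (if \<alpha> = \<beta> then 1 else 0)"
  by (simp add: adapted_def)

lemma adapted_expand: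
  "\<lbrakk>adapted E a M r c \<gamma>; j < a\<rbrakk> \<Longrightarrow> v j = (\<Sum>\<alpha><a. (\<Sum>k<a. \<gamma> \<alpha> k * v k) * c \<alpha> j)"
  unfolding adapted_def by blast

lemma adapted_kernel:
  "\<lbrakk>adapted E a M r c \<gamma>; r \<le> \<alpha>; \<alpha> < a; e \<in> E\<rbrakk> \<Longrightarrow> (\<Sum>j<a. M e j * c \<alpha> j) = 0"
  unfolding adapted_def by blast

lemma adapted_independent:
  "\<lbrakk>adapted E a M r c \<gamma>; \<And>e. e \<in> E \<Longrightarrow> (\<Sum>\<beta><r. \<mu> \<beta> * (\<Sum>j<a. M e j * c \<beta> j)) = 0; \<alpha> < r\<rbrakk> \<Longrightarrow> \<mu> \<alpha> = 0"
  unfolding adapted_def by blast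

lemma adapted_unit:
  assumes "adapted E a M r c \<gamma>" "i < a" "j < a"
  shows "(\<Sum>\<alpha><a. \<gamma> \<alpha> i * c \<alpha> j) = (if j = i then 1 else 0)"
proof -
  have "(\<Sum>k<a. \<gamma> \<alpha> k * (if k = i then 1 else 0)) = \<gamma> \<alpha> i" for \<alpha>
    using assms(2) by (simp add: if_distrib[of "\<lambda>c. _ * c"] cong: if_cong)
  then show ?thesis using adapted_expand[OF assms(1,3), of "\<lambda>k. if k = i then 1 else 0"] by simp
qed

lemma sum_symmetric_pairs:
  fixes f :: "nat \<Rightarrow> nat \<Rightarrow> 'a::comm_monoid_add"
  shows "(\<Sum>k<N. \<Sum>l<N. f k l) = (\<Sum>(k, l)\<in>{(k, l). k \<le> l \<and> l < N}. f k l + (if k = l then 0 else f l k))"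
proof (induction N)
  case (Suc N)
  have "{(k, l). k \<le> l \<and> l < Suc N} = {(k, l). k \<le> l \<and> l < N} \<union> (\<lambda>k. (k, N)) ` {..N}"
    by (auto simp: less_Suc_eq)
  moreover have "finite {(k, l). k \<le> l \<and> l < N}"
    by (rule finite_subset[of _ "{..N} \<times> {..N}"]) auto
  moreover have "{(k, l). k \<le> l \<and> l < N} \<inter> (\<lambda>k. (k, N)) ` {..N} = {}" by auto
  ultimately have "(\<Sum>(k, l)\<in>{(k, l). k \<le> l \<and> l < Suc N}. f k l + (if k = l then 0 else f l k))
    = (\<Sum>k<N. \<Sum>l<N. f k l) + (\<Sum>k\<le>N. f k N + (if k = N then 0 else f N k))"
    by (simp add: sum.union_disjoint Suc.IH sum.reindex inj_on_def)
  also have "(\<Sum>k\<le>N. f k N + (if k = N then 0 else f N k)) = f N N + (\<Sum>k<N. f k N + f N k)"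
    by (simp add: lessThan_Suc_atMost[symmetric] add.commute)
  finally show ?case by (simp add: sum.distrib ac_simps)
qed simp

text \<open>Here \<open>z\<close> is the rank of \<open>q\<close>, \<open>al i\<close> its rank on the \<open>i\<close>-th space; \<open>g\<close> is a basis of the ambient
  space whose part from \<open>z\<close> on spans \<open>ker q\<close>, \<open>c i\<close> a basis of the coefficient space of the \<open>i\<close>-th frame
  whose part from \<open>al i\<close> on is mapped into \<open>ker q\<close>, and \<open>t i\<close> a basis of the coordinates modulo \<open>ker q\<close>
  whose part from \<open>rho i\<close> on is the orthogonal of the \<open>i\<close>-th space.\<close>

locale deformable_quadric =
  fixes N :: nat and I :: "nat set" and a :: "nat \<Rightarrow> nat" and x :: "complex frame" and q :: "nat \<Rightarrow> nat \<Rightarrow> complex"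
    and z :: nat and g \<gamma> :: "nat \<Rightarrow> nat \<Rightarrow> complex" and al :: "nat \<Rightarrow> nat" and c c\<gamma> :: "nat \<Rightarrow> nat \<Rightarrow> nat \<Rightarrow> complex"
    and rho :: "nat \<Rightarrow> nat" and t \<tau> :: "nat \<Rightarrow> nat \<Rightarrow> nat \<Rightarrow> complex"
  assumes finI: "finite I" and quad: "quadric N I a x q" and nonzero: "\<exists>k<N. \<exists>l<N. q k l \<noteq> 0"
    and deform: "\<And>\<delta>. \<exists>q'. (\<forall>k<N. \<forall>l<N. q' k l = q' l k)
      \<and> (\<forall>i\<in>I. \<forall>r<a i. \<forall>t<a i. bil N q' (x i r) (x i t) + bil N q (\<delta> i r) (x i t) + bil N q (x i r) (\<delta> i t) = 0)
      \<and> (\<forall>u u'. (\<forall>l<N. (\<Sum>k<N. q l k * u k) = 0) \<longrightarrow> (\<forall>l<N. (\<Sum>k<N. q l k * u' k) = 0) \<longrightarrow> bil N q' u u' = 0)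
      \<and> (\<forall>i\<in>I. \<forall>c \<theta>. (\<forall>l<N. (\<Sum>r<a i. (\<Sum>k<N. q l k * x i r k) * c r) = 0) \<longrightarrow>
           (\<forall>r<a i. bil N q \<theta> (x i r) = 0) \<longrightarrow>
           (\<Sum>r<a i. c r * (bil N q' \<theta> (x i r) + bil N q \<theta> (\<delta> i r))) = 0)"
    and ad_q: "adapted {..<N} N q z g \<gamma>"
    and ad_w: "\<And>i. i \<in> I \<Longrightarrow> adapted {..<N} (a i) (\<lambda>l r. \<Sum>k<N. q l k * x i r k) (al i) (c i) (c\<gamma> i)"
    and ad_t: "\<And>i. i \<in> I \<Longrightarrow> adapted {..<al i} z (\<lambda>\<beta> \<alpha>. bil N q (\<lambda>k. \<Sum>r<a i. c i \<beta> r * x i r k) (g \<alpha>)) (rho i) (t i) (\<tau> i)"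
begin

definition co :: "nat \<Rightarrow> (nat \<Rightarrow> complex) \<Rightarrow> complex" where "co \<alpha> v = (\<Sum>k<N. \<gamma> \<alpha> k * v k)"
definition y :: "nat \<Rightarrow> nat \<Rightarrow> nat \<Rightarrow> complex" where "y i \<beta> = (\<lambda>k. \<Sum>r<a i. c i \<beta> r * x i r k)"
definition \<theta> :: "nat \<Rightarrow> nat \<Rightarrow> nat \<Rightarrow> complex" where "\<theta> i \<beta> = (\<lambda>k. \<Sum>\<alpha><z. t i \<beta> \<alpha> * g \<alpha> k)"
definition ker :: "(nat \<Rightarrow> complex) \<Rightarrow> bool" where "ker u \<longleftrightarrow> (\<forall>l<N. (\<Sum>k<N. q l k * u k) = 0)"

lemma zN: "z \<le> N" using adapted_rank_le[OF ad_q] .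
lemma al_le: "i \<in> I \<Longrightarrow> al i \<le> a i" using adapted_rank_le[OF ad_w] .
lemma rho_le: "i \<in> I \<Longrightarrow> rho i \<le> z" using adapted_rank_le[OF ad_t] .

lemma q_sym: "k < N \<Longrightarrow> l < N \<Longrightarrow> q k l = q l k"
  using quad by (auto simp: quadric_def)

lemma q_swap: "bil N q u v = bil N q v u"
  by (rule bil_swap) (rule q_sym)

lemma ker_bil: "ker u \<Longrightarrow> bil N q v u = 0" "ker u \<Longrightarrow> bil N q u v = 0"
proof -
  assume "ker u"
  then show "bil N q v u = 0" by (simp add: bil_alt ker_def)
  then show "bil N q u v = 0" by (simp add: q_swap)
qed

lemma kerI: "(\<And>d. bil N q u d = 0) \<Longrightarrow> ker u"
proof -
  assume 0: "\<And>d. bil N q u d = 0"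
  have "(\<Sum>k<N. q l k * u k) = 0" if "l < N" for l
  proof -
    have "bil N q (\<lambda>k. if k = l then 1 else 0) u = 0" using 0 by (subst q_swap)
    moreover have "bil N q (\<lambda>k. if k = l then 1 else 0) u = (\<Sum>k<N. if k = l then (\<Sum>j<N. q k j * u j) else 0)"
      unfolding bil_alt by (rule sum.cong) auto
    ultimately show ?thesis using that by simp
  qed
  then show ?thesis by (simp add: ker_def)
qed

lemma expand: "k < N \<Longrightarrow> v k = (\<Sum>\<alpha><N. co \<alpha> v * g \<alpha> k)"
  unfolding co_def by (rule adapted_expand[OF ad_q])

lemma co_g: "\<alpha> < N \<Longrightarrow> \<beta> < N \<Longrightarrow> co \<alpha> (g \<beta>) = (if \<alpha> = \<beta> then 1 else 0)"
  unfolding co_def by (rule adapted_dual[OF ad_q])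

lemma co_sum: "co \<alpha> (\<lambda>k. \<Sum>s\<in>S. f s * u s k) = (\<Sum>s\<in>S. f s * co \<alpha> (u s))"
  unfolding co_def sum_distrib_left by (subst sum.swap) (simp add: mult.left_commute)

lemma ker_g: "z \<le> \<alpha> \<Longrightarrow> \<alpha> < N \<Longrightarrow> ker (g \<alpha>)"
  unfolding ker_def using adapted_kernel[OF ad_q] by auto

lemma bil_expand_right: "bil N f u v = (\<Sum>\<alpha><N. co \<alpha> v * bil N f u (g \<alpha>))"
proof -
  have "bil N f u v = bil N f u (\<lambda>k. \<Sum>\<alpha><N. co \<alpha> v * g \<alpha> k)"
    by (rule bil_cong) (auto simp: expand[symmetric])
  then show ?thesis by (simp add: bil_sum_right)
qed

lemma bil_expand_left: "bil N f u v = (\<Sum>\<alpha><N. co \<alpha> u * bil N f (g \<alpha>) v)"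
proof -
  have "bil N f u v = bil N f (\<lambda>k. \<Sum>\<alpha><N. co \<alpha> u * g \<alpha> k) v"
    by (rule bil_cong) (auto simp: expand[symmetric])
  then show ?thesis by (simp add: bil_sum_left)
qed

lemma sum_below: "M \<le> N \<Longrightarrow> (\<And>\<alpha>. M \<le> \<alpha> \<Longrightarrow> \<alpha> < N \<Longrightarrow> f \<alpha> = 0) \<Longrightarrow> (\<Sum>\<alpha><N. f \<alpha>) = (\<Sum>\<alpha><M. f \<alpha> :: complex)"
  by (rule sum.mono_neutral_right) auto

lemma ker_co: "ker u \<Longrightarrow> \<alpha> < z \<Longrightarrow> co \<alpha> u = 0"
proof (rule adapted_independent[OF ad_q, of "\<lambda>\<alpha>. co \<alpha> u"])
  fix e assume u: "ker u" and e: "e \<in> {..<N}"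
  have "(\<Sum>j<N. q e j * u j) = (\<Sum>j<N. \<Sum>\<alpha><N. co \<alpha> u * (q e j * g \<alpha> j))"
    by (rule sum.cong) (auto simp: expand[of _ u] sum_distrib_left mult.left_commute)
  also have "\<dots> = (\<Sum>\<alpha><N. co \<alpha> u * (\<Sum>j<N. q e j * g \<alpha> j))"
    by (subst sum.swap) (simp add: sum_distrib_left)
  also have "\<dots> = (\<Sum>\<alpha><z. co \<alpha> u * (\<Sum>j<N. q e j * g \<alpha> j))"
    by (rule sum_below[OF zN]) (use ker_g e in \<open>auto simp: ker_def\<close>)
  finally show "(\<Sum>\<beta><z. co \<beta> u * (\<Sum>j<N. q e j * g \<beta> j)) = 0" using u e by (simp add: ker_def)
qed

lemma kerI_co: "(\<And>\<alpha>. \<alpha> < z \<Longrightarrow> co \<alpha> u = 0) \<Longrightarrow> ker u"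
proof (rule kerI)
  fix d assume 0: "\<And>\<alpha>. \<alpha> < z \<Longrightarrow> co \<alpha> u = 0"
  have "co \<alpha> u * bil N q (g \<alpha>) d = 0" if "\<alpha> < N" for \<alpha>
    using 0[of \<alpha>] ker_bil(2)[OF ker_g[of \<alpha>]] that by (cases "\<alpha> < z") auto
  then show "bil N q u d = 0" by (subst bil_expand_left, intro sum.neutral) blast
qed

lemma z_pos: "0 < z"
proof (rule ccontr)
  assume "\<not> 0 < z"
  then have "ker u" for u by (intro kerI_co) auto
  then have b: "bil N q u v = 0" for u v using ker_bil by blast
  obtain k l where kl: "k < N" "l < N" "q k l \<noteq> 0" using nonzero by auto
  have "bil N q (\<lambda>j. if j = k then 1 else 0) (\<lambda>j. if j = l then 1 else 0) = q k l"
    unfolding bil_alt using kl(1,2) by (simp add: if_distrib[of "\<lambda>c. _ * c"] if_distrib[of "\<lambda>c. c * _"] cong: if_cong)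
  then show False using b kl(3) by simp
qed

lemma y_image: "(\<Sum>k<N. q l k * y i \<beta> k) = (\<Sum>r<a i. (\<Sum>k<N. q l k * x i r k) * c i \<beta> r)"
  unfolding y_def sum_distrib_left sum_distrib_right by (subst sum.swap) (simp add: ac_simps)

lemma ker_y: "i \<in> I \<Longrightarrow> al i \<le> \<beta> \<Longrightarrow> \<beta> < a i \<Longrightarrow> ker (y i \<beta>)"
  unfolding ker_def y_image using adapted_kernel[OF ad_w] by auto

lemma y_independent:
  assumes "i \<in> I" "ker (\<lambda>k. \<Sum>\<beta><al i. \<mu> \<beta> * y i \<beta> k)" "\<beta> < al i"
  shows "\<mu> \<beta> = 0"
proof (rule adapted_independent[OF ad_w[OF assms(1)] _ assms(3)])
  fix l assume "l \<in> {..<N}"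
  then have "0 = (\<Sum>k<N. q l k * (\<Sum>\<beta><al i. \<mu> \<beta> * y i \<beta> k))" using assms(2) by (simp add: ker_def)
  also have "\<dots> = (\<Sum>\<beta><al i. \<mu> \<beta> * (\<Sum>k<N. q l k * y i \<beta> k))"
    unfolding sum_distrib_left by (subst sum.swap) (simp add: mult.left_commute)
  finally show "(\<Sum>\<beta><al i. \<mu> \<beta> * (\<Sum>r<a i. (\<Sum>k<N. q l k * x i r k) * c i \<beta> r)) = 0"
    by (simp add: y_image)
qed

lemma x_expand: "i \<in> I \<Longrightarrow> r < a i \<Longrightarrow> x i r k = (\<Sum>\<beta><a i. c\<gamma> i \<beta> r * y i \<beta> k)"
proof -
  assume i: "i \<in> I" and r: "r < a i"
  have "(\<Sum>\<beta><a i. c\<gamma> i \<beta> r * y i \<beta> k) = (\<Sum>j<a i. (\<Sum>\<beta><a i. c\<gamma> i \<beta> r * c i \<beta> j) * x i j k)"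
    unfolding y_def sum_distrib_left sum_distrib_right by (subst sum.swap) (simp add: mult.assoc)
  also have "\<dots> = (\<Sum>j<a i. if j = r then x i j k else 0)"
    by (rule sum.cong) (use adapted_unit[OF ad_w[OF i] r] in auto)
  also have "\<dots> = x i r k" using r by simp
  finally show ?thesis by simp
qed

lemma bil_x: "i \<in> I \<Longrightarrow> r < a i \<Longrightarrow> bil N f u (x i r) = (\<Sum>\<beta><a i. c\<gamma> i \<beta> r * bil N f u (y i \<beta>))"
proof -
  assume "i \<in> I" "r < a i"
  then have "bil N f u (x i r) = bil N f u (\<lambda>k. \<Sum>\<beta><a i. c\<gamma> i \<beta> r * y i \<beta> k)"
    by (intro bil_cong) (auto simp: x_expand[symmetric])
  then show ?thesis by (simp add: bil_sum_right)
qed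

lemma isotropic: "i \<in> I \<Longrightarrow> bil N q (y i \<beta>) (y i \<beta>') = 0"
  using quad unfolding y_def bil_sum_left bil_sum_right quadric_def by (simp add: y_def)

lemma \<theta>_bil: "bil N f u (\<theta> i \<beta>) = (\<Sum>\<alpha><z. bil N f u (g \<alpha>) * t i \<beta> \<alpha>)"
  unfolding \<theta>_def bil_sum_right by (simp add: mult.commute)

lemma \<theta>_orth_y: "i \<in> I \<Longrightarrow> rho i \<le> \<beta>' \<Longrightarrow> \<beta>' < z \<Longrightarrow> \<beta> < a i \<Longrightarrow> bil N q (y i \<beta>) (\<theta> i \<beta>') = 0"
proof (cases "\<beta> < al i")
  case True
  assume "i \<in> I" "rho i \<le> \<beta>'" "\<beta>' < z"
  then show ?thesis using adapted_kernel[OF ad_t, of i \<beta>' \<beta>] True by (simp add: \<theta>_bil y_def)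
next
  case False
  assume "i \<in> I" "\<beta> < a i"
  then show ?thesis using ker_bil(2)[OF ker_y, of i \<beta>] False by simp
qed

lemma \<theta>_orth: "i \<in> I \<Longrightarrow> rho i \<le> \<beta>' \<Longrightarrow> \<beta>' < z \<Longrightarrow> r < a i \<Longrightarrow> bil N q (\<theta> i \<beta>') (x i r) = 0"
  by (subst bil_x) (auto simp: q_swap[of "\<theta> _ _"] \<theta>_orth_y)

lemma \<theta>_independent_rank:
  assumes "i \<in> I" "\<And>\<beta>. \<beta> < al i \<Longrightarrow> (\<Sum>\<alpha><rho i. \<mu> \<alpha> * bil N q (y i \<beta>) (\<theta> i \<alpha>)) = 0" "\<alpha> < rho i"
  shows "\<mu> \<alpha> = 0"
  by (rule adapted_independent[OF ad_t[OF assms(1)] _ assms(3)]) (use assms(2) in \<open>simp add: \<theta>_bil y_def\<close>)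

lemma g_expand: "i \<in> I \<Longrightarrow> \<alpha> < z \<Longrightarrow> g \<alpha> k = (\<Sum>\<beta><z. \<tau> i \<beta> \<alpha> * \<theta> i \<beta> k)"
proof -
  assume i: "i \<in> I" and r: "\<alpha> < z"
  have "(\<Sum>\<beta><z. \<tau> i \<beta> \<alpha> * \<theta> i \<beta> k) = (\<Sum>j<z. (\<Sum>\<beta><z. \<tau> i \<beta> \<alpha> * t i \<beta> j) * g j k)"
    unfolding \<theta>_def sum_distrib_left sum_distrib_right by (subst sum.swap) (simp add: mult.assoc)
  also have "\<dots> = (\<Sum>j<z. if j = \<alpha> then g j k else 0)"
    by (rule sum.cong) (use adapted_unit[OF ad_t[OF i] r] in auto)
  also have "\<dots> = g \<alpha> k" using r by simp
  finally show ?thesis by simp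
qed

lemma kerI_\<theta>:
  assumes i: "i \<in> I" and 0: "\<And>\<beta>. \<beta> < z \<Longrightarrow> bil N q u (\<theta> i \<beta>) = 0"
  shows "ker u"
proof (rule kerI)
  fix d
  have "bil N q u (g \<alpha>) = 0" if "\<alpha> < N" for \<alpha>
  proof (cases "\<alpha> < z")
    case True
    have "bil N q u (g \<alpha>) = bil N q u (\<lambda>k. \<Sum>\<beta><z. \<tau> i \<beta> \<alpha> * \<theta> i \<beta> k)"
      using g_expand[OF i True] by (intro bil_cong) auto
    then show ?thesis using 0 by (simp add: bil_sum_right)
  next
    case False
    then show ?thesis using ker_bil(1)[OF ker_g] that by simp
  qed
  then show "bil N q u d = 0" by (subst bil_expand_right) simp
qed

text \<open>The pairing by q between the \<open>y i \<beta>\<close> below \<open>al i\<close> and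
  the \<open>\<theta> i \<alpha>\<close> below \<open>rho i\<close> is nondegenerate on both sides,
  so the two families have the same size.\<close>

lemma rho_eq: "i \<in> I \<Longrightarrow> rho i = al i"
proof (rule antisym)
  assume i: "i \<in> I"
  show "rho i \<le> al i"
  proof (rule ccontr)
    assume "\<not> rho i \<le> al i"
    then obtain \<mu> where \<mu>: "\<exists>\<alpha>\<in>{..<rho i}. \<mu> \<alpha> \<noteq> 0"
      "\<forall>\<beta>\<in>{..<al i}. (\<Sum>\<alpha><rho i. bil N q (y i \<beta>) (\<theta> i \<alpha>) * \<mu> \<alpha>) = 0"
      using homogeneous_system_nontrivial[of "{..<al i}" "{..<rho i}" "\<lambda>\<beta> \<alpha>. bil N q (y i \<beta>) (\<theta> i \<alpha>)"] by auto
    then show False using \<theta>_independent_rank[OF i, of \<mu>] by (auto simp: mult.commute)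
  qed
  show "al i \<le> rho i"
  proof (rule ccontr)
    assume "\<not> al i \<le> rho i"
    then obtain \<mu> where \<mu>: "\<exists>\<beta>\<in>{..<al i}. \<mu> \<beta> \<noteq> 0"
      "\<forall>\<alpha>\<in>{..<rho i}. (\<Sum>\<beta><al i. bil N q (y i \<beta>) (\<theta> i \<alpha>) * \<mu> \<beta>) = 0"
      using homogeneous_system_nontrivial[of "{..<rho i}" "{..<al i}" "\<lambda>\<alpha> \<beta>. bil N q (y i \<beta>) (\<theta> i \<alpha>)"] by auto
    have "ker (\<lambda>k. \<Sum>\<beta><al i. \<mu> \<beta> * y i \<beta> k)"
    proof (rule kerI_\<theta>[OF i])
      fix \<alpha> assume "\<alpha> < z"
      then show "bil N q (\<lambda>k. \<Sum>\<beta><al i. \<mu> \<beta> * y i \<beta> k) (\<theta> i \<alpha>) = 0"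
        using \<mu>(2) \<theta>_orth_y[OF i, of \<alpha>] al_le[OF i] unfolding bil_sum_left
        by (cases "\<alpha> < rho i") (auto simp: mult.commute intro!: sum.neutral)
    qed
    then show False using y_independent[OF i, of \<mu>] \<mu>(1) by auto
  qed
qed

text \<open>Modulo its kernel q is a nondegenerate form in dimension z, and the i-th space has an
  isotropic image of dimension \<open>al i\<close>, which is at most half of z. In coordinates:
  counting yields a combination Y of the y whose t-coordinates from \<open>al i\<close> on vanish,
  and isotropy kills the remaining ones.\<close>

lemma al_double: "i \<in> I \<Longrightarrow> 2 * al i \<le> z"
proof (rule ccontr)
  assume i: "i \<in> I" and "\<not> 2 * al i \<le> z"
  then have "card {al i..<z} < card {..<al i}" by simp
  from homogeneous_system_nontrivial[OF _ _ this, of "\<lambda>\<alpha> \<beta>. \<Sum>j<z. \<tau> i \<alpha> j * co j (y i \<beta>)"] obtain \<mu> where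
    \<mu>: "\<exists>\<beta>\<in>{..<al i}. \<mu> \<beta> \<noteq> 0" and \<mu>0': "\<forall>\<alpha>\<in>{al i..<z}. (\<Sum>\<beta><al i. (\<Sum>j<z. \<tau> i \<alpha> j * co j (y i \<beta>)) * \<mu> \<beta>) = 0"
    by blast
  have \<mu>0: "(\<Sum>\<beta><al i. (\<Sum>j<z. \<tau> i \<alpha> j * co j (y i \<beta>)) * \<mu> \<beta>) = 0" if "al i \<le> \<alpha>" "\<alpha> < z" for \<alpha>
    using \<mu>0' that by simp
  define Y where "Y = (\<lambda>k. \<Sum>\<beta><al i. \<mu> \<beta> * y i \<beta> k)"
  define s where "s = (\<lambda>\<alpha>. \<Sum>j<z. \<tau> i \<alpha> j * co j Y)"
  have s: "s \<alpha> = 0" if "al i \<le> \<alpha>" "\<alpha> < z" for \<alpha>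
  proof -
    have "s \<alpha> = (\<Sum>j<z. \<Sum>\<beta><al i. \<tau> i \<alpha> j * (\<mu> \<beta> * co j (y i \<beta>)))"
      by (simp add: s_def Y_def co_sum sum_distrib_left)
    also have "\<dots> = (\<Sum>\<beta><al i. (\<Sum>j<z. \<tau> i \<alpha> j * co j (y i \<beta>)) * \<mu> \<beta>)"
      unfolding sum_distrib_right by (subst sum.swap) (simp add: ac_simps)
    finally show ?thesis using \<mu>0[OF that] by simp
  qed
  have exp: "co j Y = (\<Sum>\<alpha><z. s \<alpha> * t i \<alpha> j)" if "j < z" for j
    unfolding s_def by (rule adapted_expand[OF ad_t[OF i] that])
  have "s \<alpha> = 0" if "\<alpha> < al i" for \<alpha>
  proof (rule \<theta>_independent_rank[OF i])
    fix \<beta> assume \<beta>: "\<beta> < al i"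
    have "0 = bil N q (y i \<beta>) Y" unfolding Y_def bil_sum_right using isotropic[OF i] by simp
    also have "\<dots> = (\<Sum>j<z. co j Y * bil N q (y i \<beta>) (g j))"
      unfolding bil_expand_right[of q "y i \<beta>" Y] by (rule sum_below[OF zN]) (use ker_bil(1)[OF ker_g] in auto)
    also have "\<dots> = (\<Sum>j<z. \<Sum>\<alpha><z. s \<alpha> * (bil N q (y i \<beta>) (g j) * t i \<alpha> j))"
      by (rule sum.cong) (auto simp: exp sum_distrib_left sum_distrib_right ac_simps)
    also have "\<dots> = (\<Sum>\<alpha><z. s \<alpha> * bil N q (y i \<beta>) (\<theta> i \<alpha>))"
      unfolding \<theta>_bil sum_distrib_left by (rule sum.swap)
    also have "\<dots> = (\<Sum>\<alpha><rho i. s \<alpha> * bil N q (y i \<beta>) (\<theta> i \<alpha>))"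
      by (rule sum.mono_neutral_right) (use rho_le[OF i] s rho_eq[OF i] in auto)
    finally show "(\<Sum>\<alpha><rho i. s \<alpha> * bil N q (y i \<beta>) (\<theta> i \<alpha>)) = 0" by simp
  qed (use that rho_eq[OF i] in simp)
  with s have "co j Y = 0" if "j < z" for j
    using exp[OF that] by (metis (no_types, lifting) lessThan_iff linorder_not_less mult_zero_left sum.neutral)
  then have "ker Y" by (rule kerI_co)
  then show False using y_independent[OF i, of \<mu>] \<mu> by (auto simp: Y_def)
qed

section \<open>Products of vectors as functionals on symmetric forms\<close>

text \<open>The first kind pairs a vector of the i-th space lying in ker q with a vector orthogonal
  to the space; the second pairs two vectors of the space from a basis modulo ker q. q vanishes on
  all these pairs, and a first-order deformation prescribes the values of q' on them.\<close>

definition D :: "((nat \<times> nat \<times> nat) + (nat \<times> nat \<times> nat)) set" where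
  "D = Inl ` (SIGMA i:I. {al i..<a i} \<times> {al i..<z}) \<union> Inr ` (SIGMA i:I. {(\<beta>, \<beta>'). \<beta> \<le> \<beta>' \<and> \<beta>' < al i})"

fun left right :: "(nat \<times> nat \<times> nat) + (nat \<times> nat \<times> nat) \<Rightarrow> nat \<Rightarrow> complex" where
  "left (Inl (i, \<beta>, \<beta>')) = \<theta> i \<beta>'" | "left (Inr (i, \<beta>, \<beta>')) = y i \<beta>"
| "right (Inl (i, \<beta>, \<beta>')) = y i \<beta>" | "right (Inr (i, \<beta>, \<beta>')) = y i \<beta>'"

text \<open>Up to sign, the value of q' on the pair \<open>left\<close>, \<open>right\<close> when
  only the vector \<open>y i0 \<beta>0\<close> moves, in direction d.\<close>

fun moved :: "nat \<Rightarrow> nat \<Rightarrow> (nat \<Rightarrow> complex) \<Rightarrow> (nat \<times> nat \<times> nat) + (nat \<times> nat \<times> nat) \<Rightarrow> complex" where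
  "moved i0 \<beta>0 d (Inl (i, \<beta>, \<beta>')) = (if i = i0 \<and> \<beta> = \<beta>0 then bil N q (\<theta> i \<beta>') d else 0)"
| "moved i0 \<beta>0 d (Inr (i, \<beta>, \<beta>')) = (if i = i0 \<and> \<beta> = \<beta>0 then bil N q d (y i \<beta>') else 0)
     + (if i = i0 \<and> \<beta>' = \<beta>0 then bil N q (y i \<beta>) d else 0)"

lemma D_cases:
  assumes "j \<in> D"
  obtains (l) i \<beta> \<beta>' where "j = Inl (i, \<beta>, \<beta>')" "i \<in> I" "al i \<le> \<beta>" "\<beta> < a i" "al i \<le> \<beta>'" "\<beta>' < z"
  | (r) i \<beta> \<beta>' where "j = Inr (i, \<beta>, \<beta>')" "i \<in> I" "\<beta> \<le> \<beta>'" "\<beta>' < al i"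
  using assms unfolding D_def by auto

lemma finite_pairs: "finite {(\<beta>, \<beta>'). \<beta> \<le> \<beta>' \<and> \<beta>' < (m::nat)}"
  by (rule finite_subset[of _ "{..m} \<times> {..m}"]) auto

lemma finite_D: "finite D"
  unfolding D_def using finI finite_pairs by auto

text \<open>The products spanning \<open>D\<close> are independent as functionals on the symmetric forms vanishing on
  \<open>ker q\<close>: a first-order deformation moving a single basis vector isolates its coefficients.\<close>

lemma products_independent:
  assumes tot: "\<And>q'. \<lbrakk>\<And>k l. k < N \<Longrightarrow> l < N \<Longrightarrow> q' k l = q' l k; \<And>u u'. ker u \<Longrightarrow> ker u' \<Longrightarrow> bil N q' u u' = 0\<rbrakk>
      \<Longrightarrow> (\<Sum>j\<in>D. lam j * bil N q' (left j) (right j)) = 0"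
    and j: "j \<in> D"
  shows "lam j = 0"
proof -
  have main: "(\<Sum>j\<in>D. lam j * moved i0 \<beta>0 d j) = 0"
    if i0: "i0 \<in> I" "\<beta>0 < a i0" for i0 \<beta>0 d
  proof -
    \<comment> \<open>Weighting d by the dual basis moves \<open>y i0 \<beta>0\<close> by d and
      fixes all other vectors \<open>y i \<beta>\<close>.\<close>
    define \<delta> where "\<delta> = (\<lambda>i r k. if i = i0 then c\<gamma> i0 \<beta>0 r * d k else 0)"
    obtain q' where q': "\<forall>k<N. \<forall>l<N. q' k l = q' l k"
      and A: "\<And>i r t. i \<in> I \<Longrightarrow> r < a i \<Longrightarrow> t < a i \<Longrightarrow> bil N q' (x i r) (x i t) + bil N q (\<delta> i r) (x i t) + bil N q (x i r) (\<delta> i t) = 0"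
      and B: "\<And>u u'. ker u \<Longrightarrow> ker u' \<Longrightarrow> bil N q' u u' = 0"
      and C: "\<And>i c \<theta>. i \<in> I \<Longrightarrow> (\<forall>l<N. (\<Sum>r<a i. (\<Sum>k<N. q l k * x i r k) * c r) = 0) \<Longrightarrow>
           (\<forall>r<a i. bil N q \<theta> (x i r) = 0) \<Longrightarrow>
           (\<Sum>r<a i. c r * (bil N q' \<theta> (x i r) + bil N q \<theta> (\<delta> i r))) = 0"
      using deform[of \<delta>] unfolding ker_def by blast
    have \<delta>sum: "(\<lambda>k. \<Sum>r<a i. c i \<beta> r * \<delta> i r k) = (\<lambda>k. if i = i0 \<and> \<beta> = \<beta>0 then d k else 0)"
      if "i \<in> I" "\<beta> < a i" for i \<beta>
    proof
      fix k
      show "(\<Sum>r<a i. c i \<beta> r * \<delta> i r k) = (if i = i0 \<and> \<beta> = \<beta>0 then d k else 0)"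
      proof (cases "i = i0")
        case True
        have "(\<Sum>r<a i. c i \<beta> r * \<delta> i r k) = (\<Sum>r<a i. c\<gamma> i0 \<beta>0 r * c i0 \<beta> r) * d k"
          unfolding \<delta>_def sum_distrib_right using True by (simp add: ac_simps)
        then show ?thesis using adapted_dual[OF ad_w[OF i0(1)] i0(2), of \<beta>] that True by simp
      qed (simp add: \<delta>_def)
    qed
    have b0: "bil N q u (\<lambda>k. if P then d k else 0) = (if P then bil N q u d else 0)"
      "bil N q (\<lambda>k. if P then d k else 0) u = (if P then bil N q d u else 0)" for u P
      by (auto simp: bil_def)
    have L: "bil N q' (\<theta> i \<beta>') (y i \<beta>) = - (if i = i0 \<and> \<beta> = \<beta>0 then bil N q (\<theta> i \<beta>') d else 0)"
      if "i \<in> I" "al i \<le> \<beta>" "\<beta> < a i" "al i \<le> \<beta>'" "\<beta>' < z" for i \<beta> \<beta>'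
    proof -
      have "(\<Sum>r<a i. c i \<beta> r * (bil N q' (\<theta> i \<beta>') (x i r) + bil N q (\<theta> i \<beta>') (\<delta> i r))) = 0"
      proof (rule C[OF that(1)])
        show "\<forall>l<N. (\<Sum>r<a i. (\<Sum>k<N. q l k * x i r k) * c i \<beta> r) = 0"
          using ker_y[OF that(1-3)] by (simp add: ker_def y_image)
        show "\<forall>r<a i. bil N q (\<theta> i \<beta>') (x i r) = 0" using \<theta>_orth that rho_eq by auto
      qed
      moreover have "(\<Sum>r<a i. c i \<beta> r * (bil N q' (\<theta> i \<beta>') (x i r) + bil N q (\<theta> i \<beta>') (\<delta> i r)))
        = bil N q' (\<theta> i \<beta>') (y i \<beta>) + bil N q (\<theta> i \<beta>') (\<lambda>k. \<Sum>r<a i. c i \<beta> r * \<delta> i r k)"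
        unfolding y_def bil_sum_right by (simp add: distrib_left sum.distrib)
      ultimately show ?thesis using \<delta>sum[OF that(1,3)] b0 by (simp add: eq_neg_iff_add_eq_0)
    qed
    have R: "bil N q' (y i \<beta>) (y i \<beta>') = - ((if i = i0 \<and> \<beta> = \<beta>0 then bil N q d (y i \<beta>') else 0)
           + (if i = i0 \<and> \<beta>' = \<beta>0 then bil N q (y i \<beta>) d else 0))"
      if "i \<in> I" "\<beta> < a i" "\<beta>' < a i" for i \<beta> \<beta>'
    proof -
      have "0 = (\<Sum>r<a i. \<Sum>s<a i. c i \<beta> r * (c i \<beta>' s * (bil N q' (x i r) (x i s) + bil N q (\<delta> i r) (x i s) + bil N q (x i r) (\<delta> i s))))"
        using A[OF that(1)] by simp
      also have "\<dots> = bil N q' (y i \<beta>) (y i \<beta>') + bil N q (\<lambda>k. \<Sum>r<a i. c i \<beta> r * \<delta> i r k) (y i \<beta>')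
         + bil N q (y i \<beta>) (\<lambda>k. \<Sum>r<a i. c i \<beta>' r * \<delta> i r k)"
        unfolding y_def bil_sum_left bil_sum_right
        by (simp add: distrib_left sum.distrib sum_distrib_left)
      finally show ?thesis unfolding \<delta>sum[OF that(1,2)] \<delta>sum[OF that(1,3)] b0
        by (simp only: eq_neg_iff_add_eq_0 add.assoc)
    qed
    have "0 = (\<Sum>j\<in>D. lam j * bil N q' (left j) (right j))"
      by (rule tot[symmetric]) (use q' B in auto)
    also have "\<dots> = (\<Sum>j\<in>D. - (lam j * moved i0 \<beta>0 d j))"
    proof (rule sum.cong[OF refl])
      fix j assume "j \<in> D"
      then consider (l) i \<beta> \<beta>' where "j = Inl (i, \<beta>, \<beta>')" "i \<in> I" "al i \<le> \<beta>" "\<beta> < a i" "al i \<le> \<beta>'" "\<beta>' < z"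
        | (r) i \<beta> \<beta>' where "j = Inr (i, \<beta>, \<beta>')" "i \<in> I" "\<beta> \<le> \<beta>'" "\<beta>' < al i"
        unfolding D_def by auto
      then show "lam j * bil N q' (left j) (right j) = - (lam j * moved i0 \<beta>0 d j)"
      proof cases
        case l
        show ?thesis unfolding l(1) left.simps right.simps moved.simps L[OF l(2-6)] by simp
      next
        case r
        have "\<beta> < a i" "\<beta>' < a i" using r al_le[of i] by auto
        then show ?thesis unfolding r(1) left.simps right.simps moved.simps R[OF r(2) \<open>\<beta> < a i\<close> \<open>\<beta>' < a i\<close>] by (simp add: algebra_simps)
      qed
    qed
    finally show ?thesis by (simp add: sum_negf)
  qed
  from j consider (l) i0 \<beta>0 \<beta>0' where "j = Inl (i0, \<beta>0, \<beta>0')" "i0 \<in> I" "al i0 \<le> \<beta>0" "\<beta>0 < a i0" "al i0 \<le> \<beta>0'" "\<beta>0' < z"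
    | (r) i0 b b' where "j = Inr (i0, b, b')" "i0 \<in> I" "b \<le> b'" "b' < al i0"
    unfolding D_def by auto
  then show ?thesis
  proof cases
    case l
    \<comment> \<open>Moving a kernel vector affects only the pairs that contain it, so the relation
      says that a combination of the \<theta> is orthogonal to every d. The \<theta> are independent
      combinations of the g below z, which are independent modulo ker q, so all coefficients
      vanish.\<close>
    define \<mu> where "\<mu> = (\<lambda>\<beta>'. lam (Inl (i0, \<beta>0, \<beta>')))"
    have "ker (\<lambda>k. \<Sum>\<beta>'\<in>{al i0..<z}. \<mu> \<beta>' * \<theta> i0 \<beta>' k)"
    proof (rule kerI)
      fix d
      have "(\<Sum>j\<in>D. lam j * moved i0 \<beta>0 d j)
        = (\<Sum>j\<in>(\<lambda>\<beta>'. Inl (i0, \<beta>0, \<beta>')) ` {al i0..<z}. lam j * bil N q (left j) d)"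
      proof (rule sum.mono_neutral_cong_right[OF finite_D])
        show "(\<lambda>\<beta>'. Inl (i0, \<beta>0, \<beta>')) ` {al i0..<z} \<subseteq> D" using l by (auto simp: D_def)
        show "\<forall>j\<in>D - (\<lambda>\<beta>'. Inl (i0, \<beta>0, \<beta>')) ` {al i0..<z}. lam j * moved i0 \<beta>0 d j = 0"
        proof
          fix j assume "j \<in> D - (\<lambda>\<beta>'. Inl (i0, \<beta>0, \<beta>')) ` {al i0..<z}"
          then have j: "j \<in> D" "j \<notin> (\<lambda>\<beta>'. Inl (i0, \<beta>0, \<beta>')) ` {al i0..<z}" by auto
          from j(1) show "lam j * moved i0 \<beta>0 d j = 0"
          proof (cases rule: D_cases)
            case (l i \<beta> \<beta>')
            then show ?thesis using j(2) by auto
          next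
            case (r i \<beta> \<beta>')
            then show ?thesis using \<open>al i0 \<le> \<beta>0\<close> by auto
          qed
        qed
      qed (auto simp: l)
      also have "\<dots> = (\<Sum>\<beta>'\<in>{al i0..<z}. \<mu> \<beta>' * bil N q (\<theta> i0 \<beta>') d)"
        by (subst sum.reindex) (auto simp: inj_on_def \<mu>_def)
      also have "\<dots> = bil N q (\<lambda>k. \<Sum>\<beta>'\<in>{al i0..<z}. \<mu> \<beta>' * \<theta> i0 \<beta>' k) d"
        by (simp add: bil_sum_left)
      finally show "bil N q (\<lambda>k. \<Sum>\<beta>'\<in>{al i0..<z}. \<mu> \<beta>' * \<theta> i0 \<beta>' k) d = 0"
        using main[OF l(2,4), of d] by simp
    qed
    then have "0 = (\<Sum>\<alpha><z. \<tau> i0 \<beta>0' \<alpha> * co \<alpha> (\<lambda>k. \<Sum>\<beta>'\<in>{al i0..<z}. \<mu> \<beta>' * \<theta> i0 \<beta>' k))"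
      using ker_co by simp
    also have "\<dots> = (\<Sum>\<alpha><z. \<Sum>\<beta>'\<in>{al i0..<z}. \<mu> \<beta>' * (\<tau> i0 \<beta>0' \<alpha> * t i0 \<beta>' \<alpha>))"
    proof (rule sum.cong[OF refl])
      fix \<alpha> assume \<alpha>: "\<alpha> \<in> {..<z}"
      have "co \<alpha> (\<theta> i0 \<beta>') = t i0 \<beta>' \<alpha>" for \<beta>'
      proof -
        have "co \<alpha> (\<theta> i0 \<beta>') = (\<Sum>\<alpha>'<z. if \<alpha>' = \<alpha> then t i0 \<beta>' \<alpha>' else 0)"
          unfolding \<theta>_def co_sum by (rule sum.cong) (use \<alpha> zN in \<open>auto simp: co_g\<close>)
        then show ?thesis using \<alpha> by simp
      qed
      then show "\<tau> i0 \<beta>0' \<alpha> * co \<alpha> (\<lambda>k. \<Sum>\<beta>'\<in>{al i0..<z}. \<mu> \<beta>' * \<theta> i0 \<beta>' k) = (\<Sum>\<beta>'\<in>{al i0..<z}. \<mu> \<beta>' * (\<tau> i0 \<beta>0' \<alpha> * t i0 \<beta>' \<alpha>))"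
        unfolding co_sum by (simp add: sum_distrib_left mult.left_commute)
    qed
    also have "\<dots> = (\<Sum>\<beta>'\<in>{al i0..<z}. \<mu> \<beta>' * (\<Sum>\<alpha><z. \<tau> i0 \<beta>0' \<alpha> * t i0 \<beta>' \<alpha>))"
      unfolding sum_distrib_left by (rule sum.swap)
    also have "\<dots> = (\<Sum>\<beta>'\<in>{al i0..<z}. if \<beta>' = \<beta>0' then \<mu> \<beta>' else 0)"
      by (rule sum.cong) (use adapted_dual[OF ad_t[OF l(2)] l(6)] in auto)
    also have "\<dots> = \<mu> \<beta>0'" using l by simp
    finally show ?thesis by (simp add: \<mu>_def l)
  next
    case r
    have b: "b < a i0" "b < al i0" using r al_le[of i0] by auto
    \<comment> \<open>The vector b may be the first or the second entry of a pair and is both in the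
      diagonal pair, so the coefficient of \<open>y i0 \<beta>\<close> collects both occurrences,
      with a factor 2 at \<beta> = b.\<close>
    define \<mu> where "\<mu> = (\<lambda>\<beta>. (if b \<le> \<beta> then lam (Inr (i0, b, \<beta>)) else 0) + (if \<beta> \<le> b then lam (Inr (i0, \<beta>, b)) else 0))"
    have "ker (\<lambda>k. \<Sum>\<beta><al i0. \<mu> \<beta> * y i0 \<beta> k)"
    proof (rule kerI)
      fix d
      define h1 :: "(nat \<times> nat \<times> nat) + (nat \<times> nat \<times> nat) \<Rightarrow> complex"
        where "h1 = (\<lambda>j. case j of Inl _ \<Rightarrow> 0 | Inr (i, \<beta>, \<beta>') \<Rightarrow> if i = i0 \<and> \<beta> = b then bil N q d (y i \<beta>') else 0)"
      define h2 :: "(nat \<times> nat \<times> nat) + (nat \<times> nat \<times> nat) \<Rightarrow> complex"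
        where "h2 = (\<lambda>j. case j of Inl _ \<Rightarrow> 0 | Inr (i, \<beta>, \<beta>') \<Rightarrow> if i = i0 \<and> \<beta>' = b then bil N q (y i \<beta>) d else 0)"
      have "(\<Sum>j\<in>D. lam j * moved i0 b d j) = (\<Sum>j\<in>D. lam j * h1 j + lam j * h2 j)"
      proof (rule sum.cong[OF refl])
        fix j assume "j \<in> D"
        then show "lam j * moved i0 b d j = lam j * h1 j + lam j * h2 j"
        proof (cases rule: D_cases)
          case (l i \<beta> \<beta>')
          then show ?thesis using b by (auto simp: h1_def h2_def)
        next
          case (r i \<beta> \<beta>')
          then show ?thesis by (simp add: h1_def h2_def distrib_left)
        qed
      qed
      also have "\<dots> = (\<Sum>j\<in>D. lam j * h1 j) + (\<Sum>j\<in>D. lam j * h2 j)" by (rule sum.distrib)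
      also have "(\<Sum>j\<in>D. lam j * h1 j) = (\<Sum>j\<in>(\<lambda>\<beta>. Inr (i0, b, \<beta>)) ` {b..<al i0}. lam j * h1 j)"
      proof (rule sum.mono_neutral_right[OF finite_D])
        show "(\<lambda>\<beta>. Inr (i0, b, \<beta>)) ` {b..<al i0} \<subseteq> D" using r b by (auto simp: D_def)
        show "\<forall>j\<in>D - (\<lambda>\<beta>. Inr (i0, b, \<beta>)) ` {b..<al i0}. lam j * h1 j = 0"
        proof
          fix j assume "j \<in> D - (\<lambda>\<beta>. Inr (i0, b, \<beta>)) ` {b..<al i0}"
          then have j: "j \<in> D" "j \<notin> (\<lambda>\<beta>. Inr (i0, b, \<beta>)) ` {b..<al i0}" by auto
          from j(1) show "lam j * h1 j = 0"
            by (cases rule: D_cases) (use j(2) in \<open>auto simp: h1_def\<close>)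
        qed
      qed
      also have "\<dots> = (\<Sum>\<beta>\<in>{b..<al i0}. lam (Inr (i0, b, \<beta>)) * bil N q (y i0 \<beta>) d)"
        by (subst sum.reindex) (auto simp: inj_on_def h1_def q_swap[of d])
      also have "\<dots> = (\<Sum>\<beta><al i0. (if b \<le> \<beta> then lam (Inr (i0, b, \<beta>)) else 0) * bil N q (y i0 \<beta>) d)"
        by (rule sum.mono_neutral_cong_left) auto
      also have "(\<Sum>j\<in>D. lam j * h2 j) = (\<Sum>j\<in>(\<lambda>\<beta>. Inr (i0, \<beta>, b)) ` {..b}. lam j * h2 j)"
      proof (rule sum.mono_neutral_right[OF finite_D])
        show "(\<lambda>\<beta>. Inr (i0, \<beta>, b)) ` {..b} \<subseteq> D" using r b by (auto simp: D_def)
        show "\<forall>j\<in>D - (\<lambda>\<beta>. Inr (i0, \<beta>, b)) ` {..b}. lam j * h2 j = 0"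
        proof
          fix j assume "j \<in> D - (\<lambda>\<beta>. Inr (i0, \<beta>, b)) ` {..b}"
          then have j: "j \<in> D" "j \<notin> (\<lambda>\<beta>. Inr (i0, \<beta>, b)) ` {..b}" by auto
          from j(1) show "lam j * h2 j = 0"
            by (cases rule: D_cases) (use j(2) in \<open>auto simp: h2_def\<close>)
        qed
      qed
      also have "\<dots> = (\<Sum>\<beta>\<in>{..b}. lam (Inr (i0, \<beta>, b)) * bil N q (y i0 \<beta>) d)"
        by (subst sum.reindex) (auto simp: inj_on_def h2_def)
      also have "\<dots> = (\<Sum>\<beta><al i0. (if \<beta> \<le> b then lam (Inr (i0, \<beta>, b)) else 0) * bil N q (y i0 \<beta>) d)"
        by (rule sum.mono_neutral_cong_left) (use b in auto)
      finally show "bil N q (\<lambda>k. \<Sum>\<beta><al i0. \<mu> \<beta> * y i0 \<beta> k) d = 0"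
        using main[OF r(2) b(1), of d] unfolding bil_sum_left \<mu>_def by (simp add: distrib_right sum.distrib)
    qed
    from y_independent[OF r(2) this r(4)] have "\<mu> b' = 0" .
    then show ?thesis using r by (cases "b' = b") (auto simp: \<mu>_def)
  qed
qed

text \<open>Indexes the coordinates of the symmetric forms that vanish on ker q x ker q: the values
  on pairs of basis vectors of which at least one lies outside the kernel.\<close>

definition P :: "(nat \<times> nat) set" where "P = {(\<alpha>, \<alpha>'). \<alpha> < z \<and> \<alpha> \<le> \<alpha>' \<and> \<alpha>' < N}"

definition prodco :: "(nat \<Rightarrow> complex) \<Rightarrow> (nat \<Rightarrow> complex) \<Rightarrow> nat \<times> nat \<Rightarrow> complex" where
  "prodco u v p = co (fst p) u * co (snd p) v + (if fst p = snd p then 0 else co (snd p) u * co (fst p) v)"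

lemma finite_P: "finite P"
  by (rule finite_subset[of _ "{..<N} \<times> {..<N}"]) (use zN in \<open>auto simp: P_def\<close>)

lemma bil_expand_pairs:
  assumes sym: "\<And>k l. k < N \<Longrightarrow> l < N \<Longrightarrow> f k l = f l k" and 0: "\<And>u u'. ker u \<Longrightarrow> ker u' \<Longrightarrow> bil N f u u' = 0"
  shows "bil N f u v = (\<Sum>p\<in>P. prodco u v p * bil N f (g (fst p)) (g (snd p)))"
proof -
  have sw: "bil N f u v = bil N f v u" for u v by (rule bil_swap) (rule sym)
  have "bil N f u v = (\<Sum>\<alpha><N. \<Sum>\<alpha>'<N. co \<alpha> u * (co \<alpha>' v * bil N f (g \<alpha>) (g \<alpha>')))"
    by (subst bil_expand_left, subst bil_expand_right) (simp add: sum_distrib_left)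
  also have "\<dots> = (\<Sum>p\<in>{(k, l). k \<le> l \<and> l < N}. prodco u v p * bil N f (g (fst p)) (g (snd p)))"
    unfolding sum_symmetric_pairs
  proof (rule sum.cong[OF refl], clarify)
    fix k l
    have "bil N f (g l) (g k) = bil N f (g k) (g l)" by (rule sw)
    then show "co k u * (co l v * bil N f (g k) (g l)) + (if k = l then 0 else co l u * (co k v * bil N f (g l) (g k)))
      = prodco u v (k, l) * bil N f (g (fst (k, l))) (g (snd (k, l)))"
      by (simp add: prodco_def distrib_right)
  qed
  also have "\<dots> = (\<Sum>p\<in>P. prodco u v p * bil N f (g (fst p)) (g (snd p)))"
    by (rule sum.mono_neutral_right[OF finite_pairs])
      (auto simp: P_def intro!: 0 ker_g)
  finally show ?thesis .
qed

lemma zero_on_ker: "ker u \<Longrightarrow> ker u' \<Longrightarrow> bil N q u u' = 0" by (rule ker_bil)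

lemma left_right: "j \<in> D \<Longrightarrow> bil N q (left j) (right j) = 0"
  unfolding D_def using isotropic ker_bil(1)[OF ker_y] by auto

text \<open>The products in D are independent functionals on a space with coordinates P, and all of
  them vanish at q, a nonzero element of this space. So they cannot span the dual, and the
  inequality is strict.\<close>

lemma card_D_less: "card D < card P"
proof (rule ccontr)
  assume "\<not> card D < card P"
  have "\<exists>p\<in>P. bil N q (g (fst p)) (g (snd p)) \<noteq> 0"
  proof (rule ccontr)
    assume "\<not> ?thesis"
    then have "bil N q u v = 0" for u v
      using bil_expand_pairs[OF q_sym zero_on_ker, of u v] by simp
    then have "ker u" for u by (intro kerI)
    then have "co 0 (g 0) = 0" using ker_co z_pos by blast
    then show False using co_g[of 0 0] z_pos zN by simp
  qed
  then obtain p0 where p0: "p0 \<in> P" "bil N q (g (fst p0)) (g (snd p0)) \<noteq> 0" by auto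
  have "card P > 0" using p0 finite_P by (auto simp: card_gt_0_iff)
  \<comment> \<open>Dropping a coordinate p0 in which q is nonzero makes room for a relation among
    the products in the remaining coordinates. It holds in p0 as well, because every product
    vanishes at q.\<close>
  then have "card (P - {p0}) < card D" using p0 \<open>\<not> card D < card P\<close> by simp
  from homogeneous_system_nontrivial[OF _ finite_D this, of "\<lambda>p j. prodco (left j) (right j) p"] obtain lam where
    lam: "\<exists>j\<in>D. lam j \<noteq> 0" and lam0: "\<And>p. p \<in> P - {p0} \<Longrightarrow> (\<Sum>j\<in>D. prodco (left j) (right j) p * lam j) = 0"
    using finite_P by auto
  have expand_tot: "(\<Sum>j\<in>D. lam j * bil N f (left j) (right j))
      = (\<Sum>p\<in>P. (\<Sum>j\<in>D. prodco (left j) (right j) p * lam j) * bil N f (g (fst p)) (g (snd p)))"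
    if "\<And>k l. k < N \<Longrightarrow> l < N \<Longrightarrow> f k l = f l k" "\<And>u u'. ker u \<Longrightarrow> ker u' \<Longrightarrow> bil N f u u' = 0" for f
  proof -
    have "(\<Sum>j\<in>D. lam j * bil N f (left j) (right j))
      = (\<Sum>j\<in>D. \<Sum>p\<in>P. prodco (left j) (right j) p * lam j * bil N f (g (fst p)) (g (snd p)))"
    proof (rule sum.cong[OF refl])
      fix j
      show "lam j * bil N f (left j) (right j) = (\<Sum>p\<in>P. prodco (left j) (right j) p * lam j * bil N f (g (fst p)) (g (snd p)))"
        by (subst bil_expand_pairs[OF that]) (auto simp: sum_distrib_left ac_simps)
    qed
    then show ?thesis by (subst (asm) sum.swap) (simp add: sum_distrib_right)
  qed
  have "0 = (\<Sum>j\<in>D. lam j * bil N q (left j) (right j))" using left_right by simp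
  also have "\<dots> = (\<Sum>p\<in>P. (\<Sum>j\<in>D. prodco (left j) (right j) p * lam j) * bil N q (g (fst p)) (g (snd p)))"
    by (rule expand_tot[OF q_sym zero_on_ker])
  also have "\<dots> = (\<Sum>p\<in>P. if p = p0 then (\<Sum>j\<in>D. prodco (left j) (right j) p0 * lam j) * bil N q (g (fst p0)) (g (snd p0)) else 0)"
    by (rule sum.cong) (use lam0 in auto)
  also have "\<dots> = (\<Sum>j\<in>D. prodco (left j) (right j) p0 * lam j) * bil N q (g (fst p0)) (g (snd p0))"
    using p0 finite_P by simp
  finally have "(\<Sum>j\<in>D. prodco (left j) (right j) p0 * lam j) = 0" using p0 by simp
  then have all0: "(\<Sum>j\<in>D. prodco (left j) (right j) p * lam j) = 0" if "p \<in> P" for p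
    using lam0[of p] that by (cases "p = p0") auto
  have "lam j = 0" if "j \<in> D" for j
    by (rule products_independent[OF _ that]) (subst expand_tot, auto simp: all0)
  with lam show False by blast
qed

text \<open>On forms vanishing on ker q x ker q, a product with a vector of ker q depends on the
  other factor only modulo ker q. Such products therefore live in dimension (N - z) z, and they are
  independent there.\<close>

lemma corank_le: "(\<Sum>i\<in>I. (a i - al i) * (z - al i)) \<le> (N - z) * z"
proof (rule ccontr)
  define D1 where "D1 = (SIGMA i:I. {al i..<a i} \<times> {al i..<z})"
  assume "\<not> ?thesis"
  then have "card ({z..<N} \<times> {..<z}) < card D1" using finI by (simp add: D1_def card_SigmaI)
  moreover have "finite D1" using finI by (auto simp: D1_def)
  ultimately have "\<exists>lam. (\<exists>j\<in>D1. lam j \<noteq> 0) \<and> (\<forall>p\<in>{z..<N} \<times> {..<z}.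
      (\<Sum>j\<in>D1. co (snd p) (left (Inl j)) * co (fst p) (right (Inl j)) * lam j) = 0)"
    by (intro homogeneous_system_nontrivial) auto
  then obtain lam where
    lam: "\<exists>j\<in>D1. lam j \<noteq> 0" and lam0': "\<forall>p\<in>{z..<N} \<times> {..<z}.
      (\<Sum>j\<in>D1. co (snd p) (left (Inl j)) * co (fst p) (right (Inl j)) * lam j) = 0"
    by blast
  have lam0: "(\<Sum>j\<in>D1. co \<alpha>' (left (Inl j)) * co \<alpha> (right (Inl j)) * lam j) = 0"
    if "z \<le> \<alpha>" "\<alpha> < N" "\<alpha>' < z" for \<alpha> \<alpha>'
    using lam0'[rule_format, of "(\<alpha>, \<alpha>')"] that by simp
  define lam' :: "(nat \<times> nat \<times> nat) + (nat \<times> nat \<times> nat) \<Rightarrow> complex" where "lam' = case_sum lam (\<lambda>_. 0)"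
  have D1D: "Inl j \<in> D" if "j \<in> D1" for j using that by (auto simp: D1_def D_def)
  have "lam' j = 0" if "j \<in> D" for j
  proof (rule products_independent[OF _ that])
    fix f assume f: "\<And>k l. k < N \<Longrightarrow> l < N \<Longrightarrow> f k l = f l k" "\<And>u u'. ker u \<Longrightarrow> ker u' \<Longrightarrow> bil N f u u' = 0"
    have "(\<Sum>j\<in>D. lam' j * bil N f (left j) (right j)) = (\<Sum>j\<in>Inl ` D1. lam' j * bil N f (left j) (right j))"
      by (rule sum.mono_neutral_right[OF finite_D]) (auto simp: D_def D1_def lam'_def)
    also have "\<dots> = (\<Sum>j\<in>D1. lam j * bil N f (left (Inl j)) (right (Inl j)))"
      by (subst sum.reindex) (auto simp: lam'_def)
    also have "\<dots> = (\<Sum>j\<in>D1. \<Sum>\<alpha>'<z. \<Sum>\<alpha>\<in>{z..<N}. co \<alpha>' (left (Inl j)) * co \<alpha> (right (Inl j)) * lam j * bil N f (g \<alpha>') (g \<alpha>))"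
    proof (rule sum.cong[OF refl])
      fix j assume "j \<in> D1"
      then obtain i \<beta> \<beta>' where j: "j = (i, \<beta>, \<beta>')" "i \<in> I" "al i \<le> \<beta>" "\<beta> < a i" "al i \<le> \<beta>'" "\<beta>' < z"
        by (auto simp: D1_def)
      have "bil N f (\<theta> i \<beta>') (y i \<beta>) = (\<Sum>\<alpha>'<N. co \<alpha>' (\<theta> i \<beta>') * bil N f (g \<alpha>') (y i \<beta>))"
        by (rule bil_expand_left)
      also have "\<dots> = (\<Sum>\<alpha>'<z. co \<alpha>' (\<theta> i \<beta>') * bil N f (g \<alpha>') (y i \<beta>))"
        by (rule sum_below[OF zN]) (use f(2)[OF ker_g ker_y[OF j(2-4)]] in auto)
      also have "\<dots> = (\<Sum>\<alpha>'<z. co \<alpha>' (\<theta> i \<beta>') * (\<Sum>\<alpha>\<in>{z..<N}. co \<alpha> (y i \<beta>) * bil N f (g \<alpha>') (g \<alpha>)))"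
      proof (intro sum.cong refl arg_cong2[of _ _ _ _ "(*)"])
        fix \<alpha>'
        show "bil N f (g \<alpha>') (y i \<beta>) = (\<Sum>\<alpha>\<in>{z..<N}. co \<alpha> (y i \<beta>) * bil N f (g \<alpha>') (g \<alpha>))"
          unfolding bil_expand_right[of f "g \<alpha>'" "y i \<beta>"]
          by (rule sum.mono_neutral_right) (use ker_co[OF ker_y[OF j(2-4)]] in auto)
      qed
      finally show "lam j * bil N f (left (Inl j)) (right (Inl j)) = (\<Sum>\<alpha>'<z. \<Sum>\<alpha>\<in>{z..<N}. co \<alpha>' (left (Inl j)) * co \<alpha> (right (Inl j)) * lam j * bil N f (g \<alpha>') (g \<alpha>))"
        by (simp add: j(1) sum_distrib_left ac_simps)
    qed
    also have "\<dots> = (\<Sum>\<alpha>'<z. \<Sum>\<alpha>\<in>{z..<N}. (\<Sum>j\<in>D1. co \<alpha>' (left (Inl j)) * co \<alpha> (right (Inl j)) * lam j) * bil N f (g \<alpha>') (g \<alpha>))"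
      unfolding sum_distrib_right by (subst sum.swap, intro sum.cong refl, subst sum.swap) rule
    also have "\<dots> = 0" using lam0 by simp
    finally show "(\<Sum>j\<in>D. lam' j * bil N f (left j) (right j)) = 0" .
  qed
  then have "lam j = 0" if "j \<in> D1" for j using D1D[OF that] by (force simp: lam'_def)
  with lam show False by blast
qed

text \<open>The frame is not known to be independent beforehand. A relation among the vectors
  \<open>y i \<beta>\<close> in ker q, multiplied by one fixed vector orthogonal to the space, would
  be a relation among the products; so these vectors are independent in ker q, which has dimension N
  - z.\<close>

lemma kappa_le: "i \<in> I \<Longrightarrow> a i - al i \<le> N - z"
proof (rule ccontr)
  assume i: "i \<in> I" and "\<not> a i - al i \<le> N - z"
  then have "card {z..<N} < card {al i..<a i}" by simp
  from homogeneous_system_nontrivial[OF _ _ this, of "\<lambda>\<alpha> \<beta>. co \<alpha> (y i \<beta>)"] obtain \<mu> where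
    \<mu>: "\<exists>\<beta>\<in>{al i..<a i}. \<mu> \<beta> \<noteq> 0" and \<mu>0': "\<forall>\<alpha>\<in>{z..<N}. (\<Sum>\<beta>\<in>{al i..<a i}. co \<alpha> (y i \<beta>) * \<mu> \<beta>) = 0"
    by blast
  have \<mu>0: "(\<Sum>\<beta>\<in>{al i..<a i}. co \<alpha> (y i \<beta>) * \<mu> \<beta>) = 0" if "z \<le> \<alpha>" "\<alpha> < N" for \<alpha>
    using \<mu>0' that by simp
  define Y where "Y = (\<lambda>k. \<Sum>\<beta>\<in>{al i..<a i}. \<mu> \<beta> * y i \<beta> k)"
  have "co \<alpha> Y = 0" if "\<alpha> < N" for \<alpha>
    using \<mu>0[of \<alpha>] that ker_co[OF ker_y[OF i]] unfolding Y_def co_sum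
    by (cases "\<alpha> < z") (auto simp: mult.commute)
  then have Y0: "Y k = 0" if "k < N" for k using expand[OF that, of Y] by simp
  have alz: "al i < z" using al_double[OF i] z_pos by linarith
  define lam :: "(nat \<times> nat \<times> nat) + (nat \<times> nat \<times> nat) \<Rightarrow> complex"
    where "lam = (\<lambda>j. case j of Inl (i', \<beta>, \<beta>') \<Rightarrow> if i' = i \<and> \<beta>' = al i then \<mu> \<beta> else 0 | Inr _ \<Rightarrow> 0)"
  have "lam j = 0" if "j \<in> D" for j
  proof (rule products_independent[OF _ that])
    fix f assume "\<And>u u'. ker u \<Longrightarrow> ker u' \<Longrightarrow> bil N f u u' = 0"
    have "(\<Sum>j\<in>D. lam j * bil N f (left j) (right j)) = (\<Sum>j\<in>(\<lambda>\<beta>. Inl (i, \<beta>, al i)) ` {al i..<a i}. lam j * bil N f (left j) (right j))"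
    proof (rule sum.mono_neutral_right[OF finite_D])
      show "(\<lambda>\<beta>. Inl (i, \<beta>, al i)) ` {al i..<a i} \<subseteq> D" using i alz by (auto simp: D_def)
      show "\<forall>j\<in>D - (\<lambda>\<beta>. Inl (i, \<beta>, al i)) ` {al i..<a i}. lam j * bil N f (left j) (right j) = 0"
      proof
        fix j assume j: "j \<in> D - (\<lambda>\<beta>. Inl (i, \<beta>, al i)) ` {al i..<a i}"
        have "lam j = 0"
        proof (cases j)
          case (Inl p)
          obtain i' \<beta> \<beta>' where p: "p = (i', \<beta>, \<beta>')" by (cases p)
          have "\<not> (i' = i \<and> \<beta>' = al i)" using j unfolding Inl p D_def by fastforce
          then show ?thesis unfolding lam_def Inl p sum.case prod.case by (simp only: if_False)
        qed (simp add: lam_def)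
        then show "lam j * bil N f (left j) (right j) = 0" by simp
      qed
    qed
    also have "\<dots> = (\<Sum>\<beta>\<in>{al i..<a i}. \<mu> \<beta> * bil N f (\<theta> i (al i)) (y i \<beta>))"
      by (subst sum.reindex) (auto simp: inj_on_def lam_def)
    also have "\<dots> = bil N f (\<theta> i (al i)) Y" unfolding Y_def by (simp add: bil_sum_right)
    also have "\<dots> = 0" using Y0 by (simp add: bil_def)
    finally show "(\<Sum>j\<in>D. lam j * bil N f (left j) (right j)) = 0" .
  qed
  then have "\<mu> \<beta> = 0" if "\<beta> \<in> {al i..<a i}" for \<beta>
  proof -
    assume l0: "\<And>j. j \<in> D \<Longrightarrow> lam j = 0"
    have "Inl (i, \<beta>, al i) \<in> D" using that i alz by (auto simp: D_def)
    from l0[OF this] show ?thesis by (simp add: lam_def)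
  qed
  with \<mu> show False by blast
qed

end

section \<open>The numerical contradiction and its application\<close>

text \<open>Here z is the rank of q and k its corank, and \<open>\<kappa> i\<close>,
  \<open>\<alpha> i\<close> are the dimensions of the i-th space inside and modulo ker q.
  Subtracting \<open>N1\<close> from \<open>tot\<close> bounds a \<kappa>-weighted sum from below,
  and \<open>N2\<close> bounds the sum of the \<kappa> by 2k. The pair inequality reads
  \<open>lam i + lam j \<le> 2 * (k - 1)\<close>, so at most one \<open>lam i\<close> exceeds k - 1,
  and its excess is compensated by all the others.\<close>

lemma rank_numerics:
  fixes \<kappa> \<alpha> :: "nat \<Rightarrow> int" and k z :: int
  assumes fI: "finite I" and nn: "\<And>i. i \<in> I \<Longrightarrow> 0 \<le> \<kappa> i" "\<And>i. i \<in> I \<Longrightarrow> 2 * \<alpha> i \<le> z" "\<And>i. i \<in> I \<Longrightarrow> \<kappa> i \<le> k"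
    and z: "1 \<le> z" and k: "0 \<le> k"
    and pairs: "\<And>i j. i \<in> I \<Longrightarrow> j \<in> I \<Longrightarrow> i \<noteq> j \<Longrightarrow> \<kappa> i + \<alpha> i + \<kappa> j + \<alpha> j \<le> k + z - 1"
    and N1: "(\<Sum>i\<in>I. 2 * \<kappa> i * (z - \<alpha> i) + \<alpha> i * (\<alpha> i + 1)) \<le> 2 * k * z + z * (z + 1) - 2"
    and N2: "(\<Sum>i\<in>I. \<kappa> i * (z - \<alpha> i)) \<le> k * z"
    and tot: "(k + z) * (k + z + 1) \<le> (\<Sum>i\<in>I. (\<kappa> i + \<alpha> i) * (\<kappa> i + \<alpha> i + 1))"
  shows False
proof -
  define lam where "lam = (\<lambda>i. 2 * \<kappa> i - (z - 2 * \<alpha> i))"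
  have "(\<Sum>i\<in>I. \<kappa> i * (\<kappa> i + 1 - 2 * (z - 2 * \<alpha> i)))
    = (\<Sum>i\<in>I. (\<kappa> i + \<alpha> i) * (\<kappa> i + \<alpha> i + 1)) - (\<Sum>i\<in>I. 2 * \<kappa> i * (z - \<alpha> i) + \<alpha> i * (\<alpha> i + 1))"
    unfolding sum_subtractf[symmetric] by (rule sum.cong) (auto simp: algebra_simps)
  moreover have "(k + z) * (k + z + 1) - (2 * k * z + z * (z + 1) - 2) = k * (k + 1) + 2" by (simp add: algebra_simps)
  ultimately have S: "k * (k + 1) + 2 \<le> (\<Sum>i\<in>I. \<kappa> i * (\<kappa> i + 1 - 2 * (z - 2 * \<alpha> i)))"
    using tot N1 by linarith
  have "2 * (\<Sum>i\<in>I. \<kappa> i * (\<kappa> i + 1 - 2 * (z - 2 * \<alpha> i))) \<le> (\<Sum>i\<in>I. \<kappa> i * (lam i + 2))"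
    unfolding sum_distrib_left
  proof (rule sum_mono)
    fix i assume i: "i \<in> I"
    have "\<kappa> i * (2 * (\<kappa> i + 1 - 2 * (z - 2 * \<alpha> i))) \<le> \<kappa> i * (lam i + 2)"
      by (rule mult_left_mono) (use nn[OF i] in \<open>auto simp: lam_def\<close>)
    then show "2 * (\<kappa> i * (\<kappa> i + 1 - 2 * (z - 2 * \<alpha> i))) \<le> \<kappa> i * (lam i + 2)" by (simp add: mult.left_commute)
  qed
  with S have S2: "2 * (k * (k + 1)) + 4 \<le> (\<Sum>i\<in>I. \<kappa> i * (lam i + 2))" by linarith
  have "z * (\<Sum>i\<in>I. \<kappa> i) \<le> (\<Sum>i\<in>I. 2 * (\<kappa> i * (z - \<alpha> i)))"
    unfolding sum_distrib_left
  proof (rule sum_mono)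
    fix i assume i: "i \<in> I"
    have "\<kappa> i * z \<le> \<kappa> i * (2 * (z - \<alpha> i))" by (rule mult_left_mono) (use nn[OF i] in auto)
    then show "z * \<kappa> i \<le> 2 * (\<kappa> i * (z - \<alpha> i))" by (simp add: ac_simps)
  qed
  also have "\<dots> = 2 * (\<Sum>i\<in>I. \<kappa> i * (z - \<alpha> i))" by (simp only: sum_distrib_left)
  also have "\<dots> \<le> 2 * (k * z)" using N2 by linarith
  also have "\<dots> = z * (2 * k)" by simp
  finally have K: "(\<Sum>i\<in>I. \<kappa> i) \<le> 2 * k" using z by simp
  have "(\<Sum>i\<in>I. \<kappa> i * (lam i + 2)) \<le> 2 * (k * (k + 1))"
  proof (cases "\<forall>i\<in>I. lam i \<le> k - 1")
    case True
    have "(\<Sum>i\<in>I. \<kappa> i * (lam i + 2)) \<le> (\<Sum>i\<in>I. \<kappa> i * (k + 1))"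
      by (intro sum_mono mult_left_mono) (use True nn in auto)
    also have "\<dots> = (\<Sum>i\<in>I. \<kappa> i) * (k + 1)" by (simp add: sum_distrib_right)
    also have "\<dots> \<le> 2 * k * (k + 1)" by (rule mult_right_mono) (use K k in auto)
    finally show ?thesis by simp
  next
    case False
    then obtain i0 where i0: "i0 \<in> I" "lam i0 \<ge> k" by force
    \<comment> \<open>t is the excess over k - 1, and every other \<open>lam j\<close> falls short
      of k - 1 by at least t. Against the case without excess the bound changes by
      \<open>2 * t * (\<kappa> i0 - k)\<close>, which is not positive.\<close>
    define t where "t = lam i0 - (k - 1)"
    have t: "1 \<le> t" "t \<le> k + 1" using i0 nn[OF i0(1)] by (auto simp: t_def lam_def)
    have oth: "lam j \<le> k - 1 - t" if "j \<in> I - {i0}" for j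
      using pairs[of i0 j] that i0 by (auto simp: t_def lam_def)
    have "(\<Sum>i\<in>I. \<kappa> i * (lam i + 2)) = \<kappa> i0 * (k + 1 + t) + (\<Sum>i\<in>I - {i0}. \<kappa> i * (lam i + 2))"
      by (subst sum.remove[OF fI i0(1)]) (simp add: t_def algebra_simps)
    also have "(\<Sum>i\<in>I - {i0}. \<kappa> i * (lam i + 2)) \<le> (\<Sum>i\<in>I - {i0}. \<kappa> i * (k + 1 - t))"
    proof (rule sum_mono)
      fix i assume i: "i \<in> I - {i0}"
      show "\<kappa> i * (lam i + 2) \<le> \<kappa> i * (k + 1 - t)"
        by (rule mult_left_mono) (use oth[OF i] nn(1)[of i] i in auto)
    qed
    also have "\<dots> = ((\<Sum>i\<in>I. \<kappa> i) - \<kappa> i0) * (k + 1 - t)"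
      using fI i0 by (simp add: sum_distrib_right[symmetric] sum_diff1 left_diff_distrib)
    also have "\<dots> \<le> (2 * k - \<kappa> i0) * (k + 1 - t)"
      by (rule mult_right_mono) (use K t in auto)
    also have "\<kappa> i0 * (k + 1 + t) + (2 * k - \<kappa> i0) * (k + 1 - t) = 2 * (k * (k + 1)) + 2 * t * (\<kappa> i0 - k)"
      by (simp add: algebra_simps)
    also have "2 * t * (\<kappa> i0 - k) \<le> 0" using t nn(3)[OF i0(1)] by (simp add: mult_nonneg_nonpos)
    finally show ?thesis by simp
  qed
  with S2 show False by linarith
qed

lemma choice3: "\<forall>i. \<exists>r c \<gamma>. P i r c \<gamma> \<Longrightarrow> \<exists>r c \<gamma>. \<forall>i. P i (r i) (c i) (\<gamma> i)"
  by metis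

lemma card_symmetric_pairs: "2 * card {(\<beta>, \<beta>'). \<beta> \<le> \<beta>' \<and> \<beta>' < (m::nat)} = m * (m + 1)"
proof -
  have "{(\<beta>, \<beta>'). \<beta> \<le> \<beta>' \<and> \<beta>' < m} = (\<lambda>(\<beta>', \<beta>). (\<beta>, \<beta>')) ` (SIGMA \<beta>':{..<m}. {..\<beta>'})" by force
  then have "card {(\<beta>, \<beta>'). \<beta> \<le> \<beta>' \<and> \<beta>' < m} = (\<Sum>\<beta>'<m. Suc \<beta>')"
    by (simp add: card_image inj_on_def card_SigmaI)
  moreover have "2 * (\<Sum>\<beta>'<m. Suc \<beta>') = m * (m + 1)" by (induction m) auto
  ultimately show ?thesis by simp
qed

lemma no_quadric_strict:
  assumes fI: "finite I" and pairs: "\<And>i j. i \<in> I \<Longrightarrow> j \<in> I \<Longrightarrow> i \<noteq> j \<Longrightarrow> a i + a j < N"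
    and tot: "N * (N + 1) \<le> (\<Sum>i\<in>I. a i * (a i + 1))"
  shows "\<exists>x. no_quadric N I a x"
proof (rule ccontr)
  assume "\<nexists>x. no_quadric N I a x"
  then have no: "\<And>x. \<not> no_quadric N I a x" by blast
  show False
  proof (rule first_order_deformation[OF fI no])
    fix x and q :: "nat \<Rightarrow> nat \<Rightarrow> complex"
    assume q: "quadric N I a x q" "\<exists>k<N. \<exists>l<N. q k l \<noteq> 0"
    and deform: "\<And>\<delta>. \<exists>q'. (\<forall>k<N. \<forall>l<N. q' k l = q' l k)
      \<and> (\<forall>i\<in>I. \<forall>r<a i. \<forall>t<a i. bil N q' (x i r) (x i t) + bil N q (\<delta> i r) (x i t) + bil N q (x i r) (\<delta> i t) = 0)
      \<and> (\<forall>u u'. (\<forall>l<N. (\<Sum>k<N. q l k * u k) = 0) \<longrightarrow> (\<forall>l<N. (\<Sum>k<N. q l k * u' k) = 0) \<longrightarrow> bil N q' u u' = 0)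
      \<and> (\<forall>i\<in>I. \<forall>c \<theta>. (\<forall>l<N. (\<Sum>r<a i. (\<Sum>k<N. q l k * x i r k) * c r) = 0) \<longrightarrow>
           (\<forall>r<a i. bil N q \<theta> (x i r) = 0) \<longrightarrow>
           (\<Sum>r<a i. c r * (bil N q' \<theta> (x i r) + bil N q \<theta> (\<delta> i r))) = 0)"
    have "\<exists>z g \<gamma>. adapted {..<N} N q z g \<gamma>" by (rule ex_adapted) simp
    then obtain z g \<gamma> where 1: "adapted {..<N} N q z g \<gamma>" by (elim exE)
    have "\<forall>i. \<exists>r c \<gamma>. adapted {..<N} (a i) (\<lambda>l r. \<Sum>k<N. q l k * x i r k) r c \<gamma>"
      by (intro allI ex_adapted) simp
    from choice3[OF this] obtain al c c\<gamma> where 2: "\<And>i. adapted {..<N} (a i) (\<lambda>l r. \<Sum>k<N. q l k * x i r k) (al i) (c i) (c\<gamma> i)"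
      by blast
    have "\<forall>i. \<exists>r t \<tau>. adapted {..<al i} z (\<lambda>\<beta> \<alpha>. bil N q (\<lambda>k. \<Sum>r<a i. c i \<beta> r * x i r k) (g \<alpha>)) r t \<tau>"
      by (intro allI ex_adapted) simp
    from choice3[OF this] obtain rho t \<tau> where 3: "\<And>i. adapted {..<al i} z (\<lambda>\<beta> \<alpha>. bil N q (\<lambda>k. \<Sum>r<a i. c i \<beta> r * x i r k) (g \<alpha>)) (rho i) (t i) (\<tau> i)"
      by blast
    interpret deformable_quadric N I a x q z g \<gamma> al c c\<gamma> rho t \<tau>
      by unfold_locales (use fI q deform 1 2 3 in \<open>assumption | blast\<close>)+
    have cD: "2 * card D = (\<Sum>i\<in>I. 2 * ((a i - al i) * (z - al i)) + al i * (al i + 1))"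
    proof -
      have "card D = card (SIGMA i:I. {al i..<a i} \<times> {al i..<z}) + card (SIGMA i:I. {(\<beta>, \<beta>'). \<beta> \<le> \<beta>' \<and> \<beta>' < al i})"
        unfolding D_def by (subst card_Un_disjoint) (use fI finite_pairs in \<open>auto simp: card_image\<close>)
      then show ?thesis using fI finite_pairs
        by (simp add: card_SigmaI sum.distrib sum_distrib_left card_symmetric_pairs)
    qed
    have cP: "2 * card P + z * z = 2 * N * z + z"
    proof -
      have "P = (SIGMA \<alpha>:{..<z}. {\<alpha>..<N})" by (auto simp: P_def)
      then have "card P = (\<Sum>\<alpha><z. N - \<alpha>)" by (simp add: card_SigmaI)
      moreover have "z' \<le> N \<Longrightarrow> 2 * (\<Sum>\<alpha><z'. N - \<alpha>) + z' * z' = 2 * N * z' + z'" for z'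
        by (induction z') (auto simp: algebra_simps diff_mult_distrib2)
      ultimately show ?thesis using zN by simp
    qed
    show False
    proof (rule rank_numerics[OF fI, of "\<lambda>i. int (a i) - int (al i)" "\<lambda>i. int (al i)" "int z" "int N - int z"])
      fix i assume i: "i \<in> I"
      show "0 \<le> int (a i) - int (al i)" using al_le[OF i] by simp
      show "2 * int (al i) \<le> int z" using al_double[OF i] by linarith
      show "int (a i) - int (al i) \<le> int N - int z" using kappa_le[OF i] al_le[OF i] zN by linarith
    next
      show "1 \<le> int z" "0 \<le> int N - int z" using z_pos zN by auto
    next
      fix i j assume "i \<in> I" "j \<in> I" "i \<noteq> j"
      then show "int (a i) - int (al i) + int (al i) + (int (a j) - int (al j)) + int (al j) \<le> int N - int z + int z - 1"
        using pairs[of i j] by simp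
    next
      have conv: "int (2 * ((a i - al i) * (z - al i)) + al i * (al i + 1))
        = 2 * (int (a i) - int (al i)) * (int z - int (al i)) + int (al i) * (int (al i) + 1)" if "i \<in> I" for i
      proof -
        have "al i \<le> a i" "al i + al i \<le> z" using al_le[OF that] al_double[OF that] by auto
        then obtain d e where "a i = al i + d" "z = al i + e"
          by (metis add_leE le_Suc_ex mult_2)
        then show ?thesis by (simp add: algebra_simps)
      qed
      have "(\<Sum>i\<in>I. 2 * (int (a i) - int (al i)) * (int z - int (al i)) + int (al i) * (int (al i) + 1)) = int (2 * card D)"
        unfolding cD of_nat_sum by (rule sum.cong) (use conv in auto)
      also have "\<dots> \<le> int (2 * card P) - 2" using card_D_less by linarith
      also have "\<dots> = 2 * (int N - int z) * int z + int z * (int z + 1) - 2"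
        using arg_cong[OF cP, of int] by (simp add: algebra_simps)
      finally show "(\<Sum>i\<in>I. 2 * (int (a i) - int (al i)) * (int z - int (al i)) + int (al i) * (int (al i) + 1))
        \<le> 2 * (int N - int z) * int z + int z * (int z + 1) - 2" .
    next
      have "(\<Sum>i\<in>I. (int (a i) - int (al i)) * (int z - int (al i))) = int (\<Sum>i\<in>I. (a i - al i) * (z - al i))"
        unfolding of_nat_sum
      proof (rule sum.cong[OF refl])
        fix i assume "i \<in> I"
        then show "(int (a i) - int (al i)) * (int z - int (al i)) = int ((a i - al i) * (z - al i))"
          using al_le[of i] al_double[of i] by (simp add: of_nat_diff)
      qed
      also have "\<dots> \<le> int ((N - z) * z)" using corank_le by linarith
      also have "\<dots> = (int N - int z) * int z" using zN by (simp add: of_nat_diff)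
      finally show "(\<Sum>i\<in>I. (int (a i) - int (al i)) * (int z - int (al i))) \<le> (int N - int z) * int z" .
    next
      have "int (N * (N + 1)) \<le> int (\<Sum>i\<in>I. a i * (a i + 1))" using tot by linarith
      then show "(int N - int z + int z) * (int N - int z + int z + 1)
        \<le> (\<Sum>i\<in>I. (int (a i) - int (al i) + int (al i)) * (int (a i) - int (al i) + int (al i) + 1))"
        by (simp add: distrib_left add.commute)
    qed
  qed
qed

subsection \<open>Generic subspaces of pairwise complementary or smaller dimension\<close>

definition unit :: "nat \<Rightarrow> nat \<Rightarrow> complex" where "unit k = (\<lambda>j. if j = k then 1 else 0)"

lemma bil_unit: "k < N \<Longrightarrow> l < N \<Longrightarrow> bil N q (unit k) (unit l) = q k l"
  unfolding bil_alt unit_def by (simp add: if_distrib[of "\<lambda>c. _ * c"] if_distrib[of "\<lambda>c. c * _"] cong: if_cong)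

lemma bil_add_left: "bil N q (\<lambda>k. u k + u' k) v = bil N q u v + bil N q u' v"
  unfolding bil_def by (simp add: algebra_simps sum.distrib)

lemma bil_add_right: "bil N q u (\<lambda>k. v k + v' k) = bil N q u v + bil N q u v'"
  unfolding bil_def by (simp add: algebra_simps sum.distrib)

lemma bil_scale_left: "bil N q (\<lambda>k. c * u k) v = c * bil N q u v"
  unfolding bil_def by (simp add: sum_distrib_left ac_simps)

lemma bil_scale_right: "bil N q u (\<lambda>k. c * v k) = c * bil N q u v"
  unfolding bil_def by (simp add: sum_distrib_left ac_simps)

text \<open>Four spaces of dimension h in dimension 2h: the two coordinate halves, the graph of the
  identity, and the graph of the diagonal matrix with entries 1, ..., h.\<close>

definition halves_vec :: "nat \<Rightarrow> nat \<Rightarrow> nat \<Rightarrow> nat \<Rightarrow> complex" where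
  "halves_vec h c r = (if c = 0 then unit r else if c = 1 then unit (h + r)
     else (\<lambda>k. unit r k + (of_nat ((c - 2) * r + 1)) * unit (h + r) k))"

text \<open>The coordinate halves kill the diagonal blocks of q. The graph of the identity makes the
  off-diagonal block skew, and the graph of the diagonal matrix, whose entries are distinct,
  multiplies its entry at r, t by t - r; the entries with t = r vanish by skewness.\<close>

lemma four_halves:
  assumes sym: "\<And>k l. k < 2 * h \<Longrightarrow> l < 2 * h \<Longrightarrow> q k l = q l k"
    and 0: "\<And>c r t. c < 4 \<Longrightarrow> r < h \<Longrightarrow> t < h \<Longrightarrow> bil (2 * h) q (halves_vec h c r) (halves_vec h c t) = 0"
    and kl: "k < 2 * h" "l < 2 * h"
  shows "q k l = (0::complex)"
proof -
  have A: "q r t = 0" if "r < h" "t < h" for r t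
    using 0[of 0 r t] that by (simp add: halves_vec_def bil_unit)
  have B: "q (h + r) (h + t) = 0" if "r < h" "t < h" for r t
    using 0[of 1 r t] that by (simp add: halves_vec_def bil_unit)
  have C: "q r (h + t) = 0" if rt: "r < h" "t < h" for r t
  proof -
    have e: "of_nat ((c - 2) * t + 1) * q r (h + t) + of_nat ((c - 2) * r + 1) * q (h + r) t = 0" if "c = 2 \<or> c = 3" for c
      using 0[of c r t] that rt A[OF rt] B[OF rt]
      by (auto simp: halves_vec_def bil_add_left bil_add_right bil_scale_left bil_scale_right bil_unit algebra_simps)
    have s: "q (h + r) t = q t (h + r)" using sym rt by simp
    have "q r (h + t) + q t (h + r) = 0" using e[of 2] s by simp
    then have m: "q t (h + r) = - q r (h + t)" by (simp add: eq_neg_iff_add_eq_0 add.commute)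
    have "(of_nat t + 1) * q r (h + t) - (of_nat r + 1) * q r (h + t) = 0" using e[of 3] s m by simp
    then have "(of_nat t - of_nat r) * q r (h + t) = 0" by (simp add: algebra_simps)
    then show ?thesis using m by (cases "t = r") auto
  qed
  show ?thesis
  proof (cases "k < h"; cases "l < h")
    assume "k < h" "l < h" then show ?thesis by (rule A)
  next
    assume "k < h" "\<not> l < h" then show ?thesis using C[of k "l - h"] kl by simp
  next
    assume "\<not> k < h" "l < h" then show ?thesis using C[of l "k - h"] kl sym[of k l] by simp
  next
    assume "\<not> k < h" "\<not> l < h" then show ?thesis using B[of "k - h" "l - h"] kl by simp
  qed
qed

definition vec_rows :: "(nat \<Rightarrow> nat) \<Rightarrow> nat set \<Rightarrow> (nat \<times> nat) set" where
  "vec_rows a S = (SIGMA i:S. {..<a i})"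

lemma line_open_vec_rows:
  assumes "finite S"
  shows "line_open (\<lambda>x. nullity_le (vec_rows a S) {..<M} (\<lambda>(i, r). x i r) c)"
proof -
  have "line_open (\<lambda>x. nullity_le (vec_rows a S) {..<M} ((\<lambda>x e. x (fst e) (snd e)) x) c)"
  proof (rule line_open_nullity_le[where I = UNIV and d = "\<lambda>e j i. if i = fst e then 1 else 0"])
    show "finite (vec_rows a S)" using assms by (auto simp: vec_rows_def)
    show "multihom UNIV (\<lambda>i. if i = fst e then 1 else 0) (\<lambda>x. x (fst e) (snd e) j)" for e j
      by (rule multihom.coord) simp
  qed simp
  then show ?thesis by (simp add: split_def)
qed

text \<open>Coordinate vectors, numbered on from the first frame to the second, give two frames of
  the largest possible joint rank. Vectors numbered from M on vanish in the first M coordinates, and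
  the truncated difference is then 0.\<close>

lemma ex_pair_nullity:
  assumes "i \<noteq> j"
  shows "\<exists>x. nullity_le (vec_rows a {i, j}) {..<M} (\<lambda>(i, r). x i r) (M - (a i + a j))"
proof -
  define x where "x = (\<lambda>p r. if p = i then unit r else unit (a i + r))"
  have "nullity_le (vec_rows a {i, j}) {..<M} (\<lambda>(i, r). x i r) (M - (a i + a j))"
  proof (rule nullity_leI_finite[of "{a i + a j..<M}" _ _ _ _ unit])
    fix v assume v: "\<And>e. e \<in> vec_rows a {i, j} \<Longrightarrow> (\<Sum>k<M. (case e of (i, r) \<Rightarrow> x i r) k * v k) = 0"
      and v': "\<And>f. f \<in> {a i + a j..<M} \<Longrightarrow> (\<Sum>k<M. unit f k * v k) = 0"
    have u: "(\<Sum>k<M. unit f k * v k) = v f" if "f < M" for f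
      using that by (simp add: unit_def if_distrib[of "\<lambda>c. c * _"] cong: if_cong)
    show "\<forall>k\<in>{..<M}. v k = 0"
    proof
      fix k assume k: "k \<in> {..<M}"
      consider "k < a i" | "a i \<le> k" "k < a i + a j" | "a i + a j \<le> k" by linarith
      then show "v k = 0"
      proof cases
        case 1
        then have "(i, k) \<in> vec_rows a {i, j}" by (simp add: vec_rows_def)
        from v[OF this] show ?thesis using u[of k] k by (simp add: x_def)
      next
        case 2
        then have "(j, k - a i) \<in> vec_rows a {i, j}" by (auto simp: vec_rows_def)
        from v[OF this] show ?thesis using u[of k] k 2 assms by (simp add: x_def)
      next
        case 3
        then show ?thesis using v'[of k] u[of k] k by simp
      qed
    qed
  qed auto
  then show ?thesis by blast
qed

lemma bil_Suc: "(\<And>k l. k < M \<Longrightarrow> l < M \<Longrightarrow> q k l = 0) \<Longrightarrow>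
  bil (Suc M) q u v = q M M * u M * v M + u M * (\<Sum>l<M. q M l * v l) + v M * (\<Sum>k<M. q k M * u k)"
  unfolding bil_def by (simp add: sum.distrib sum_distrib_left ac_simps)

lemma bil_Suc_0: "u M = 0 \<Longrightarrow> v M = 0 \<Longrightarrow> bil (Suc M) q u v = bil M q u v"
  unfolding bil_def by simp

text \<open>Two complementary spaces are moved to meet a hyperplane in codimension one each, while all others
  are specialised into it.\<close>

lemma no_quadric_hyperplane_step:
  assumes fI: "finite I" and ij: "i \<in> I" "j \<in> I" "i \<noteq> j" and sum: "a i + a j = Suc M" and pos: "a i > 0" "a j > 0"
    and ih: "\<exists>x. no_quadric M I (a(i := a i - 1, j := a j - 1)) x"
  shows "\<exists>x. no_quadric (Suc M) I a x"
proof -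
  define b where "b = a(i := a i - 1, j := a j - 1)"
  have b: "b i = a i - 1" "b j = a j - 1" using ij by (auto simp: b_def)
  obtain x1 where x1: "no_quadric M I b x1" using ih b_def by auto
  \<comment> \<open>The two spaces, cut down by one vector each, span codimension one in the
    hyperplane; the functional \<open>l 0\<close> supplies the missing direction.\<close>
  have "M - (b i + b j) = 1" using sum pos b by simp
  then obtain x2 where x2: "nullity_le (vec_rows b {i, j}) {..<M} (\<lambda>(i, r). x2 i r) 1"
    using ex_pair_nullity[OF ij(3), of b M] by auto
  have lo: "line_open (\<lambda>x. nullity_le (vec_rows b {i, j}) {..<M} (\<lambda>(i, r). x i r) 1)"
    by (rule line_open_vec_rows) simp
  obtain x where x: "no_quadric M I b x" and xs: "nullity_le (vec_rows b {i, j}) {..<M} (\<lambda>(i, r). x i r) 1"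
    using line_open_ex_conj[OF line_open_no_quadric[OF fI] lo x1 x2] by (elim exE conjE)
  from xs obtain l :: "nat \<Rightarrow> nat \<Rightarrow> complex" where l: "\<And>v. \<lbrakk>\<forall>e\<in>vec_rows b {i, j}. (\<Sum>k<M. (case e of (i, r) \<Rightarrow> x i r) k * v k) = 0;
      (\<Sum>k<M. l 0 k * v k) = 0\<rbrakk> \<Longrightarrow> \<forall>k\<in>{..<M}. v k = 0"
  proof -
    from xs obtain l :: "nat \<Rightarrow> nat \<Rightarrow> complex" where l: "\<forall>v. (\<forall>e\<in>vec_rows b {i, j}. (\<Sum>k<M. (case e of (i, r) \<Rightarrow> x i r) k * v k) = 0)
      \<longrightarrow> (\<forall>i<1. (\<Sum>k<M. l i k * v k) = 0) \<longrightarrow> (\<forall>k\<in>{..<M}. v k = 0)"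
      unfolding nullity_le_def by blast
    show thesis by (rule that[of l]) (use l in simp)
  qed
  \<comment> \<open>Coordinate M is new. The last vector of space j is the new coordinate vector,
    which gives \<open>q M M = 0\<close>; that of space i is the new coordinate vector plus
    \<open>l 0\<close>, which makes row M of q orthogonal to \<open>l 0\<close>. That row is also
    orthogonal to the two cut spaces, hence zero.\<close>
  define X where "X = (\<lambda>p r k. if k = M then (if (p = i \<and> r = a i - 1) \<or> (p = j \<and> r = a j - 1) then 1 else 0)
    else if p = i \<and> r = a i - 1 then l 0 k else if p = j \<and> r = a j - 1 then 0 else x p r k)"
  have XM: "X p r M = 0" "\<And>k. k < M \<Longrightarrow> X p r k = x p r k" if "r < b p" for p r
    using that by (auto simp: X_def b_def split: if_splits)
  have "no_quadric (Suc M) I a X"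
    unfolding no_quadric_def
  proof (intro allI impI)
    fix q k k' assume q: "quadric (Suc M) I a X q" and kk: "k < Suc M" "k' < Suc M"
    have ba: "b p \<le> a p" for p by (auto simp: b_def)
    have qx: "bil (Suc M) q (X p r) (X p t) = 0" if "p \<in> I" "r < a p" "t < a p" for p r t
      using q that by (auto simp: quadric_def)
    have qs: "q k l = q l k" if "k < Suc M" "l < Suc M" for k l using q that by (auto simp: quadric_def)
    have "quadric M I b x q"
      unfolding quadric_def
    proof (intro conjI allI impI ballI)
      fix p r t assume prt: "p \<in> I" "r < b p" "t < b p"
      have "bil M q (x p r) (x p t) = bil M q (X p r) (X p t)"
        by (rule bil_cong) (use XM prt in auto)
      also have "\<dots> = bil (Suc M) q (X p r) (X p t)" using XM(1)[OF prt(2)] XM(1)[OF prt(3)] by (simp add: bil_Suc_0)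
      also have "\<dots> = 0" using qx[of p r t] prt ba[of p] by simp
      finally show "bil M q (x p r) (x p t) = 0" .
    qed (use qs in auto)
    then have q0: "q k l = 0" if "k < M" "l < M" for k l using x that by (auto simp: no_quadric_def)
    have bS: "bil (Suc M) q u v = q M M * u M * v M + u M * (\<Sum>l<M. q M l * v l) + v M * (\<Sum>k<M. q k M * u k)" for u v
      by (rule bil_Suc) (rule q0)
    have wM: "X i (a i - 1) M = 1" "X j (a j - 1) M = 1" by (auto simp: X_def)
    have wi: "X i (a i - 1) k = l 0 k" and wj: "X j (a j - 1) k = 0" if "k < M" for k
      using that ij(3) by (auto simp: X_def)
    have c0: "q M M = 0"
    proof -
      have "bil (Suc M) q (X j (a j - 1)) (X j (a j - 1)) = 0" using qx[OF ij(2)] pos by simp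
      with bS[of "X j (a j - 1)" "X j (a j - 1)"] show ?thesis unfolding wM by (simp add: wj del: One_nat_def)
    qed
    have row: "(\<Sum>k<M. q M k * x p r k) = 0" if p: "p = i \<or> p = j" and r: "r < b p" for p r
    proof -
      have "r < a p" "p \<in> I" using r p ij ba[of p] by auto
      then have "bil (Suc M) q (X p (a p - 1)) (X p r) = 0" using qx[of p "a p - 1" r] by auto
      moreover have "X p (a p - 1) M = 1" using p wM by auto
      ultimately have "(\<Sum>k<M. q M k * X p r k) = 0" unfolding bS XM(1)[OF r] by (simp add: c0)
      then show ?thesis using XM(2)[OF r] by simp
    qed
    have "bil (Suc M) q (X i (a i - 1)) (X i (a i - 1)) = 0" using qx[OF ij(1)] pos by simp
    then have "(\<Sum>k<M. q M k * l 0 k) + (\<Sum>k<M. q k M * l 0 k) = 0" unfolding bS wM by (simp add: c0 wi del: One_nat_def)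
    moreover have "(\<Sum>k<M. q k M * l 0 k) = (\<Sum>k<M. q M k * l 0 k)" by (rule sum.cong) (use qs in auto)
    ultimately have hl: "(\<Sum>k<M. l 0 k * q M k) = 0" by (simp add: mult.commute)
    have "\<forall>k\<in>{..<M}. q M k = 0"
    proof (rule l[OF _ hl], rule ballI)
      fix e assume "e \<in> vec_rows b {i, j}"
      then obtain p r where "e = (p, r)" "p = i \<or> p = j" "r < b p" by (auto simp: vec_rows_def)
      then show "(\<Sum>k<M. (case e of (i, r) \<Rightarrow> x i r) k * q M k) = 0" using row[of p r] by (simp add: mult.commute)
    qed
    then show "q k k' = 0" using q0[of k k'] c0 qs[of k k'] kk by (auto simp: less_Suc_eq)
  qed
  then show ?thesis by blast
qed

text \<open>For a complementary pair i, j the hyperplane step reduces both sides of the count by 2(a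
  i + a j) = 2N. The bounds on pairs survive in dimension N - 1 unless two further spaces are
  complementary, which is the case of four halves.\<close>

theorem ex_no_quadric:
  assumes "finite I" and "\<And>i. i \<in> I \<Longrightarrow> a i \<le> N"
    and "\<And>i j. i \<in> I \<Longrightarrow> j \<in> I \<Longrightarrow> i \<noteq> j \<Longrightarrow> a i + a j \<le> N"
    and "N * (N + 1) \<le> (\<Sum>i\<in>I. a i * (a i + 1))"
  shows "\<exists>x. no_quadric N I a x"
  using assms(2-4)
proof (induction N arbitrary: a)
  case 0
  then show ?case by (auto simp: no_quadric_def)
next
  case (Suc M)
  consider (full) i where "i \<in> I" "a i = Suc M"
    | (strict) "\<And>i j. i \<in> I \<Longrightarrow> j \<in> I \<Longrightarrow> i \<noteq> j \<Longrightarrow> a i + a j < Suc M"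
    | (pair) i j where "i \<in> I" "j \<in> I" "i \<noteq> j" "a i + a j = Suc M" "\<And>i. i \<in> I \<Longrightarrow> a i \<noteq> Suc M"
    using Suc.prems(2) by (metis le_neq_implies_less)
  then show ?case
  proof cases
    case full
    have "no_quadric (Suc M) I a (\<lambda>_. unit)"
      unfolding no_quadric_def quadric_def using full by (metis bil_unit)
    then show ?thesis by blast
  next
    case strict
    then show ?thesis by (intro no_quadric_strict[OF assms(1)]) (use Suc.prems(3) in auto)
  next
    case pair
    have pos: "a i > 0" "a j > 0" using pair(4) pair(5)[OF pair(1)] pair(5)[OF pair(2)] by auto
    show ?thesis
    proof (cases "\<exists>l l'. l \<in> I - {i, j} \<and> l' \<in> I - {i, j} \<and> l \<noteq> l' \<and> a l + a l' = Suc M")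
      case True
      then obtain l l' where l: "l \<in> I - {i, j}" "l' \<in> I - {i, j}" "l \<noteq> l'" "a l + a l' = Suc M" by auto
      define h where "h = a i"
      \<comment> \<open>These four inequalities add up in pairs to the two equalities, so all of
        them are equalities and the four dimensions agree.\<close>
      have "a i + a l \<le> Suc M" "a j + a l' \<le> Suc M" "a i + a l' \<le> Suc M" "a j + a l \<le> Suc M"
        using Suc.prems(2) l pair by auto
      then have eq: "a i = h" "a j = h" "a l = h" "a l' = h" "Suc M = 2 * h"
        using l(4) pair(4) by (auto simp: h_def)
      define f where "f = (\<lambda>c::nat. if c = 0 then i else if c = 1 then j else if c = 2 then l else l')"
      have f: "f c \<in> I" "a (f c) = h" if "c < 4" for c
        using that l pair eq by (auto simp: f_def)
      have fi: "c = c'" if "f c = f c'" "c < 4" "c' < 4" for c c'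
        using that l pair(3) by (auto simp: f_def numeral_eq_Suc less_Suc_eq split: if_splits)
      define x where "x = (\<lambda>p. halves_vec h (THE c. c < 4 \<and> f c = p))"
      have xf: "x (f c) = halves_vec h c" if "c < 4" for c
      proof -
        have "(THE c'. c' < 4 \<and> f c' = f c) = c" by (rule the_equality) (use that fi in auto)
        then show ?thesis by (simp add: x_def)
      qed
      have "no_quadric (Suc M) I a x"
        unfolding no_quadric_def
      proof (intro allI impI)
        fix q k k' assume q: "quadric (Suc M) I a x q" and k: "k < Suc M" "k' < Suc M"
        show "q k k' = 0"
        proof (rule four_halves[of h])
          show "\<And>k l. k < 2 * h \<Longrightarrow> l < 2 * h \<Longrightarrow> q k l = q l k" using q eq by (simp add: quadric_def)
          fix c r t assume "c < (4::nat)" "r < h" "t < h"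
          then show "bil (2 * h) q (halves_vec h c r) (halves_vec h c t) = 0"
            using q f[of c] xf[of c] eq(5) unfolding quadric_def by metis
        qed (use k eq in auto)
      qed
      then show ?thesis by blast
    next
      case False
      have bnd: "a p + a p' \<le> M" if "p \<in> I - {i, j}" "p' \<in> I - {i, j}" "p \<noteq> p'" for p p'
        using Suc.prems(2)[of p p'] False that by (metis DiffE le_Suc_eq)
      define b where "b = a(i := a i - 1, j := a j - 1)"
      have "\<exists>x. no_quadric M I b x"
      proof (rule Suc.IH)
        show "b p \<le> M" if "p \<in> I" for p
          using Suc.prems(1)[OF that] pair(5)[OF that] by (auto simp: b_def)
        show "b p + b p' \<le> M" if "p \<in> I" "p' \<in> I" "p \<noteq> p'" for p p'
          using Suc.prems(2)[OF that] bnd[of p p'] that pos by (auto simp: b_def)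
        have "(\<Sum>p\<in>I. a p * (a p + 1)) = a i * (a i + 1) + (a j * (a j + 1) + (\<Sum>p\<in>I - {i} - {j}. a p * (a p + 1)))"
          using assms(1) pair(1-3) by (simp add: sum.remove[of I i] sum.remove[of "I - {i}" j])
        moreover have "(\<Sum>p\<in>I. b p * (b p + 1)) = b i * (b i + 1) + (b j * (b j + 1) + (\<Sum>p\<in>I - {i} - {j}. b p * (b p + 1)))"
          using assms(1) pair(1-3) by (simp add: sum.remove[of I i] sum.remove[of "I - {i}" j])
        moreover have "(\<Sum>p\<in>I - {i} - {j}. b p * (b p + 1)) = (\<Sum>p\<in>I - {i} - {j}. a p * (a p + 1))"
          by (rule sum.cong) (auto simp: b_def)
        moreover obtain p p' where "a i = Suc p" "a j = Suc p'" using pos by (metis gr0_implies_Suc)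
        moreover have "b i = p" "b j = p'" using calculation(4,5) pair(3) by (auto simp: b_def)
        moreover have "p + p' + 1 = M" using pair(4) calculation(4,5) by simp
        ultimately show "M * (M + 1) \<le> (\<Sum>p\<in>I. b p * (b p + 1))"
          using Suc.prems(3) by (auto simp: algebra_simps)
      qed
      then show ?thesis unfolding b_def by (rule no_quadric_hyperplane_step[OF assms(1) pair(1-4) pos])
    qed
  qed
qed

subsection \<open>Configurations with intersecting spaces\<close>

text \<open>Stated by duality, which is the form used to conclude that a row of q vanishes.\<close>

definition spans :: "nat \<Rightarrow> (nat \<Rightarrow> complex) set \<Rightarrow> bool" where
  "spans M S \<longleftrightarrow> (\<forall>l. (\<forall>u\<in>S. (\<Sum>k<M. u k * l k) = 0) \<longrightarrow> (\<forall>k<M. l k = 0))"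

text \<open>Sets instead of frames allow coordinate vectors to be added to a space without
  numbering; \<open>no_quadric_of_set\<close> returns to frames.\<close>

definition no_quadric_set :: "nat \<Rightarrow> nat set \<Rightarrow> (nat \<Rightarrow> (nat \<Rightarrow> complex) set) \<Rightarrow> bool" where
  "no_quadric_set N I S \<longleftrightarrow> (\<forall>q. (\<forall>k<N. \<forall>l<N. q k l = q l k) \<longrightarrow> (\<forall>i\<in>I. \<forall>u\<in>S i. \<forall>v\<in>S i. bil N q u v = 0)
     \<longrightarrow> (\<forall>k<N. \<forall>l<N. q k l = 0))"

lemma no_quadric_of_set:
  assumes S: "no_quadric_set N I S" and card: "\<And>i. i \<in> I \<Longrightarrow> finite (S i) \<and> card (S i) \<le> a i"
  shows "\<exists>x. no_quadric N I a x"
proof -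
  have "\<forall>i. \<exists>f. i \<in> I \<longrightarrow> S i \<subseteq> f ` {..<a i}"
  proof
    fix i
    show "\<exists>f. i \<in> I \<longrightarrow> S i \<subseteq> f ` {..<a i}"
    proof (cases "i \<in> I")
      case True
      obtain f where "bij_betw f {..<card (S i)} (S i)"
        using ex_bij_betw_nat_finite[of "S i"] card[OF True] by (auto simp: atLeast0LessThan)
      then have "S i = f ` {..<card (S i)}" by (simp add: bij_betw_def)
      also have "\<dots> \<subseteq> f ` {..<a i}" using card[OF True] by (intro image_mono) auto
      finally show ?thesis by blast
    qed simp
  qed
  from choice[OF this] obtain x where x: "\<And>i. i \<in> I \<Longrightarrow> S i \<subseteq> x i ` {..<a i}" by blast
  have "no_quadric N I a x"
    unfolding no_quadric_def
  proof (intro allI impI)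
    fix q k l assume q: "quadric N I a x q" "k < N" "l < N"
    have "bil N q u v = 0" if iuv: "i \<in> I" "u \<in> S i" "v \<in> S i" for i u v
    proof -
      obtain r t where "u = x i r" "r < a i" "v = x i t" "t < a i" using x[OF iuv(1)] iuv by blast
      then show ?thesis using q(1) iuv(1) by (simp add: quadric_def)
    qed
    then show "q k l = 0" using S q unfolding no_quadric_set_def quadric_def by blast
  qed
  then show ?thesis by blast
qed

text \<open>A form vanishing on both spaces that contain a coordinate vector is orthogonal to their span.\<close>

lemma no_quadric_set_cone:
  assumes MN: "M \<le> N" and S: "no_quadric_set M I S" and supp: "\<And>i u k. i \<in> I \<Longrightarrow> u \<in> S i \<Longrightarrow> M \<le> k \<Longrightarrow> u k = 0"
    and common: "\<And>k l. k \<in> {M..<N} \<Longrightarrow> l \<in> {M..<N} \<Longrightarrow> \<exists>i\<in>I. i \<in> F k \<and> i \<in> F l"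
    and span: "\<And>k. k \<in> {M..<N} \<Longrightarrow> \<exists>i\<in>I. \<exists>j\<in>I. i \<in> F k \<and> j \<in> F k \<and> spans M (S i \<union> S j)"
  shows "no_quadric_set N I (\<lambda>i. S i \<union> unit ` {k\<in>{M..<N}. i \<in> F k})"
  unfolding no_quadric_set_def
proof (intro allI impI)
  fix q k0 l0 assume sym: "\<forall>k<N. \<forall>l<N. q k l = q l k" and kl: "k0 < N" "l0 < N"
    and q: "\<forall>i\<in>I. \<forall>u\<in>S i \<union> unit ` {k\<in>{M..<N}. i \<in> F k}. \<forall>v\<in>S i \<union> unit ` {k\<in>{M..<N}. i \<in> F k}. bil N q u v = 0"
  have unit_bil: "bil N q u (unit k) = (\<Sum>l<M. u l * q l k)" if "\<And>l. M \<le> l \<Longrightarrow> u l = 0" "k < N" for u k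
  proof -
    have "bil N q u (unit k) = (\<Sum>l<N. u l * q l k)"
      unfolding bil_alt unit_def using that(2) by (simp add: if_distrib[of "\<lambda>c. _ * c"] cong: if_cong)
    also have "\<dots> = (\<Sum>l<M. u l * q l k)" by (rule sum.mono_neutral_right) (use that MN in auto)
    finally show ?thesis .
  qed
  have A: "q k l = 0" if "k < M" "l < M" for k l
  proof -
    have "bil M q u v = 0" if "i \<in> I" "u \<in> S i" "v \<in> S i" for i u v
    proof -
      have "bil N q u v = bil M q u v"
      proof -
        have "bil N q u v = (\<Sum>k<M. \<Sum>l<N. q k l * u k * v l)"
          unfolding bil_def by (rule sum.mono_neutral_right) (use supp[OF that(1,2)] MN in auto)
        also have "\<dots> = bil M q u v" unfolding bil_def
          by (intro sum.cong refl sum.mono_neutral_right) (use supp[OF that(1,3)] MN in auto)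
        finally show ?thesis .
      qed
      then show ?thesis using q that by auto
    qed
    then have "\<forall>i\<in>I. \<forall>u\<in>S i. \<forall>v\<in>S i. bil M q u v = 0" by blast
    moreover have "\<forall>k<M. \<forall>l<M. q k l = q l k" using sym MN by simp
    ultimately have "\<forall>k<M. \<forall>l<M. q k l = 0" using S unfolding no_quadric_set_def by blast
    then show ?thesis using that by blast
  qed
  have B: "q l k = 0" if k: "k \<in> {M..<N}" and l: "l < M" for k l
  proof -
    obtain i j where ij: "i \<in> I" "j \<in> I" "i \<in> F k" "j \<in> F k" "spans M (S i \<union> S j)" using span[OF k] by blast
    have "(\<Sum>l<M. u l * q l k) = 0" if u: "u \<in> S i \<union> S j" for u
    proof -
      obtain p where p: "p \<in> I" "p \<in> F k" "u \<in> S p" using u ij by auto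
      have "unit k \<in> S p \<union> unit ` {k\<in>{M..<N}. p \<in> F k}" using k p by blast
      moreover have "u \<in> S p \<union> unit ` {k\<in>{M..<N}. p \<in> F k}" using p by blast
      ultimately have "bil N q u (unit k) = 0" by (intro q[THEN bspec, OF p(1), THEN bspec, THEN bspec])
      moreover have "bil N q u (unit k) = (\<Sum>l<M. u l * q l k)"
        by (rule unit_bil) (use supp[OF p(1,3)] k in auto)
      ultimately show ?thesis by simp
    qed
    then have "\<forall>u\<in>S i \<union> S j. (\<Sum>l<M. u l * q l k) = 0" by blast
    with spec[OF ij(5)[unfolded spans_def], of "\<lambda>l. q l k"] have "\<forall>l<M. q l k = 0" by (rule mp)
    then show ?thesis using l by blast
  qed
  have C: "q k l = 0" if k: "k \<in> {M..<N}" and l: "l \<in> {M..<N}" for k l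
  proof -
    obtain i where "i \<in> I" "i \<in> F k" "i \<in> F l" using common[OF k l] by blast
    then have i: "i \<in> I" "unit k \<in> S i \<union> unit ` {k\<in>{M..<N}. i \<in> F k}" "unit l \<in> S i \<union> unit ` {k\<in>{M..<N}. i \<in> F k}"
      using k l by blast+
    have "bil N q (unit k) (unit l) = 0" by (rule q[THEN bspec, OF i(1), THEN bspec, OF i(2), THEN bspec, OF i(3)])
    then show ?thesis using bil_unit[of k N l q] k l by simp
  qed
  show "q k0 l0 = 0"
    using A[of k0 l0] B[of k0 l0] B[of l0 k0] C[of k0 l0] sym kl
    by (cases "k0 < M"; cases "l0 < M") auto
qed

text \<open>Absence of quadrics and the spanning of each pair in R are conditions open on lines, and
  each holds somewhere, so they hold at one frame. The coordinates from M on are cut off and so stay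
  free for the added vectors.\<close>

lemma ex_no_quadric_set:
  assumes fI: "finite I" and nq: "\<exists>x. no_quadric M I b x" and R: "R \<subseteq> I \<times> I" "\<And>i j. (i, j) \<in> R \<Longrightarrow> i \<noteq> j \<and> M \<le> b i + b j"
  shows "\<exists>S. no_quadric_set M I S \<and> (\<forall>i\<in>I. finite (S i) \<and> card (S i) \<le> b i) \<and> (\<forall>i\<in>I. \<forall>u\<in>S i. \<forall>k\<ge>M. u k = 0)
     \<and> (\<forall>(i, j)\<in>R. spans M (S i \<union> S j))"
proof -
  define Q where "Q = (\<lambda>p x. nullity_le (vec_rows b {fst p, snd p}) {..<M} (\<lambda>(i, r). x i r) 0)"
  have fR: "finite R" using R(1) fI by (meson finite_SigmaI finite_subset)
  have lo: "line_open (Q p)" for p unfolding Q_def by (rule line_open_vec_rows) simp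
  have exQ: "\<exists>x. Q p x" if "p \<in> R" for p
  proof -
    have "fst p \<noteq> snd p" "M - (b (fst p) + b (snd p)) = 0" using R(2)[of "fst p" "snd p"] that by auto
    then show ?thesis using ex_pair_nullity[of "fst p" "snd p" b M] by (simp add: Q_def)
  qed
  obtain x1 where x1: "no_quadric M I b x1" using nq by blast
  obtain x2 where x2: "\<forall>p\<in>R. Q p x2" using line_open_ex_ball[of R Q, OF fR lo exQ] by blast
  obtain x where x: "no_quadric M I b x" "\<forall>p\<in>R. Q p x"
    using line_open_ex_conj[OF line_open_no_quadric[OF fI] line_open_ball[OF fR lo] x1 x2] by blast
  define y where "y = (\<lambda>i r k. if k < M then x i r k else 0)"
  define S where "S = (\<lambda>i. y i ` {..<b i})"
  have "no_quadric_set M I S"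
    unfolding no_quadric_set_def
  proof (intro allI impI)
    fix q k l assume sym: "\<forall>k<M. \<forall>l<M. q k l = q l k" and q: "\<forall>i\<in>I. \<forall>u\<in>S i. \<forall>v\<in>S i. bil M q u v = 0" and kl: "k < M" "l < M"
    have "bil M q (x i r) (x i t) = 0" if "i \<in> I" "r < b i" "t < b i" for i r t
    proof -
      have "bil M q (x i r) (x i t) = bil M q (y i r) (y i t)" by (rule bil_cong) (auto simp: y_def)
      then show ?thesis using q that by (auto simp: S_def)
    qed
    then show "q k l = 0" using x(1) sym kl by (auto simp: no_quadric_def quadric_def)
  qed
  moreover have "finite (S i) \<and> card (S i) \<le> b i" for i
    unfolding S_def using card_image_le[of "{..<b i}" "y i"] by auto
  moreover have "u k = 0" if "u \<in> S i" "k \<ge> M" for i u k using that by (auto simp: S_def y_def)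
  moreover have "spans M (S i \<union> S j)" if "(i, j) \<in> R" for i j
    unfolding spans_def
  proof (intro allI impI)
    fix l k assume l: "\<forall>u\<in>S i \<union> S j. (\<Sum>k<M. u k * l k) = 0" and k: "k < M"
    have "inj_system (vec_rows b {i, j}) {..<M} (\<lambda>(i, r). x i r)"
      using x(2) that unfolding Q_def nullity_le_0 by force
    then show "l k = 0"
    proof (rule inj_systemD)
      fix e assume "e \<in> vec_rows b {i, j}"
      then obtain p r where e: "e = (p, r)" "p = i \<or> p = j" "r < b p" by (auto simp: vec_rows_def)
      have "(\<Sum>k<M. y p r k * l k) = 0" using l e by (auto simp: S_def)
      then show "(\<Sum>j<M. (case e of (i, r) \<Rightarrow> x i r) j * l j) = 0" using e by (simp add: y_def)
    qed (use k in simp)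
  qed
  ultimately show ?thesis by (intro exI[of _ S]) auto
qed

text \<open>K is injected into the disjoint union of sets of sizes \<open>c i\<close>, and f is the
  projection to the index.\<close>

lemma ex_fibres_le:
  fixes c :: "'a \<Rightarrow> nat"
  assumes "finite K" "finite T" "card K \<le> (\<Sum>i\<in>T. c i)"
  shows "\<exists>f. f ` K \<subseteq> T \<and> (\<forall>i\<in>T. card {k\<in>K. f k = i} \<le> c i)"
proof -
  define G where "G = (SIGMA i:T. {..<c i})"
  have fG: "finite G" "card K \<le> card G" using assms by (auto simp: G_def card_SigmaI)
  obtain g where g: "g ` K \<subseteq> G" "inj_on g K" using card_le_inj[OF assms(1) fG] by blast
  have "card {k\<in>K. fst (g k) = i} \<le> c i" if "i \<in> T" for i
  proof -
    have "card {k\<in>K. fst (g k) = i} = card (g ` {k\<in>K. fst (g k) = i})"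
      by (rule card_image[symmetric]) (use g(2) in \<open>auto simp: inj_on_def\<close>)
    also have "\<dots> \<le> card ({i} \<times> {..<c i})"
    proof (rule card_mono)
      show "g ` {k\<in>K. fst (g k) = i} \<subseteq> {i} \<times> {..<c i}"
      proof
        fix y assume "y \<in> g ` {k\<in>K. fst (g k) = i}"
        then obtain k where "k \<in> K" "y = g k" "fst y = i" by auto
        then have "y \<in> G" "fst y = i" using g(1) by auto
        then show "y \<in> {i} \<times> {..<c i}" by (auto simp: G_def)
      qed
    qed simp
    finally show ?thesis by simp
  qed
  moreover have "fst (g k) \<in> T" if "k \<in> K" for k using g(1) that by (auto simp: G_def)
  ultimately show ?thesis by (intro exI[of _ "\<lambda>k. fst (g k)"]) auto
qed

text \<open>Besides \<open>M\<close> coordinates carrying a generic configuration there are \<open>w\<close> coordinate vectors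
  distributed over the intersections of the first with the \<open>i\<close>-th space, at most \<open>c i\<close> in each,
  and \<open>e\<close> coordinate vectors in the intersection of the spaces \<open>2, \<dots>, \<tau>\<close>.\<close>

lemma ex_no_quadric_star:
  assumes fI: "finite I" and \<tau>: "2 \<le> \<tau>" "{1..\<tau>} \<subseteq> I" and N: "N = M + w + e"
    and b: "\<exists>x. no_quadric M I b x"
    and w: "w \<le> (\<Sum>i=2..\<tau>. c i)" and a1: "b 1 + w \<le> a 1" and ai: "\<And>i. 2 \<le> i \<Longrightarrow> i \<le> \<tau> \<Longrightarrow> b i + c i + e \<le> a i"
    and rest: "\<And>i. i \<in> I - {1..\<tau>} \<Longrightarrow> b i \<le> a i"
    and s1: "0 < w \<Longrightarrow> (\<And>i. 2 \<le> i \<Longrightarrow> i \<le> \<tau> \<Longrightarrow> M \<le> b 1 + b i)" and s2: "0 < e \<Longrightarrow> 3 \<le> \<tau> \<and> M \<le> b 2 + b 3"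
  shows "\<exists>x. no_quadric N I a x"
proof -
  define R where "R = {(i, j). 0 < w \<and> i = 1 \<and> 2 \<le> j \<and> j \<le> \<tau> \<or> 0 < e \<and> i = (2::nat) \<and> j = (3::nat)}"
  have R: "R \<subseteq> I \<times> I" "\<And>i j. (i, j) \<in> R \<Longrightarrow> i \<noteq> j \<and> M \<le> b i + b j"
    using \<tau> s1 s2 by (auto simp: R_def subset_iff)
  obtain S where S: "no_quadric_set M I S" "\<And>i. i \<in> I \<Longrightarrow> finite (S i) \<and> card (S i) \<le> b i"
    "\<And>i u k. i \<in> I \<Longrightarrow> u \<in> S i \<Longrightarrow> k \<ge> M \<Longrightarrow> u k = 0" "\<And>i j. (i, j) \<in> R \<Longrightarrow> spans M (S i \<union> S j)"
    using ex_no_quadric_set[OF fI b R] by blast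
  obtain f where f: "f ` {M..<M + w} \<subseteq> {2..\<tau>}" "\<And>i. i \<in> {2..\<tau>} \<Longrightarrow> card {k\<in>{M..<M + w}. f k = i} \<le> c i"
    using ex_fibres_le[of "{M..<M + w}" "{2..\<tau>}" c] w by auto
  have fk: "2 \<le> f k" "f k \<le> \<tau>" if "k \<in> {M..<M + w}" for k using f(1) that by (auto simp: image_subset_iff)
  \<comment> \<open>\<open>F k\<close> is the set of spaces through the k-th coordinate vector. Any
    two such sets meet: those of the first w vectors share 1, and \<open>{2..\<tau>}\<close>
    contains every \<open>f k\<close>. So q vanishes between any two added vectors.\<close>
  define F where "F = (\<lambda>k. if k < M + w then {1, f k} else {2..\<tau>})"
  have "no_quadric_set N I (\<lambda>i. S i \<union> unit ` {k\<in>{M..<N}. i \<in> F k})"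
  proof (rule no_quadric_set_cone[OF _ S(1)])
    show "M \<le> N" by (simp add: N)
    show "\<And>i u k. i \<in> I \<Longrightarrow> u \<in> S i \<Longrightarrow> M \<le> k \<Longrightarrow> u k = 0" by (rule S(3))
    fix k assume k: "k \<in> {M..<N}"
    show "\<exists>i\<in>I. \<exists>j\<in>I. i \<in> F k \<and> j \<in> F k \<and> spans M (S i \<union> S j)"
    proof (cases "k < M + w")
      case True
      then have "(1, f k) \<in> R" "1 \<in> I" "f k \<in> I" using fk[of k] k \<tau> by (auto simp: R_def subset_iff)
      then show ?thesis using S(4)[of 1 "f k"] True by (auto simp: F_def)
    next
      case False
      then have "0 < e" using k N by auto
      then have "(2, 3) \<in> R" "2 \<in> I" "3 \<in> I" "3 \<le> \<tau>" using s2 \<tau> by (auto simp: R_def subset_iff)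
      moreover have "2 \<in> F k" "3 \<in> F k" using False \<open>3 \<le> \<tau>\<close> by (auto simp: F_def)
      ultimately show ?thesis using S(4)[of 2 3] by blast
    qed
    fix l assume l: "l \<in> {M..<N}"
    have I: "1 \<in> I" "2 \<in> I" using \<tau> by (auto simp: subset_iff)
    consider "k < M + w" "l < M + w" | "k < M + w" "\<not> l < M + w" | "\<not> k < M + w" "l < M + w" | "\<not> k < M + w" "\<not> l < M + w" by blast
    then show "\<exists>i\<in>I. i \<in> F k \<and> i \<in> F l"
    proof cases
      case 1
      then show ?thesis using I(1) by (auto simp: F_def)
    next
      case 2
      then have "f k \<in> I" "f k \<in> {2..\<tau>}" using fk[of k] k \<tau> by (auto simp: subset_iff)
      then show ?thesis using 2 by (auto simp: F_def)
    next
      case 3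
      then have "f l \<in> I" "f l \<in> {2..\<tau>}" using fk[of l] l \<tau> by (auto simp: subset_iff)
      then show ?thesis using 3 by (auto simp: F_def)
    next
      case 4
      then show ?thesis using I(2) \<tau> by (auto simp: F_def)
    qed
  qed
  moreover have "finite (S i \<union> unit ` {k\<in>{M..<N}. i \<in> F k}) \<and> card (S i \<union> unit ` {k\<in>{M..<N}. i \<in> F k}) \<le> a i" if i: "i \<in> I" for i
  proof -
    have le: "card (S i \<union> unit ` {k\<in>{M..<N}. i \<in> F k}) \<le> b i + card {k\<in>{M..<N}. i \<in> F k}"
    proof -
      have "card (unit ` {k\<in>{M..<N}. i \<in> F k}) \<le> card {k\<in>{M..<N}. i \<in> F k}" by (rule card_image_le) simp
      then show ?thesis using card_Un_le[of "S i" "unit ` {k\<in>{M..<N}. i \<in> F k}"] S(2)[OF i] by linarith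
    qed
    consider "i = 1" | "i \<in> {2..\<tau>}" | "i \<in> I - {1..\<tau>}" using i by force
    then have "b i + card {k\<in>{M..<N}. i \<in> F k} \<le> a i"
    proof cases
      case 1
      have "{k\<in>{M..<N}. i \<in> F k} \<subseteq> {M..<M + w}" using 1 by (auto simp: F_def split: if_splits)
      then have "card {k\<in>{M..<N}. i \<in> F k} \<le> w" using card_mono[of "{M..<M + w}"] by fastforce
      then show ?thesis using a1 1 by simp
    next
      case 2
      have "{k\<in>{M..<N}. i \<in> F k} \<subseteq> {k\<in>{M..<M + w}. f k = i} \<union> {M + w..<N}" using 2 by (auto simp: F_def split: if_splits)
      then have "card {k\<in>{M..<N}. i \<in> F k} \<le> card ({k\<in>{M..<M + w}. f k = i} \<union> {M + w..<N})" by (intro card_mono) auto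
      also have "\<dots> \<le> card {k\<in>{M..<M + w}. f k = i} + card {M + w..<N}" by (rule card_Un_le)
      also have "\<dots> \<le> c i + e" using f(2)[OF 2] N by simp
      finally show ?thesis using ai[of i] 2 by simp
    next
      case 3
      have "{k\<in>{M..<N}. i \<in> F k} = {}"
      proof -
        have "i \<notin> F k" if k: "k \<in> {M..<N}" for k
          using 3 \<tau>(1) fk[of k] k by (auto simp: F_def)
        then show ?thesis by blast
      qed
      then show ?thesis using rest[OF 3] by (simp only: card.empty)
    qed
    then show ?thesis using le S(2)[OF i] by auto
  qed
  ultimately show ?thesis by (rule no_quadric_of_set)
qed

subsection \<open>Evaluation of polynomials\<close>

definition mon_eval :: "('v \<Rightarrow> complex) \<Rightarrow> 'v monom \<Rightarrow> complex" where
  "mon_eval x \<mu> = (\<Prod>v\<in>Poly_Mapping.keys \<mu>. x v ^ Poly_Mapping.lookup \<mu> v)"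

lemma mon_eval_superset:
  assumes "finite S" "Poly_Mapping.keys \<mu> \<subseteq> S"
  shows "mon_eval x \<mu> = (\<Prod>v\<in>S. x v ^ Poly_Mapping.lookup \<mu> v)"
  unfolding mon_eval_def by (rule prod.mono_neutral_left) (use assms in \<open>auto simp: in_keys_iff\<close>)

lemma mon_eval_add: "mon_eval x (\<mu> + \<nu>) = mon_eval x \<mu> * mon_eval x \<nu>"
proof -
  define S where "S = Poly_Mapping.keys \<mu> \<union> Poly_Mapping.keys \<nu>"
  have S: "finite S" "Poly_Mapping.keys \<mu> \<subseteq> S" "Poly_Mapping.keys \<nu> \<subseteq> S" "Poly_Mapping.keys (\<mu> + \<nu>) \<subseteq> S"
    using Poly_Mapping.keys_add[of \<mu> \<nu>] by (auto simp: S_def)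
  show ?thesis
    using S by (simp add: mon_eval_superset[where S = S] lookup_add power_add prod.distrib)
qed

lemma poly_eval_superset:
  assumes "finite S" "Poly_Mapping.keys f \<subseteq> S"
  shows "poly_eval x f = (\<Sum>\<mu>\<in>S. Poly_Mapping.lookup f \<mu> * mon_eval x \<mu>)"
  unfolding poly_eval_def mon_eval_def[symmetric]
  by (rule sum.mono_neutral_left) (use assms in \<open>auto simp: in_keys_iff\<close>)

lemma poly_eval_add: "poly_eval x (f + g) = poly_eval x f + poly_eval x g"
proof -
  define S where "S = Poly_Mapping.keys f \<union> Poly_Mapping.keys g"
  have S: "finite S" "Poly_Mapping.keys f \<subseteq> S" "Poly_Mapping.keys g \<subseteq> S" "Poly_Mapping.keys (f + g) \<subseteq> S"
    using Poly_Mapping.keys_add[of f g] by (auto simp: S_def)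
  show ?thesis
    using S by (simp add: poly_eval_superset[where S = S] lookup_add distrib_right sum.distrib)
qed

lemma poly_eval_0 [simp]: "poly_eval x 0 = 0"
  by (simp add: poly_eval_def)

lemma poly_eval_sum: "poly_eval x (\<Sum>s\<in>S. f s) = (\<Sum>s\<in>S. poly_eval x (f s))"
  by (induction S rule: infinite_finite_induct) (auto simp: poly_eval_add)

lemma poly_eval_single: "poly_eval x (Poly_Mapping.single \<mu> c) = c * mon_eval x \<mu>"
  by (subst poly_eval_superset[of "{\<mu>}"]) auto

lemma sum_monomials: "f = (\<Sum>\<mu>\<in>Poly_Mapping.keys f. Poly_Mapping.single \<mu> (Poly_Mapping.lookup f \<mu>))"
proof (rule poly_mapping_eqI)
  fix \<nu>
  have "Poly_Mapping.lookup (\<Sum>\<mu>\<in>Poly_Mapping.keys f. Poly_Mapping.single \<mu> (Poly_Mapping.lookup f \<mu>)) \<nu>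
    = (\<Sum>\<mu>\<in>Poly_Mapping.keys f. if \<mu> = \<nu> then Poly_Mapping.lookup f \<mu> else 0)"
    unfolding lookup_sum by (rule sum.cong) (auto simp: lookup_single when_def)
  also have "\<dots> = Poly_Mapping.lookup f \<nu>"
    by (simp add: in_keys_iff)
  finally show "Poly_Mapping.lookup f \<nu> = Poly_Mapping.lookup (\<Sum>\<mu>\<in>Poly_Mapping.keys f. Poly_Mapping.single \<mu> (Poly_Mapping.lookup f \<mu>)) \<nu>" ..
qed

lemma poly_eval_mult: "poly_eval x (f * g) = poly_eval x f * poly_eval x g"
proof -
  have "f * g = (\<Sum>\<mu>\<in>Poly_Mapping.keys f. Poly_Mapping.single \<mu> (Poly_Mapping.lookup f \<mu>))
      * (\<Sum>\<nu>\<in>Poly_Mapping.keys g. Poly_Mapping.single \<nu> (Poly_Mapping.lookup g \<nu>))"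
    using sum_monomials[of f] sum_monomials[of g] by simp
  also have "\<dots> = (\<Sum>\<mu>\<in>Poly_Mapping.keys f. \<Sum>\<nu>\<in>Poly_Mapping.keys g.
      Poly_Mapping.single (\<mu> + \<nu>) (Poly_Mapping.lookup f \<mu> * Poly_Mapping.lookup g \<nu>))"
    by (simp add: sum_product mult_single)
  finally have "poly_eval x (f * g) = (\<Sum>\<mu>\<in>Poly_Mapping.keys f. \<Sum>\<nu>\<in>Poly_Mapping.keys g.
      (Poly_Mapping.lookup f \<mu> * mon_eval x \<mu>) * (Poly_Mapping.lookup g \<nu> * mon_eval x \<nu>))"
    by (simp add: poly_eval_sum poly_eval_single mon_eval_add ac_simps)
  also have "\<dots> = poly_eval x f * poly_eval x g"
    unfolding poly_eval_def mon_eval_def[symmetric] by (simp add: sum_product)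
  finally show ?thesis .
qed

definition deg_in :: "'v set \<Rightarrow> 'v monom \<Rightarrow> nat" where
  "deg_in A \<mu> = (\<Sum>v\<in>Poly_Mapping.keys \<mu> \<inter> A. Poly_Mapping.lookup \<mu> v)"

lemma deg_in_superset:
  assumes "finite S" "Poly_Mapping.keys \<mu> \<subseteq> S"
  shows "deg_in A \<mu> = (\<Sum>v\<in>S \<inter> A. Poly_Mapping.lookup \<mu> v)"
  unfolding deg_in_def by (rule sum.mono_neutral_left) (use assms in \<open>auto simp: in_keys_iff\<close>)

lemma deg_in_add: "deg_in A (\<mu> + \<nu>) = deg_in A \<mu> + deg_in A \<nu>"
proof -
  define S where "S = Poly_Mapping.keys \<mu> \<union> Poly_Mapping.keys \<nu>"
  have S: "finite S" "Poly_Mapping.keys \<mu> \<subseteq> S" "Poly_Mapping.keys \<nu> \<subseteq> S" "Poly_Mapping.keys (\<mu> + \<nu>) \<subseteq> S"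
    using Poly_Mapping.keys_add[of \<mu> \<nu>] by (auto simp: S_def)
  show ?thesis
    using S by (simp add: deg_in_superset[where S = S] lookup_add sum.distrib)
qed

lemma homogeneous_in_iff: "homogeneous_in A d f \<longleftrightarrow> (\<forall>\<mu>\<in>Poly_Mapping.keys f. deg_in A \<mu> = d)"
  by (simp add: homogeneous_in_def deg_in_def)

lemma homogeneous_in_add: "\<lbrakk>homogeneous_in A d f; homogeneous_in A d g\<rbrakk> \<Longrightarrow> homogeneous_in A d (f + g)"
  unfolding homogeneous_in_iff using Poly_Mapping.keys_add[of f g] by blast

lemma homogeneous_in_mult:
  assumes "homogeneous_in A d f" "homogeneous_in A d' g"
  shows "homogeneous_in A (d + d') (f * g)"
  unfolding homogeneous_in_iff
proof
  fix \<mu> assume "\<mu> \<in> Poly_Mapping.keys (f * g)"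
  then obtain \<nu> \<nu>' where "\<mu> = \<nu> + \<nu>'" "\<nu> \<in> Poly_Mapping.keys f" "\<nu>' \<in> Poly_Mapping.keys g"
    using keys_mult[of f g] by blast
  then show "deg_in A \<mu> = d + d'" using assms by (simp add: deg_in_add homogeneous_in_iff)
qed

lemma polys_in_add: "\<lbrakk>f \<in> polys_in V; g \<in> polys_in V\<rbrakk> \<Longrightarrow> f + g \<in> polys_in V"
  unfolding polys_in_def using Poly_Mapping.keys_add[of f g] by blast

lemma polys_in_mult: 
  assumes "f \<in> polys_in V" "g \<in> polys_in V"
  shows "f * g \<in> polys_in V"
proof -
  have "Poly_Mapping.keys \<mu> \<subseteq> V" if \<mu>: "\<mu> \<in> Poly_Mapping.keys (f * g)" for \<mu>
  proof -
    obtain \<nu> \<nu>' where "\<mu> = \<nu> + \<nu>'" "\<nu> \<in> Poly_Mapping.keys f" "\<nu>' \<in> Poly_Mapping.keys g"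
      using keys_mult[of f g] \<mu> by blast
    then show ?thesis using assms Poly_Mapping.keys_add[of \<nu> \<nu>'] unfolding polys_in_def by blast
  qed
  then show ?thesis by (simp add: polys_in_def)
qed

subsection \<open>Frames from Pluecker coordinates\<close>

text \<open>For the chart where the minor with columns \<open>J i\<close> does not vanish, the basis of the \<open>i\<close>-th space
  in reduced echelon form, up to that minor, has Pluecker coordinates as entries.\<close>

definition chart :: "nat \<Rightarrow> nat \<Rightarrow> (nat \<Rightarrow> nat) \<Rightarrow> (nat \<Rightarrow> nat set) \<Rightarrow> (nat \<Rightarrow> nat set \<Rightarrow> complex) \<Rightarrow> complex frame" where
  "chart n s m J p = (\<lambda>i r k. let I = J i - {pick (J i) r} in
     if i \<in> {1..s} \<and> r < m i + 1 \<and> k \<le> n \<and> k \<notin> I then (-1) ^ card {j\<in>I. j < k} * p i (insert k I) else 0)"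

text \<open>Every entry of the chart frame is 0 or, up to sign, one Pluecker coordinate of the same
  space. So each coordinate of a frame is replaced by something of the same multidegree.\<close>

lemma multihom_pluecker:
  assumes J: "\<And>i. i \<in> {1..s} \<Longrightarrow> J i \<subseteq> {0..n} \<and> card (J i) = m i + 1"
    and P: "multihom {1..s} d P"
  shows "\<exists>f \<in> polys_in (pluecker_vars n s m). (\<forall>i\<in>{1..s}. homogeneous_in ({i} \<times> UNIV) (d i) f)
    \<and> (\<forall>p. poly_eval (\<lambda>(i, J). p i J) f = P (chart n s m J p))"
  using P
proof induction
  case (const c)
  show ?case
    by (rule bexI[of _ "Poly_Mapping.single 0 c"])
      (auto simp: poly_eval_single mon_eval_def homogeneous_in_def polys_in_def)
next
  case (zero d)
  show ?case by (rule bexI[of _ 0]) (auto simp: homogeneous_in_def polys_in_def)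
next
  case (coord i r k)
  define I where "I = J i - {pick (J i) r}"
  show ?case
  proof (cases "i \<in> {1..s} \<and> r < m i + 1 \<and> k \<le> n \<and> k \<notin> I")
    case True
    define f :: "(nat \<times> nat set) cpoly" where
      "f = Poly_Mapping.single (Poly_Mapping.single (i, insert k I) 1) ((-1) ^ card {j\<in>I. j < k})"
    have kf: "Poly_Mapping.keys f = {Poly_Mapping.single (i, insert k I) 1}"
      by (simp add: f_def)
    have Ji: "J i \<subseteq> {0..n}" "card (J i) = m i + 1" using J True by auto
    have fin: "finite (J i)" using Ji(1) finite_subset by blast
    have pk: "pick (J i) r \<in> J i" using pick_in_set_le[of r "J i"] Ji True by simp
    have "card (insert k I) = m i + 1" "insert k I \<subseteq> {0..n}"
      using Ji fin pk True by (auto simp: I_def)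
    then have "f \<in> polys_in (pluecker_vars n s m)"
      using True by (auto simp: polys_in_def kf pluecker_vars_def)
    moreover have "homogeneous_in ({i'} \<times> UNIV) (if i' = i then 1 else 0) f" for i'
    proof -
      have "{(i, insert k I)} \<inter> {i'} \<times> UNIV = (if i' = i then {(i, insert k I)} else {})" by auto
      then show ?thesis unfolding homogeneous_in_def kf by simp
    qed
    moreover have "poly_eval (\<lambda>(i, J). p i J) f = chart n s m J p i r k" for p
      unfolding chart_def Let_def I_def[symmetric] using True
      by (simp add: f_def poly_eval_single mon_eval_def)
    ultimately show ?thesis by blast
  next
    case False
    then have "chart n s m J p i r k = 0" for p unfolding chart_def Let_def I_def[symmetric] by (simp only: if_False)
    then show ?thesis by (intro bexI[of _ 0]) (auto simp: homogeneous_in_def polys_in_def)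
  qed
next
  case (add d P Q)
  from add.IH obtain f g where "f \<in> polys_in (pluecker_vars n s m)" "g \<in> polys_in (pluecker_vars n s m)"
    "\<forall>i\<in>{1..s}. homogeneous_in ({i} \<times> UNIV) (d i) f" "\<forall>i\<in>{1..s}. homogeneous_in ({i} \<times> UNIV) (d i) g"
    "\<forall>p. poly_eval (\<lambda>(i, J). p i J) f = P (chart n s m J p)" "\<forall>p. poly_eval (\<lambda>(i, J). p i J) g = Q (chart n s m J p)"
    by blast
  then show ?case
    by (intro bexI[of _ "f + g"] conjI ballI allI) (simp_all add: poly_eval_add polys_in_add homogeneous_in_add)
next
  case (mult d P d' Q)
  from mult.IH obtain f g where "f \<in> polys_in (pluecker_vars n s m)" "g \<in> polys_in (pluecker_vars n s m)"
    "\<forall>i\<in>{1..s}. homogeneous_in ({i} \<times> UNIV) (d i) f" "\<forall>i\<in>{1..s}. homogeneous_in ({i} \<times> UNIV) (d' i) g"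
    "\<forall>p. poly_eval (\<lambda>(i, J). p i J) f = P (chart n s m J p)" "\<forall>p. poly_eval (\<lambda>(i, J). p i J) g = Q (chart n s m J p)"
    by blast
  then show ?case
    by (intro bexI[of _ "f * g"] conjI ballI allI) (simp_all add: poly_eval_mult polys_in_mult homogeneous_in_mult)
qed

text \<open>Inserting k shifts the positions of the larger elements by one. This identifies the
  columns of the submatrix left after deleting column k from a minor on I and k.\<close>

lemma pick_insert:
  assumes "finite I" "k \<notin> I" "j < card I"
  shows "pick (insert k I) (if j < card {i\<in>I. i < k} then j else Suc j) = pick I j"
proof -
  define x where "x = pick I j"
  have x: "x \<in> I" "card {i\<in>I. i < x} = j" unfolding x_def using pick_in_set_le card_pick assms by auto
  have "j < card {i\<in>I. i < k} \<longleftrightarrow> x < k"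
  proof
    assume "j < card {i\<in>I. i < k}"
    then have "\<not> {i\<in>I. i < k} \<subseteq> {i\<in>I. i < x}" using x assms card_mono[of "{i\<in>I. i < x}" "{i\<in>I. i < k}"] by auto
    then show "x < k" by force
  next
    assume "x < k"
    then have "{i\<in>I. i < x} \<subset> {i\<in>I. i < k}" using x by auto
    then show "j < card {i\<in>I. i < k}" using psubset_card_mono[of "{i\<in>I. i < k}"] x assms by auto
  qed
  moreover have "card {i\<in>insert k I. i < x} = (if x < k then j else Suc j)"
  proof (cases "x < k")
    case True
    then have "{i\<in>insert k I. i < x} = {i\<in>I. i < x}" by auto
    then show ?thesis using x True by simp
  next
    case False
    moreover have "x \<noteq> k" using x(1) assms(2) by blast
    ultimately have "{i\<in>insert k I. i < x} = insert k {i\<in>I. i < x}" by auto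
    then show ?thesis using x False assms by simp
  qed
  ultimately show ?thesis using pick_card_in_set[of x "insert k I"] x(1) by (auto simp: x_def)
qed

text \<open>Laplace expansion along column k. The cofactors \<open>M r\<close> involve the columns I
  only, so after correction by the sign of the position of k one and the same combination of the
  rows of b serves for every k; for k in I it expands a determinant with a repeated column.\<close>

lemma minor_expansion:
  fixes b :: "nat \<Rightarrow> nat \<Rightarrow> complex"
  assumes I: "I \<subseteq> {0..n}" "card I = m"
  defines "M \<equiv> \<lambda>r. det (mat m m (\<lambda>(r', j). b (if r' < r then r' else Suc r') (pick I j)))"
  shows "k \<le> n \<Longrightarrow> k \<notin> I \<Longrightarrow>
      (-1) ^ card {j\<in>I. j < k} * det (submatrix (mat (m + 1) (n + 1) (\<lambda>(r, k). b r k)) UNIV (insert k I))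
      = (\<Sum>r<m + 1. (-1) ^ r * M r * b r k)"
    and "k \<in> I \<Longrightarrow> (\<Sum>r<m + 1. (-1) ^ r * M r * b r k) = 0"
proof -
  have fI: "finite I" using I finite_subset by blast
  show "(-1) ^ card {j\<in>I. j < k} * det (submatrix (mat (m + 1) (n + 1) (\<lambda>(r, k). b r k)) UNIV (insert k I))
      = (\<Sum>r<m + 1. (-1) ^ r * M r * b r k)" if k: "k \<le> n" "k \<notin> I"
  proof -
    define K where "K = insert k I"
    define c where "c = card {j\<in>I. j < k}"
    have "{j. j < n + 1 \<and> j \<in> K} = K" using I k by (auto simp: K_def)
    moreover have "card K = m + 1" using k fI I by (simp add: K_def)
    ultimately have cK: "card {j. j < n + 1 \<and> j \<in> K} = m + 1" by simp
    define B where "B = mat (m + 1) (m + 1) (\<lambda>(r, j). b r (pick K j))"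
    have sub: "submatrix (mat (m + 1) (n + 1) (\<lambda>(r, k). b r k)) UNIV K = B"
    proof (rule eq_matI)
      fix i j assume "i < dim_row B" "j < dim_col B"
      then have ij: "i < m + 1" "j < m + 1" by (auto simp: B_def)
      have "pick K j \<in> K" using pick_in_set_le[of j K] ij \<open>card K = m + 1\<close> by simp
      then have "pick K j < n + 1" using I k by (auto simp: K_def)
      then show "submatrix (mat (m + 1) (n + 1) (\<lambda>(r, k). b r k)) UNIV K $$ (i, j) = B $$ (i, j)"
        using ij cK by (simp add: submatrix_def B_def pick_UNIV)
    qed (use cK in \<open>auto simp: submatrix_def B_def\<close>)
    have cm: "c < m + 1" using card_mono[OF fI, of "{j\<in>I. j < k}"] I by (auto simp: c_def)
    have "{j\<in>K. j < k} = {j\<in>I. j < k}" by (auto simp: K_def)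
    then have pc: "pick K c = k" using pick_card_in_set[of k K] by (simp add: c_def K_def)
    have B: "B \<in> carrier_mat (m + 1) (m + 1)" by (simp add: B_def)
    have "mat_delete B r c = mat m m (\<lambda>(r', j). b (if r' < r then r' else Suc r') (pick I j))" if "r < m + 1" for r
    proof (rule eq_matI)
      fix r' j assume "r' < dim_row (mat m m (\<lambda>(r', j). b (if r' < r then r' else Suc r') (pick I j)))"
        "j < dim_col (mat m m (\<lambda>(r', j). b (if r' < r then r' else Suc r') (pick I j)))"
      then have rj: "r' < m" "j < m" by auto
      have "pick K (if j < c then j else Suc j) = pick I j"
        unfolding K_def c_def by (rule pick_insert[OF fI k(2)]) (use rj I in simp)
      then show "mat_delete B r c $$ (r', j) = mat m m (\<lambda>(r', j). b (if r' < r then r' else Suc r') (pick I j)) $$ (r', j)"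
        using rj by (auto simp: mat_delete_def B_def split: if_splits)
    qed (auto simp: mat_delete_def B_def)
    then have "det B = (\<Sum>r<m + 1. b r k * ((-1) ^ (r + c) * M r))"
      unfolding laplace_expansion_column[OF B cm] cofactor_def using cm pc by (simp add: B_def M_def)
    then have "(-1) ^ c * det B = (\<Sum>r<m + 1. (-1) ^ c * (b r k * ((-1) ^ (r + c) * M r)))"
      by (simp only: sum_distrib_left)
    also have "\<dots> = (\<Sum>r<m + 1. (-1) ^ r * M r * b r k)"
    proof (rule sum.cong[OF refl])
      fix r
      have "(-1) ^ c * (b r k * ((-1) ^ (r + c) * M r)) = ((-1) ^ c * (-1) ^ c) * ((-1) ^ r * M r * b r k)"
        by (simp only: power_add ac_simps)
      also have "(-1) ^ c * (-1) ^ c = (1::complex)" by (simp add: power_mult_distrib[symmetric])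
      finally show "(-1) ^ c * (b r k * ((-1) ^ (r + c) * M r)) = (-1) ^ r * M r * b r k" by simp
    qed
    finally show ?thesis unfolding c_def[symmetric] K_def[symmetric] sub by simp
  qed
  show "(\<Sum>r<m + 1. (-1) ^ r * M r * b r k) = 0" if k: "k \<in> I"
  proof -
    define C where "C = mat (m + 1) (m + 1) (\<lambda>(r, j). b r (if j = 0 then k else pick I (j - 1)))"
    have C: "C \<in> carrier_mat (m + 1) (m + 1)" by (simp add: C_def)
    have "mat_delete C r 0 = mat m m (\<lambda>(r', j). b (if r' < r then r' else Suc r') (pick I j))" for r
      by (rule eq_matI) (auto simp: mat_delete_def C_def)
    moreover have m0: "0 < m + 1" by simp
    ultimately have "det C = (\<Sum>r<m + 1. b r k * ((-1) ^ r * M r))"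
      unfolding laplace_expansion_column[OF C m0] cofactor_def
      by (simp add: C_def M_def)
    moreover have "det C = 0"
    proof (rule det_identical_columns[OF C])
      define c where "c = card {j\<in>I. j < k}"
      have "{j\<in>I. j < k} \<subset> I" using k by auto
      then have "c < m" using psubset_card_mono[OF fI] I(2) by (simp add: c_def)
      moreover have "pick I c = k" using pick_card_in_set[OF k] by (simp add: c_def)
      ultimately show "col C 0 = col C (Suc c)" "Suc c < m + 1" by (auto simp: C_def intro!: eq_vecI)
    qed auto
    ultimately show ?thesis by (simp add: ac_simps)
  qed
qed

subsection \<open>Subspaces spanned by frames\<close>

lemma sum_fun_apply: "(\<Sum>r\<in>S. f r) k = (\<Sum>r\<in>S. f r k)"
  by (induction S rule: infinite_finite_induct) auto

lemma span_frame: "cvec.span (b ` {..<a}) = range (\<lambda>c k. \<Sum>r<a. c r * b r k)" for b :: "nat \<Rightarrow> nat \<Rightarrow> complex"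
proof
  let ?R = "range (\<lambda>c k. \<Sum>r<a. c r * b r k)"
  have "cvec.subspace ?R"
    unfolding cvec.subspace_def
  proof (intro conjI ballI allI)
    show "0 \<in> ?R" by (rule range_eqI[of _ _ "\<lambda>_. 0"]) (simp add: fun_eq_iff)
    fix u v assume "u \<in> ?R" "v \<in> ?R"
    then obtain c d where "u = (\<lambda>k. \<Sum>r<a. c r * b r k)" "v = (\<lambda>k. \<Sum>r<a. d r * b r k)" by blast
    then show "u + v \<in> ?R"
      by (intro range_eqI[of _ _ "\<lambda>r. c r + d r"]) (simp add: fun_eq_iff distrib_right sum.distrib)
  next
    fix e u assume "u \<in> ?R"
    then obtain c where "u = (\<lambda>k. \<Sum>r<a. c r * b r k)" by blast
    then show "vec_scale e u \<in> ?R"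
      by (intro range_eqI[of _ _ "\<lambda>r. e * c r"]) (simp add: fun_eq_iff vec_scale_def sum_distrib_left mult.assoc)
  qed
  moreover have "b ` {..<a} \<subseteq> ?R"
  proof
    fix u assume "u \<in> b ` {..<a}"
    then obtain r where r: "r < a" "u = b r" by auto
    have "(\<Sum>r'<a. (if r' = r then 1 else 0) * b r' k) = b r k" for k
      using r by (simp add: if_distrib[of "\<lambda>c. c * _"] cong: if_cong)
    then show "u \<in> ?R" by (intro range_eqI[of _ _ "\<lambda>r'. if r' = r then 1 else 0"]) (simp add: r fun_eq_iff)
  qed
  ultimately show "cvec.span (b ` {..<a}) \<subseteq> ?R" by (intro cvec.span_minimal)
next
  show "range (\<lambda>c k. \<Sum>r<a. c r * b r k) \<subseteq> cvec.span (b ` {..<a})"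
  proof
    fix u assume "u \<in> range (\<lambda>c k. \<Sum>r<a. c r * b r k)"
    then obtain c where c: "u = (\<lambda>k. \<Sum>r<a. c r * b r k)" by blast
    have "u = (\<Sum>r<a. vec_scale (c r) (b r))" by (simp add: c fun_eq_iff sum_fun_apply vec_scale_def)
    also have "\<dots> \<in> cvec.span (b ` {..<a})"
      by (intro cvec.span_sum cvec.span_scale cvec.span_base) auto
    finally show "u \<in> cvec.span (b ` {..<a})" .
  qed
qed

text \<open>Independence of the family rather than of its set of values, so repetitions are excluded
  as well.\<close>

definition indep_frame :: "nat \<Rightarrow> (nat \<Rightarrow> nat \<Rightarrow> complex) \<Rightarrow> bool" where
  "indep_frame a b \<longleftrightarrow> (\<forall>c. (\<forall>k. (\<Sum>r<a. c r * b r k) = 0) \<longrightarrow> (\<forall>r<a. c r = 0))"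

lemma indep_frame_inj: "indep_frame a b \<Longrightarrow> inj_on b {..<a}"
proof (rule inj_onI)
  fix r t assume b: "indep_frame a b" and rt: "r \<in> {..<a}" "t \<in> {..<a}" "b r = b t"
  show "r = t"
  proof (rule ccontr)
    assume ne: "r \<noteq> t"
    define c :: "nat \<Rightarrow> complex" where "c = (\<lambda>j. (if j = r then 1 else 0) - (if j = t then 1 else 0))"
    have "(\<Sum>j<a. c j * b j k) = b r k - b t k" for k
      using rt by (simp add: c_def left_diff_distrib sum_subtractf if_distrib[of "\<lambda>c. c * _"] cong: if_cong)
    then have "c r = 0" using b rt by (auto simp: indep_frame_def)
    then show False using ne by (simp add: c_def)
  qed
qed

lemma indep_frame_independent:
  assumes b: "indep_frame a b"
  shows "cvec.independent (b ` {..<a})"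
proof
  assume "cvec.dependent (b ` {..<a})"
  then obtain u where u: "\<exists>v\<in>b ` {..<a}. u v \<noteq> 0" "(\<Sum>v\<in>b ` {..<a}. vec_scale (u v) v) = 0"
    using cvec.dependent_finite[of "b ` {..<a}"] by auto
  have "(\<Sum>r<a. vec_scale (u (b r)) (b r)) = 0"
    using u(2) sum.reindex[OF indep_frame_inj[OF b], of "\<lambda>v. vec_scale (u v) v"] by simp
  then have "(\<Sum>r<a. u (b r) * b r k) = 0" for k
    by (drule_tac arg_cong[where f = "\<lambda>h. h k"]) (simp add: sum_fun_apply vec_scale_def)
  then have "\<forall>r<a. u (b r) = 0" using b unfolding indep_frame_def by (drule_tac spec[of _ "\<lambda>r. u (b r)"]) blast
  with u(1) show False by auto
qed

lemma dim_span_frame: "indep_frame a b \<Longrightarrow> cvec.dim (cvec.span (b ` {..<a})) = a"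
  using cvec.dim_span_eq_card_independent[OF indep_frame_independent] card_image[OF indep_frame_inj] by simp

lemma indep_frame_spans:
  assumes b: "indep_frame a b" and x: "\<And>r. r < a \<Longrightarrow> b r \<in> cvec.span (x ` {..<a})"
  shows "cvec.span (b ` {..<a}) = cvec.span (x ` {..<a})"
proof
  show "cvec.span (b ` {..<a}) \<subseteq> cvec.span (x ` {..<a})"
    using x by (intro cvec.span_minimal cvec.subspace_span) auto
  have "x r \<in> cvec.span (b ` {..<a})" if r: "r < a" for r
  proof (rule ccontr)
    assume no: "x r \<notin> cvec.span (b ` {..<a})"
    have ind: "cvec.independent (insert (x r) (b ` {..<a}))"
      using cvec.independent_insert[of "x r" "b ` {..<a}"] no indep_frame_independent[OF b] by auto
    have "insert (x r) (b ` {..<a}) \<subseteq> cvec.span (x ` {..<a})"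
      using x r by (auto intro: cvec.span_base)
    from cvec.independent_span_bound[OF _ ind this] have "card (insert (x r) (b ` {..<a})) \<le> card (x ` {..<a})" by simp
    also have "\<dots> \<le> a" using card_image_le[of "{..<a}" x] by simp
    finally have "card (insert (x r) (b ` {..<a})) \<le> a" .
    moreover have "x r \<notin> b ` {..<a}" using no by (auto intro: cvec.span_base)
    ultimately show False using card_image[OF indep_frame_inj[OF b]] by simp
  qed
  then show "cvec.span (x ` {..<a}) \<subseteq> cvec.span (b ` {..<a})"
    by (intro cvec.span_minimal cvec.subspace_span) auto
qed

lemma bij_betw_pick: "finite J \<Longrightarrow> bij_betw (pick J) {..<card J} J"
proof (rule bij_betwI')
  assume J: "finite J"
  fix x y assume xy: "x \<in> {..<card J}" "y \<in> {..<card J}"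
  show "(pick J x = pick J y) = (x = y)"
    using card_pick[of x J] card_pick[of y J] xy by (metis lessThan_iff)
next
  fix x assume "x \<in> {..<card J}"
  then show "pick J x \<in> J" using pick_in_set_le by simp
next
  assume J: "finite J"
  fix y assume y: "y \<in> J"
  then have "{a\<in>J. a < y} \<subset> J" by auto
  then have "card {a\<in>J. a < y} < card J" using psubset_card_mono[OF J] by blast
  then show "\<exists>x\<in>{..<card J}. y = pick J x" using pick_card_in_set[OF y] by (metis lessThan_iff)
qed

text \<open>Independence of the rows means that the transposed system has trivial kernel; selecting
  as many of its equations as unknowns selects the columns of a nonzero minor.\<close>

lemma ex_nonzero_minor:
  assumes b: "indep_frame (m + 1) b" and supp: "\<And>r k. r < m + 1 \<Longrightarrow> n < k \<Longrightarrow> b r k = 0"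
  obtains J where "J \<subseteq> {0..n}" "card J = m + 1"
    "det (submatrix (mat (m + 1) (n + 1) (\<lambda>(r, k). b r k)) UNIV J) \<noteq> 0"
proof -
  have "inj_system {0..n} {..<m + 1} (\<lambda>k r. b r k)"
    unfolding inj_system_def
  proof (intro allI impI)
    fix c assume c: "\<forall>k\<in>{0..n}. (\<Sum>r<m + 1. b r k * c r) = 0"
    have "(\<Sum>r<m + 1. c r * b r k) = 0" for k
    proof (cases "k \<le> n")
      case True
      then show ?thesis using c by (simp add: mult.commute)
    next
      case False
      then show ?thesis using supp by (intro sum.neutral) auto
    qed
    then show "\<forall>r\<in>{..<m + 1}. c r = 0" using b unfolding indep_frame_def by blast
  qed
  then obtain J where J: "J \<subseteq> {0..n}" "card J = card {..<m + 1}" and inj: "inj_system J {..<m + 1} (\<lambda>k r. b r k)"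
    by (rule inj_system_row_selection[rotated 2]) auto
  have cJ: "card J = m + 1" using J by simp
  have fJ: "finite J" using J(1) finite_subset by blast
  have f: "bij_betw (pick J) {..<m + 1} J" using bij_betw_pick[OF fJ] cJ by simp
  have g: "bij_betw (\<lambda>j. j) {..<m + 1} {..<m + 1}" by (rule bij_betwI') auto
  have d: "det (mat (m + 1) (m + 1) (\<lambda>(i, j). b j (pick J i))) \<noteq> 0"
    using inj_system_iff_det[OF f g, of "\<lambda>k r. b r k"] inj by simp
  have "{j. j < n + 1 \<and> j \<in> J} = J" using J(1) by auto
  then have cc: "card {j. j < n + 1 \<and> j \<in> J} = m + 1" using cJ by simp
  have "submatrix (mat (m + 1) (n + 1) (\<lambda>(r, k). b r k)) UNIV J
    = transpose_mat (mat (m + 1) (m + 1) (\<lambda>(i, j). b j (pick J i)))"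
  proof (rule eq_matI)
    fix i j assume "i < dim_row (transpose_mat (mat (m + 1) (m + 1) (\<lambda>(i, j). b j (pick J i))))"
      "j < dim_col (transpose_mat (mat (m + 1) (m + 1) (\<lambda>(i, j). b j (pick J i))))"
    then have ij: "i < m + 1" "j < m + 1" by auto
    have "pick J j \<in> J" using pick_in_set_le[of j J] ij cJ by simp
    then have "pick J j < n + 1" using J(1) by auto
    then show "submatrix (mat (m + 1) (n + 1) (\<lambda>(r, k). b r k)) UNIV J $$ (i, j)
      = transpose_mat (mat (m + 1) (m + 1) (\<lambda>(i, j). b j (pick J i))) $$ (i, j)"
      using ij cc by (simp add: submatrix_def pick_UNIV)
  qed (use cc in \<open>auto simp: submatrix_def\<close>)
  then have "det (submatrix (mat (m + 1) (n + 1) (\<lambda>(r, k). b r k)) UNIV J) \<noteq> 0"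
    using d by (simp add: det_transpose[of _ "m + 1"])
  then show thesis using that J(1) cJ by blast
qed

lemma chart_in_span:
  assumes i: "i \<in> {1..s}" and r: "r < m i + 1" and J: "J i \<subseteq> {0..n}" "card (J i) = m i + 1"
    and b: "\<And>r k. r < m i + 1 \<Longrightarrow> n < k \<Longrightarrow> b r k = 0"
    and p: "p i = (\<lambda>J. det (submatrix (mat (m i + 1) (n + 1) (\<lambda>(r, k). b r k)) UNIV J))"
  shows "chart n s m J p i r \<in> cvec.span (b ` {..<m i + 1})"
proof -
  define I where "I = J i - {pick (J i) r}"
  have fJ: "finite (J i)" using J(1) finite_subset by blast
  have "pick (J i) r \<in> J i" using pick_in_set_le[of r "J i"] J(2) r by simp
  then have I: "I \<subseteq> {0..n}" "card I = m i" using J fJ by (auto simp: I_def)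
  define M where "M = (\<lambda>r. det (mat (m i) (m i) (\<lambda>(r', j). b (if r' < r then r' else Suc r') (pick I j))))"
  have "chart n s m J p i r k = (\<Sum>\<rho><m i + 1. ((-1) ^ \<rho> * M \<rho>) * b \<rho> k)" for k
  proof -
    consider "k > n" | "k \<in> I" | "k \<le> n" "k \<notin> I" by linarith
    then show ?thesis
    proof cases
      case 1
      then show ?thesis using b unfolding chart_def Let_def by simp
    next
      case 2
      then show ?thesis using minor_expansion(2)[OF I 2, of b] unfolding chart_def Let_def I_def[symmetric] M_def by simp
    next
      case 3
      then show ?thesis using minor_expansion(1)[OF I 3, of b] i r
        unfolding chart_def Let_def I_def[symmetric] M_def p by simp
    qed
  qed
  then have "chart n s m J p i r = (\<lambda>k. \<Sum>\<rho><m i + 1. ((-1) ^ \<rho> * M \<rho>) * b \<rho> k)" by (rule ext)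
  then show ?thesis unfolding span_frame by (rule range_eqI[of _ _ "\<lambda>\<rho>. (-1) ^ \<rho> * M \<rho>"])
qed

text \<open>Restricted to the columns in \<open>J i\<close>, the chart frame is diagonal with
  entries plus or minus the minor on \<open>J i\<close>.\<close>

lemma chart_indep:
  assumes i: "i \<in> {1..s}" and J: "J i \<subseteq> {0..n}" "card (J i) = m i + 1" and p: "p i (J i) \<noteq> 0"
  shows "indep_frame (m i + 1) (chart n s m J p i)"
  unfolding indep_frame_def
proof (intro allI impI)
  fix c t assume c: "\<forall>k. (\<Sum>r<m i + 1. c r * chart n s m J p i r k) = 0" and t: "t < m i + 1"
  have fJ: "finite (J i)" using J(1) finite_subset by blast
  have pk: "pick (J i) r \<in> J i" if "r < m i + 1" for r using pick_in_set_le[of r "J i"] J(2) that by simp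
  have val: "chart n s m J p i r (pick (J i) t)
    = (if r = t then (-1) ^ card {j\<in>J i - {pick (J i) t}. j < pick (J i) t} * p i (J i) else 0)" if r: "r < m i + 1" for r
  proof (cases "r = t")
    case True
    have "insert (pick (J i) t) (J i - {pick (J i) t}) = J i" using pk[OF t] by auto
    moreover have "pick (J i) t \<le> n" using pk[OF t] J(1) by auto
    ultimately show ?thesis using True i t by (simp add: chart_def Let_def)
  next
    case False
    have "pick (J i) r \<noteq> pick (J i) t"
      using bij_betw_pick[OF fJ] False r t J(2) by (auto simp: bij_betw_def inj_on_def)
    then have "pick (J i) t \<in> J i - {pick (J i) r}" using pk[OF t] by auto
    then show ?thesis using False by (simp add: chart_def Let_def)
  qed
  have "0 = (\<Sum>r<m i + 1. c r * chart n s m J p i r (pick (J i) t))" using c by simp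
  also have "\<dots> = (\<Sum>r<m i + 1. if r = t then c t * ((-1) ^ card {j\<in>J i - {pick (J i) t}. j < pick (J i) t} * p i (J i)) else 0)"
    by (rule sum.cong) (auto simp: val)
  also have "\<dots> = c t * ((-1) ^ card {j\<in>J i - {pick (J i) t}. j < pick (J i) t} * p i (J i))"
    using t by simp
  finally show "c t = 0" using p by simp
qed

text \<open>The frame x fixes a chart, and by \<open>inv\<close> its chart frame satisfies Q too.
  The polynomial from \<open>opn\<close>, evaluated on chart frames, is multihomogeneous in the
  Pluecker coordinates and its nonvanishing defines the open set U. At other points of U the chart
  frame consists of vectors of the spaces but may fail to be a basis, so \<open>concl\<close> asks
  only for membership.\<close>

lemma generic_configI:
  assumes supp: "\<And>i r k. i \<in> {1..s} \<Longrightarrow> r < m i + 1 \<Longrightarrow> n < k \<Longrightarrow> x i r k = 0"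
    and ind: "\<And>i. i \<in> {1..s} \<Longrightarrow> indep_frame (m i + 1) (x i)"
    and inv: "\<And>y. (\<And>i. i \<in> {1..s} \<Longrightarrow> cvec.span (y i ` {..<m i + 1}) = cvec.span (x i ` {..<m i + 1})) \<Longrightarrow> Q y"
    and opn: "\<And>y. Q y \<Longrightarrow> \<exists>d P. multihom {1..s} d P \<and> P y \<noteq> 0 \<and> (\<forall>y'. P y' \<noteq> 0 \<longrightarrow> Q y')"
    and concl: "\<And>\<Lambda> y. \<Lambda> \<in> config_space n s m \<Longrightarrow> (\<And>i r. i \<in> {1..s} \<Longrightarrow> r < m i + 1 \<Longrightarrow> y i r \<in> \<Lambda> i) \<Longrightarrow> Q y \<Longrightarrow> R \<Lambda>"
  shows "generic_config n s m R"
proof -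
  have "\<exists>J. J \<subseteq> {0..n} \<and> card J = m i + 1 \<and>
      det (submatrix (mat (m i + 1) (n + 1) (\<lambda>(r, k). x i r k)) UNIV J) \<noteq> 0" if "i \<in> {1..s}" for i
    by (rule ex_nonzero_minor[OF ind[OF that] supp[OF that]]) auto
  then obtain J where J: "\<And>i. i \<in> {1..s} \<Longrightarrow> J i \<subseteq> {0..n} \<and> card (J i) = m i + 1"
    and det: "\<And>i. i \<in> {1..s} \<Longrightarrow> det (submatrix (mat (m i + 1) (n + 1) (\<lambda>(r, k). x i r k)) UNIV (J i)) \<noteq> 0"
    by metis
  define p0 where "p0 = (\<lambda>i J. det (submatrix (mat (m i + 1) (n + 1) (\<lambda>(r, k). x i r k)) UNIV J))"
  have "cvec.span (chart n s m J p0 i ` {..<m i + 1}) = cvec.span (x i ` {..<m i + 1})" if i: "i \<in> {1..s}" for i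
  proof (rule indep_frame_spans)
    show "indep_frame (m i + 1) (chart n s m J p0 i)"
      by (rule chart_indep[of i s J n m p0]) (use i J det in \<open>auto simp: p0_def\<close>)
    show "chart n s m J p0 i r \<in> cvec.span (x i ` {..<m i + 1})" if "r < m i + 1" for r
      by (rule chart_in_span[where m = m, OF i that]) (use i J supp in \<open>auto simp: p0_def\<close>)
  qed
  then have "Q (chart n s m J p0)" by (rule inv)
  then obtain d P where P: "multihom {1..s} d P" "P (chart n s m J p0) \<noteq> 0" "\<And>y. P y \<noteq> 0 \<Longrightarrow> Q y" using opn by blast
  obtain f where f: "f \<in> polys_in (pluecker_vars n s m)" "\<forall>i\<in>{1..s}. homogeneous_in ({i} \<times> UNIV) (d i) f"
    and fe: "\<And>p. poly_eval (\<lambda>(i, J). p i J) f = P (chart n s m J p)"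
    using multihom_pluecker[of s J n m, OF J P(1)] by blast
  define good where "good = (\<lambda>\<Lambda>. \<exists>p. (\<forall>i\<in>{1..s}. pluecker_coords n (m i) (\<Lambda> i) (p i)) \<and> poly_eval (\<lambda>(i, J). p i J) f \<noteq> 0)"
  define U where "U = {\<Lambda> \<in> config_space n s m. good \<Lambda>}"
  have "{f} \<subseteq> {f \<in> polys_in (pluecker_vars n s m). multihomogeneous s f}"
    using f by (auto simp: multihomogeneous_def)
  moreover have "config_space n s m - U = {\<Lambda> \<in> config_space n s m. \<forall>f\<in>{f}. \<forall>p.
               (\<forall>i\<in>{1..s}. pluecker_coords n (m i) (\<Lambda> i) (p i)) \<longrightarrow>
               poly_eval (\<lambda>(i, J). p i J) f = 0}"
    by (auto simp: U_def good_def)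
  ultimately have "zariski_closed n s m (config_space n s m - U)"
    unfolding zariski_closed_def by blast
  then have "zariski_open n s m U" by (auto simp: zariski_open_def U_def)
  moreover have "U \<noteq> {}"
  proof -
    define \<Lambda> where "\<Lambda> = restrict (\<lambda>i. cvec.span (x i ` {..<m i + 1})) {1..s}"
    have "\<Lambda> i \<in> grassmannian (m i) n" if i: "i \<in> {1..s}" for i
    proof -
      have "cvec.span (x i ` {..<m i + 1}) \<subseteq> coord_space n"
        unfolding span_frame using supp[OF i] by (auto simp: coord_space_def intro!: sum.neutral)
      then show ?thesis using i dim_span_frame[OF ind[OF i]] by (auto simp: \<Lambda>_def grassmannian_def)
    qed
    then have "\<Lambda> \<in> config_space n s m" by (auto simp: config_space_def \<Lambda>_def)
    moreover have "pluecker_coords n (m i) (\<Lambda> i) (p0 i)" if i: "i \<in> {1..s}" for i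
      unfolding pluecker_coords_def
    proof (intro exI conjI)
      have "{0..m i} = {..<m i + 1}" by auto
      then show "cvec.span (x i ` {0..m i}) = \<Lambda> i" using i by (simp add: \<Lambda>_def)
      show "p0 i = (\<lambda>J. det (submatrix (mat (m i + 1) (n + 1) (\<lambda>(r, k). x i r k)) UNIV J))" by (simp add: p0_def)
    qed
    moreover have "poly_eval (\<lambda>(i, J). p0 i J) f \<noteq> 0" unfolding fe by (rule P(2))
    ultimately have "\<Lambda> \<in> U" unfolding U_def good_def by blast
    then show ?thesis by blast
  qed
  moreover have "R \<Lambda>" if \<Lambda>U: "\<Lambda> \<in> U" for \<Lambda>
  proof -
    have \<Lambda>: "\<Lambda> \<in> config_space n s m" using \<Lambda>U by (simp add: U_def)
    obtain p where p: "\<And>i. i \<in> {1..s} \<Longrightarrow> pluecker_coords n (m i) (\<Lambda> i) (p i)" "P (chart n s m J p) \<noteq> 0"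
      using \<Lambda>U unfolding U_def good_def fe by blast
    show ?thesis
    proof (rule concl[OF \<Lambda> _ P(3)[OF p(2)]])
      fix i r assume i: "i \<in> {1..s}" and r: "r < m i + 1"
      obtain b where b: "cvec.span (b ` {0..m i}) = \<Lambda> i"
        "p i = (\<lambda>J. det (submatrix (mat (m i + 1) (n + 1) (\<lambda>(r, k). b r k)) UNIV J))"
        using p(1)[OF i] unfolding pluecker_coords_def by blast
      have eq: "{0..m i} = {..<m i + 1}" by auto
      have "\<Lambda> i \<subseteq> coord_space n" using \<Lambda> i by (auto simp: config_space_def grassmannian_def PiE_iff)
      then have "b r k = 0" if "r < m i + 1" "n < k" for r k
        using b(1) cvec.span_superset[of "b ` {0..m i}"] that unfolding eq coord_space_def by blast
      then have "chart n s m J p i r \<in> cvec.span (b ` {..<m i + 1})"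
        using J[OF i] by (intro chart_in_span[of i s r m J n b p, OF i r _ _ _ b(2)]) auto
      then show "chart n s m J p i r \<in> \<Lambda> i" using b(1) by (simp add: eq)
    qed
  qed
  ultimately show ?thesis unfolding generic_config_def by blast
qed

subsection \<open>Open conditions on frames\<close>

text \<open>The multihomogeneous counterpart of \<open>nullity_le_cofinite\<close>: P is the minor
  that witnesses the bound at y, and the functionals contribute rows of degree 0.\<close>

lemma multihom_nullity_le:
  assumes fE: "finite E" and fJ: "finite J" and hom: "\<And>e. e \<in> E \<Longrightarrow> \<exists>d. \<forall>j. multihom I d (\<lambda>x. M x e j)"
    and le: "nullity_le E J (M y) c"
  shows "\<exists>d P. multihom I d P \<and> P y \<noteq> 0 \<and> (\<forall>y'. P y' \<noteq> 0 \<longrightarrow> nullity_le E J (M y') c)"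
proof -
  obtain d where d: "\<And>e j. e \<in> E \<Longrightarrow> multihom I (d e) (\<lambda>x. M x e j)"
    using bchoice[of E "\<lambda>e d. \<forall>j. multihom I d (\<lambda>x. M x e j)"] hom by blast
  obtain l :: "nat \<Rightarrow> 'b \<Rightarrow> complex" where l: "\<And>v. \<lbrakk>\<forall>e\<in>E. (\<Sum>j\<in>J. M y e j * v j) = 0; \<forall>i<c. (\<Sum>j\<in>J. l i j * v j) = 0\<rbrakk>
      \<Longrightarrow> \<forall>j\<in>J. v j = 0" using le by (auto simp: nullity_le_def)
  define M' where "M' = (\<lambda>x e j. case e of Inl e \<Rightarrow> M x e j | Inr i \<Rightarrow> l i j)"
  have "inj_system (Inl ` E \<union> Inr ` {..<c}) J (M' y)"
    unfolding inj_system_def using l by (auto simp: M'_def ball_Un)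
  from inj_system_row_selection[OF _ fJ this] fE obtain R where
    R: "R \<subseteq> Inl ` E \<union> Inr ` {..<c}" "card R = card J" "inj_system R J (M' y)" by auto
  have fR: "finite R" by (rule finite_subset[OF R(1)]) (use fE in auto)
  define d' :: "'a + nat \<Rightarrow> nat \<Rightarrow> nat" where "d' = (\<lambda>e. case e of Inl e \<Rightarrow> d e | Inr i \<Rightarrow> (\<lambda>_. 0))"
  have hom': "multihom I (d' e) (\<lambda>x. M' x e j)" if "e \<in> R" for e j
  proof -
    have "e \<in> Inl ` E \<union> Inr ` {..<c}" using R(1) that by blast
    then show ?thesis using d by (auto simp: d'_def M'_def multihom.const)
  qed
  have "\<exists>P d''. multihom I d'' P \<and> (\<forall>x. (P x \<noteq> 0) = inj_system R J (M' x))"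
  proof (rule multihom_det[of R J I d' M'])
    fix P d'' assume "multihom I d'' P" "\<And>x. (P x \<noteq> 0) = inj_system R J (M' x)"
    then show ?thesis by blast
  qed (rule hom' fR fJ R(2); assumption?)+
  then obtain P d'' where P: "multihom I d'' P" "\<And>x. P x \<noteq> 0 \<longleftrightarrow> inj_system R J (M' x)" by blast
  have "nullity_le E J (M y') c" if "P y' \<noteq> 0" for y'
    unfolding nullity_le_def
  proof (intro exI[of _ l] allI impI)
    fix v assume v: "\<forall>e\<in>E. (\<Sum>j\<in>J. M y' e j * v j) = 0" "\<forall>i<c. (\<Sum>j\<in>J. l i j * v j) = 0"
    have inj: "inj_system R J (M' y')" using P(2) that by blast
    show "\<forall>j\<in>J. v j = 0"
    proof
      fix j assume "j \<in> J"
      show "v j = 0"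
      proof (rule inj_systemD[OF inj _ \<open>j \<in> J\<close>])
        fix e assume "e \<in> R"
        then have "e \<in> Inl ` E \<union> Inr ` {..<c}" using R(1) by blast
        then show "(\<Sum>j\<in>J. M' y' e j * v j) = 0" using v by (auto simp: M'_def)
      qed
    qed
  qed
  moreover have "P y \<noteq> 0" using P(2) R(3) by blast
  ultimately show ?thesis using P(1) by blast
qed

lemma multihom_conj:
  assumes "\<exists>d P. multihom I d P \<and> P y \<noteq> 0 \<and> (\<forall>y'. P y' \<noteq> 0 \<longrightarrow> Q y')"
    and "\<exists>d P. multihom I d P \<and> P y \<noteq> 0 \<and> (\<forall>y'. P y' \<noteq> 0 \<longrightarrow> Q' y')"
  shows "\<exists>d P. multihom I d P \<and> P y \<noteq> 0 \<and> (\<forall>y'. P y' \<noteq> 0 \<longrightarrow> Q y' \<and> Q' y')"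
proof -
  obtain d P d' P' where P: "multihom I d P" "P y \<noteq> 0" "\<And>y'. P y' \<noteq> 0 \<Longrightarrow> Q y'"
    "multihom I d' P'" "P' y \<noteq> 0" "\<And>y'. P' y' \<noteq> 0 \<Longrightarrow> Q' y'" using assms by blast
  have "multihom I (\<lambda>i. d i + d' i) (\<lambda>x. P x * P' x)" using P(1,4) by (rule multihom.mult)
  moreover have "P y * P' y \<noteq> 0" using P by simp
  moreover have "Q y' \<and> Q' y'" if "P y' * P' y' \<noteq> 0" for y' using that P by simp
  ultimately show ?thesis by blast
qed

lemma rows_independent:
  assumes fE: "finite E" and fJ: "finite J" and le: "nullity_le E J M c" and c: "card E + c = card J"
    and 0: "\<And>j. j \<in> J \<Longrightarrow> (\<Sum>e\<in>E. f e * M e j) = 0" and e0: "e0 \<in> E"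
  shows "f e0 = 0"
proof (rule ccontr)
  assume f0: "f e0 \<noteq> 0"
  obtain l :: "nat \<Rightarrow> 'b \<Rightarrow> complex" where l: "\<And>v. \<lbrakk>\<forall>e\<in>E. (\<Sum>j\<in>J. M e j * v j) = 0; \<forall>i<c. (\<Sum>j\<in>J. l i j * v j) = 0\<rbrakk>
      \<Longrightarrow> \<forall>j\<in>J. v j = 0" using le by (auto simp: nullity_le_def)
  define M' where "M' = (\<lambda>e j. case e of Inl e \<Rightarrow> M e j | Inr i \<Rightarrow> l i j)"
  have "inj_system (Inl ` (E - {e0}) \<union> Inr ` {..<c}) J M'"
    unfolding inj_system_def
  proof (intro allI impI)
    fix v assume v: "\<forall>e\<in>Inl ` (E - {e0}) \<union> Inr ` {..<c}. (\<Sum>j\<in>J. M' e j * v j) = 0"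
    have vE: "(\<Sum>j\<in>J. M e j * v j) = 0" if "e \<in> E - {e0}" for e
      using v[rule_format, of "Inl e"] that by (auto simp: M'_def)
    have vl: "(\<Sum>j\<in>J. l i j * v j) = 0" if "i < c" for i
      using v[rule_format, of "Inr i"] that by (auto simp: M'_def)
    have "0 = (\<Sum>j\<in>J. (\<Sum>e\<in>E. f e * M e j) * v j)" using 0 by simp
    also have "\<dots> = (\<Sum>e\<in>E. f e * (\<Sum>j\<in>J. M e j * v j))"
      unfolding sum_distrib_right sum_distrib_left by (subst sum.swap) (simp add: mult.assoc)
    also have "\<dots> = f e0 * (\<Sum>j\<in>J. M e0 j * v j) + (\<Sum>e\<in>E - {e0}. f e * (\<Sum>j\<in>J. M e j * v j))"
      by (rule sum.remove[OF fE e0])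
    also have "(\<Sum>e\<in>E - {e0}. f e * (\<Sum>j\<in>J. M e j * v j)) = 0" using vE by simp
    finally have "(\<Sum>j\<in>J. M e0 j * v j) = 0" using f0 by simp
    then show "\<forall>j\<in>J. v j = 0" using l[of v] vE vl by blast
  qed
  then have "card J \<le> card (Inl ` (E - {e0}) \<union> Inr ` {..<c})"
    by (rule inj_system_card[rotated 2]) (use fE fJ in auto)
  also have "\<dots> \<le> card (E - {e0}) + c"
    using card_Un_le[of "Inl ` (E - {e0})" "Inr ` {..<c}"] by (simp add: card_image)
  finally show False using c fE e0 by (simp add: card_Diff_singleton) (metis One_nat_def Suc_pred card_gt_0_iff empty_iff not_less_eq_eq add_Suc le_refl)
qed

subsection \<open>Quadratic polynomials and symmetric forms\<close>

lemma finite_symmetric_pairs: "finite {(k, l). k \<le> l \<and> l < (N::nat)}"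
  by (rule finite_subset[of _ "{..N} \<times> {..N}"]) auto

definition mono2 :: "nat \<Rightarrow> nat \<Rightarrow> nat monom" where
  "mono2 k l = Poly_Mapping.single k 1 + Poly_Mapping.single l 1"

lemma lookup_mono2: "Poly_Mapping.lookup (mono2 k l) v = (if v = k then 1 else 0) + (if v = l then 1 else 0)"
  by (auto simp: mono2_def lookup_add lookup_single when_def)

lemma keys_mono2: "Poly_Mapping.keys (mono2 k l) = {k, l}"
  by (auto simp: in_keys_iff lookup_mono2 split: if_splits)

lemma mono2_commute: "mono2 k l = mono2 l k"
  by (simp add: mono2_def add.commute)

lemma inj_mono2: "inj_on (\<lambda>(k, l). mono2 k l) {(k, l). k \<le> l \<and> l < N}"
proof (rule inj_onI, clarify)
  fix k l k' l' assume le: "k \<le> l" "k' \<le> l'" and eq: "mono2 k l = mono2 k' l'"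
  have "{k, l} = {k', l'}" using eq keys_mono2 by metis
  then show "k = k' \<and> l = l'" using le by (auto simp: doubleton_eq_iff)
qed

lemma mon_eval_mono2: "mon_eval x (mono2 k l) = x k * x l"
  by (simp add: mono2_def mon_eval_add) (simp add: mon_eval_def)

lemma degree_2_mono2:
  assumes deg: "(\<Sum>v\<in>Poly_Mapping.keys \<mu>. Poly_Mapping.lookup \<mu> v) = (2::nat)"
  obtains k l where "k \<le> l" "\<mu> = mono2 k l"
proof -
  have ne: "Poly_Mapping.keys \<mu> \<noteq> {}" using deg by auto
  then obtain k where k: "k \<in> Poly_Mapping.keys \<mu>" by blast
  define K where "K = Poly_Mapping.keys \<mu>"
  have rest: "Poly_Mapping.lookup \<mu> k + (\<Sum>v\<in>K - {k}. Poly_Mapping.lookup \<mu> v) = 2"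
    using deg k by (simp add: K_def sum.remove[of _ k])
  have pos: "Poly_Mapping.lookup \<mu> v \<ge> 1" if "v \<in> K" for v
    using that by (simp add: K_def in_keys_iff Suc_leI)
  have "\<exists>l. \<mu> = mono2 k l"
  proof (cases "K - {k} = {}")
    case True
    have "\<mu> = mono2 k k"
    proof (rule poly_mapping_eqI)
      fix v
      show "Poly_Mapping.lookup \<mu> v = Poly_Mapping.lookup (mono2 k k) v"
      proof (cases "v = k")
        case True
        have "sum (Poly_Mapping.lookup \<mu>) (K - {k}) = 0" unfolding \<open>K - {k} = {}\<close> by simp
        then show ?thesis using rest True by (simp add: lookup_mono2)
      next
        case False
        then have "v \<notin> K" using \<open>K - {k} = {}\<close> by blast
        then show ?thesis using False by (simp add: lookup_mono2 K_def in_keys_iff)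
      qed
    qed
    then show ?thesis by blast
  next
    case False
    then obtain l where l: "l \<in> K - {k}" by blast
    have "(\<Sum>v\<in>K - {k}. Poly_Mapping.lookup \<mu> v) = Poly_Mapping.lookup \<mu> l + (\<Sum>v\<in>K - {k} - {l}. Poly_Mapping.lookup \<mu> v)"
      using l by (intro sum.remove) (auto simp: K_def)
    moreover have "Poly_Mapping.lookup \<mu> k \<ge> 1" "Poly_Mapping.lookup \<mu> l \<ge> 1" using pos k l by (auto simp: K_def)
    ultimately have 1: "Poly_Mapping.lookup \<mu> k = 1" "Poly_Mapping.lookup \<mu> l = 1" "(\<Sum>v\<in>K - {k} - {l}. Poly_Mapping.lookup \<mu> v) = 0"
      using rest by auto
    have 0: "Poly_Mapping.lookup \<mu> v = 0" if "v \<noteq> k" "v \<noteq> l" for v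
    proof (cases "v \<in> K")
      case True
      then show ?thesis using 1(3) that by (auto simp: K_def)
    qed (simp add: K_def in_keys_iff)
    have "\<mu> = mono2 k l"
      by (rule poly_mapping_eqI) (use 0 1 l in \<open>auto simp: lookup_mono2\<close>)
    then show ?thesis by blast
  qed
  then obtain l where "\<mu> = mono2 k l" by blast
  then show thesis using that[of k l] that[of l k] mono2_commute[of k l] by (cases "k \<le> l") simp_all
qed

lemma keys_quadratic:
  assumes f: "f \<in> coord_ring_deg n 2"
  shows "Poly_Mapping.keys f \<subseteq> (\<lambda>(k, l). mono2 k l) ` {(k, l). k \<le> l \<and> l < n + 1}"
proof
  fix \<mu> assume \<mu>: "\<mu> \<in> Poly_Mapping.keys f"
  then have deg: "(\<Sum>v\<in>Poly_Mapping.keys \<mu>. Poly_Mapping.lookup \<mu> v) = 2" and K: "Poly_Mapping.keys \<mu> \<subseteq> {0..n}"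
    using f by (auto simp: coord_ring_deg_def coord_ring_def polys_in_def homogeneous_in_def)
  obtain k l where "k \<le> l" "\<mu> = mono2 k l" by (rule degree_2_mono2[OF deg])
  then show "\<mu> \<in> (\<lambda>(k, l). mono2 k l) ` {(k, l). k \<le> l \<and> l < n + 1}" using K by (auto simp: keys_mono2)
qed

text \<open>The symmetric matrix of a quadratic polynomial; an off-diagonal coefficient is shared by
  two entries, whence the half.\<close>

definition form_of :: "nat cpoly \<Rightarrow> nat \<Rightarrow> nat \<Rightarrow> complex" where
  "form_of f k l = (if k = l then Poly_Mapping.lookup f (mono2 k l) else Poly_Mapping.lookup f (mono2 k l) / 2)"

lemma form_of_sym: "form_of f k l = form_of f l k"
  unfolding form_of_def mono2_commute[of k l] by auto

lemma poly_eval_quadratic: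
  assumes f: "f \<in> coord_ring_deg n 2"
  shows "poly_eval x f = bil (n + 1) (form_of f) x x"
proof -
  have fin: "finite ((\<lambda>(k, l). mono2 k l) ` {(k, l). k \<le> l \<and> l < n + 1})" using finite_symmetric_pairs by blast
  have "poly_eval x f = (\<Sum>\<mu>\<in>(\<lambda>(k, l). mono2 k l) ` {(k, l). k \<le> l \<and> l < n + 1}. Poly_Mapping.lookup f \<mu> * mon_eval x \<mu>)"
    by (rule poly_eval_superset[OF fin keys_quadratic[OF f]])
  also have "\<dots> = (\<Sum>(k, l)\<in>{(k, l). k \<le> l \<and> l < n + 1}. Poly_Mapping.lookup f (mono2 k l) * (x k * x l))"
    by (subst sum.reindex[OF inj_mono2], rule sum.cong[OF refl]) (clarsimp simp: mon_eval_mono2)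
  also have "\<dots> = (\<Sum>(k, l)\<in>{(k, l). k \<le> l \<and> l < n + 1}. form_of f k l * x k * x l + (if k = l then 0 else form_of f l k * x l * x k))"
  proof (rule sum.cong[OF refl], clarify)
    fix k l
    show "Poly_Mapping.lookup f (mono2 k l) * (x k * x l)
      = form_of f k l * x k * x l + (if k = l then 0 else form_of f l k * x l * x k)"
      unfolding form_of_sym[of f l k] by (cases "k = l") (simp_all add: form_of_def field_simps)
  qed
  also have "\<dots> = bil (n + 1) (form_of f) x x"
    unfolding bil_def by (rule sum_symmetric_pairs[symmetric])
  finally show ?thesis .
qed

lemma form_of_0:
  assumes f: "f \<in> coord_ring_deg n 2" and 0: "\<And>k l. k < n + 1 \<Longrightarrow> l < n + 1 \<Longrightarrow> form_of f k l = 0"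
  shows "f = 0"
proof -
  have "Poly_Mapping.keys f = {}"
  proof (rule ccontr)
    assume "Poly_Mapping.keys f \<noteq> {}"
    then obtain \<mu> where \<mu>: "\<mu> \<in> Poly_Mapping.keys f" by blast
    have "\<mu> \<in> (\<lambda>(k, l). mono2 k l) ` {(k, l). k \<le> l \<and> l < n + 1}" by (rule subsetD[OF keys_quadratic[OF f] \<mu>])
    then obtain k l where kl: "k \<le> l" "l < n + 1" "\<mu> = mono2 k l" by auto
    have "form_of f k l = 0" by (rule 0) (use kl in auto)
    then have "Poly_Mapping.lookup f \<mu> = 0" unfolding kl(3) form_of_def by (simp split: if_splits)
    then show False using \<mu> by (simp add: in_keys_iff)
  qed
  then show ?thesis by simp
qed

lemma form_of_sum: "form_of (\<Sum>s\<in>S. poly_scale (c s) (f s)) k l = (\<Sum>s\<in>S. c s * form_of (f s) k l)"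
  by (simp add: form_of_def lookup_sum lookup_poly_scale sum_divide_distrib)

definition poly_of :: "nat \<Rightarrow> (nat \<Rightarrow> nat \<Rightarrow> complex) \<Rightarrow> nat cpoly" where
  "poly_of N q = (\<Sum>(k, l)\<in>{(k, l). k \<le> l \<and> l < N}. Poly_Mapping.single (mono2 k l) (if k = l then q k l else 2 * q k l))"

lemma lookup_poly_of:
  "k \<le> l \<Longrightarrow> l < N \<Longrightarrow> Poly_Mapping.lookup (poly_of N q) (mono2 k l) = (if k = l then q k l else 2 * q k l)"
proof -
  assume kl: "k \<le> l" "l < N"
  have "Poly_Mapping.lookup (poly_of N q) (mono2 k l)
    = (\<Sum>p\<in>{(k, l). k \<le> l \<and> l < N}. if p = (k, l) then (if k = l then q k l else 2 * q k l) else 0)"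
    unfolding poly_of_def lookup_sum
  proof (rule sum.cong[OF refl])
    fix p assume p: "p \<in> {(k, l). k \<le> l \<and> l < N}"
    obtain k' l' where kl': "p = (k', l')" by (cases p)
    have "mono2 k' l' = mono2 k l \<longleftrightarrow> p = (k, l)"
      using inj_onD[OF inj_mono2[of N], of p "(k, l)"] p kl kl' by auto
    then show "Poly_Mapping.lookup (case p of (k, l) \<Rightarrow> Poly_Mapping.single (mono2 k l) (if k = l then q k l else 2 * q k l)) (mono2 k l)
      = (if p = (k, l) then if k = l then q k l else 2 * q k l else 0)"
      unfolding kl' prod.case lookup_single when_def by auto
  qed
  also have "\<dots> = (if k = l then q k l else 2 * q k l)"
    using kl finite_symmetric_pairs[of N] by (subst sum.delta) auto
  finally show ?thesis .
qed

lemma form_of_poly_of: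
  assumes sym: "\<And>k l. k < N \<Longrightarrow> l < N \<Longrightarrow> q k l = q l k" and kl: "k < N" "l < N"
  shows "form_of (poly_of N q) k l = q k l"
  using lookup_poly_of[of k l N q] lookup_poly_of[of l k N q] mono2_commute[of k l] sym[OF kl] kl
  by (cases "k \<le> l") (auto simp: form_of_def)

lemma poly_of_in: "poly_of (n + 1) q \<in> coord_ring_deg n 2"
proof -
  have "\<exists>k l. k \<le> l \<and> l < n + 1 \<and> \<mu> = mono2 k l" if \<mu>: "\<mu> \<in> Poly_Mapping.keys (poly_of (n + 1) q)" for \<mu>
  proof (rule ccontr)
    assume no: "\<not> ?thesis"
    have "Poly_Mapping.lookup (poly_of (n + 1) q) \<mu> = 0"
      unfolding poly_of_def lookup_sum
      by (rule sum.neutral) (use no in \<open>auto simp: lookup_single when_def\<close>)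
    with \<mu> show False by (simp add: in_keys_iff)
  qed
  note mono = this
  have deg: "(\<Sum>v\<in>Poly_Mapping.keys (mono2 k l). Poly_Mapping.lookup (mono2 k l) v) = 2" for k l
    unfolding keys_mono2 by (cases "k = l") (auto simp: lookup_mono2)
  have "poly_of (n + 1) q \<in> coord_ring n"
    unfolding coord_ring_def polys_in_def
  proof (intro CollectI ballI)
    fix \<mu> assume "\<mu> \<in> Poly_Mapping.keys (poly_of (n + 1) q)"
    from mono[OF this] obtain k l where "k \<le> l" "l < n + 1" "\<mu> = mono2 k l" by blast
    then show "Poly_Mapping.keys \<mu> \<subseteq> {0..n}" by (auto simp: keys_mono2)
  qed
  moreover have "homogeneous_in UNIV 2 (poly_of (n + 1) q)"
    unfolding homogeneous_in_def
  proof
    fix \<mu> assume "\<mu> \<in> Poly_Mapping.keys (poly_of (n + 1) q)"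
    from mono[OF this] obtain k l where "\<mu> = mono2 k l" by blast
    then show "(\<Sum>v\<in>Poly_Mapping.keys \<mu> \<inter> UNIV. Poly_Mapping.lookup \<mu> v) = 2" using deg by simp
  qed
  ultimately show ?thesis by (simp add: coord_ring_deg_def)
qed

lemma bil_sum_form: "bil N (\<lambda>k l. \<Sum>s\<in>S. c s * q s k l) u v = (\<Sum>s\<in>S. c s * bil N (q s) u v)"
proof -
  have "bil N (\<lambda>k l. \<Sum>s\<in>S. c s * q s k l) u v = (\<Sum>k<N. \<Sum>l<N. \<Sum>s\<in>S. c s * (q s k l * u k * v l))"
    unfolding bil_def by (simp add: sum_distrib_left sum_distrib_right ac_simps)
  also have "\<dots> = (\<Sum>s\<in>S. \<Sum>k<N. \<Sum>l<N. c s * (q s k l * u k * v l))"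
    by (subst (2) sum.swap, subst sum.swap) rule
  finally show ?thesis by (simp add: bil_def sum_distrib_left)
qed

lemma poly_vs_subspace_deg: "poly_vs.subspace (coord_ring_deg n 2)"
  unfolding poly_vs.subspace_def
proof (intro conjI ballI allI)
  show "0 \<in> coord_ring_deg n 2" by (simp add: coord_ring_deg_def coord_ring_def polys_in_def homogeneous_in_def)
  fix f g assume "f \<in> coord_ring_deg n 2" "g \<in> coord_ring_deg n 2"
  then show "f + g \<in> coord_ring_deg n 2"
    by (auto simp: coord_ring_deg_def coord_ring_def intro: polys_in_add homogeneous_in_add)
next
  fix c f assume f: "f \<in> coord_ring_deg n 2"
  have "Poly_Mapping.keys (poly_scale c f) \<subseteq> Poly_Mapping.keys f"
    by (auto simp: in_keys_iff lookup_poly_scale)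
  then show "poly_scale c f \<in> coord_ring_deg n 2"
    using f unfolding coord_ring_deg_def coord_ring_def polys_in_def homogeneous_in_def by blast
qed

lemma quadratic_in_span:
  assumes f: "f \<in> coord_ring_deg n 2"
  shows "f \<in> poly_vs.span ((\<lambda>(k, l). Poly_Mapping.single (mono2 k l) 1) ` {(k, l). k \<le> l \<and> l < n + 1})"
proof -
  have sc: "Poly_Mapping.single \<mu> c = poly_scale c (Poly_Mapping.single \<mu> 1)" for \<mu> :: "nat monom" and c
    by (rule poly_mapping_eqI) (auto simp: lookup_poly_scale lookup_single when_def)
  have "Poly_Mapping.single \<mu> (Poly_Mapping.lookup f \<mu>) \<in> poly_vs.span ((\<lambda>(k, l). Poly_Mapping.single (mono2 k l) 1) ` {(k, l). k \<le> l \<and> l < n + 1})"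
    if "\<mu> \<in> Poly_Mapping.keys f" for \<mu>
  proof -
    have "\<mu> \<in> (\<lambda>(k, l). mono2 k l) ` {(k, l). k \<le> l \<and> l < n + 1}" by (rule subsetD[OF keys_quadratic[OF f] that])
    then obtain k l where "k \<le> l" "l < n + 1" "\<mu> = mono2 k l" by auto
    then have "Poly_Mapping.single \<mu> 1 \<in> (\<lambda>(k, l). Poly_Mapping.single (mono2 k l) 1) ` {(k, l). k \<le> l \<and> l < n + 1}"
      by (intro image_eqI[of _ _ "(k, l)"]) auto
    then show ?thesis unfolding sc[of \<mu> "Poly_Mapping.lookup f \<mu>"] by (intro poly_vs.span_scale poly_vs.span_base)
  qed
  then show ?thesis by (subst sum_monomials[of f]) (rule poly_vs.span_sum)
qed

text \<open>Polarisation: f vanishes at u, v and u + v. The ideal speaks of nonzero vectors only, so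
  the zero vector is treated apart.\<close>

lemma config_ideal_form:
  assumes f: "f \<in> config_ideal n s \<Lambda> \<inter> coord_ring_deg n 2" and i: "i \<in> {1..s}" and sub: "cvec.subspace (\<Lambda> i)"
    and uv: "u \<in> \<Lambda> i" "v \<in> \<Lambda> i"
  shows "bil (n + 1) (form_of f) u v = 0"
proof -
  have sq: "bil (n + 1) (form_of f) w w = 0" if "w \<in> \<Lambda> i" for w
  proof (cases "w = 0")
    case True
    then show ?thesis by (simp add: bil_def)
  next
    case False
    then have "w \<in> (\<Union>i\<in>{1..s}. \<Lambda> i) - {0}" using i that by blast
    then have "poly_eval w f = 0" using f unfolding config_ideal_def by blast
    then show ?thesis using poly_eval_quadratic[of f n w] f by simp
  qed
  have "(\<lambda>k. u k + v k) \<in> \<Lambda> i" using cvec.subspace_add[OF sub uv] by (simp add: plus_fun_def)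
  from sq[OF this] have "bil (n + 1) (form_of f) u v + bil (n + 1) (form_of f) v u = 0"
    using sq[OF uv(1)] sq[OF uv(2)] by (simp add: bil_add_left bil_add_right)
  moreover have "bil (n + 1) (form_of f) v u = bil (n + 1) (form_of f) u v" by (rule bil_swap) (rule form_of_sym)
  ultimately show ?thesis by simp
qed

text \<open>More than D independent quadrics would have a nontrivial combination killed by the D
  functionals that witness the nullity, and its form would be zero.\<close>

lemma config_ideal_dim_le:
  assumes sub: "\<And>i. i \<in> {1..s} \<Longrightarrow> cvec.subspace (\<Lambda> i)" and y: "\<And>i r. i \<in> {1..s} \<Longrightarrow> r < a i \<Longrightarrow> y i r \<in> \<Lambda> i"
    and le: "nullity_le (quad_rows (n + 1) {1..s} a) ({..<n + 1} \<times> {..<n + 1}) (quad_coeff y) D"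
  shows "config_ideal_dim n s \<Lambda> 2 \<le> D"
proof (rule ccontr)
  define S where "S = config_ideal n s \<Lambda> \<inter> coord_ring_deg n 2"
  define J where "J = {..<n + 1} \<times> {..<n + 1}"
  assume "\<not> config_ideal_dim n s \<Lambda> 2 \<le> D"
  then have big: "D < poly_vs.dim S" by (simp add: config_ideal_dim_def S_def)
  obtain B where B: "B \<subseteq> S" "poly_vs.independent B" "card B = poly_vs.dim S"
    using poly_vs.basis_exists[of S] by metis
  have fB: "finite B" using B(3) big card.infinite by fastforce
  obtain l :: "nat \<Rightarrow> nat \<times> nat \<Rightarrow> complex" where l: "\<And>v. \<lbrakk>\<forall>e\<in>quad_rows (n + 1) {1..s} a. (\<Sum>j\<in>J. quad_coeff y e j * v j) = 0; \<forall>i<D. (\<Sum>j\<in>J. l i j * v j) = 0\<rbrakk>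
      \<Longrightarrow> \<forall>j\<in>J. v j = 0" using le by (auto simp: nullity_le_def J_def)
  obtain c where c: "\<exists>b\<in>B. c b \<noteq> 0" "\<forall>i\<in>{..<D}. (\<Sum>b\<in>B. (\<Sum>j\<in>J. l i j * form_of b (fst j) (snd j)) * c b) = 0"
    using homogeneous_system_nontrivial[of "{..<D}" B "\<lambda>i b. \<Sum>j\<in>J. l i j * form_of b (fst j) (snd j)"] fB B(3) big by auto
  define f where "f = (\<Sum>b\<in>B. poly_scale (c b) b)"
  have fo: "form_of f k l = (\<Sum>b\<in>B. c b * form_of b k l)" for k l
    unfolding f_def by (rule form_of_sum)
  have "quadric (n + 1) {1..s} a y (form_of f)"
    unfolding quadric_def
  proof (intro conjI allI impI ballI)
    fix i r t assume irt: "i \<in> {1..s}" "r < a i" "t < a i"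
    have "bil (n + 1) (form_of b) (y i r) (y i t) = 0" if "b \<in> B" for b
      by (rule config_ideal_form[of b n s \<Lambda> i]) (use that B(1) y irt sub in \<open>auto simp: S_def\<close>)
    moreover have "bil (n + 1) (form_of f) (y i r) (y i t) = (\<Sum>b\<in>B. c b * bil (n + 1) (form_of b) (y i r) (y i t))"
      unfolding fo by (rule bil_sum_form)
    ultimately show "bil (n + 1) (form_of f) (y i r) (y i t) = 0" by simp
  qed (rule form_of_sym)
  then have "\<forall>e\<in>quad_rows (n + 1) {1..s} a. (\<Sum>j\<in>J. quad_coeff y e j * (\<lambda>j. form_of f (fst j) (snd j)) j) = 0"
    unfolding J_def quad_system_iff by simp
  moreover have "\<forall>i<D. (\<Sum>j\<in>J. l i j * (\<lambda>j. form_of f (fst j) (snd j)) j) = 0"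
  proof (intro allI impI)
    fix i assume "i < D"
    have "(\<Sum>j\<in>J. l i j * form_of f (fst j) (snd j)) = (\<Sum>b\<in>B. (\<Sum>j\<in>J. l i j * form_of b (fst j) (snd j)) * c b)"
      unfolding fo sum_distrib_left sum_distrib_right by (subst sum.swap) (simp add: ac_simps)
    then show "(\<Sum>j\<in>J. l i j * (\<lambda>j. form_of f (fst j) (snd j)) j) = 0" using c(2) \<open>i < D\<close> by simp
  qed
  ultimately have z: "\<forall>j\<in>J. form_of f (fst j) (snd j) = 0" by (rule l)
  have "form_of f k l = 0" if "k < n + 1" "l < n + 1" for k l
    using bspec[OF z, of "(k, l)"] that by (simp add: J_def)
  moreover have "f \<in> coord_ring_deg n 2"
    unfolding f_def using B(1) by (intro poly_vs.subspace_sum[OF poly_vs_subspace_deg] poly_vs.subspace_scale[OF poly_vs_subspace_deg]) (auto simp: S_def)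
  ultimately have "f = 0" using form_of_0 by blast
  then have "poly_vs.dependent B"
    using poly_vs.dependent_finite[OF fB] c(1) unfolding f_def by blast
  with B(2) show False by blast
qed

lemma kernel_family:
  assumes fE: "finite E" and fJ: "finite J"
  shows "\<exists>(w::nat \<Rightarrow> 'j \<Rightarrow> complex). (\<forall>i<card J - card E. \<forall>e\<in>E. (\<Sum>j\<in>J. M e j * w i j) = 0)
    \<and> (\<forall>c. (\<forall>j\<in>J. (\<Sum>i<card J - card E. c i * w i j) = 0) \<longrightarrow> (\<forall>i<card J - card E. c i = 0))"
proof -
  define d where "d = nullity E J M"
  have le: "nullity_le E J M d" unfolding d_def by (rule nullity_le_nullity[OF fJ])
  have min: "\<And>d'. d' < d \<Longrightarrow> \<not> nullity_le E J M d'" unfolding d_def by (rule not_nullity_le)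
  obtain R l where R: "R \<subseteq> E" "card R + d = card J"
    and inj: "inj_system (Inl ` R \<union> Inr ` {..<d}) J (\<lambda>e. case e of Inl e \<Rightarrow> M e | Inr i \<Rightarrow> l i)"
    by (rule minimal_nullity_rows[OF fE fJ le min])
  define S where "S = (Inl ` R \<union> Inr ` {..<d} :: ('a + nat) set)"
  have fR: "finite R" using R fE finite_subset by auto
  have fS: "finite S" "card S = card J"
    using fR R(2) unfolding S_def by (simp, subst card_Un_disjoint) (auto simp: card_image)
  define M' where "M' = (\<lambda>e. case e of Inl e \<Rightarrow> M e | Inr i \<Rightarrow> l i)"
  have "\<forall>i. \<exists>w. \<forall>e\<in>S. (\<Sum>j\<in>J. M' e j * w j) = (case e of Inl _ \<Rightarrow> 0 | Inr i' \<Rightarrow> if i' = i then 1 else 0)"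
    using inj_system_solvable[OF fS(1) fJ fS(2) inj[folded S_def M'_def]] by blast
  from choice[OF this] obtain w where w: "\<And>i e. e \<in> S \<Longrightarrow> (\<Sum>j\<in>J. M' e j * w i j) = (case e of Inl _ \<Rightarrow> 0 | Inr i' \<Rightarrow> if i' = i then 1 else 0)"
    by blast
  have wR: "(\<Sum>j\<in>J. M e j * w i j) = 0" if "e \<in> R" for e i
    using w[of "Inl e" i] that by (auto simp: S_def M'_def)
  have wl: "(\<Sum>j\<in>J. l i' j * w i j) = (if i' = i then 1 else 0)" if "i' < d" for i i'
    using w[of "Inr i'" i] that by (auto simp: S_def M'_def)
  have wE: "(\<Sum>j\<in>J. M e j * w i j) = 0" if "e \<in> E" for e i
    by (rule kernel_of_rows[OF fE fJ R inj min wR that])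
  have cd: "card J - card E \<le> d" using R card_mono[OF fE R(1)] by linarith
  have "c i = 0" if c: "\<forall>j\<in>J. (\<Sum>i<card J - card E. c i * w i j) = 0" and i: "i < card J - card E" for c i
  proof -
    have "0 = (\<Sum>j\<in>J. l i j * (\<Sum>i'<card J - card E. c i' * w i' j))" using c by simp
    also have "\<dots> = (\<Sum>i'<card J - card E. c i' * (\<Sum>j\<in>J. l i j * w i' j))"
      unfolding sum_distrib_left by (subst sum.swap) (simp add: ac_simps)
    also have "\<dots> = (\<Sum>i'<card J - card E. if i' = i then c i' else 0)"
      by (rule sum.cong) (use wl i cd in auto)
    also have "\<dots> = c i" using i by simp
    finally show ?thesis by simp
  qed
  with wE show ?thesis by blast
qed

text \<open>The conditions E and one symmetry equation for each k < l leave at least N * N - (N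
  choose 2) - card E independent forms, with N = n + 1, and N * N - (N choose 2) is (n + 2) choose
  2. Passing from forms to polynomials keeps independence.\<close>

lemma config_ideal_dim_ge:
  assumes fE: "finite E" and E: "\<And>q. (\<And>k l. k < n + 1 \<Longrightarrow> l < n + 1 \<Longrightarrow> q k l = q l k) \<Longrightarrow>
      (\<And>e. e \<in> E \<Longrightarrow> bil (n + 1) q (u e) (v e) = 0) \<Longrightarrow> (\<And>i w. i \<in> {1..s} \<Longrightarrow> w \<in> \<Lambda> i \<Longrightarrow> bil (n + 1) q w w = 0)"
  shows "(n + 2) choose 2 \<le> config_ideal_dim n s \<Lambda> 2 + card E"
proof -
  define N where "N = n + 1"
  define J where "J = {..<N} \<times> {..<N}"
  define L where "L = {(k, l). k < l \<and> l < N}"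
  define R where "R = Inl ` E \<union> Inr ` L"
  define M :: "'a + nat \<times> nat \<Rightarrow> nat \<times> nat \<Rightarrow> complex" where
    "M = (\<lambda>e j. case e of Inl e \<Rightarrow> u e (fst j) * v e (snd j) | Inr (k, l) \<Rightarrow> (if j = (k, l) then 1 else 0) - (if j = (l, k) then 1 else 0))"
  have fL: "finite L" unfolding L_def by (rule finite_subset[of _ "{..<N} \<times> {..<N}"]) auto
  have fJ: "finite J" by (simp add: J_def)
  have fR: "finite R" using fE fL by (simp add: R_def)
  have cR: "card R = card E + card L"
    unfolding R_def by (subst card_Un_disjoint) (use fE fL in \<open>auto simp: card_image\<close>)
  have cL: "card L + N = (N + 1) choose 2" "card L + ((N + 1) choose 2) = N * N"
  proof -
    have "{(k, l). k \<le> l \<and> l < N} = L \<union> (\<lambda>k. (k, k)) ` {..<N}" by (auto simp: L_def)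
    moreover have "card (L \<union> (\<lambda>k. (k, k)) ` {..<N}) = card L + card ((\<lambda>k. (k, k)) ` {..<N})"
      by (rule card_Un_disjoint) (use fL in \<open>auto simp: L_def\<close>)
    ultimately have "card {(k, l). k \<le> l \<and> l < N} = card L + N" by (simp add: card_image inj_on_def)
    then have 1: "2 * (card L + N) = N * (N + 1)" using card_symmetric_pairs[of N] by simp
    have "2 * ((N + 1) choose 2) = N * (N + 1)" by (simp add: choose_two)
    then show "card L + N = (N + 1) choose 2" "card L + ((N + 1) choose 2) = N * N" using 1 by (auto simp: algebra_simps)
  qed
  define d where "d = card J - card R"
  obtain w where w: "\<And>i e. i < d \<Longrightarrow> e \<in> R \<Longrightarrow> (\<Sum>j\<in>J. M e j * w i j) = 0"
    and wi: "\<And>c. (\<forall>j\<in>J. (\<Sum>i<d. c i * w i j) = 0) \<Longrightarrow> \<forall>i<d. c i = 0"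
    using kernel_family[OF fR fJ, of M] unfolding d_def by blast
  define q where "q = (\<lambda>i k l. w i (k, l))"
  have rowE: "(\<Sum>j\<in>J. M (Inl e) j * w i j) = bil N (q i) (u e) (v e)" for i e
    unfolding bil_def by (simp add: M_def J_def q_def sum.cartesian_product split_def ac_simps)
  \<comment> \<open>The symmetry rows do not involve the frame, so an arbitrary one can be
    inserted.\<close>
  have rowL: "(\<Sum>j\<in>J. M (Inr (k, l)) j * w i j) = q i k l - q i l k" if "k < N" "l < N" for i k l
    using quad_sum_Inr[OF that, of undefined "w i"] unfolding M_def J_def q_def quad_coeff_def by simp
  have qs: "q i k l = q i l k" if "i < d" "k < N" "l < N" for i k l
  proof -
    consider "k < l" | "l < k" | "k = l" by linarith
    then show ?thesis
    proof cases
      case 1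
      then show ?thesis using w[OF that(1), of "Inr (k, l)"] rowL[OF that(2,3), of i] that by (simp add: R_def L_def)
    next
      case 2
      then show ?thesis using w[OF that(1), of "Inr (l, k)"] rowL[OF that(3,2), of i] that by (simp add: R_def L_def)
    qed simp
  qed
  define S where "S = config_ideal n s \<Lambda> \<inter> coord_ring_deg n 2"
  define f where "f = (\<lambda>i. poly_of N (q i))"
  have fq: "form_of (f i) k l = q i k l" if "i < d" "k < N" "l < N" for i k l
    unfolding f_def by (rule form_of_poly_of) (use qs that in auto)
  have fdeg: "f i \<in> coord_ring_deg n 2" for i unfolding f_def N_def by (rule poly_of_in)
  have fS: "f i \<in> S" if i: "i < d" for i
  proof -
    have "poly_eval x (f i) = 0" if "x \<in> \<Lambda> p" "p \<in> {1..s}" for x p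
    proof -
      have "poly_eval x (f i) = bil N (q i) x x"
        unfolding poly_eval_quadratic[OF fdeg] N_def[symmetric] by (rule bil_cong) (use fq i in auto)
      also have "\<dots> = 0"
        unfolding N_def
      proof (rule E[OF _ _ that(2,1)])
        show "q i k l = q i l k" if "k < n + 1" "l < n + 1" for k l using qs[OF i] that by (simp add: N_def)
        show "bil (n + 1) (q i) (u e) (v e) = 0" if "e \<in> E" for e
          using w[OF i, of "Inl e"] rowE that by (simp add: R_def N_def)
      qed
      finally show ?thesis .
    qed
    moreover have "f i \<in> coord_ring n" using fdeg[of i] by (simp add: coord_ring_deg_def)
    ultimately show ?thesis using fdeg[of i] by (auto simp: S_def config_ideal_def)
  qed
  have ind: "\<forall>i<d. c i = 0" if "(\<Sum>i<d. poly_scale (c i) (f i)) = 0" for c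
  proof (rule wi, rule ballI)
    fix j assume "j \<in> J"
    then obtain k l where j: "j = (k, l)" "k < N" "l < N" by (auto simp: J_def)
    have "(\<Sum>i<d. c i * w i j) = (\<Sum>i<d. c i * form_of (f i) k l)"
      by (rule sum.cong) (use fq j in \<open>auto simp: q_def\<close>)
    also have "\<dots> = form_of 0 k l" using that form_of_sum[of c f "{..<d}" k l] by simp
    also have "\<dots> = 0" by (simp add: form_of_def)
    finally show "(\<Sum>i<d. c i * w i j) = 0" .
  qed
  have injf: "inj_on f {..<d}"
  proof (rule inj_onI, rule ccontr)
    fix r t assume rt: "r \<in> {..<d}" "t \<in> {..<d}" "f r = f t" "r \<noteq> t"
    define c :: "nat \<Rightarrow> complex" where "c = (\<lambda>j. if j = r then 1 else if j = t then - 1 else 0)"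
    have "(\<Sum>i<d. poly_scale (c i) (f i)) = (\<Sum>i<d. (if i = r then f r else 0) - (if i = t then f t else 0))"
      by (rule sum.cong) (use rt(4) in \<open>auto simp: c_def\<close>)
    also have "\<dots> = f r - f t" using rt by (simp add: sum_subtractf)
    finally have "c r = 0" using ind[of c] rt by auto
    then show False by (simp add: c_def)
  qed
  have indep: "poly_vs.independent (f ` {..<d})"
  proof
    assume "poly_vs.dependent (f ` {..<d})"
    then obtain h where h: "\<exists>v\<in>f ` {..<d}. h v \<noteq> 0" "(\<Sum>v\<in>f ` {..<d}. poly_scale (h v) v) = 0"
      using poly_vs.dependent_finite[of "f ` {..<d}"] by auto
    have "(\<Sum>i<d. poly_scale (h (f i)) (f i)) = 0"
      using h(2) by (simp add: sum.reindex[OF injf])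
    then show False using ind[of "\<lambda>i. h (f i)"] h(1) by auto
  qed
  obtain B where B: "B \<subseteq> S" "poly_vs.independent B" "S \<subseteq> poly_vs.span B" "card B = poly_vs.dim S"
    using poly_vs.basis_exists[of S] by metis
  have "finite B"
  proof -
    have "B \<subseteq> poly_vs.span ((\<lambda>(k, l). Poly_Mapping.single (mono2 k l) 1) ` {(k, l). k \<le> l \<and> l < n + 1})"
      using B(1) quadratic_in_span by (auto simp: S_def)
    from poly_vs.independent_span_bound[OF _ B(2) this] show ?thesis using finite_symmetric_pairs[of "n + 1"] by blast
  qed
  moreover have "f ` {..<d} \<subseteq> poly_vs.span B" using fS B(3) by auto
  ultimately have "card (f ` {..<d}) \<le> card B"
    using poly_vs.independent_span_bound[OF _ indep] by blast
  then have "d \<le> poly_vs.dim S" using card_image[OF injf] B(4) by simp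
  moreover have "card J = N * N" by (simp add: J_def)
  ultimately have "N * N \<le> poly_vs.dim S + card E + card L" unfolding d_def cR by linarith
  then show ?thesis using cL(2) by (simp add: config_ideal_dim_def S_def N_def)
qed

subsection \<open>Adapted bases and lower bounds\<close>

lemma indep_frameI:
  fixes a :: nat and b :: "nat \<Rightarrow> nat \<Rightarrow> complex"
  assumes inj: "inj_on b {..<a}" and ind: "cvec.independent (b ` {..<a})"
  shows "indep_frame a b"
  unfolding indep_frame_def
proof (intro allI impI, rule ccontr)
  fix c r assume c: "\<forall>k. (\<Sum>r<a. c r * b r k) = 0" and r: "r < a" "c r \<noteq> 0"
  define u where "u = (\<lambda>x. c (the_inv_into {..<a} b x))"
  have u: "u (b r) = c r" if "r < a" for r
    unfolding u_def using the_inv_into_f_f[OF inj] that by simp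
  have "(\<Sum>x\<in>b ` {..<a}. vec_scale (u x) x) = (\<Sum>r<a. vec_scale (u (b r)) (b r))"
    by (rule sum.reindex[OF inj, unfolded o_def])
  also have "\<dots> = (\<Sum>r<a. vec_scale (c r) (b r))" by (rule sum.cong) (use u in auto)
  also have "\<dots> = 0" using c by (simp add: fun_eq_iff sum_fun_apply vec_scale_def)
  finally have s: "(\<Sum>x\<in>b ` {..<a}. vec_scale (u x) x) = 0" .
  have "\<exists>v\<in>b ` {..<a}. u v \<noteq> 0" using u[OF r(1)] r by (intro bexI[of _ "b r"]) auto
  with s have "cvec.dependent (b ` {..<a})"
    using cvec.dependent_finite[of "b ` {..<a}"] by blast
  with ind show False by blast
qed

lemma adapted_frame:
  assumes W: "W \<in> grassmannian m n" and u: "indep_frame k u" and uW: "\<And>r. r < k \<Longrightarrow> u r \<in> W"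
  obtains b where "indep_frame (m + 1) b" "cvec.span (b ` {..<m + 1}) = W" "\<And>r. r < k \<Longrightarrow> b r = u r" "k \<le> m + 1"
proof -
  have sW: "cvec.subspace W" and dW: "cvec.dim W = m + 1" using W by (auto simp: grassmannian_def)
  define S where "S = u ` {..<k}"
  have S: "S \<subseteq> W" "cvec.independent S" using uW indep_frame_independent[OF u] by (auto simp: S_def)
  have cS: "card S = k" using card_image[OF indep_frame_inj[OF u]] by (simp add: S_def)
  obtain B where B: "S \<subseteq> B" "B \<subseteq> W" "cvec.independent B" "W \<subseteq> cvec.span B"
    by (rule cvec.maximal_independent_subset_extend[OF S])
  have cB: "card B = m + 1" using cvec.basis_card_eq_dim[OF B(2,4,3)] dW by simp
  then have fB: "finite B" using card.infinite by fastforce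
  have km: "k \<le> m + 1" using card_mono[OF fB B(1)] cB cS by simp
  have "card (B - S) = m + 1 - k" using card_Diff_subset[of S B] B(1) finite_subset[OF B(1) fB] cS cB by simp
  then obtain g where g: "bij_betw g {..<m + 1 - k} (B - S)"
    using ex_bij_betw_nat_finite[of "B - S"] fB by (auto simp: atLeast0LessThan)
  define b where "b = (\<lambda>r. if r < k then u r else g (r - k))"
  have "b ` {..<m + 1} = u ` {..<k} \<union> g ` {..<m + 1 - k}"
  proof (intro equalityI subsetI)
    fix x assume "x \<in> b ` {..<m + 1}"
    then obtain r where r: "r < m + 1" "x = b r" by auto
    show "x \<in> u ` {..<k} \<union> g ` {..<m + 1 - k}"
    proof (cases "r < k")
      case False
      then have "r - k \<in> {..<m + 1 - k}" using r(1) by auto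
      then show ?thesis using False r(2) by (simp add: b_def)
    qed (use r(2) in \<open>simp add: b_def\<close>)
  next
    fix x assume "x \<in> u ` {..<k} \<union> g ` {..<m + 1 - k}"
    then consider r where "r < k" "x = u r" | r where "r < m + 1 - k" "x = g r" by auto
    then show "x \<in> b ` {..<m + 1}"
    proof cases
      case 1
      then show ?thesis using km by (intro image_eqI[of _ _ r]) (auto simp: b_def)
    next
      case 2
      then show ?thesis using km by (intro image_eqI[of _ _ "k + r"]) (auto simp: b_def)
    qed
  qed
  also have "\<dots> = B" using g B(1) by (auto simp: bij_betw_def S_def)
  finally have bB: "b ` {..<m + 1} = B" .
  have inj: "inj_on b {..<m + 1}" by (rule eq_card_imp_inj_on) (use bB cB in simp_all)
  show thesis
  proof (rule that[of b])
    show "indep_frame (m + 1) b" by (rule indep_frameI[OF inj]) (unfold bB, rule B(3))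
    show "cvec.span (b ` {..<m + 1}) = W"
      unfolding bB using cvec.span_minimal[OF B(2) sW] B(4) by blast
  qed (use km in \<open>auto simp: b_def\<close>)
qed

lemma sum_lessThan_add: "(\<Sum>r<k + l. f r) = (\<Sum>r<k. f r) + (\<Sum>r<l. f (k + r))" for l :: nat
  by (induction l) (auto simp: add.assoc)

lemma indep_frame_0: "indep_frame 0 u"
  by (simp add: indep_frame_def)

lemma frame_combination_in:
  "cvec.subspace W \<Longrightarrow> (\<And>r. r < a \<Longrightarrow> b r \<in> W) \<Longrightarrow> (\<lambda>k. \<Sum>r<a. c r * b r k) \<in> W" for a :: nat
proof -
  assume W: "cvec.subspace W" "\<And>r. r < a \<Longrightarrow> b r \<in> W"
  have "cvec.span (b ` {..<a}) \<subseteq> W" by (rule cvec.span_minimal) (use W in auto)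
  then show ?thesis unfolding span_frame by blast
qed

text \<open>Subtracting a combination of one basis from a combination of the other gives n + 1
  equations in (m1 + 1) + (m2 + 1) unknowns, and independent solutions yield independent common
  vectors. For spaces not forced to meet, the truncated difference is 0.\<close>

lemma intersection_frame:
  assumes W1: "W1 \<in> grassmannian m1 n" and W2: "W2 \<in> grassmannian m2 n"
  obtains u where "indep_frame (m1 + m2 + 1 - n) u" "\<And>r. r < m1 + m2 + 1 - n \<Longrightarrow> u r \<in> W1 \<inter> W2"
proof -
  define a1 where "a1 = m1 + 1"
  define a2 where "a2 = m2 + 1"
  define d where "d = m1 + m2 + 1 - n"
  obtain b1 where b1: "indep_frame a1 b1" "cvec.span (b1 ` {..<a1}) = W1"
    by (rule adapted_frame[OF W1 indep_frame_0, of _]) (auto simp: a1_def)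
  obtain b2 where b2: "indep_frame a2 b2" "cvec.span (b2 ` {..<a2}) = W2"
    by (rule adapted_frame[OF W2 indep_frame_0, of _]) (auto simp: a2_def)
  have sub: "cvec.subspace W1" "cvec.subspace W2" "W1 \<subseteq> coord_space n" "W2 \<subseteq> coord_space n"
    using W1 W2 by (auto simp: grassmannian_def)
  have b1W: "b1 r \<in> W1" if "r < a1" for r using cvec.span_base[of "b1 r" "b1 ` {..<a1}"] b1(2) that by auto
  have b2W: "b2 r \<in> W2" if "r < a2" for r using cvec.span_base[of "b2 r" "b2 ` {..<a2}"] b2(2) that by auto
  define M where "M = (\<lambda>k j. if j < a1 then b1 j k else - b2 (j - a1) k)"
  have d: "d = card {..<a1 + a2} - card {..<n + 1}" by (simp add: d_def a1_def a2_def)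
  obtain w where w: "\<And>i k. i < d \<Longrightarrow> k < n + 1 \<Longrightarrow> (\<Sum>j<a1 + a2. M k j * w i j) = 0"
    and wi: "\<And>c. (\<forall>j<a1 + a2. (\<Sum>i<d. c i * w i j) = 0) \<Longrightarrow> \<forall>i<d. c i = 0"
  proof -
    obtain w where "\<forall>i<d. \<forall>e\<in>{..<n + 1}. (\<Sum>j<a1 + a2. M e j * w i j) = 0"
      "\<forall>c. (\<forall>j\<in>{..<a1 + a2}. (\<Sum>i<d. c i * w i j) = 0) \<longrightarrow> (\<forall>i<d. c i = 0)"
      using kernel_family[of "{..<n + 1}" "{..<a1 + a2}" M] unfolding d[symmetric] by auto
    then show thesis by (intro that[of w]) auto
  qed
  define u where "u = (\<lambda>i k. \<Sum>r<a1. w i r * b1 r k)"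
  define u' where "u' = (\<lambda>i k. \<Sum>r<a2. w i (a1 + r) * b2 r k)"
  have uW: "u i \<in> W1" "u' i \<in> W2" for i
    unfolding u_def u'_def by (rule frame_combination_in; use sub b1W b2W in blast)+
  have eq: "u i = u' i" if "i < d" for i
  proof
    fix k
    show "u i k = u' i k"
    proof (cases "k < n + 1")
      case True
      have "(\<Sum>r<a1. M k r * w i r) = u i k" unfolding u_def by (rule sum.cong) (auto simp: M_def)
      moreover have "(\<Sum>r<a2. M k (a1 + r) * w i (a1 + r)) = - u' i k"
        unfolding u'_def by (simp add: M_def sum_negf mult.commute)
      ultimately show ?thesis using w[OF that True] unfolding sum_lessThan_add by simp
    next
      case False
      moreover have "u i \<in> coord_space n" "u' i \<in> coord_space n" using uW[of i] sub(3,4) by blast+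
      ultimately show ?thesis by (simp add: coord_space_def)
    qed
  qed
  have swap: "(\<Sum>i<d. c i * (\<Sum>r<a. v i r * b r k)) = (\<Sum>r<a. (\<Sum>i<d. c i * v i r) * b r k)"
    for c :: "nat \<Rightarrow> complex" and v :: "nat \<Rightarrow> nat \<Rightarrow> complex" and b :: "nat \<Rightarrow> nat \<Rightarrow> complex" and a k
    unfolding sum_distrib_left sum_distrib_right by (subst sum.swap) (simp add: mult.assoc)
  have "indep_frame d u"
    unfolding indep_frame_def
  proof (rule allI, rule impI)
    fix c assume c: "\<forall>k. (\<Sum>r<d. c r * u r k) = 0"
    have "(\<Sum>i<d. c i * u' i k) = (\<Sum>i<d. c i * u i k)" for k
      by (rule sum.cong) (use eq in auto)
    then have c': "\<forall>k. (\<Sum>i<d. c i * u' i k) = 0" using c by simp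
    have 1: "\<forall>r<a1. (\<Sum>i<d. c i * w i r) = 0"
      using b1(1)[unfolded indep_frame_def, THEN spec[of _ "\<lambda>r. \<Sum>i<d. c i * w i r"]] c
      unfolding u_def swap by blast
    have 2: "\<forall>r<a2. (\<Sum>i<d. c i * w i (a1 + r)) = 0"
      using b2(1)[unfolded indep_frame_def, THEN spec[of _ "\<lambda>r. \<Sum>i<d. c i * w i (a1 + r)"]] c'
      unfolding u'_def swap[where v = "\<lambda>i r. w i (a1 + r)"] by blast
    show "\<forall>r<d. c r = 0"
    proof (rule wi, intro allI impI)
      fix j assume j: "j < a1 + a2"
      show "(\<Sum>i<d. c i * w i j) = 0"
        using 1 2[rule_format, of "j - a1"] j by (cases "j < a1") auto
    qed
  qed
  moreover have "u r \<in> W1 \<inter> W2" if "r < d" for r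
    using uW[of r] eq[OF that] by (metis IntI)
  ultimately show thesis
    unfolding d_def by (rule that[of u])
qed

lemma indep_frame_append:
  assumes u: "indep_frame k u" and u': "indep_frame l u'"
    and P: "cvec.subspace P" "\<And>r. r < k \<Longrightarrow> u r \<in> P" and P': "cvec.subspace P'" "\<And>r. r < l \<Longrightarrow> u' r \<in> P'"
    and 0: "P \<inter> P' \<subseteq> {0}"
  shows "indep_frame (k + l) (\<lambda>r. if r < k then u r else u' (r - k))"
  unfolding indep_frame_def
proof (rule allI, rule impI)
  fix c assume c: "\<forall>j. (\<Sum>r<k + l. c r * (if r < k then u r else u' (r - k)) j) = 0"
  define z where "z = (\<lambda>j. \<Sum>r<k. c r * u r j)"
  define z' where "z' = (\<lambda>j. \<Sum>r<l. (- c (k + r)) * u' r j)"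
  have "z = z'"
  proof
    fix j
    have "(\<Sum>r<k. c r * (if r < k then u r else u' (r - k)) j) = z j" unfolding z_def by (rule sum.cong) auto
    moreover have "(\<Sum>r<l. c (k + r) * (if k + r < k then u (k + r) else u' (k + r - k)) j) = - z' j"
      by (simp add: z'_def sum_negf)
    ultimately show "z j = z' j" using spec[OF c, of j] unfolding sum_lessThan_add by simp
  qed
  moreover have "z \<in> P" unfolding z_def by (rule frame_combination_in[OF P])
  moreover have "z' \<in> P'" unfolding z'_def by (rule frame_combination_in[OF P'])
  ultimately have z0: "z = 0" "z' = 0" using 0 by auto
  have "\<forall>r<k. c r = 0"
    using u[unfolded indep_frame_def, THEN spec[of _ c]] z0(1) unfolding z_def fun_eq_iff by simp
  moreover have "\<forall>r<l. - c (k + r) = 0"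
    using u'[unfolded indep_frame_def, THEN spec[of _ "\<lambda>r. - c (k + r)"]] z0(2) unfolding z'_def fun_eq_iff by simp
  ultimately show "\<forall>r<k + l. c r = 0"
    by (metis add_diff_inverse_nat nat_add_left_cancel_less neg_equal_0_iff_equal)
qed

lemma card_symmetric_pairs_choose: "card {(r, t). r \<le> t \<and> t < k} = (k + 1) choose 2"
proof -
  have "2 * ((k + 1) choose 2) = k * (k + 1)" by (simp add: choose_two)
  then show ?thesis using card_symmetric_pairs[of k] by simp
qed

text \<open>Each pair of basis vectors of a space gives one condition. A pair in \<open>Z i\<close>
  costs nothing, since both vectors lie in one earlier space, on which the form vanishes by
  induction on i.\<close>

lemma config_ideal_dim_ge_frames:
  assumes b: "\<And>i. i \<in> {1..s} \<Longrightarrow> \<Lambda> i \<subseteq> cvec.span (b i ` {..<m i + 1})"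
    and Z: "\<And>i. i \<in> {1..s} \<Longrightarrow> Z i \<subseteq> {(r, t). r \<le> t \<and> t < m i + 1}"
    and skip: "\<And>i r t. i \<in> {1..s} \<Longrightarrow> (r, t) \<in> Z i \<Longrightarrow> \<exists>j. 1 \<le> j \<and> j < i \<and> b i r \<in> \<Lambda> j \<and> b i t \<in> \<Lambda> j"
  shows "((n + 2) choose 2) + (\<Sum>i=1..s. card (Z i)) \<le> config_ideal_dim n s \<Lambda> 2 + (\<Sum>i=1..s. (m i + 2) choose 2)"
proof -
  define T where "T = (\<lambda>i. {(r, t). r \<le> t \<and> t < m i + 1} - Z i)"
  have fT: "finite (T i)" for i unfolding T_def using finite_symmetric_pairs by blast
  define E where "E = Sigma {1..s} T"
  define u where "u = (\<lambda>(i, r, t::nat). b i r)"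
  define v where "v = (\<lambda>(i, r::nat, t). b i t)"
  have "(n + 2) choose 2 \<le> config_ideal_dim n s \<Lambda> 2 + card E"
  proof (rule config_ideal_dim_ge[where u = u and v = v])
    show "finite E" using fT by (auto simp: E_def)
    fix q i w
    assume sym: "\<And>k l. k < n + 1 \<Longrightarrow> l < n + 1 \<Longrightarrow> q k l = q l k" and i: "i \<in> {1..s}" and w: "w \<in> \<Lambda> i"
      and E: "\<And>e. e \<in> E \<Longrightarrow> bil (n + 1) q (u e) (v e) = 0"
    have "\<forall>w\<in>\<Lambda> i. \<forall>w'\<in>\<Lambda> i. bil (n + 1) q w w' = 0" using i
    proof (induction i rule: less_induct)
      case (less i)
      have le: "bil (n + 1) q (b i r) (b i t) = 0" if "r \<le> t" "t < m i + 1" for r t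
      proof (cases "(r, t) \<in> Z i")
        case True
        from skip[OF less.prems True] obtain j where j: "1 \<le> j" "j < i" "b i r \<in> \<Lambda> j" "b i t \<in> \<Lambda> j" by blast
        then show ?thesis using less.IH[of j] less.prems by auto
      next
        case False
        then have "(i, r, t) \<in> E" using that less.prems by (simp add: E_def T_def)
        from E[OF this] show ?thesis by (simp add: u_def v_def)
      qed
      have all: "bil (n + 1) q (b i r) (b i t) = 0" if "r < m i + 1" "t < m i + 1" for r t
      proof (cases "r \<le> t")
        case False
        have "bil (n + 1) q (b i r) (b i t) = bil (n + 1) q (b i t) (b i r)" by (rule bil_swap) (rule sym)
        then show ?thesis using le[of t r] False that by simp
      qed (use le that in blast)
      show ?case
      proof (intro ballI)
        fix w w' assume "w \<in> \<Lambda> i" "w' \<in> \<Lambda> i"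
        then have "w \<in> range (\<lambda>c k. \<Sum>r<m i + 1. c r * b i r k)" "w' \<in> range (\<lambda>c k. \<Sum>r<m i + 1. c r * b i r k)"
          using b[OF less.prems] unfolding span_frame by blast+
        then obtain c c' where w: "w = (\<lambda>k. \<Sum>r<m i + 1. c r * b i r k)" and w': "w' = (\<lambda>k. \<Sum>r<m i + 1. c' r * b i r k)" by blast
        show "bil (n + 1) q w w' = 0"
          unfolding w w' bil_sum_left bil_sum_right using all by (intro sum.neutral ballI) simp
      qed
    qed
    with w show "bil (n + 1) q w w = 0" by blast
  qed
  moreover have "card E + (\<Sum>i=1..s. card (Z i)) = (\<Sum>i=1..s. (m i + 2) choose 2)"
  proof -
    have "card E = (\<Sum>i=1..s. card (T i))" unfolding E_def using fT by (intro card_SigmaI) auto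
    moreover have "card (T i) + card (Z i) = (m i + 2) choose 2" if "i \<in> {1..s}" for i
    proof -
      have "finite (Z i)" using Z[OF that] finite_subset finite_symmetric_pairs by blast
      moreover have "card (Z i) \<le> card {(r, t). r \<le> t \<and> t < m i + 1}"
        by (rule card_mono[OF finite_symmetric_pairs Z[OF that]])
      ultimately show ?thesis
        using card_Diff_subset[OF _ Z[OF that]] card_symmetric_pairs_choose[of "m i + 1"] by (simp add: T_def)
    qed
    ultimately show ?thesis by (simp add: sum.distrib[symmetric])
  qed
  ultimately show ?thesis by linarith
qed

text \<open>For i between 2 and \<tau> the basis of the i-th space starts with k = m 1 + m i + 1 - n
  vectors of its intersection with the first, which saves (k + 1) choose 2 conditions.\<close>

lemma ge_star:
  assumes \<Lambda>: "\<Lambda> \<in> config_space n s m" and \<tau>: "\<tau> \<le> s"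
  shows "((n + 2) choose 2) + (\<Sum>i=2..\<tau>. (m 1 + m i + 2 - n) choose 2)
    \<le> config_ideal_dim n s \<Lambda> 2 + (\<Sum>i=1..s. (m i + 2) choose 2)"
proof -
  have gr: "\<Lambda> i \<in> grassmannian (m i) n" if "i \<in> {1..s}" for i
    using \<Lambda> that by (auto simp: config_space_def PiE_iff)
  define k where "k = (\<lambda>i. if 2 \<le> i \<and> i \<le> \<tau> then m 1 + m i + 1 - n else 0)"
  have "\<exists>b. cvec.span (b ` {..<m i + 1}) = \<Lambda> i \<and> (\<forall>r<k i. b r \<in> \<Lambda> 1) \<and> k i \<le> m i + 1" if i: "i \<in> {1..s}" for i
  proof (cases "2 \<le> i \<and> i \<le> \<tau>")
    case True
    have "1 \<in> {1..s}" using True \<tau> by auto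
    obtain u where u: "indep_frame (k i) u" "\<And>r. r < k i \<Longrightarrow> u r \<in> \<Lambda> 1 \<inter> \<Lambda> i"
      by (rule intersection_frame[OF gr[OF \<open>1 \<in> {1..s}\<close>] gr[OF i]]) (use True in \<open>auto simp: k_def\<close>)
    obtain b where "cvec.span (b ` {..<m i + 1}) = \<Lambda> i" "\<And>r. r < k i \<Longrightarrow> b r = u r" "k i \<le> m i + 1"
      by (rule adapted_frame[OF gr[OF i] u(1)]) (use u(2) in auto)
    then show ?thesis using u(2) by (intro exI[of _ b]) auto
  next
    case False
    obtain b where "cvec.span (b ` {..<m i + 1}) = \<Lambda> i"
      by (rule adapted_frame[OF gr[OF i] indep_frame_0]) auto
    then show ?thesis using False by (intro exI[of _ b]) (auto simp: k_def)
  qed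
  then have "\<exists>b. \<forall>i\<in>{1..s}. cvec.span (b i ` {..<m i + 1}) = \<Lambda> i \<and> (\<forall>r<k i. b i r \<in> \<Lambda> 1) \<and> k i \<le> m i + 1"
    by (intro bchoice ballI)
  then obtain b where b': "\<forall>i\<in>{1..s}. cvec.span (b i ` {..<m i + 1}) = \<Lambda> i \<and> (\<forall>r<k i. b i r \<in> \<Lambda> 1) \<and> k i \<le> m i + 1"
    by (rule exE)
  have b: "cvec.span (b i ` {..<m i + 1}) = \<Lambda> i" "k i \<le> m i + 1" if "i \<in> {1..s}" for i
    using bspec[OF b' that] by simp_all
  have bk: "b i r \<in> \<Lambda> 1" if "i \<in> {1..s}" "r < k i" for i r
    using bspec[OF b' that(1)] that(2) by (elim conjE) simp
  define Z where "Z = (\<lambda>i. {(r, t). r \<le> t \<and> t < k i})"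
  have "((n + 2) choose 2) + (\<Sum>i=1..s. card (Z i)) \<le> config_ideal_dim n s \<Lambda> 2 + (\<Sum>i=1..s. (m i + 2) choose 2)"
  proof (rule config_ideal_dim_ge_frames)
    show "\<Lambda> i \<subseteq> cvec.span (b i ` {..<m i + 1})" if "i \<in> {1..s}" for i using b(1)[OF that] by simp
    show "Z i \<subseteq> {(r, t). r \<le> t \<and> t < m i + 1}" if "i \<in> {1..s}" for i using b(2)[OF that] by (auto simp: Z_def)
    show "\<exists>j. 1 \<le> j \<and> j < i \<and> b i r \<in> \<Lambda> j \<and> b i t \<in> \<Lambda> j" if i: "i \<in> {1..s}" and rt: "(r, t) \<in> Z i" for i r t
    proof (rule exI[of _ 1])
      have "k i > 0" using rt by (auto simp: Z_def)
      then have "1 < i" by (auto simp: k_def split: if_splits)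
      then show "1 \<le> (1::nat) \<and> 1 < i \<and> b i r \<in> \<Lambda> 1 \<and> b i t \<in> \<Lambda> 1" using bk[OF i] rt by (auto simp: Z_def)
    qed
  qed
  moreover have "(\<Sum>i=1..s. card (Z i)) = (\<Sum>i=2..\<tau>. (m 1 + m i + 2 - n) choose 2)"
  proof -
    have "(\<Sum>i=1..s. card (Z i)) = (\<Sum>i=2..\<tau>. card (Z i))"
      by (rule sum.mono_neutral_right) (use \<tau> in \<open>auto simp: Z_def k_def\<close>)
    also have "\<dots> = (\<Sum>i=2..\<tau>. (m 1 + m i + 2 - n) choose 2)"
    proof (rule sum.cong[OF refl])
      fix i assume i: "i \<in> {2..\<tau>}"
      show "card (Z i) = (m 1 + m i + 2 - n) choose 2"
      proof (cases "n \<le> m 1 + m i + 1")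
        case True
        then have "k i + 1 = m 1 + m i + 2 - n" using i by (auto simp: k_def)
        then show ?thesis unfolding Z_def card_symmetric_pairs_choose by simp
      next
        case False
        then have "k i = 0" "m 1 + m i + 2 - n = 0" using i by (auto simp: k_def)
        then show ?thesis by (simp add: Z_def)
      qed
    qed
    finally show ?thesis .
  qed
  ultimately show ?thesis by simp
qed

text \<open>The basis of the third space is adapted to its intersections with the first and with the
  second simultaneously: as no nonzero vector is common to the three spaces, bases of these two
  intersections are independent together.\<close>

lemma ge_triple:
  assumes \<Lambda>: "\<Lambda> \<in> config_space n s m" and s: "3 \<le> s" and 0: "\<Lambda> 1 \<inter> \<Lambda> 2 \<inter> \<Lambda> 3 \<subseteq> {0}"
    and n: "n \<le> m 1 + m 2 + 1" "n \<le> m 1 + m 3 + 1" "n \<le> m 2 + m 3 + 1"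
  shows "((n + 2) choose 2) + (((m 1 + m 2 + 2 - n) choose 2) + ((m 1 + m 3 + 2 - n) choose 2) + ((m 2 + m 3 + 2 - n) choose 2))
    \<le> config_ideal_dim n s \<Lambda> 2 + (\<Sum>i=1..s. (m i + 2) choose 2)"
proof -
  have gr: "\<Lambda> i \<in> grassmannian (m i) n" if "i \<in> {1..s}" for i
    using \<Lambda> that by (auto simp: config_space_def PiE_iff)
  have in123: "1 \<in> {1..s}" "2 \<in> {1..s}" "3 \<in> {1..s}" using s by auto
  have sub: "cvec.subspace (\<Lambda> i)" if "i \<in> {1..s}" for i using gr[OF that] by (simp add: grassmannian_def)
  define k where "k = m 1 + m 2 + 1 - n"
  define l where "l = m 1 + m 3 + 1 - n"
  define h where "h = m 2 + m 3 + 1 - n"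
  obtain u where u: "indep_frame k u" "\<And>r. r < k \<Longrightarrow> u r \<in> \<Lambda> 1 \<inter> \<Lambda> 2"
    by (rule intersection_frame[OF gr[OF in123(1)] gr[OF in123(2)]]) (auto simp: k_def)
  obtain x where x: "indep_frame l x" "\<And>r. r < l \<Longrightarrow> x r \<in> \<Lambda> 1 \<inter> \<Lambda> 3"
    by (rule intersection_frame[OF gr[OF in123(1)] gr[OF in123(3)]]) (auto simp: l_def)
  obtain y where y: "indep_frame h y" "\<And>r. r < h \<Longrightarrow> y r \<in> \<Lambda> 2 \<inter> \<Lambda> 3"
    by (rule intersection_frame[OF gr[OF in123(2)] gr[OF in123(3)]]) (auto simp: h_def)
  define xy where "xy = (\<lambda>r. if r < l then x r else y (r - l))"
  have xyi: "indep_frame (l + h) xy" unfolding xy_def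
  proof (rule indep_frame_append[OF x(1) y(1)])
    show "cvec.subspace (\<Lambda> 1 \<inter> \<Lambda> 3)" "cvec.subspace (\<Lambda> 2 \<inter> \<Lambda> 3)"
      by (intro cvec.subspace_inter sub in123)+
    show "\<Lambda> 1 \<inter> \<Lambda> 3 \<inter> (\<Lambda> 2 \<inter> \<Lambda> 3) \<subseteq> {0}" using 0 by blast
  qed (use x y in blast)+
  have xy3: "xy r \<in> \<Lambda> 3" if "r < l + h" for r
    using x(2)[of r] y(2)[of "r - l"] that by (auto simp: xy_def)
  obtain b2 where b2: "cvec.span (b2 ` {..<m 2 + 1}) = \<Lambda> 2" "\<And>r. r < k \<Longrightarrow> b2 r = u r" "k \<le> m 2 + 1"
    by (rule adapted_frame[OF gr[OF in123(2)] u(1)]) (use u(2) in auto)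
  obtain b3 where b3: "cvec.span (b3 ` {..<m 3 + 1}) = \<Lambda> 3" "\<And>r. r < l + h \<Longrightarrow> b3 r = xy r" "l + h \<le> m 3 + 1"
    by (rule adapted_frame[OF gr[OF in123(3)] xyi]) (use xy3 in auto)
  have "\<exists>b. cvec.span (b ` {..<m i + 1}) = \<Lambda> i" if i: "i \<in> {1..s}" for i
  proof -
    obtain b where "cvec.span (b ` {..<m i + 1}) = \<Lambda> i"
      by (rule adapted_frame[OF gr[OF i] indep_frame_0]) auto
    then show ?thesis by blast
  qed
  then have "\<exists>b. \<forall>i\<in>{1..s}. cvec.span (b i ` {..<m i + 1}) = \<Lambda> i" by (intro bchoice ballI)
  then obtain b0 where b0': "\<forall>i\<in>{1..s}. cvec.span (b0 i ` {..<m i + 1}) = \<Lambda> i" by (rule exE)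
  have b0: "cvec.span (b0 i ` {..<m i + 1}) = \<Lambda> i" if "i \<in> {1..s}" for i by (rule bspec[OF b0' that])
  define b where "b = b0(2 := b2, 3 := b3)"
  define Z3 where "Z3 = {(r, t). r \<le> t \<and> t < l} \<union> (\<lambda>(r, t). (l + r, l + t)) ` {(r, t). r \<le> t \<and> t < h}"
  define Z where "Z = (\<lambda>i::nat. if i = 2 then {(r, t). r \<le> t \<and> t < k} else if i = 3 then Z3 else {})"
  have "((n + 2) choose 2) + (\<Sum>i=1..s. card (Z i)) \<le> config_ideal_dim n s \<Lambda> 2 + (\<Sum>i=1..s. (m i + 2) choose 2)"
  proof (rule config_ideal_dim_ge_frames)
    show "\<Lambda> i \<subseteq> cvec.span (b i ` {..<m i + 1})" if "i \<in> {1..s}" for i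
      using b0[OF that] b2(1) b3(1) by (auto simp: b_def)
    show "Z i \<subseteq> {(r, t). r \<le> t \<and> t < m i + 1}" if "i \<in> {1..s}" for i
      using b2(3) b3(3) by (auto simp: Z_def Z3_def)
    show "\<exists>j. 1 \<le> j \<and> j < i \<and> b i r \<in> \<Lambda> j \<and> b i t \<in> \<Lambda> j" if i: "i \<in> {1..s}" and rt: "(r, t) \<in> Z i" for i r t
    proof -
      consider "i = 2" "r \<le> t" "t < k" | "i = 3" "r \<le> t" "t < l" | r' t' where "i = 3" "r = l + r'" "t = l + t'" "r' \<le> t'" "t' < h"
        using rt by (auto simp: Z_def Z3_def split: if_splits)
      then show ?thesis
      proof cases
        case 1
        then show ?thesis using b2(2)[of r] b2(2)[of t] u(2)[of r] u(2)[of t]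
          by (intro exI[of _ 1]) (auto simp: b_def)
      next
        case 2
        then show ?thesis using b3(2)[of r] b3(2)[of t] x(2)[of r] x(2)[of t]
          by (intro exI[of _ 1]) (auto simp: b_def xy_def)
      next
        case 3
        then show ?thesis using b3(2)[of r] b3(2)[of t] y(2)[of r'] y(2)[of t']
          by (intro exI[of _ 2]) (auto simp: b_def xy_def)
      qed
    qed
  qed
  moreover have "(\<Sum>i=1..s. card (Z i)) = ((m 1 + m 2 + 2 - n) choose 2) + ((m 1 + m 3 + 2 - n) choose 2) + ((m 2 + m 3 + 2 - n) choose 2)"
  proof -
    have "(\<Sum>i=1..s. card (Z i)) = (\<Sum>i\<in>{2, 3}. card (Z i))"
      by (rule sum.mono_neutral_right) (use s in \<open>auto simp: Z_def\<close>)
    moreover have "card Z3 = card {(r, t). r \<le> t \<and> t < l} + card ((\<lambda>(r, t). (l + r, l + t)) ` {(r, t). r \<le> t \<and> t < h})"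
      unfolding Z3_def by (rule card_Un_disjoint) (use finite_symmetric_pairs in auto)
    moreover have "card ((\<lambda>(r, t). (l + r, l + t)) ` {(r, t). r \<le> t \<and> t < h}) = card {(r, t). r \<le> t \<and> t < h}"
      by (rule card_image) (auto simp: inj_on_def)
    ultimately have "(\<Sum>i=1..s. card (Z i)) = ((k + 1) choose 2) + ((l + 1) choose 2) + ((h + 1) choose 2)"
      by (simp add: Z_def card_symmetric_pairs_choose)
    moreover have "k + 1 = m 1 + m 2 + 2 - n" "l + 1 = m 1 + m 3 + 2 - n" "h + 1 = m 2 + m 3 + 2 - n"
      using n by (auto simp: k_def l_def h_def)
    ultimately show ?thesis by simp
  qed
  ultimately show ?thesis by simp
qed

subsection \<open>Generic upper bounds\<close>

lemma nullity_le_kernel: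
  assumes "nullity_le E J M d"
    and "\<And>v. (\<And>e. e \<in> E' \<Longrightarrow> (\<Sum>j\<in>J. M' e j * v j) = 0) \<Longrightarrow> (\<And>e. e \<in> E \<Longrightarrow> (\<Sum>j\<in>J. M e j * v j) = 0)"
  shows "nullity_le E' J M' d"
proof -
  obtain l :: "nat \<Rightarrow> 'b \<Rightarrow> complex" where l: "\<And>v. \<lbrakk>\<forall>e\<in>E. (\<Sum>j\<in>J. M e j * v j) = 0; \<forall>i<d. (\<Sum>j\<in>J. l i j * v j) = 0\<rbrakk>
      \<Longrightarrow> \<forall>j\<in>J. v j = 0" using assms(1) by (auto simp: nullity_le_def)
  show ?thesis
    unfolding nullity_le_def
  proof (intro exI[of _ l] allI impI)
    fix v assume v: "\<forall>e\<in>E'. (\<Sum>j\<in>J. M' e j * v j) = 0" "\<forall>i<d. (\<Sum>j\<in>J. l i j * v j) = 0"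
    have "\<forall>e\<in>E. (\<Sum>j\<in>J. M e j * v j) = 0"
    proof
      fix e assume "e \<in> E"
      show "(\<Sum>j\<in>J. M e j * v j) = 0" by (rule assms(2)[OF _ \<open>e \<in> E\<close>]) (use v(1) in blast)
    qed
    then show "\<forall>j\<in>J. v j = 0" using v(2) by (rule l)
  qed
qed

lemma quad_nullity_span:
  assumes le: "nullity_le (quad_rows N I a) ({..<N} \<times> {..<N}) (quad_coeff x) D"
    and x: "\<And>i r. i \<in> I \<Longrightarrow> r < a i \<Longrightarrow> x i r \<in> cvec.span (y i ` {..<a i})"
  shows "nullity_le (quad_rows N I a) ({..<N} \<times> {..<N}) (quad_coeff y) D"
proof (rule nullity_le_kernel[OF le])
  fix v e
  assume v: "\<And>e. e \<in> quad_rows N I a \<Longrightarrow> (\<Sum>j\<in>{..<N} \<times> {..<N}. quad_coeff y e j * v j) = 0" and e: "e \<in> quad_rows N I a"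
  have y: "quadric N I a y (\<lambda>k l. v (k, l))" unfolding quad_system_iff[symmetric] using v by blast
  have "quadric N I a x (\<lambda>k l. v (k, l))"
    unfolding quadric_def
  proof (intro conjI ballI allI impI)
    fix i r t assume i: "i \<in> I" and rt: "r < a i" "t < a i"
    have "x i r \<in> range (\<lambda>c k. \<Sum>r<a i. c r * y i r k)" "x i t \<in> range (\<lambda>c k. \<Sum>r<a i. c r * y i r k)"
      using x[OF i] rt unfolding span_frame by blast+
    then obtain c c' where c: "x i r = (\<lambda>k. \<Sum>r<a i. c r * y i r k)" and c': "x i t = (\<lambda>k. \<Sum>r<a i. c' r * y i r k)" by blast
    show "bil N (\<lambda>k l. v (k, l)) (x i r) (x i t) = 0"
      unfolding c c' bil_sum_left bil_sum_right
      using y i by (intro sum.neutral ballI) (simp add: quadric_def)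
  qed (use y in \<open>auto simp: quadric_def\<close>)
  then show "(\<Sum>j\<in>{..<N} \<times> {..<N}. quad_coeff x e j * v j) = 0"
    unfolding quad_system_iff[symmetric] using e by blast
qed

text \<open>Evaluation of a form at D points gives D functionals. If the spaces and the points
  together lie on no quadric, these functionals witness nullity at most D for the spaces
  alone.\<close>

lemma quad_nullity_points:
  assumes nq: "no_quadric N {1..s + D} (\<lambda>i. if i \<le> s then a i else 1) x"
  shows "nullity_le (quad_rows N {1..s} a) ({..<N} \<times> {..<N}) (quad_coeff x) D"
  unfolding nullity_le_def
proof (intro exI[of _ "\<lambda>i j. x (s + 1 + i) 0 (fst j) * x (s + 1 + i) 0 (snd j)"] allI impI ballI)
  fix v j
  assume v: "\<forall>e\<in>quad_rows N {1..s} a. (\<Sum>j\<in>{..<N} \<times> {..<N}. quad_coeff x e j * v j) = 0"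
    and p: "\<forall>i<D. (\<Sum>j\<in>{..<N} \<times> {..<N}. x (s + 1 + i) 0 (fst j) * x (s + 1 + i) 0 (snd j) * v j) = 0"
    and j: "j \<in> {..<N} \<times> {..<N}"
  have y: "quadric N {1..s} a x (\<lambda>k l. v (k, l))" using v unfolding quad_system_iff .
  have "quadric N {1..s + D} (\<lambda>i. if i \<le> s then a i else 1) x (\<lambda>k l. v (k, l))"
    unfolding quadric_def
  proof (intro conjI ballI allI impI)
    fix i r t assume i: "i \<in> {1..s + D}" and rt: "r < (if i \<le> s then a i else 1)" "t < (if i \<le> s then a i else 1)"
    show "bil N (\<lambda>k l. v (k, l)) (x i r) (x i t) = 0"
    proof (cases "i \<le> s")
      case True
      then show ?thesis using y i rt by (simp add: quadric_def)
    next
      case False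
      then have "i - (s + 1) < D" "i = s + 1 + (i - (s + 1))" "r = 0" "t = 0" using i rt by auto
      then have "(\<Sum>j\<in>{..<N} \<times> {..<N}. x i 0 (fst j) * x i 0 (snd j) * v j) = 0" using p by metis
      then have "bil N (\<lambda>k l. v (k, l)) (x i 0) (x i 0) = 0"
        unfolding bil_def by (simp add: sum.cartesian_product split_def ac_simps)
      then show ?thesis using \<open>r = 0\<close> \<open>t = 0\<close> by simp
    qed
  qed (use y in \<open>auto simp: quadric_def\<close>)
  then have "\<forall>k<N. \<forall>l<N. v (k, l) = 0" using nq by (auto simp: no_quadric_def)
  then show "v j = 0" using j by (cases j) auto
qed

lemma line_open_quad_nullity:
  "finite I \<Longrightarrow> line_open (\<lambda>x. nullity_le (quad_rows N I a) ({..<N} \<times> {..<N}) (quad_coeff x) D)"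
proof -
  assume fI: "finite I"
  have "\<forall>e\<in>quad_rows N I a. \<exists>d. \<forall>j. multihom I d (\<lambda>x. quad_coeff x e j)"
    by (intro ballI multihom_quad_coeff)
  from bchoice[OF this] obtain d where d: "\<forall>e\<in>quad_rows N I a. \<forall>j. multihom I (d e) (\<lambda>x. quad_coeff x e j)" ..
  show ?thesis
  proof (rule line_open_nullity_le[where d = "\<lambda>e j. d e" and I = I])
    show "finite (quad_rows N I a)" using fI by (rule finite_quad_rows)
    show "multihom I (d e) (\<lambda>x. quad_coeff x e j)" if "e \<in> quad_rows N I a" for e j
      using d that by blast
  qed simp
qed

text \<open>The vectors of three frames, placed in the first, the second, and both copies of a doubled space.
  They are independent if and only if the frames are and the three spans have no common vector.\<close>

definition doubled :: "complex frame \<Rightarrow> nat \<times> nat \<Rightarrow> bool \<times> nat \<Rightarrow> complex" where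
  "doubled x e j = (if fst e = 1 \<and> fst j \<or> fst e = 2 \<and> \<not> fst j then 0 else x (fst e) (snd e) (snd j))"

lemma doubled_nullity_span:
  assumes le: "nullity_le (vec_rows a I) (UNIV \<times> {..<N}) (doubled x) D"
    and x: "\<And>i r. i \<in> I \<Longrightarrow> r < a i \<Longrightarrow> x i r \<in> cvec.span (y i ` {..<a i})"
  shows "nullity_le (vec_rows a I) (UNIV \<times> {..<N}) (doubled y) D"
proof (rule nullity_le_kernel[OF le])
  fix v e
  assume v: "\<And>e. e \<in> vec_rows a I \<Longrightarrow> (\<Sum>j\<in>UNIV \<times> {..<N}. doubled y e j * v j) = 0" and e: "e \<in> vec_rows a I"
  obtain i r where ir: "e = (i, r)" "i \<in> I" "r < a i" using e by (auto simp: vec_rows_def)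
  have "x i r \<in> range (\<lambda>c k. \<Sum>r<a i. c r * y i r k)" using x[OF ir(2,3)] unfolding span_frame .
  then obtain c where c: "x i r = (\<lambda>k. \<Sum>r<a i. c r * y i r k)" by blast
  have "doubled x (i, r) j = (\<Sum>t<a i. c t * doubled y (i, t) j)" for j
    unfolding doubled_def fst_conv snd_conv c
    by (cases "i = 1 \<and> fst j \<or> i = 2 \<and> \<not> fst j") (simp_all only: if_True if_False mult_zero_right sum.neutral_const)
  then have "(\<Sum>j\<in>UNIV \<times> {..<N}. doubled x e j * v j) = (\<Sum>j\<in>UNIV \<times> {..<N}. \<Sum>t<a i. c t * (doubled y (i, t) j * v j))"
    unfolding ir(1) by (simp only: sum_distrib_right mult.assoc)
  also have "\<dots> = (\<Sum>t<a i. c t * (\<Sum>j\<in>UNIV \<times> {..<N}. doubled y (i, t) j * v j))"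
    by (subst sum.swap) (simp only: sum_distrib_left)
  also have "\<dots> = 0"
    by (rule sum.neutral) (use v ir in \<open>auto simp: vec_rows_def\<close>)
  finally show "(\<Sum>j\<in>UNIV \<times> {..<N}. doubled x e j * v j) = 0" .
qed

lemma multihom_doubled: "fst e \<in> I \<Longrightarrow> multihom I (\<lambda>j. if j = fst e then 1 else 0) (\<lambda>x. doubled x e j)"
  unfolding doubled_def by (cases "fst e = 1 \<and> fst j \<or> fst e = 2 \<and> \<not> fst j") (simp_all only: if_True if_False multihom.zero multihom.coord)

lemma line_open_doubled:
  "finite I \<Longrightarrow> line_open (\<lambda>x. nullity_le (vec_rows a I) (UNIV \<times> {..<N}) (doubled x) D)"
proof (rule line_open_nullity_le[where d = "\<lambda>e j i. if i = fst e then 1 else 0" and I = I])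
  assume "finite I"
  then show "finite (vec_rows a I)" by (auto simp: vec_rows_def)
  show "multihom I (\<lambda>i. if i = fst e then 1 else 0) (\<lambda>x. doubled x e j)" if "e \<in> vec_rows a I" for e j
    by (rule multihom_doubled) (use that in \<open>auto simp: vec_rows_def\<close>)
qed simp

lemma sum_bool_times: "(\<Sum>j\<in>UNIV \<times> {..<N::nat}. f j) = (\<Sum>k<N. f (False, k)) + (\<Sum>k<N. f (True, k))"
proof -
  have "UNIV \<times> {..<N} = Pair False ` {..<N} \<union> Pair True ` {..<N}" by (auto simp: UNIV_bool)
  then have "(\<Sum>j\<in>UNIV \<times> {..<N}. f j) = (\<Sum>j\<in>Pair False ` {..<N}. f j) + (\<Sum>j\<in>Pair True ` {..<N}. f j)"
    by (simp only:) (rule sum.union_disjoint, auto)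
  then show ?thesis by (simp add: sum.reindex inj_on_def)
qed

lemma sum_unit: "k < N \<Longrightarrow> (\<Sum>j<N. unit k j * v j) = v k" for v :: "nat \<Rightarrow> complex"
  by (simp add: unit_def if_distrib[of "\<lambda>c. c * _"] cong: if_cong)

text \<open>All three spaces are spanned by coordinate vectors. The first omits the first N - a 1
  coordinates, the second omits the next N - a 2, and the third lies in the first a 3, each of which
  is by \<open>tot\<close> omitted by one of the other two. The remaining functionals are
  coordinates of one of the two copies.\<close>

lemma ex_doubled_nullity:
  assumes a: "a 1 \<le> N" "a 2 \<le> N" "N \<le> a 1 + a 2" "N \<le> a 1 + a 3" and tot: "a 1 + a 2 + a 3 \<le> 2 * N"
  shows "\<exists>x. nullity_le (vec_rows a {1, 2, 3}) (UNIV \<times> {..<N}) (doubled x) (2 * N - (a 1 + a 2 + a 3))"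
proof -
  define p where "p = (\<lambda>r. if r < N - a 1 then r else r + (N - a 2))"
  define x :: "complex frame" where "x = (\<lambda>i r. if i = 1 then unit (N - a 1 + r) else if i = 2 then unit (p r) else unit r)"
  have "nullity_le (vec_rows a {1, 2, 3}) (UNIV \<times> {..<N}) (doubled x) (2 * N - (a 1 + a 2 + a 3))"
  proof (rule nullity_leI_finite[of "{a 3..<2 * N - (a 1 + a 2)}" _ _ _ _ "\<lambda>k j. if fst j then unit k (snd j) else 0"])
    show "finite {a 3..<2 * N - (a 1 + a 2)}" "card {a 3..<2 * N - (a 1 + a 2)} = 2 * N - (a 1 + a 2 + a 3)" by simp_all
    fix v :: "bool \<times> nat \<Rightarrow> complex"
    assume v: "\<And>e. e \<in> vec_rows a {1, 2, 3} \<Longrightarrow> (\<Sum>j\<in>UNIV \<times> {..<N}. doubled x e j * v j) = 0"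
      and v': "\<And>f. f \<in> {a 3..<2 * N - (a 1 + a 2)} \<Longrightarrow> (\<Sum>j\<in>UNIV \<times> {..<N}. (if fst j then unit f (snd j) else 0) * v j) = 0"
    have 1: "v (False, N - a 1 + r) = 0" if "r < a 1" for r
      using v[of "(1, r)"] that a(1) by (simp add: vec_rows_def sum_bool_times doubled_def x_def sum_unit)
    have 2: "v (True, p r) = 0" if "r < a 2" for r
    proof -
      have "p r < N" using that a by (auto simp: p_def)
      then show ?thesis
        using v[of "(2, r)"] that by (simp add: vec_rows_def sum_bool_times doubled_def x_def sum_unit)
    qed
    have 3: "v (False, r) + v (True, r) = 0" if "r < a 3" "r < N" for r
      using v[of "(3, r)"] that by (simp add: vec_rows_def sum_bool_times doubled_def x_def sum_unit)
    have 4: "v (True, k) = 0" if "a 3 \<le> k" "k < 2 * N - (a 1 + a 2)" for k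
      using v'[of k] that a by (simp add: sum_bool_times sum_unit)
    note r1 = 1 and r2 = 2 and r3 = 3 and r4 = 4
    have T: "v (True, k) = 0" if k: "k < N" for k
    proof -
      consider "k < N - a 1" | "2 * N - (a 1 + a 2) \<le> k" | "a 3 \<le> k" "k < 2 * N - (a 1 + a 2)"
        | "N - a 1 \<le> k" "k < a 3" by linarith
      then show ?thesis
      proof cases
        case 1
        then show ?thesis using r2[of k] a by (simp add: p_def)
      next
        case 2
        then have "\<not> k - (N - a 2) < N - a 1" "k - (N - a 2) + (N - a 2) = k" and lt: "k - (N - a 2) < a 2" using a k by linarith+
        then have "p (k - (N - a 2)) = k" unfolding p_def by (simp only: if_False)
        then show ?thesis using r2[OF lt] by simp
      next
        case 3
        then show ?thesis by (rule r4)
      next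
        case 4
        then show ?thesis using r1[of "k - (N - a 1)"] r3[of k] k by simp
      qed
    qed
    have F: "v (False, k) = 0" if k: "k < N" for k
    proof (cases "k < N - a 1")
      case True
      then show ?thesis using 3[of k] T[OF k] a k by simp
    next
      case False
      then show ?thesis using 1[of "k - (N - a 1)"] k by simp
    qed
    show "\<forall>j\<in>UNIV \<times> {..<N}. v j = 0"
    proof
      fix j assume "j \<in> (UNIV :: bool set) \<times> {..<N}"
      then show "v j = 0" using T F by (cases j; cases "fst j") auto
    qed
  qed
  then show ?thesis by blast
qed

text \<open>The doubled vectors and the functionals add up to the dimension of the doubled space, so
  the doubled vectors are independent. A vector common to the three spans is a relation of the kind
  excluded here.\<close>

lemma doubled_independent:
  assumes le: "nullity_le (vec_rows a {1, 2, 3}) (UNIV \<times> {..<N}) (doubled x) (2 * N - (a 1 + a 2 + a 3))"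
    and tot: "a 1 + a 2 + a 3 \<le> 2 * N"
    and 1: "\<And>k. k < N \<Longrightarrow> (\<Sum>r<a 1. c 1 r * x 1 r k) + (\<Sum>r<a 3. c 3 r * x 3 r k) = 0"
    and 2: "\<And>k. k < N \<Longrightarrow> (\<Sum>r<a 2. c 2 r * x 2 r k) + (\<Sum>r<a 3. c 3 r * x 3 r k) = 0"
    and ir: "i \<in> {1, 2, 3}" "r < a i"
  shows "c i r = 0"
proof -
  have S: "(\<Sum>e\<in>vec_rows a {1, 2, 3}. f e) = (\<Sum>r<a 1. f (1, r)) + (\<Sum>r<a 2. f (2, r)) + (\<Sum>r<a 3. f (3, r))"
    for f :: "nat \<times> nat \<Rightarrow> 'z::comm_monoid_add"
  proof -
    have "vec_rows a {1, 2, 3} = (Pair 1 ` {..<a 1} \<union> Pair 2 ` {..<a 2}) \<union> Pair 3 ` {..<a 3}"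
      by (auto simp: vec_rows_def)
    then have "(\<Sum>e\<in>vec_rows a {1, 2, 3}. f e) = (\<Sum>e\<in>Pair 1 ` {..<a 1} \<union> Pair 2 ` {..<a 2}. f e) + (\<Sum>e\<in>Pair 3 ` {..<a 3}. f e)"
      by (simp only:) (rule sum.union_disjoint, auto)
    also have "(\<Sum>e\<in>Pair 1 ` {..<a 1} \<union> Pair 2 ` {..<a 2}. f e) = (\<Sum>e\<in>Pair 1 ` {..<a 1}. f e) + (\<Sum>e\<in>Pair 2 ` {..<a 2}. f e)"
      by (rule sum.union_disjoint) auto
    finally show ?thesis by (simp add: sum.reindex inj_on_def)
  qed
  have "(\<lambda>e. c (fst e) (snd e)) (i, r) = 0"
  proof (rule rows_independent[OF _ _ le])
    show "finite (vec_rows a {1, 2, 3})" by (auto simp: vec_rows_def)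
    have "card (vec_rows a {1, 2, 3}) = a 1 + a 2 + a 3" unfolding card_eq_sum S by simp
    moreover have "card ((UNIV :: bool set) \<times> {..<N}) = 2 * N" by (simp add: card_cartesian_product)
    ultimately show "card (vec_rows a {1, 2, 3}) + (2 * N - (a 1 + a 2 + a 3)) = card ((UNIV :: bool set) \<times> {..<N})"
      using tot by simp
    show "(\<Sum>e\<in>vec_rows a {1, 2, 3}. c (fst e) (snd e) * doubled x e j) = 0" if j: "j \<in> UNIV \<times> {..<N}" for j
    proof (cases "fst j")
      case True
      then show ?thesis using 2[of "snd j"] j unfolding S by (auto simp: doubled_def)
    next
      case False
      then show ?thesis using 1[of "snd j"] j unfolding S by (auto simp: doubled_def)
    qed
  qed (use ir in \<open>auto simp: vec_rows_def\<close>)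
  then show ?thesis by simp
qed

lemma ex_indep_frame_nullity: "a i \<le> N \<Longrightarrow> \<exists>x. nullity_le (vec_rows a {i}) {..<N} (\<lambda>(i, r). x i r) (N - a i)"
proof -
  assume a: "a i \<le> N"
  have "nullity_le (vec_rows a {i}) {..<N} (\<lambda>(i, r). (\<lambda>i. unit) i r) (N - a i)"
  proof (rule nullity_leI_finite[of "{a i..<N}" _ _ _ _ unit])
    fix v :: "nat \<Rightarrow> complex" assume v: "\<And>e. e \<in> vec_rows a {i} \<Longrightarrow> (\<Sum>k<N. (case e of (i, r) \<Rightarrow> unit r) k * v k) = 0"
      and v': "\<And>f. f \<in> {a i..<N} \<Longrightarrow> (\<Sum>k<N. unit f k * v k) = 0"
    show "\<forall>k\<in>{..<N}. v k = 0"
    proof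
      fix k assume "k \<in> {..<N}"
      then show "v k = 0" using v[of "(i, k)"] v'[of k] sum_unit[of k N v] by (cases "k < a i") (auto simp: vec_rows_def)
    qed
  qed simp_all
  then show ?thesis by (rule exI[of _ "\<lambda>i. unit"])
qed

lemma indep_frame_of_nullity:
  assumes le: "nullity_le (vec_rows a {i}) {..<N} (\<lambda>(i, r). x i r) (N - a i)" and a: "a i \<le> N"
    and 0: "\<And>k. k < N \<Longrightarrow> (\<Sum>r<a i. c r * x i r k) = 0" and r: "r < a i"
  shows "c r = 0"
proof -
  have v: "vec_rows a {i} = Pair i ` {..<a i}" by (auto simp: vec_rows_def)
  have "(\<lambda>e. c (snd e)) (i, r) = 0"
  proof (rule rows_independent[OF _ _ le])
    show "finite (vec_rows a {i})" by (simp add: v)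
    show "card (vec_rows a {i}) + (N - a i) = card {..<N}" using a unfolding v by (simp add: card_image inj_on_def)
    show "(\<Sum>e\<in>vec_rows a {i}. c (snd e) * (case e of (i, r) \<Rightarrow> x i r) j) = 0" if "j \<in> {..<N}" for j
      using 0[of j] that unfolding v by (simp add: sum.reindex inj_on_def)
  qed (use r in \<open>auto simp: v\<close>)
  then show ?thesis by simp
qed

subsection \<open>Generic configurations with few quadrics\<close>

text \<open>Three line-open conditions are met by one frame: few quadrics (\<open>P\<close>), no
  common vector (\<open>T\<close>), and independence (\<open>V\<close>), which makes the spans a
  configuration of the right dimensions. \<open>P\<close> and \<open>T\<close> pass to any frame
  with the same spans and are given by nonvanishing polynomials, so together they are the Q of
  \<open>generic_configI\<close>.\<close>

lemma generic_config_dim_le: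
  fixes n s :: nat and m :: "nat \<Rightarrow> nat"
  assumes m: "\<And>i. i \<in> {1..s} \<Longrightarrow> m i < n"
    and nq: "\<exists>x. no_quadric (n + 1) {1..s + D} (\<lambda>i. if i \<le> s then m i + 1 else 1) x"
    and I: "I \<subseteq> {1..s}" and tr: "\<exists>x. nullity_le (vec_rows (\<lambda>i. m i + 1) I) (UNIV \<times> {..<n + 1}) (doubled x) d"
    and R: "\<And>\<Lambda> y. \<Lambda> \<in> config_space n s m \<Longrightarrow> (\<And>i r. i \<in> {1..s} \<Longrightarrow> r < m i + 1 \<Longrightarrow> y i r \<in> \<Lambda> i) \<Longrightarrow>
      nullity_le (vec_rows (\<lambda>i. m i + 1) I) (UNIV \<times> {..<n + 1}) (doubled y) d \<Longrightarrow> config_ideal_dim n s \<Lambda> 2 \<le> D \<Longrightarrow> R \<Lambda>"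
  shows "generic_config n s m R"
proof -
  define N where "N = n + 1"
  define a where "a = (\<lambda>i. m i + 1)"
  define P where "P = (\<lambda>x. nullity_le (quad_rows N {1..s} a) ({..<N} \<times> {..<N}) (quad_coeff x) D)"
  define T where "T = (\<lambda>x. nullity_le (vec_rows a I) (UNIV \<times> {..<N}) (doubled x) d)"
  define V where "V = (\<lambda>x. \<forall>i\<in>{1..s}. nullity_le (vec_rows a {i}) {..<N} (\<lambda>(i, r). x i r) (N - a i))"
  have fI: "finite I" using I finite_subset by blast
  have aN: "a i \<le> N" if "i \<in> {1..s}" for i using m[OF that] by (simp add: a_def N_def)
  have loP: "line_open P" unfolding P_def by (rule line_open_quad_nullity) simp
  have loT: "line_open T" unfolding T_def by (rule line_open_doubled[OF fI])
  have loV: "line_open V" unfolding V_def by (rule line_open_ball) (simp, rule line_open_vec_rows, simp)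
  obtain x1 where x1: "P x1"
    using nq quad_nullity_points[of N s D a] unfolding P_def N_def a_def by blast
  obtain x2 where x2: "T x2" using tr unfolding T_def N_def a_def by blast
  have "\<exists>x. V x" unfolding V_def
  proof (rule line_open_ex_ball)
    show "line_open (\<lambda>x. nullity_le (vec_rows a {i}) {..<N} (\<lambda>(i, r). x i r) (N - a i))" for i by (rule line_open_vec_rows) simp
    show "\<exists>x. nullity_le (vec_rows a {i}) {..<N} (\<lambda>(i, r). x i r) (N - a i)" if "i \<in> {1..s}" for i
      by (rule ex_indep_frame_nullity) (rule aN[OF that])
  qed simp
  then obtain x3 where x3: "V x3" by blast
  obtain x4 where x4: "P x4 \<and> T x4" using line_open_ex_conj[where P = P and Q = T, OF loP loT x1 x2] by blast
  obtain z where z: "(P z \<and> T z) \<and> V z"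
    using line_open_ex_conj[where P = "\<lambda>x. P x \<and> T x" and Q = V, OF line_open_conj[OF loP loT] loV x4 x3] by blast
  define x where "x = (\<lambda>i r k. if k < N then z i r k else 0)"
  have cP: "quad_coeff x e j = quad_coeff z e j" if "j \<in> {..<N} \<times> {..<N}" for e j
    using that by (auto simp: quad_coeff_def x_def split: sum.split)
  have Px: "P x" unfolding P_def
  proof (rule nullity_le_kernel)
    show "nullity_le (quad_rows N {1..s} a) ({..<N} \<times> {..<N}) (quad_coeff z) D" using z by (simp add: P_def)
    fix v e assume v: "\<And>e. e \<in> quad_rows N {1..s} a \<Longrightarrow> (\<Sum>j\<in>{..<N} \<times> {..<N}. quad_coeff x e j * v j) = 0" and e: "e \<in> quad_rows N {1..s} a"
    have "(\<Sum>j\<in>{..<N} \<times> {..<N}. quad_coeff z e j * v j) = (\<Sum>j\<in>{..<N} \<times> {..<N}. quad_coeff x e j * v j)"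
      by (rule sum.cong[OF refl]) (simp only: cP)
    then show "(\<Sum>j\<in>{..<N} \<times> {..<N}. quad_coeff z e j * v j) = 0" using v[OF e] by simp
  qed
  have cT: "doubled x e j = doubled z e j" if "j \<in> UNIV \<times> {..<N}" for e j
    using that by (auto simp: doubled_def x_def)
  have Tx: "T x" unfolding T_def
  proof (rule nullity_le_kernel)
    show "nullity_le (vec_rows a I) (UNIV \<times> {..<N}) (doubled z) d" using z by (simp add: T_def)
    fix v e assume v: "\<And>e. e \<in> vec_rows a I \<Longrightarrow> (\<Sum>j\<in>UNIV \<times> {..<N}. doubled x e j * v j) = 0" and e: "e \<in> vec_rows a I"
    have "(\<Sum>j\<in>UNIV \<times> {..<N}. doubled z e j * v j) = (\<Sum>j\<in>UNIV \<times> {..<N}. doubled x e j * v j)"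
      by (rule sum.cong[OF refl]) (simp only: cT)
    then show "(\<Sum>j\<in>UNIV \<times> {..<N}. doubled z e j * v j) = 0" using v[OF e] by simp
  qed
  show ?thesis
  proof (rule generic_configI[where x = x and Q = "\<lambda>y. P y \<and> T y"])
    show "x i r k = 0" if "n < k" for i r k using that by (simp add: x_def N_def)
    show "indep_frame (m i + 1) (x i)" if i: "i \<in> {1..s}" for i
      unfolding indep_frame_def
    proof (intro allI impI)
      fix c r assume c: "\<forall>k. (\<Sum>r<m i + 1. c r * x i r k) = 0" and r: "r < m i + 1"
      show "c r = 0"
      proof (rule indep_frame_of_nullity[of a i N z])
        show "nullity_le (vec_rows a {i}) {..<N} (\<lambda>(i, r). z i r) (N - a i)" using z i by (simp add: V_def)
        show "(\<Sum>r<a i. c r * z i r k) = 0" if "k < N" for k using spec[OF c, of k] that by (simp add: a_def x_def)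
      qed (use aN[OF i] r in \<open>auto simp: a_def\<close>)
    qed
    fix y assume sp: "\<And>i. i \<in> {1..s} \<Longrightarrow> cvec.span (y i ` {..<m i + 1}) = cvec.span (x i ` {..<m i + 1})"
    have xy: "x i r \<in> cvec.span (y i ` {..<a i})" if "i \<in> {1..s}" "r < a i" for i r
      unfolding a_def sp[OF that(1)] by (rule cvec.span_base) (use that in \<open>auto simp: a_def\<close>)
    show "P y \<and> T y"
    proof
      show "P y" unfolding P_def by (rule quad_nullity_span[OF Px[unfolded P_def]]) (rule xy)
      show "T y" unfolding T_def by (rule doubled_nullity_span[OF Tx[unfolded T_def]]) (use xy I in blast)
    qed
  next
    fix y assume y: "P y \<and> T y"
    show "\<exists>d P'. multihom {1..s} d P' \<and> P' y \<noteq> 0 \<and> (\<forall>y'. P' y' \<noteq> 0 \<longrightarrow> P y' \<and> T y')"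
    proof (rule multihom_conj)
      show "\<exists>d P'. multihom {1..s} d P' \<and> P' y \<noteq> 0 \<and> (\<forall>y'. P' y' \<noteq> 0 \<longrightarrow> P y')"
        unfolding P_def
        by (rule multihom_nullity_le[OF _ _ multihom_quad_coeff]) (use y in \<open>auto simp: P_def finite_quad_rows\<close>)
      show "\<exists>d P'. multihom {1..s} d P' \<and> P' y \<noteq> 0 \<and> (\<forall>y'. P' y' \<noteq> 0 \<longrightarrow> T y')"
        unfolding T_def
      proof (rule multihom_nullity_le)
        show "\<exists>d. \<forall>j. multihom {1..s} d (\<lambda>x. doubled x e j)" if "e \<in> vec_rows a I" for e
          by (intro exI allI, rule multihom_doubled) (use that I in \<open>auto simp: vec_rows_def\<close>)
      qed (use y fI in \<open>auto simp: T_def vec_rows_def\<close>)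
    qed
  next
    fix \<Lambda> y assume \<Lambda>: "\<Lambda> \<in> config_space n s m" and y: "\<And>i r. i \<in> {1..s} \<Longrightarrow> r < m i + 1 \<Longrightarrow> y i r \<in> \<Lambda> i" and Q: "P y \<and> T y"
    show "R \<Lambda>"
    proof (rule R[OF \<Lambda> y])
      show "nullity_le (vec_rows (\<lambda>i. m i + 1) I) (UNIV \<times> {..<n + 1}) (doubled y) d"
        using Q by (simp add: T_def a_def N_def)
      have "cvec.subspace (\<Lambda> i)" if "i \<in> {1..s}" for i
        using \<Lambda> that by (auto simp: config_space_def PiE_iff grassmannian_def)
      then show "config_ideal_dim n s \<Lambda> 2 \<le> D"
        using Q y by (intro config_ideal_dim_le[where y = y and a = a]) (simp_all add: P_def a_def N_def)
    qed
  qed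
qed

text \<open>The condition on common vectors is made vacuous by allowing as many functionals as there
  are unknowns.\<close>

lemma generic_config_dim_le_simple:
  fixes n s :: nat and m :: "nat \<Rightarrow> nat"
  assumes m: "\<And>i. i \<in> {1..s} \<Longrightarrow> m i < n"
    and nq: "\<exists>x. no_quadric (n + 1) {1..s + D} (\<lambda>i. if i \<le> s then m i + 1 else 1) x"
    and R: "\<And>\<Lambda>. \<Lambda> \<in> config_space n s m \<Longrightarrow> config_ideal_dim n s \<Lambda> 2 \<le> D \<Longrightarrow> R \<Lambda>"
  shows "generic_config n s m R"
proof (rule generic_config_dim_le[OF m nq, of "{}" "card ((UNIV :: bool set) \<times> {..<n + 1})"])
  show "\<exists>x. nullity_le (vec_rows (\<lambda>i. m i + 1) {}) (UNIV \<times> {..<n + 1}) (doubled x) (card ((UNIV :: bool set) \<times> {..<n + 1}))"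
    by (intro exI nullity_le_card) simp
qed (use R in auto)

text \<open>Independence of the doubled vectors of the first three spaces shows both that their
  frames are bases and that the three have no nonzero vector in common.\<close>

lemma generic_config_dim_le_triple:
  fixes n s :: nat and m :: "nat \<Rightarrow> nat"
  assumes m: "\<And>i. i \<in> {1..s} \<Longrightarrow> m i < n" and s: "3 \<le> s"
    and nq: "\<exists>x. no_quadric (n + 1) {1..s + D} (\<lambda>i. if i \<le> s then m i + 1 else 1) x"
    and tot: "m 1 + m 2 + m 3 + 3 \<le> 2 * (n + 1)" and n: "n \<le> m 1 + m 2 + 1" "n \<le> m 1 + m 3 + 1"
    and R: "\<And>\<Lambda>. \<Lambda> \<in> config_space n s m \<Longrightarrow> \<Lambda> 1 \<inter> \<Lambda> 2 \<inter> \<Lambda> 3 \<subseteq> {0} \<Longrightarrow> config_ideal_dim n s \<Lambda> 2 \<le> D \<Longrightarrow> R \<Lambda>"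
  shows "generic_config n s m R"
proof -
  define a where "a = (\<lambda>i. m i + 1)"
  have in123: "i \<in> {1..s}" if "i \<in> {1, 2, 3}" for i using that s by auto
  have atot: "a 1 + a 2 + a 3 \<le> 2 * (n + 1)" using tot by (simp add: a_def)
  show ?thesis
  proof (rule generic_config_dim_le[OF m nq, of "{1, 2, 3}" "2 * (n + 1) - (a 1 + a 2 + a 3)"])
    show "{1, 2, 3} \<subseteq> {1..s}" using s by auto
    show "\<exists>x. nullity_le (vec_rows (\<lambda>i. m i + 1) {1, 2, 3}) (UNIV \<times> {..<n + 1}) (doubled x) (2 * (n + 1) - (a 1 + a 2 + a 3))"
      unfolding a_def[symmetric]
      by (rule ex_doubled_nullity) (use m[of 1] m[of 2] s n tot in \<open>auto simp: a_def\<close>)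
    fix \<Lambda> y assume \<Lambda>: "\<Lambda> \<in> config_space n s m" and y: "\<And>i r. i \<in> {1..s} \<Longrightarrow> r < m i + 1 \<Longrightarrow> y i r \<in> \<Lambda> i"
      and le: "nullity_le (vec_rows (\<lambda>i. m i + 1) {1, 2, 3}) (UNIV \<times> {..<n + 1}) (doubled y) (2 * (n + 1) - (a 1 + a 2 + a 3))"
      and dim: "config_ideal_dim n s \<Lambda> 2 \<le> D"
    note ind = doubled_independent[of a "n + 1" y, OF le[folded a_def] atot]
    have sp: "\<exists>c. w = (\<lambda>k. \<Sum>r<a i. c r * y i r k)" if i: "i \<in> {1, 2, 3}" and w: "w \<in> \<Lambda> i" for i w
    proof -
      have gr: "\<Lambda> i \<in> grassmannian (m i) n" using \<Lambda> in123[OF i] by (auto simp: config_space_def PiE_iff)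
      have "indep_frame (a i) (y i)" unfolding indep_frame_def
      proof (intro allI impI)
        fix c r assume c: "\<forall>k. (\<Sum>r<a i. c r * y i r k) = 0" and r: "r < a i"
        define c' where "c' = (\<lambda>j r. if j = i then c r else 0)"
        have c'0: "(\<Sum>r<a j. c' j r * y j r k) = 0" for j k using c by (cases "j = i") (auto simp: c'_def)
        have "c' i r = 0" by (rule ind) (use c'0 i r in auto)
        then show "c r = 0" by (simp add: c'_def)
      qed
      then obtain b where b: "cvec.span (b ` {..<m i + 1}) = \<Lambda> i" "\<And>r. r < a i \<Longrightarrow> b r = y i r"
        by (rule adapted_frame[OF gr]) (use y[OF in123[OF i]] in \<open>auto simp: a_def\<close>)
      have "b ` {..<a i} = y i ` {..<a i}" by (rule image_cong) (use b(2) in auto)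
      then have "w \<in> cvec.span (y i ` {..<a i})" using b(1) w by (simp add: a_def)
      then show ?thesis unfolding span_frame by blast
    qed
    have "\<Lambda> 1 \<inter> \<Lambda> 2 \<inter> \<Lambda> 3 \<subseteq> {0}"
    proof
      fix w assume w: "w \<in> \<Lambda> 1 \<inter> \<Lambda> 2 \<inter> \<Lambda> 3"
      obtain c1 where c1: "w = (\<lambda>k. \<Sum>r<a 1. c1 r * y 1 r k)" using sp[of 1 w] w by blast
      obtain c2 where c2: "w = (\<lambda>k. \<Sum>r<a 2. c2 r * y 2 r k)" using sp[of 2 w] w by blast
      obtain c3 where c3: "w = (\<lambda>k. \<Sum>r<a 3. c3 r * y 3 r k)" using sp[of 3 w] w by blast
      define c where "c = (\<lambda>i::nat. if i = 1 then c1 else if i = 2 then c2 else (\<lambda>r. - c3 r))"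
      have s1: "(\<Sum>r<a 1. c 1 r * y 1 r k) = w k" for k using fun_cong[OF c1, of k] by (simp add: c_def)
      have s2: "(\<Sum>r<a 2. c 2 r * y 2 r k) = w k" for k using fun_cong[OF c2, of k] by (simp add: c_def)
      have s3: "(\<Sum>r<a 3. c 3 r * y 3 r k) = - w k" for k using fun_cong[OF c3, of k] by (simp add: c_def sum_negf)
      have "c 1 r = 0" if "r < a 1" for r
        by (rule ind) (use s1 s2 s3 that in auto)
      then have "w k = 0" for k unfolding s1[symmetric] by simp
      then show "w \<in> {0}" by (simp add: fun_eq_iff)
    qed
    then show "R \<Lambda>" using \<Lambda> dim R by blast
  qed
qed

subsection \<open>The numerical cases\<close>

lemma sum_with_points:
  "(\<Sum>i\<in>{1..s + D}. f (if i \<le> s then a i else 1)) = (\<Sum>i=1..s. f (a i)) + D * f (1::nat)" for f :: "nat \<Rightarrow> nat"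
proof -
  have "{1..s + D} = {1..s} \<union> {s + 1..s + D}" by auto
  then have "(\<Sum>i\<in>{1..s + D}. f (if i \<le> s then a i else 1))
      = (\<Sum>i=1..s. f (if i \<le> s then a i else 1)) + (\<Sum>i=s + 1..s + D. f (if i \<le> s then a i else 1))"
    by (simp only:) (rule sum.union_disjoint, auto)
  also have "(\<Sum>i=1..s. f (if i \<le> s then a i else 1)) = (\<Sum>i=1..s. f (a i))" by (rule sum.cong) auto
  also have "(\<Sum>i=s + 1..s + D. f (if i \<le> s then a i else 1)) = (\<Sum>i=s + 1..s + D. f 1)" by (rule sum.cong) auto
  finally show ?thesis by simp
qed

lemma ex_no_quadric_points:
  assumes b: "\<And>i. i \<in> {1..s} \<Longrightarrow> b i \<le> M" and pairs: "\<And>i j. i \<in> {1..s} \<Longrightarrow> j \<in> {1..s} \<Longrightarrow> i < j \<Longrightarrow> b i + b j \<le> M"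
    and pts: "0 < D \<Longrightarrow> 2 \<le> M \<and> (\<forall>i\<in>{1..s}. b i + 1 \<le> M)"
    and tot: "M * (M + 1) \<le> (\<Sum>i=1..s. b i * (b i + 1)) + 2 * D"
  shows "\<exists>x. no_quadric M {1..s + D} (\<lambda>i. if i \<le> s then b i else 1) x"
proof (rule ex_no_quadric)
  fix i assume i: "i \<in> {1..s + D}"
  show "(if i \<le> s then b i else 1) \<le> M"
  proof (cases "i \<le> s")
    case False
    then show ?thesis using pts i by auto
  qed (use b i in auto)
next
  fix i j assume ij: "i \<in> {1..s + D}" "j \<in> {1..s + D}" "i \<noteq> j"
  show "(if i \<le> s then b i else 1) + (if j \<le> s then b j else 1) \<le> M"
  proof (cases "i \<le> s \<and> j \<le> s")
    case True
    then show ?thesis using pairs[of i j] pairs[of j i] ij by (cases "i < j") auto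
  next
    case False
    then have "0 < D" using ij by auto
    from pts[OF this] show ?thesis using False ij by auto
  qed
next
  show "M * (M + 1) \<le> (\<Sum>i\<in>{1..s + D}. (if i \<le> s then b i else 1) * ((if i \<le> s then b i else 1) + 1))"
    using tot sum_with_points[of "\<lambda>k. k * (k + 1)" s b D] by simp
qed simp

lemma ex_no_quadric_star_points:
  assumes \<tau>: "2 \<le> \<tau>" "\<tau> \<le> s" and N: "N = M + w + e"
    and b: "\<exists>x. no_quadric M {1..s + D} (\<lambda>i. if i \<le> s then b i else 1) x"
    and w: "w \<le> (\<Sum>i=2..\<tau>. c i)" and a1: "b 1 + w \<le> a 1" and ai: "\<And>i. 2 \<le> i \<Longrightarrow> i \<le> \<tau> \<Longrightarrow> b i + c i + e \<le> a i"
    and rest: "\<And>i. i \<in> {\<tau> + 1..s} \<Longrightarrow> b i \<le> a i"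
    and s1: "\<And>i. 2 \<le> i \<Longrightarrow> i \<le> \<tau> \<Longrightarrow> M \<le> b 1 + b i" and s2: "0 < e \<Longrightarrow> 3 \<le> \<tau> \<and> M \<le> b 2 + b 3"
  shows "\<exists>x. no_quadric N {1..s + D} (\<lambda>i. if i \<le> s then a i else 1) x"
proof (rule ex_no_quadric_star[where \<tau> = \<tau> and M = M and w = w and e = e and c = c, OF _ \<tau>(1) _ N b])
  show "(if i \<le> s then b i else 1) \<le> (if i \<le> s then a i else 1)" if "i \<in> {1..s + D} - {1..\<tau>}" for i
    using rest[of i] that by (cases "i \<le> s") auto
qed (use \<tau> w a1 ai s1 s2 in auto)

lemma sum_split_first:
  fixes f :: "nat \<Rightarrow> nat"
  assumes "1 \<le> \<tau>" "\<tau> \<le> s"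
  shows "(\<Sum>i=1..s. f i) = f 1 + (\<Sum>i=2..\<tau>. f i) + (\<Sum>i=\<tau> + 1..s. f i)"
proof -
  have "{1..s} = ({1} \<union> {2..\<tau>}) \<union> {\<tau> + 1..s}" using assms by auto
  then have "(\<Sum>i=1..s. f i) = (\<Sum>i\<in>{1} \<union> {2..\<tau>}. f i) + (\<Sum>i=\<tau> + 1..s. f i)"
    by (simp only:) (rule sum.union_disjoint, use assms in auto)
  also have "(\<Sum>i\<in>{1} \<union> {2..\<tau>}. f i) = (\<Sum>i\<in>{1}. f i) + (\<Sum>i=2..\<tau>. f i)"
    by (rule sum.union_disjoint) auto
  finally show ?thesis by simp
qed

section \<open>The ranges of v, in vector dimensions\<close>

text \<open>To be used with \<open>N = n + 1\<close> and \<open>a i = m i + 1\<close>.\<close>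

locale weights =
  fixes N s :: nat and a :: "nat \<Rightarrow> nat"
  assumes s2: "2 \<le> s" and pos: "\<And>i. i \<in> {1..s} \<Longrightarrow> 1 \<le> a i" and less: "\<And>i. i \<in> {1..s} \<Longrightarrow> a i < N"
    and mono: "\<And>i j. i \<in> {1..s} \<Longrightarrow> j \<in> {1..s} \<Longrightarrow> i \<le> j \<Longrightarrow> a j \<le> a i"
begin

lemma ex_disjoint:
  assumes 12: "a 1 + a 2 \<le> N" and tot: "N * (N + 1) \<le> (\<Sum>i=1..s. a i * (a i + 1)) + 2 * D"
  shows "\<exists>x. no_quadric N {1..s + D} (\<lambda>i. if i \<le> s then a i else 1) x"
proof (rule ex_no_quadric_points)
  fix i j assume ij: "i \<in> {1..s}" "j \<in> {1..s}" "i < j"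
  then have "a i \<le> a 1" "a j \<le> a 2" using mono[of 1 i] mono[of 2 j] s2 by auto
  then show "a i + a j \<le> N" using 12 by linarith
next
  have "1 \<le> a 1" "a 1 < N" using pos[of 1] less[of 1] s2 by auto
  then show "2 \<le> N \<and> (\<forall>i\<in>{1..s}. a i + 1 \<le> N)" using less by (auto simp: Suc_le_eq)
qed (use less tot in \<open>auto simp: less_imp_le\<close>)

end

text \<open>g is the codimension of the first space and \<open>k i\<close> the dimension in which
  the i-th is expected to meet it; spaces beyond \<tau> are not expected to meet it. v is the total
  dimension that these intersections claim inside the first space.\<close>

locale star_weights = weights +
  fixes \<tau> g v :: nat and k :: "nat \<Rightarrow> nat"
  assumes \<tau>: "2 \<le> \<tau>" "\<tau> \<le> s" and g: "a 1 + g = N" and k: "\<And>i. i \<in> {2..\<tau>} \<Longrightarrow> a i = g + k i"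
    and k_pos: "\<And>i. i \<in> {2..\<tau>} \<Longrightarrow> 1 \<le> k i"
    and beyond: "\<And>i. i \<in> {\<tau> + 1..s} \<Longrightarrow> a i \<le> g" and v: "v = (\<Sum>i=2..\<tau>. k i)"
begin

lemma g_pos: "1 \<le> g"
  using less[of 1] g s2 by simp

text \<open>The intersections fill the first space, so no general part remains: M = 0, and the g
  coordinates outside the first space go into the common intersection of the spaces 2 to \<tau>. For
  \<tau> = 2 the only intersection would be too small, since k 2 = a 2 - g < a 1.\<close>

lemma ex_star_full:
  assumes big: "a 1 \<le> v"
  shows "\<exists>x. no_quadric N {1..s + 0} (\<lambda>i. if i \<le> s then a i else 1) x"
proof (rule ex_no_quadric_star_points[where \<tau> = \<tau> and M = 0 and b = "\<lambda>_. 0" and w = "a 1" and e = g and c = k])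
  have "\<tau> \<noteq> 2"
  proof
    assume "\<tau> = 2"
    then have "v = k 2" by (simp add: v)
    moreover have "a 2 = g + k 2" using k \<tau> by simp
    moreover have "a 2 \<le> a 1" using mono s2 by simp
    ultimately show False using big g_pos by linarith
  qed
  then show "3 \<le> \<tau> \<and> (0::nat) \<le> 0 + 0" using \<tau> by simp
  show "\<exists>x. no_quadric 0 {1..s + 0} (\<lambda>i. if i \<le> s then 0 else 1) x" by (simp add: no_quadric_def)
qed (use \<tau> g k big v in auto)

text \<open>Splitting off v coordinates leaves dimension p + g, a first space of dimension p = a 1 -
  v and spaces of dimension g for i up to \<tau>. Two of the latter must fit, which is
  \<open>g \<le> p\<close>; the count carries over by cancellation of all terms with v and
  \<open>k i\<close>.\<close>

lemma ex_star:
  assumes small: "v + g \<le> a 1"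
    and tot: "N * (N + 1) + (\<Sum>i=2..\<tau>. k i * (k i + 1)) \<le> (\<Sum>i=1..s. a i * (a i + 1)) + 2 * D"
  shows "\<exists>x. no_quadric N {1..s + D} (\<lambda>i. if i \<le> s then a i else 1) x"
proof -
  define p where "p = a 1 - v"
  have a1: "a 1 = p + v" and pg: "g \<le> p" using small by (auto simp: p_def)
  define b where "b = (\<lambda>i. if i = 1 then p else if i \<le> \<tau> then g else a i)"
  have bg: "b i \<le> g" if "i \<in> {2..s}" for i using that beyond[of i] by (auto simp: b_def)
  have "\<exists>x. no_quadric (p + g) {1..s + D} (\<lambda>i. if i \<le> s then b i else 1) x"
  proof (rule ex_no_quadric_points)
    show "b i \<le> p + g" if "i \<in> {1..s}" for i using that bg[of i] by (cases "i = 1") (auto simp: b_def)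
    show "b i + b j \<le> p + g" if "i \<in> {1..s}" "j \<in> {1..s}" "i < j" for i j
      using that bg[of i] bg[of j] pg by (cases "i = 1") (auto simp: b_def)
    have "b i + 1 \<le> p + g" if "i \<in> {1..s}" for i
      using that bg[of i] pg g_pos by (cases "i = 1") (auto simp: b_def)
    then show "2 \<le> p + g \<and> (\<forall>i\<in>{1..s}. b i + 1 \<le> p + g)" using pg g_pos by auto
    define G where "G = (\<Sum>i=2..\<tau>. g * (g + 1))"
    define K where "K = (\<Sum>i=2..\<tau>. k i * (k i + 1))"
    define S where "S = (\<Sum>i=\<tau> + 1..s. a i * (a i + 1))"
    have "(\<Sum>i=2..\<tau>. a i * (a i + 1)) = (\<Sum>i=2..\<tau>. g * (g + 1) + 2 * g * k i + k i * (k i + 1))"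
      by (rule sum.cong[OF refl]) (simp add: k algebra_simps)
    also have "\<dots> = G + 2 * g * v + K"
      by (simp add: G_def K_def v sum.distrib sum_distrib_left)
    finally have "(\<Sum>i=1..s. a i * (a i + 1)) = (p + v) * (p + v + 1) + (G + 2 * g * v + K) + S"
      using sum_split_first[of \<tau> s "\<lambda>i. a i * (a i + 1)"] \<tau> a1 by (simp add: S_def)
    with tot have "(p + v + g) * (p + v + g + 1) + K \<le> (p + v) * (p + v + 1) + (G + 2 * g * v + K) + S + 2 * D"
      using g a1 by (simp add: K_def)
    then have "(p + g) * (p + g + 1) \<le> p * (p + 1) + G + S + 2 * D" by (simp add: algebra_simps)
    moreover have "(\<Sum>i=2..\<tau>. b i * (b i + 1)) = G"
      unfolding G_def by (rule sum.cong) (auto simp: b_def)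
    moreover have "(\<Sum>i=\<tau> + 1..s. b i * (b i + 1)) = S"
      unfolding S_def by (rule sum.cong) (use \<tau> in \<open>auto simp: b_def\<close>)
    moreover have "b 1 * (b 1 + 1) = p * (p + 1)" by (simp add: b_def)
    ultimately show "(p + g) * (p + g + 1) \<le> (\<Sum>i=1..s. b i * (b i + 1)) + 2 * D"
      using sum_split_first[of \<tau> s "\<lambda>i. b i * (b i + 1)"] \<tau> by simp
  qed
  then show ?thesis
    by (rule ex_no_quadric_star_points[where w = v and e = 0 and c = k and \<tau> = \<tau>, rotated 3])
      (use \<tau> g a1 v k in \<open>auto simp: b_def\<close>)
qed

text \<open>Now only c < g is left of the first space, and two spaces of dimension g do not fit into
  c + g. Therefore g - c further coordinates are put into the common intersection of the spaces 2 to
  \<tau>; what remains is \<tau> spaces of dimension c in dimension 2c.\<close>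

lemma ex_star_middle:
  assumes c: "a 1 = c + v" "1 \<le> c" "c < g" and \<tau>3: "3 \<le> \<tau>"
    and b: "\<And>i. i \<in> {1..\<tau>} \<Longrightarrow> b i = c" "\<And>i. i \<in> {\<tau> + 1..s} \<Longrightarrow> b i \<le> c \<and> b i \<le> a i"
    and tot: "2 * c * (2 * c + 1) \<le> (\<Sum>i=1..s. b i * (b i + 1)) + 2 * D"
  shows "\<exists>x. no_quadric N {1..s + D} (\<lambda>i. if i \<le> s then a i else 1) x"
proof -
  have bc: "b i \<le> c" if "i \<in> {1..s}" for i using b[of i] that by (cases "i \<le> \<tau>") auto
  have "\<exists>x. no_quadric (2 * c) {1..s + D} (\<lambda>i. if i \<le> s then b i else 1) x"
  proof (rule ex_no_quadric_points)
    show "b i \<le> 2 * c" if "i \<in> {1..s}" for i using bc[OF that] by simp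
    show "b i + b j \<le> 2 * c" if "i \<in> {1..s}" "j \<in> {1..s}" for i j using bc[OF that(1)] bc[OF that(2)] by simp
    have "b i + 1 \<le> 2 * c" if "i \<in> {1..s}" for i using bc[OF that] c(2) by simp
    then show "2 \<le> 2 * c \<and> (\<forall>i\<in>{1..s}. b i + 1 \<le> 2 * c)" using c(2) by auto
  qed (rule tot)
  then show ?thesis
  proof (rule ex_no_quadric_star_points[where w = v and e = "g - c" and c = k and \<tau> = \<tau>, rotated 3])
    show "N = 2 * c + v + (g - c)" using g c by simp
    show "b 1 + v \<le> a 1" using b(1)[of 1] c \<tau>3 by simp
    show "b i + k i + (g - c) \<le> a i" if "2 \<le> i" "i \<le> \<tau>" for i using b(1)[of i] k[of i] c that by simp
    show "2 * c \<le> b 1 + b i" if "2 \<le> i" "i \<le> \<tau>" for i using b(1)[of 1] b(1)[of i] that by simp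
    show "3 \<le> \<tau> \<and> 2 * c \<le> b 2 + b 3" using b(1)[of 2] b(1)[of 3] \<tau>3 by simp
  qed (use \<tau> v b(2) in auto)
qed

text \<open>Four spaces of dimension c suffice in dimension 2c, because 4c(c + 1) \<ge> 2c(2c +
  1).\<close>

lemma ex_star_four:
  assumes c: "a 1 = c + v" "1 \<le> c" "c < g" and \<tau>4: "4 \<le> \<tau>"
  shows "\<exists>x. no_quadric N {1..s + 0} (\<lambda>i. if i \<le> s then a i else 1) x"
proof (rule ex_star_middle[OF c, where b = "\<lambda>i. if i \<le> \<tau> then c else 0"])
  have "(\<Sum>i=1..4::nat. c * (c + 1)) \<le> (\<Sum>i=1..\<tau>. c * (c + 1))"
    by (rule sum_mono2) (use \<tau>4 in auto)
  also have "\<dots> = (\<Sum>i=1..\<tau>. (if i \<le> \<tau> then c else 0) * ((if i \<le> \<tau> then c else 0) + 1))"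
    by (rule sum.cong) auto
  also have "\<dots> \<le> (\<Sum>i=1..s. (if i \<le> \<tau> then c else 0) * ((if i \<le> \<tau> then c else 0) + 1))"
    by (rule sum_mono2) (use \<tau> in auto)
  finally show "2 * c * (2 * c + 1) \<le> (\<Sum>i=1..s. (if i \<le> \<tau> then c else 0) * ((if i \<le> \<tau> then c else 0) + 1)) + 2 * 0"
    by (simp add: algebra_simps)
qed (use \<tau>4 in auto)

text \<open>The fourth space, cut down to dimension c, completes the first three to four halves of
  dimension 2c.\<close>

lemma ex_star_three_big:
  assumes c: "a 1 = c + v" "1 \<le> c" "c < g" and \<tau>3: "\<tau> = 3" and s4: "4 \<le> s" "c \<le> a 4"
  shows "\<exists>x. no_quadric N {1..s + 0} (\<lambda>i. if i \<le> s then a i else 1) x"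
proof (rule ex_star_middle[OF c, where b = "\<lambda>i. if i \<le> 4 then c else 0"])
  have "(\<Sum>i=1..4::nat. c * (c + 1)) = (\<Sum>i=1..4::nat. (if i \<le> 4 then c else 0) * ((if i \<le> 4 then c else 0) + 1))"
    by (rule sum.cong) auto
  also have "\<dots> \<le> (\<Sum>i=1..s. (if i \<le> 4 then c else 0) * ((if i \<le> 4 then c else 0) + 1))"
    by (rule sum_mono2) (use s4 in auto)
  finally show "2 * c * (2 * c + 1) \<le> (\<Sum>i=1..s. (if i \<le> 4 then c else 0) * ((if i \<le> 4 then c else 0) + 1)) + 2 * 0"
    by (simp add: algebra_simps)
  show "(if i \<le> 4 then c else 0) \<le> c \<and> (if i \<le> 4 then c else 0) \<le> a i" if "i \<in> {\<tau> + 1..s}" for i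
  proof (cases "i \<le> 4")
    case True
    then have "i = 4" using that \<tau>3 by simp
    then show ?thesis using s4 by simp
  qed simp
qed (use \<tau>3 in auto)

text \<open>h = g - c equals a 2 + a 3 - N, the expected dimension of the intersection of the spaces
  2 and 3. So the correction in \<open>tot\<close> accounts for all three pairwise
  intersections.\<close>

lemma ex_star_three_small:
  assumes c: "a 1 = c + v" "1 \<le> c" "g = c + h" "1 \<le> h" and \<tau>3: "\<tau> = 3" and s4: "4 \<le> s \<Longrightarrow> a 4 \<le> c"
    and tot: "N * (N + 1) + (k 2 * (k 2 + 1) + k 3 * (k 3 + 1) + h * (h + 1)) \<le> (\<Sum>i=1..s. a i * (a i + 1)) + 2 * D"
  shows "\<exists>x. no_quadric N {1..s + D} (\<lambda>i. if i \<le> s then a i else 1) x"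
proof (rule ex_star_middle[OF c(1,2) _ _, where b = "\<lambda>i. if i \<le> 3 then c else a i"])
  define S where "S = (\<Sum>i=\<tau> + 1..s. a i * (a i + 1))"
  have e23: "{2..3} = {2, 3::nat}" by auto
  have vk: "v = k 2 + k 3" unfolding v \<tau>3 e23 by simp
  have a23: "a 2 = g + k 2" "a 3 = g + k 3" using k \<tau>3 by auto
  have "(\<Sum>i=1..s. a i * (a i + 1)) = a 1 * (a 1 + 1) + (a 2 * (a 2 + 1) + a 3 * (a 3 + 1)) + S"
    using sum_split_first[of \<tau> s "\<lambda>i. a i * (a i + 1)"] \<tau> unfolding S_def \<tau>3 e23 by simp
  with tot have "2 * c * (2 * c + 1) \<le> 3 * (c * (c + 1)) + S + 2 * D"
    unfolding g[symmetric] a23 c(1) vk c(3) by (simp add: algebra_simps)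
  moreover have "(\<Sum>i=1..s. (if i \<le> 3 then c else a i) * ((if i \<le> 3 then c else a i) + 1)) = c * (c + 1) + (c * (c + 1) + c * (c + 1)) + S"
    using sum_split_first[of \<tau> s "\<lambda>i. (if i \<le> 3 then c else a i) * ((if i \<le> 3 then c else a i) + 1)"] \<tau> unfolding S_def \<tau>3 e23 by simp
  ultimately show "2 * c * (2 * c + 1) \<le> (\<Sum>i=1..s. (if i \<le> 3 then c else a i) * ((if i \<le> 3 then c else a i) + 1)) + 2 * D" by simp
  show "(if i \<le> 3 then c else a i) \<le> c \<and> (if i \<le> 3 then c else a i) \<le> a i" if i: "i \<in> {\<tau> + 1..s}" for i
    using mono[of 4 i] i \<tau>3 s4 by auto
qed (use \<tau>3 c in auto)

end

lemma two_choose: "2 * ((k + 1) choose 2) = k * (k + 1)"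
  by (simp add: choose_two)

lemma dim_eq_max:
  assumes "F = int X - int Y + int Z" "X + Z \<le> d + Y" "d \<le> nat F"
  shows "int d = max F 0"
  using assms by linarith

section \<open>The theorem, by ranges of v\<close>

theorem theorem4p3:
  fixes n s :: nat and m :: "nat \<Rightarrow> nat"
  assumes "n \<ge> 1" and "s \<ge> 2"
    and "\<forall>i\<in>{1..s}. m i < n"
    and "\<forall>i\<in>{1..s}. \<forall>j\<in>{1..s}. i \<le> j \<longrightarrow> m j \<le> m i"
  shows "generic_config n s m (\<lambda>\<Lambda>.
    (m 1 + m 2 < n \<longrightarrow>
       int (config_ideal_dim n s \<Lambda> 2) =
         max (int ((n + 2) choose 2) - (\<Sum>i=1..s. int ((m i + 2) choose 2))) 0) \<and>
    (m 1 + m 2 \<ge> n \<longrightarrow>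
      (let \<tau> = Max {i \<in> {1..s}. m 1 + m i \<ge> n};
           v = (\<Sum>i=2..\<tau>. int (m 1) + int (m i) - int n + 1)
       in
        (v \<ge> int (m 1) + 1 \<longrightarrow> config_ideal_dim n s \<Lambda> 2 = 0) \<and>
        (2 * int (m 1) - int n + 2 \<le> v \<and> v \<le> int (m 1) \<longrightarrow>
          (\<tau> \<ge> 4 \<longrightarrow> config_ideal_dim n s \<Lambda> 2 = 0) \<and>
          (\<tau> = 3 \<and> s \<ge> 4 \<and> 2 * n \<le> (\<Sum>i=1..4. m i) + 2 \<longrightarrow>
             config_ideal_dim n s \<Lambda> 2 = 0) \<and>
          ((\<tau> = 3 \<and> s \<ge> 4 \<and> 2 * n \<ge> (\<Sum>i=1..4. m i) + 2) \<or> (\<tau> = 3 \<and> s = 3) \<longrightarrow>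
             int (config_ideal_dim n s \<Lambda> 2) =
               max (int ((n + 2) choose 2) - (\<Sum>i=1..s. int ((m i + 2) choose 2))
                    + (\<Sum>(i, j) \<in> {(i, j). 1 \<le> i \<and> i < j \<and> j \<le> 3}.
                         int ((m i + m j + 2 - n) choose 2))) 0)) \<and>
        (v \<le> 2 * int (m 1) - int n + 1 \<longrightarrow>
           int (config_ideal_dim n s \<Lambda> 2) =
             max (int ((n + 2) choose 2) - (\<Sum>i=1..s. int ((m i + 2) choose 2))
                  + (\<Sum>i=2..\<tau>. int ((m 1 + m i + 2 - n) choose 2))) 0))))"
  (is "generic_config n s m ?P")
proof -
  have m_less: "m i < n" if "i \<in> {1..s}" for i using assms(3) that by blast
  have m_mono: "m j \<le> m i" if "i \<in> {1..s}" "j \<in> {1..s}" "i \<le> j" for i j using assms(4) that by blast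
  have in12: "1 \<in> {1..s}" "2 \<in> {1..s}" using assms(2) by auto
  define N where "N = n + 1"
  define a where "a = (\<lambda>i. m i + 1)"
  define X where "X = (n + 2) choose 2"
  define Y where "Y = (\<Sum>i=1..s. (m i + 2) choose 2)"
  interpret weights N s a
    by unfold_locales (use assms(2) m_less m_mono in \<open>auto simp: a_def N_def\<close>)
  have X2: "2 * X = N * (N + 1)" using two_choose[of "n + 1"] by (simp add: X_def N_def)
  have Y2: "2 * Y = (\<Sum>i=1..s. a i * (a i + 1))"
    unfolding Y_def sum_distrib_left
  proof (rule sum.cong[OF refl])
    fix i
    show "2 * ((m i + 2) choose 2) = a i * (a i + 1)" using two_choose[of "m i + 1"] by (simp add: a_def)
  qed
  have Y_int: "(\<Sum>i=1..s. int ((m i + 2) choose 2)) = int Y" by (simp add: Y_def)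
  have nq_cong: "(\<lambda>i. if i \<le> s then m i + 1 else 1) = (\<lambda>i. if i \<le> s then a i else 1)" by (auto simp: fun_eq_iff a_def)
  have upper: "generic_config n s m R"
    if "\<exists>x. no_quadric N {1..s + D} (\<lambda>i. if i \<le> s then a i else 1) x"
      and "\<And>\<Lambda>. \<Lambda> \<in> config_space n s m \<Longrightarrow> config_ideal_dim n s \<Lambda> 2 \<le> D \<Longrightarrow> R \<Lambda>" for R D
    by (rule generic_config_dim_le_simple[OF m_less]) (use that in \<open>simp_all only: nq_cong N_def\<close>)
  show ?thesis
  proof (cases "m 1 + m 2 < n")
    case True
    \<comment> \<open>F is the predicted dimension before truncation at 0. With \<open>nat F\<close>
      points the count holds whatever the sign of F, and \<open>dim_eq_max\<close> recovers the
      maximum.\<close>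
    define F where "F = int X - int Y + int 0"
    show ?thesis
    proof (rule upper[where D = "nat F"])
      show "\<exists>x. no_quadric N {1..s + nat F} (\<lambda>i. if i \<le> s then a i else 1) x"
      proof (rule ex_disjoint)
        show "a 1 + a 2 \<le> N" using True by (simp add: a_def N_def)
        have "X \<le> Y + nat F" by (simp add: F_def)
        then show "N * (N + 1) \<le> (\<Sum>i=1..s. a i * (a i + 1)) + 2 * nat F" using X2 Y2 by linarith
      qed
      fix \<Lambda> assume \<Lambda>: "\<Lambda> \<in> config_space n s m" and le: "config_ideal_dim n s \<Lambda> 2 \<le> nat F"
      have "X + 0 \<le> config_ideal_dim n s \<Lambda> 2 + Y"
        using ge_star[OF \<Lambda>, of 1] assms(2) by (simp add: X_def Y_def)
      from dim_eq_max[OF F_def this le]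
      have "int (config_ideal_dim n s \<Lambda> 2) = max (int X - int Y) 0" by (simp add: F_def)
      then show "?P \<Lambda>" using True unfolding Y_int X_def[symmetric] by (simp only: not_le[symmetric] simp_thms)
    qed
  next
    case False
    define \<tau> where "\<tau> = Max {i \<in> {1..s}. m 1 + m i \<ge> n}"
    have "2 \<in> {i \<in> {1..s}. m 1 + m i \<ge> n}" using in12 False by simp
    then have \<tau>2: "2 \<le> \<tau>" and \<tau>_in: "\<tau> \<in> {i \<in> {1..s}. m 1 + m i \<ge> n}"
      unfolding \<tau>_def by (intro Max_ge Max_in; auto)+
    have \<tau>s: "\<tau> \<le> s" using \<tau>_in by simp
    have below: "n \<le> m 1 + m i" if "i \<in> {1..\<tau>}" for i
      using \<tau>_in m_mono[of i \<tau>] that by auto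
    have above: "m 1 + m i < n" if "i \<in> {\<tau> + 1..s}" for i
    proof (rule ccontr)
      assume "\<not> m 1 + m i < n"
      then have "i \<le> \<tau>" unfolding \<tau>_def using that by (intro Max_ge) auto
      then show False using that by simp
    qed
    define k where "k = (\<lambda>i. m 1 + m i + 1 - n)"
    define V where "V = (\<Sum>i=2..\<tau>. k i)"
    define Z where "Z = (\<Sum>i=2..\<tau>. (m 1 + m i + 2 - n) choose 2)"
    define Z3 where "Z3 = ((m 1 + m 2 + 2 - n) choose 2) + ((m 1 + m 3 + 2 - n) choose 2) + ((m 2 + m 3 + 2 - n) choose 2)"
    define g where "g = n - m 1"
    have m1: "m 1 < n" by (rule m_less[OF in12(1)])
    have ki: "int (k i) = int (m 1) + int (m i) - int n + 1" if "i \<in> {2..\<tau>}" for i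
      using below[of i] that by (auto simp: k_def)
    have V_int: "(\<Sum>i=2..\<tau>. int (m 1) + int (m i) - int n + 1) = int V"
      unfolding V_def of_nat_sum by (rule sum.cong[OF refl]) (simp only: ki)
    have Z_int: "(\<Sum>i=2..\<tau>. int ((m 1 + m i + 2 - n) choose 2)) = int Z" by (simp add: Z_def)
    have Z3_int: "(\<Sum>(i, j) \<in> {(i, j). 1 \<le> i \<and> i < j \<and> j \<le> 3}. int ((m i + m j + 2 - n) choose 2)) = int Z3"
    proof -
      have "{(i, j). 1 \<le> i \<and> i < j \<and> j \<le> (3::nat)} = {(1, 2), (1, 3), (2, 3)}" by auto
      then show ?thesis by (simp add: Z3_def)
    qed
    interpret star_weights N s a \<tau> g V k
    proof unfold_locales
      show "a 1 + g = N" using m1 by (simp add: a_def g_def N_def)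
      show "a i = g + k i" "1 \<le> k i" if "i \<in> {2..\<tau>}" for i
        using below[of i] m1 that by (auto simp: a_def g_def k_def)
      show "a i \<le> g" if "i \<in> {\<tau> + 1..s}" for i
        using above[OF that] by (simp add: a_def g_def)
    qed (use \<tau>2 \<tau>s V_def in simp_all)
    have Z2: "2 * Z = (\<Sum>i=2..\<tau>. k i * (k i + 1))"
      unfolding Z_def sum_distrib_left
    proof (rule sum.cong[OF refl])
      fix i assume "i \<in> {2..\<tau>}"
      then have "m 1 + m i + 2 - n = k i + 1" using below[of i] by (auto simp: k_def)
      then show "2 * ((m 1 + m i + 2 - n) choose 2) = k i * (k i + 1)" using two_choose[of "k i"] by simp
    qed
    have red: "?P \<Lambda>"
      if "int V \<ge> int (m 1) + 1 \<longrightarrow> config_ideal_dim n s \<Lambda> 2 = 0"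
        and "2 * int (m 1) - int n + 2 \<le> int V \<and> int V \<le> int (m 1) \<longrightarrow>
          (\<tau> \<ge> 4 \<longrightarrow> config_ideal_dim n s \<Lambda> 2 = 0) \<and>
          (\<tau> = 3 \<and> s \<ge> 4 \<and> 2 * n \<le> (\<Sum>i=1..4. m i) + 2 \<longrightarrow> config_ideal_dim n s \<Lambda> 2 = 0) \<and>
          ((\<tau> = 3 \<and> s \<ge> 4 \<and> 2 * n \<ge> (\<Sum>i=1..4. m i) + 2) \<or> (\<tau> = 3 \<and> s = 3) \<longrightarrow>
             int (config_ideal_dim n s \<Lambda> 2) = max (int X - int Y + int Z3) 0)"
        and "int V \<le> 2 * int (m 1) - int n + 1 \<longrightarrow> int (config_ideal_dim n s \<Lambda> 2) = max (int X - int Y + int Z) 0" for \<Lambda>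
      unfolding \<tau>_def[symmetric] Let_def V_int Y_int Z_int Z3_int X_def[symmetric]
      using that False by (intro conjI) blast+
    \<comment> \<open>The ranges (i), (iii) and (ii) of the statement, in this order, freed of
      negative differences.\<close>
    consider (big) "m 1 + 1 \<le> V" | (small) "V + n \<le> 2 * m 1 + 1" | (middle) "2 * m 1 + 2 \<le> V + n" "V \<le> m 1"
      by linarith
    then show ?thesis
    proof cases
      case big
      show ?thesis
      proof (rule upper[where D = 0])
        show "\<exists>x. no_quadric N {1..s + 0} (\<lambda>i. if i \<le> s then a i else 1) x"
          by (rule ex_star_full) (use big in \<open>simp add: a_def\<close>)
        fix \<Lambda> assume "config_ideal_dim n s \<Lambda> 2 \<le> 0"
        then show "?P \<Lambda>" by (intro red) (use big m1 in auto)
      qed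
    next
      case small
      define F where "F = int X - int Y + int Z"
      show ?thesis
      proof (rule upper[where D = "nat F"])
        show "\<exists>x. no_quadric N {1..s + nat F} (\<lambda>i. if i \<le> s then a i else 1) x"
        proof (rule ex_star)
          show "V + g \<le> a 1" using small m1 by (simp add: a_def g_def)
          have "X + Z \<le> Y + nat F" unfolding F_def by linarith
          then show "N * (N + 1) + (\<Sum>i=2..\<tau>. k i * (k i + 1)) \<le> (\<Sum>i=1..s. a i * (a i + 1)) + 2 * nat F"
            using X2 Y2 Z2 by linarith
        qed
        fix \<Lambda> assume \<Lambda>: "\<Lambda> \<in> config_space n s m" and le: "config_ideal_dim n s \<Lambda> 2 \<le> nat F"
        have "X + Z \<le> config_ideal_dim n s \<Lambda> 2 + Y"
          using ge_star[OF \<Lambda> \<tau>s] by (simp only: X_def Y_def Z_def)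
        from dim_eq_max[OF F_def this le] have eq: "int (config_ideal_dim n s \<Lambda> 2) = max (int X - int Y + int Z) 0"
          by (simp only: F_def)
        show "?P \<Lambda>" 
        proof (rule red)
          show "int (m 1) + 1 \<le> int V \<longrightarrow> config_ideal_dim n s \<Lambda> 2 = 0" using small m1 by linarith
        qed (use small eq in \<open>linarith | blast\<close>)+
      qed
    next
      case middle
      \<comment> \<open>c is what remains of the first space after v coordinates; the two
        inequalities of this range say that 1 \<le> c < g.\<close>
      define c where "c = m 1 + 1 - V"
      have c: "a 1 = c + V" "1 \<le> c" "c < g" using middle m1 by (auto simp: c_def a_def g_def)
      \<comment> \<open>For \<tau> = 2 the sum v is the single term m 1 + m 2 - n + 1, at most 2 m 1
        - n + 1, which belongs to range (iii).\<close>
      have \<tau>3: "3 \<le> \<tau>"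
      proof (rule ccontr)
        assume "\<not> 3 \<le> \<tau>"
        then have "\<tau> = 2" using \<tau>2 by simp
        then have "V = k 2" by (simp add: V_def)
        then show False using middle(1) ki[of 2] \<open>\<tau> = 2\<close> m_mono[OF in12] by simp
      qed
      show ?thesis
      proof (cases "4 \<le> \<tau>")
        case True
        show ?thesis
        proof (rule upper[where D = 0])
          show "\<exists>x. no_quadric N {1..s + 0} (\<lambda>i. if i \<le> s then a i else 1) x"
            by (rule ex_star_four[OF c True])
          fix \<Lambda> assume "config_ideal_dim n s \<Lambda> 2 \<le> 0"
          then show "?P \<Lambda>" by (intro red) (use middle True in auto)
        qed
      next
        case False
        then have \<tau>_eq: "\<tau> = 3" using \<tau>3 by simp
        have s3: "3 \<le> s" using \<tau>s \<tau>_eq by simp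
        have "V = k 2 + k 3"
        proof -
          have "{2..3} = {2, 3::nat}" by auto
          then show ?thesis by (simp add: V_def \<tau>_eq)
        qed
        \<comment> \<open>This is the definition of c with v written out. It turns the hypotheses of
          (b) and (c) into comparisons of c with \<open>a 4\<close>.\<close>
        then have sum3: "m 1 + m 2 + m 3 + 1 + c = 2 * n"
          using c(1) ki[of 2] ki[of 3] \<tau>_eq by (simp add: a_def)
        define h where "h = g - c"
        have h: "g = c + h" "1 \<le> h" using c(3) by (auto simp: h_def)
        have k23: "m 1 + m 2 + 2 - n = k 2 + 1" "m 1 + m 3 + 2 - n = k 3 + 1" "m 2 + m 3 + 2 - n = h + 1" "n \<le> m 2 + m 3 + 1"
          using below[of 2] below[of 3] \<tau>_eq sum3 h m1 by (auto simp: k_def g_def)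
        have Z32: "2 * Z3 = k 2 * (k 2 + 1) + k 3 * (k 3 + 1) + h * (h + 1)"
          unfolding Z3_def k23 distrib_left two_choose ..
        have sum4: "(\<Sum>i=1..4. m i) = m 1 + m 2 + m 3 + m 4"
        proof -
          have "{1..4} = {1, 2, 3, 4::nat}" by auto
          then show ?thesis by simp
        qed
        define F where "F = int X - int Y + int Z3"
        have lower: "X + Z3 \<le> config_ideal_dim n s \<Lambda> 2 + Y" if "\<Lambda> \<in> config_space n s m" "\<Lambda> 1 \<inter> \<Lambda> 2 \<inter> \<Lambda> 3 \<subseteq> {0}" for \<Lambda>
          using ge_triple[OF that(1) s3 that(2)] below[of 2] below[of 3] k23(4) \<tau>_eq by (simp add: X_def Y_def Z3_def)
        have upper3: "generic_config n s m R"
          if "\<exists>x. no_quadric N {1..s + D} (\<lambda>i. if i \<le> s then a i else 1) x"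
            and "\<And>\<Lambda>. int (config_ideal_dim n s \<Lambda> 2) = max F 0 \<Longrightarrow> config_ideal_dim n s \<Lambda> 2 \<le> D \<Longrightarrow> R \<Lambda>" and "D \<le> nat F" for R D
        proof (rule generic_config_dim_le_triple[where m = m and n = n and s = s and D = D, OF m_less s3])
          show "\<exists>x. no_quadric (n + 1) {1..s + D} (\<lambda>i. if i \<le> s then m i + 1 else 1) x"
            using that(1) unfolding nq_cong N_def .
          fix \<Lambda> assume \<Lambda>: "\<Lambda> \<in> config_space n s m" "\<Lambda> 1 \<inter> \<Lambda> 2 \<inter> \<Lambda> 3 \<subseteq> {0}" and le: "config_ideal_dim n s \<Lambda> 2 \<le> D"
          show "R \<Lambda>"
            by (rule that(2)[OF dim_eq_max[OF F_def lower[OF \<Lambda>] order.trans[OF le that(3)]] le])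
        qed (use below[of 2] below[of 3] \<tau>_eq sum3 c(2) in auto)
        show ?thesis
        proof (cases "4 \<le> s \<and> 2 * n \<le> (\<Sum>i=1..4. m i) + 2")
          \<comment> \<open>When 2n equals the sum plus 2, both (b) and (c) apply, so the formula of
            (c) has to be obtained along with dimension 0; \<open>upper3\<close> provides
            both.\<close>
          case True
          show ?thesis
          proof (rule upper3[where D = 0])
            show "\<exists>x. no_quadric N {1..s + 0} (\<lambda>i. if i \<le> s then a i else 1) x"
              by (rule ex_star_three_big[OF c \<tau>_eq]) (use True sum3 sum4 in \<open>auto simp: a_def\<close>)
            fix \<Lambda> assume eq: "int (config_ideal_dim n s \<Lambda> 2) = max F 0" and 0: "config_ideal_dim n s \<Lambda> 2 \<le> 0"
            have "int V \<le> int (m 1)" "\<not> int V \<le> 2 * int (m 1) - int n + 1" using middle by linarith+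
            then show "?P \<Lambda>"
              by (intro red) (use eq 0 in \<open>simp_all only: F_def le_zero_eq simp_thms, linarith?\<close>)
          qed simp
        next
          case small4: False
          show ?thesis
          proof (rule upper3[where D = "nat F"])
            show "\<exists>x. no_quadric N {1..s + nat F} (\<lambda>i. if i \<le> s then a i else 1) x"
            proof (rule ex_star_three_small[OF c(1,2) h \<tau>_eq])
              show "a 4 \<le> c" if "4 \<le> s" using small4 that sum3 sum4 by (simp add: a_def)
              have "X + Z3 \<le> Y + nat F" unfolding F_def by linarith
              then show "N * (N + 1) + (k 2 * (k 2 + 1) + k 3 * (k 3 + 1) + h * (h + 1)) \<le> (\<Sum>i=1..s. a i * (a i + 1)) + 2 * nat F"
                using X2 Y2 Z32 by linarith
            qed
            fix \<Lambda> assume eq: "int (config_ideal_dim n s \<Lambda> 2) = max F 0"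
            have "\<not> int V \<ge> int (m 1) + 1" "\<not> int V \<le> 2 * int (m 1) - int n + 1" using middle by linarith+
            then show "?P \<Lambda>"
              by (intro red) (use eq small4 \<tau>_eq in \<open>auto simp: F_def\<close>)
          qed simp
        qed
      qed
    qed
  qed
qed

end
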